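(* Let $0<\vec p,\vec s,\vec r,\vec q\le\infty$, $\vec\alpha_1=(\alpha_1^1,\dots,\alpha_n^1)\in\mathbb R^n$ and $\vec\alpha_2=(\alpha_1^2,\dots,\alpha_n^2)\in\mathbb R^n$. Suppose that $$\alpha_i^1+\frac1{s_i}>0,\qquad 0<p_i\le s_i\le\infty,\qquad \alpha_i^2\ge\alpha_i^1,\qquad i\in\{1,\dots,n\}.$$ Define $\vec\theta=(\theta_1,\dots,\theta_n)$ by $\theta_i=r_i$ if $\alpha_i^2=\alpha_i^1$ and $\theta_i=q_i$ if $\alpha_i^2>\alpha_i^1$. Then there is a constant $c>0$ such that for every $R>0$ and every $f\in\dot E_{\vec p}^{\vec\alpha_2,\vec\theta}(\mathbb R^n)\cap\mathcal S'(\mathbb R^n)$ with $\operatorname{supp}\mathcal Ff\subset\{\xi\in\mathbb R^n:|\xi|\le R\}$, $$\|f\|_{\dot E_{\vec s}^{\vec\alpha_1,\vec r}(\mathbb R^n)}\le c\,R^{\frac1{\mathbf p}-\frac1{\mathbf s}+\boldsymbol\alpha_2-\boldsymbol\alpha_1}\,\|f\|_{\dot E_{\vec p}^{\vec\alpha_2,\vec\theta}(\mathbb R^n)}.$$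
   Context: Conventions: $0<\vec p\le\infty$ means $p_i\in(0,\infty]$ for every $i\in\{1,\dots,n\}$; $1/\infty=0$; $\frac1{\mathbf p}=\sum_{i=1}^n\frac1{p_i}$, $\frac1{\mathbf s}=\sum_{i=1}^n\frac1{s_i}$, $\boldsymbol\alpha_j=\sum_{i=1}^n\alpha_i^j$ for $j=1,2$. $\mathcal F$ is the Fourier transform on tempered distributions $\mathcal S'(\mathbb R^n)$. Mixed-norm Herz spaces: for $k\in\mathbb Z$ let $R_k=\{t\in\mathbb R:2^{k-1}\le|t|<2^k\}$. For $0<p,q\le\infty$, $\alpha\in\mathbb R$ and measurable $g$ on $\mathbb R$, $\|g\|_{\dot K_p^{\alpha,q}}=\big(\sum_{k\in\mathbb Z}2^{k\alpha q}\|g\chi_{R_k}\|_{L^p(\mathbb R)}^q\big)^{1/q}$ (supremum over $k$ if $q=\infty$). The space $\dot E_{\vec p}^{\vec\alpha,\vec q}(\mathbb R^n)$ consists of all measurable $f$ on $\mathbb R^n$ with $\|f\|_{\dot E_{\vec p}^{\vec\alpha,\vec q}(\mathbb R^n)}=\big\|\cdots\|f\|_{\dot K_{p_1}^{\alpha_1,q_1}}\cdots\big\|_{\dot K_{p_n}^{\alpha_n,q_n}}<\infty$, where the $\dot K_{p_i}^{\alpha_i,q_i}$-quasi-norm is taken in the variable $x_i$, successively for $i=1,2,\dots,n$ ($x_1$ innermost). *)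

theory Defs
  imports "HOL-Analysis.Analysis" "HOL-Probability.Essential_Supremum"
begin

section \<open>Mixed-norm Herz spaces\<close>

text \<open>Powers of elements of \<open>[0,\<infinity>]\<close> with a positive real exponent. Quasi-norms take values in
  \<^typ>\<open>ennreal\<close>, so that they are defined for every function.\<close>

definition ennpow :: "ennreal \<Rightarrow> real \<Rightarrow> ennreal" where
  "ennpow x a = (if x = top then top else ennreal (enn2real x powr a))"

text \<open>The exponent \<open>p \<in> (0,\<infinity>]\<close> is an \<^typ>\<open>ennreal\<close>, and \<open>g\<close> is the modulus of the function whose
  quasi-norm is taken. Lebesgue measure is the complete one.\<close>

definition Lp_qnorm :: "ennreal \<Rightarrow> (real \<Rightarrow> ennreal) \<Rightarrow> ennreal" where
  "Lp_qnorm p g =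
     (if p = top then esssup lebesgue g
      else ennpow (\<integral>\<^sup>+t. ennpow (g t) (enn2real p) \<partial>lebesgue) (1 / enn2real p))"

definition dyadic_shell :: "int \<Rightarrow> real set" where
  "dyadic_shell k = {t. 2 powi (k - 1) \<le> \<bar>t\<bar> \<and> \<bar>t\<bar> < 2 powi k}"

definition herz_qnorm :: "ennreal \<Rightarrow> real \<Rightarrow> ennreal \<Rightarrow> (real \<Rightarrow> ennreal) \<Rightarrow> ennreal" where
  "herz_qnorm p \<alpha> q g =
     (if q = top
      then (SUP k. ennreal (2 powr (of_int k * \<alpha>)) *
                   Lp_qnorm p (\<lambda>t. g t * indicator (dyadic_shell k) t))
      else ennpow (\<Sum>\<^sub>\<infinity>k\<in>UNIV. ennreal (2 powr (of_int k * \<alpha> * enn2real q)) *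
                   ennpow (Lp_qnorm p (\<lambda>t. g t * indicator (dyadic_shell k) t)) (enn2real q))
             (1 / enn2real q))"

text \<open>The quasi-norm in the variable \<open>x\<^sub>i\<close> alone. The result is again regarded as a function of the
  full vector \<open>x\<close>; it does not depend on \<open>x\<^sub>i\<close> any more.\<close>

definition herz_step ::
  "ennreal ^ 'n \<Rightarrow> real ^ 'n \<Rightarrow> ennreal ^ 'n \<Rightarrow> 'n::finite \<Rightarrow>
   (real ^ 'n \<Rightarrow> ennreal) \<Rightarrow> real ^ 'n \<Rightarrow> ennreal" where
  "herz_step p \<alpha> q i F =
     (\<lambda>x. herz_qnorm (p $ i) (\<alpha> $ i) (q $ i) (\<lambda>t. F (\<chi> j. if j = i then t else x $ j)))"

text \<open>The coordinates \<open>1, \<dots>, n\<close> are the elements of the index type in increasing order; \<^const>\<open>fold\<close>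
  treats the first coordinate first, i.e. innermost. At the end all variables are used up, so
  that the evaluation point \<open>0\<close> is immaterial, see \<open>fold_herz_step_const\<close> below.\<close>

definition mixed_herz_qnorm ::
  "ennreal ^ 'n::{finite,linorder} \<Rightarrow> real ^ 'n::{finite,linorder} \<Rightarrow>
   ennreal ^ 'n::{finite,linorder} \<Rightarrow> (real ^ 'n::{finite,linorder} \<Rightarrow> complex) \<Rightarrow> ennreal" where
  "mixed_herz_qnorm p \<alpha> q f =
     fold (herz_step p \<alpha> q) (sorted_list_of_set UNIV) (\<lambda>x. ennreal (norm (f x))) 0"

definition mixed_herz_space ::
  "ennreal ^ 'n::{finite,linorder} \<Rightarrow> real ^ 'n::{finite,linorder} \<Rightarrow>
   ennreal ^ 'n::{finite,linorder} \<Rightarrow> (real ^ 'n::{finite,linorder} \<Rightarrow> complex) set" where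
  "mixed_herz_space p \<alpha> q =
     {f. f \<in> borel_measurable lebesgue \<and> mixed_herz_qnorm p \<alpha> q f < top}"

lemma fold_herz_step_indep:
  assumes "\<forall>x y. (\<forall>j. j \<notin> A \<longrightarrow> x $ j = y $ j) \<longrightarrow> F x = F y"
    and "\<forall>j. j \<notin> A \<union> set is \<longrightarrow> x $ j = y $ j"
  shows "fold (herz_step p \<alpha> q) is F x = fold (herz_step p \<alpha> q) is F y"
  using assms
proof (induction "is" arbitrary: F A)
  case Nil
  have "\<forall>j. j \<notin> A \<longrightarrow> x $ j = y $ j" using Nil.prems(2) by auto
  then have "F x = F y" using Nil.prems(1) by blast
  then show ?case by simp
next
  case (Cons i "is")
  have 1: "herz_step p \<alpha> q i F u = herz_step p \<alpha> q i F v"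
    if "\<forall>j. j \<notin> insert i A \<longrightarrow> u $ j = v $ j" for u v
  proof -
    have "F (\<chi> j. if j = i then t else u $ j) = F (\<chi> j. if j = i then t else v $ j)" for t
    proof -
      have "\<forall>j. j \<notin> A \<longrightarrow> (\<chi> j. if j = i then t else u $ j) $ j = (\<chi> j. if j = i then t else v $ j) $ j"
        using that by auto
      then show ?thesis using Cons.prems(1) by blast
    qed
    then show ?thesis by (simp only: herz_step_def)
  qed
  have 2: "\<forall>j. j \<notin> insert i A \<union> set is \<longrightarrow> x $ j = y $ j"
    using Cons.prems(2) by auto
  have "fold (herz_step p \<alpha> q) is (herz_step p \<alpha> q i F) x =
        fold (herz_step p \<alpha> q) is (herz_step p \<alpha> q i F) y"
    using Cons.IH[of "insert i A" "herz_step p \<alpha> q i F"] 1 2 by blast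
  then show ?case by (simp only: fold_simps)
qed

lemma fold_herz_step_const:
  fixes x y :: "real ^ 'n::{finite,linorder}"
  shows "fold (herz_step p \<alpha> q) (sorted_list_of_set UNIV) F x =
         fold (herz_step p \<alpha> q) (sorted_list_of_set UNIV) F y"
proof (rule fold_herz_step_indep[where A = "{}"])
  show "\<forall>u v. (\<forall>j. j \<notin> {} \<longrightarrow> u $ j = v $ j) \<longrightarrow> F u = F v"
  proof (intro allI impI)
    fix u v :: "real ^ 'n::{finite,linorder}" assume "\<forall>j. j \<notin> {} \<longrightarrow> u $ j = v $ j"
    then have "u = v" by (simp add: vec_eq_iff)
    then show "F u = F v" by simp
  qed
qed simp


section \<open>Tempered distributions\<close>

definition partial_deriv :: "'n \<Rightarrow> (real ^ 'n \<Rightarrow> complex) \<Rightarrow> real ^ 'n::finite \<Rightarrow> complex" where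
  "partial_deriv i \<phi> x = frechet_derivative \<phi> (at x) (axis i 1)"

text \<open>Iterated partial derivatives are indexed by lists of coordinates instead of multi-indices.\<close>

definition partials :: "'n list \<Rightarrow> (real ^ 'n \<Rightarrow> complex) \<Rightarrow> real ^ 'n::finite \<Rightarrow> complex" where
  "partials is \<phi> = fold partial_deriv is \<phi>"

text \<open>\<open>C\<^sup>\<infinity>\<close>: all iterated partial derivatives are totally differentiable, hence continuous.\<close>

definition smooth_fun :: "(real ^ 'n::finite \<Rightarrow> complex) \<Rightarrow> bool" where
  "smooth_fun \<phi> \<longleftrightarrow> (\<forall>is x. partials is \<phi> differentiable (at x))"

definition schwartz_space :: "(real ^ 'n::finite \<Rightarrow> complex) set" where
  "schwartz_space =
     {\<phi>. smooth_fun \<phi> \<and> (\<forall>N is. bounded (range (\<lambda>x. (1 + norm x) ^ N * norm (partials is \<phi> x))))}"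

definition schwartz_norm :: "nat \<Rightarrow> (real ^ 'n::finite \<Rightarrow> complex) \<Rightarrow> real" where
  "schwartz_norm N \<phi> =
     (SUP (is, x) \<in> {is. length is \<le> N} \<times> UNIV. (1 + norm x) ^ N * norm (partials is \<phi> x))"

text \<open>Continuous linear functionals on the Schwartz space, whose topology is generated by the
  increasing sequence of norms \<^const>\<open>schwartz_norm\<close>. The values of \<open>T\<close> outside the Schwartz space
  are irrelevant.\<close>

definition tempered_distribution :: "((real ^ 'n::finite \<Rightarrow> complex) \<Rightarrow> complex) \<Rightarrow> bool" where
  "tempered_distribution T \<longleftrightarrow>
     (\<forall>\<phi>\<in>schwartz_space. \<forall>\<psi>\<in>schwartz_space. \<forall>a b.
        T (\<lambda>x. a * \<phi> x + b * \<psi> x) = a * T \<phi> + b * T \<psi>) \<and>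
     (\<forall>\<phi>\<in>schwartz_space. \<forall>\<epsilon>>0. \<exists>N. \<exists>\<delta>>0. \<forall>\<psi>\<in>schwartz_space.
        schwartz_norm N (\<lambda>x. \<psi> x - \<phi> x) < \<delta> \<longrightarrow> norm (T \<psi> - T \<phi>) < \<epsilon>)"

definition fourier :: "(real ^ 'n::finite \<Rightarrow> complex) \<Rightarrow> real ^ 'n \<Rightarrow> complex" where
  "fourier \<phi> \<xi> =
     of_real ((2 * pi) powr (- real CARD('n) / 2)) * (LINT x|lborel. cis (- (x \<bullet> \<xi>)) * \<phi> x)"

definition fourier_distr ::
  "((real ^ 'n::finite \<Rightarrow> complex) \<Rightarrow> complex) \<Rightarrow> (real ^ 'n \<Rightarrow> complex) \<Rightarrow> complex" where
  "fourier_distr T \<phi> = T (fourier \<phi>)"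

text \<open>The space \<open>C\<^sub>c\<^sup>\<infinity>(V)\<close> for an open set \<open>V\<close>.\<close>

definition test_functions :: "(real ^ 'n::finite) set \<Rightarrow> (real ^ 'n \<Rightarrow> complex) set" where
  "test_functions V =
     {\<phi>. smooth_fun \<phi> \<and> compact (closure {x. \<phi> x \<noteq> 0}) \<and> closure {x. \<phi> x \<noteq> 0} \<subseteq> V}"

definition distr_support ::
  "((real ^ 'n::finite \<Rightarrow> complex) \<Rightarrow> complex) \<Rightarrow> (real ^ 'n) set" where
  "distr_support U = - \<Union> {V. open V \<and> (\<forall>\<phi>\<in>test_functions V. U \<phi> = 0)}"

text \<open>The function \<open>f\<close>, as a regular distribution, is (the restriction to \<open>C\<^sub>c\<^sup>\<infinity>\<close> of) \<open>T\<close>. Only test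
  functions are used here because \<open>f \<phi>\<close> need not be integrable for all Schwartz functions \<open>\<phi>\<close>,
  even if \<open>f\<close> defines a tempered distribution; \<open>C\<^sub>c\<^sup>\<infinity>\<close> being dense, \<open>T\<close> is unique on Schwartz functions.\<close>

definition is_regular_distr ::
  "(real ^ 'n::finite \<Rightarrow> complex) \<Rightarrow> ((real ^ 'n \<Rightarrow> complex) \<Rightarrow> complex) \<Rightarrow> bool" where
  "is_regular_distr f T \<longleftrightarrow>
     (\<forall>K. compact K \<longrightarrow> f absolutely_integrable_on K) \<and>
     (\<forall>\<phi>\<in>test_functions UNIV. T \<phi> = (LINT x|lebesgue. f x * \<phi> x))"

end

theory Submission
  imports Defs "HOL-Probability.Sinc_Integral" "HOL-Computational_Algebra.Polynomial"
begin

text \<open>Let \<open>a = 2\<^sup>j\<close> with \<open>R \<le> a \<le> 2 R\<close>, and let \<open>\<theta>\<close> be the Schwartz function of one variable whose Fourier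
  transform is a cutoff function, equal to \<open>1\<close> on \<open>[-5/4, 5/4]\<close>. The convolution of \<open>f\<close> with the tensor
  product of the dilates \<open>a \<theta>(a y)\<close> agrees with \<open>f\<close> almost everywhere. Expanding the cutoff function in a Fourier
  series gives \<open>\<theta>(y) = \<Sum>\<^sub>k c(\<tau> + k) \<theta>(y - \<tau> - k)\<close> for every shift \<open>\<tau>\<close>, with rapidly decaying \<open>c\<close>. Hence
  \<open>f(x) = \<Sum>\<^sub>k c(\<tau> + k) f(x + (\<tau> + k) e\<^sub>i / a)\<close>; as \<open>t\<^sup>d\<close> is subadditive for \<open>d \<le> 1\<close>, averaging over \<open>\<tau> \<in> [0,1)\<close>
  bounds \<open>\<bar>f(x)\<bar>\<^sup>d\<close> by \<open>C \<integral> \<bar>f(x + y e\<^sub>i / a)\<bar>\<^sup>d (1 + \<bar>y\<bar>)\<^bsup>-N\<^esup> dy\<close>. For small \<open>d\<close>, the \<open>d\<close>-th power of a mixed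
  quasi-norm of \<open>f\<close> is a mixed norm of \<open>\<bar>f\<bar>\<^sup>d\<close> with all exponents at least \<open>1\<close>. By Minkowski's
  inequality the integral inequality in the variable \<open>x\<^sub>i\<close> survives taking norms in the other variables, so that
  the theorem follows from a one-dimensional embedding for functions dominated by such weighted means,
  applied to one variable after the other.\<close>

subsection \<open>Powers in the extended nonnegative reals\<close>

text \<open>The number d does more than raise the exponents to 1. A weighted mean sees the shells
  near the origin through Hoelder's inequality, and these contributions can be summed only if d
  (\<alpha>2 + 1/p) < 1; a small d enforces this whatever \<alpha>2 is. The hypothesis \<alpha>1 +
  1/s > 0 sums the small shells on the target side, where the mean is essentially constant. On large
  shells essentially only neighbours interact: a gap \<alpha>2 > \<alpha>1 leaves a geometric factor
  that absorbs any change of the summability exponent, while equality leaves none, whence \<theta> =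
  r there. The scale a is a power of two because such dilations permute the shells. Averaging over
  \<tau> turns point samples, which no integral norm controls, into an integral to which Minkowski's
  inequality applies. As \<open>f\<close> is determined only up to null sets and its product with a
  Schwartz function need not be integrable, the convolution is defined through the distribution,
  which is evaluated on tensor products only: their seminorms, derivatives and Fourier transforms
  reduce to one variable.\<close>

lemma ennpow_top [simp]: "ennpow top a = top"
  by (simp add: ennpow_def)

lemma ennpow_0 [simp]: "ennpow 0 a = 0"
  by (simp add: ennpow_def)

lemma ennpow_ennreal: "0 \<le> x \<Longrightarrow> ennpow (ennreal x) a = ennreal (x powr a)"
  by (simp add: ennpow_def)

lemma ennpow_1 [simp]: "ennpow x 1 = x"
  by (cases x) (auto simp: ennpow_ennreal)

lemma ennpow_eq_top_iff [simp]: "ennpow x a = top \<longleftrightarrow> x = top"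
  by (simp add: ennpow_def)

lemma ennpow_eq_0_iff [simp]: "ennpow x a = 0 \<longleftrightarrow> x = 0"
  by (cases x) (auto simp: ennpow_ennreal)

lemma ennpow_mono: "0 \<le> a \<Longrightarrow> x \<le> y \<Longrightarrow> ennpow x a \<le> ennpow y a"
  by (cases x; cases y) (auto simp: ennpow_ennreal powr_mono2 top_unique)

lemma ennpow_ennpow: "ennpow (ennpow x a) b = ennpow x (a * b)"
  by (cases x) (auto simp: ennpow_ennreal powr_powr)

lemma ennpow_le_iff: "0 < a \<Longrightarrow> ennpow x a \<le> ennpow y a \<longleftrightarrow> x \<le> y"
  using ennpow_mono[of a x y] ennpow_mono[of "1/a" "ennpow x a" "ennpow y a"]
  by (auto simp: ennpow_ennpow)

lemma ennpow_mult: "ennpow (x * y) a = ennpow x a * ennpow y a"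
proof (cases "x = 0 \<or> y = 0")
  case False
  then show ?thesis
    by (cases x; cases y)
       (auto simp: ennpow_ennreal powr_mult ennreal_mult ennreal_mult_top ennreal_top_mult simp flip: ennreal_mult)
qed auto

lemma ennpow_add: "x \<noteq> 0 \<Longrightarrow> ennpow x (a + b) = ennpow x a * ennpow x b"
  by (cases x) (auto simp: ennpow_ennreal powr_add ennreal_mult)

lemma ennreal_inverse_mult_self: "a \<noteq> 0 \<Longrightarrow> a \<noteq> top \<Longrightarrow> inverse a * a = (1::ennreal)"
  by (metis mult.commute ennreal_divide_self divide_ennreal_def top.not_eq_extremum)

lemma ennreal_mult_divide_cancel: "a \<noteq> 0 \<Longrightarrow> a \<noteq> top \<Longrightarrow> a * (b / a) = (b::ennreal)"
  unfolding divide_ennreal_def using ennreal_inverse_mult_self[of a] by (metis mult.assoc mult.commute mult_1)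

lemma borel_measurable_ennpow [measurable]:
  assumes [measurable]: "f \<in> borel_measurable M"
  shows "(\<lambda>x. ennpow (f x) a) \<in> borel_measurable M"
proof -
  have "f -` {top} \<inter> space M \<in> sets M" by (rule measurable_sets[OF assms]) simp
  then have [measurable]: "{x \<in> space M. f x = top} \<in> sets M"
    by (simp add: vimage_def Int_def conj_commute)
  show ?thesis unfolding ennpow_def by measurable
qed

text \<open>Replaces the unordered sum by an integral over counting measure, so that the theorems on
  integrals cover the sequence norms as well.\<close>

lemma infsum_int_nn: "(\<Sum>\<^sub>\<infinity>k\<in>UNIV. f k) = (\<integral>\<^sup>+k. f k \<partial>count_space (UNIV::int set))" for f :: "int \<Rightarrow> ennreal"
proof -
  have fin: "(\<Sum>k\<in>F. f k) = (\<integral>\<^sup>+k. f k * indicator F k \<partial>count_space UNIV)" if "finite F" for F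
    using that by (subst nn_integral_count_space'[of F]) auto
  have "infsum f UNIV = (SUP F\<in>{F. finite F \<and> F\<subseteq>UNIV}. sum f F)"
    by (rule nonneg_infsum_complete) auto
  also have "\<dots> = (\<integral>\<^sup>+k. f k \<partial>count_space (UNIV::int set))"
  proof (rule antisym)
    show "(SUP F\<in>{F. finite F \<and> F\<subseteq>UNIV}. sum f F) \<le> (\<integral>\<^sup>+k. f k \<partial>count_space UNIV)"
      by (rule SUP_least) (auto simp: fin intro!: nn_integral_mono split: split_indicator)
  next
    have "(\<integral>\<^sup>+k. f k \<partial>count_space UNIV) = (\<integral>\<^sup>+k. (SUP n. f k * indicator {-int n..int n} k) \<partial>count_space UNIV)"
    proof (rule nn_integral_cong)
      fix k :: int
      show "f k = (SUP n. f k * indicator {-int n..int n} k)"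
        by (rule antisym, rule SUP_upper2[of "nat \<bar>k\<bar>"]) (auto intro!: SUP_least split: split_indicator)
    qed
    also have "\<dots> = (SUP n. \<integral>\<^sup>+k. f k * indicator {-int n..int n} k \<partial>count_space UNIV)"
      by (rule nn_integral_monotone_convergence_SUP)
         (auto simp: incseq_def le_fun_def split: split_indicator)
    also have "\<dots> \<le> (SUP F\<in>{F. finite F \<and> F\<subseteq>UNIV}. sum f F)"
      by (rule SUP_least) (auto simp flip: fin intro!: SUP_upper)
    finally show "(\<integral>\<^sup>+k. f k \<partial>count_space UNIV) \<le> (SUP F\<in>{F. finite F \<and> F\<subseteq>UNIV}. sum f F)" .
  qed
  finally show ?thesis .
qed

subsection \<open>Lebesgue quasi-norms\<close>

text \<open>Used with Lebesgue measure for the norm on a shell and with counting measure on the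
  integers for the sum over the shells. A Herz quasi-norm is thus an iterated \<open>lnorm\<close>,
  and each inequality is proved once for both.\<close>

definition lnorm :: "'a measure \<Rightarrow> ennreal \<Rightarrow> ('a \<Rightarrow> ennreal) \<Rightarrow> ennreal" where
  "lnorm M p g = (if p = top then esssup M g
      else ennpow (\<integral>\<^sup>+x. ennpow (g x) (enn2real p) \<partial>M) (1 / enn2real p))"

lemma lnorm_top: "lnorm M top g = esssup M g"
  by (simp add: lnorm_def)

lemma lnorm_real: "0 < u \<Longrightarrow> lnorm M (ennreal u) g = ennpow (\<integral>\<^sup>+x. ennpow (g x) u \<partial>M) (1/u)"
  by (simp add: lnorm_def)

lemma lnorm_real_pow: "0 < u \<Longrightarrow> ennpow (lnorm M (ennreal u) g) u = (\<integral>\<^sup>+x. ennpow (g x) u \<partial>M)"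
  by (simp add: lnorm_real ennpow_ennpow)

lemma lnorm_mono_AE:
  assumes "g \<in> borel_measurable M" "AE x in M. g x \<le> h x"
  shows "lnorm M p g \<le> lnorm M p h"
  unfolding lnorm_def
  using assms by (auto intro!: esssup_AE_mono ennpow_mono nn_integral_mono_AE elim!: eventually_mono)

lemma lnorm_mono:
  assumes "g \<in> borel_measurable M" "\<And>x. x \<in> space M \<Longrightarrow> g x \<le> h x"
  shows "lnorm M p g \<le> lnorm M p h"
  using assms by (intro lnorm_mono_AE) auto

lemma lnorm_cong_AE:
  assumes "g \<in> borel_measurable M" "h \<in> borel_measurable M" "AE x in M. g x = h x"
  shows "lnorm M p g = lnorm M p h"
  by (intro antisym lnorm_mono_AE) (use assms in \<open>auto elim: eventually_mono\<close>)

lemma lnorm_cong: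
  assumes "\<And>x. x \<in> space M \<Longrightarrow> g x = h x"
  shows "lnorm M p g = lnorm M p h"
  unfolding lnorm_def using assms
  by (auto intro!: arg_cong[where f="\<lambda>x. ennpow x _"] nn_integral_cong simp: esssup_def cong: measurable_cong)
     (auto intro!: Limsup_eq)

lemma esssup_ennreal_cmult_le:
  fixes g :: "'a \<Rightarrow> ennreal"
  assumes [measurable]: "g \<in> borel_measurable M"
  shows "esssup M (\<lambda>x. c * g x) \<le> c * esssup M g"
  using esssup_AE[of g M] by (intro esssup_I) (auto elim!: eventually_mono intro!: mult_left_mono)

lemma lnorm_cmult:
  assumes [measurable]: "g \<in> borel_measurable M" and p: "0 < p" and c: "c < top"
  shows "lnorm M p (\<lambda>x. c * g x) = c * lnorm M p g"
proof (cases p)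
  case (real u)
  then have u: "0 < u" using p by auto
  show ?thesis unfolding real(2) lnorm_real[OF u]
    by (simp add: ennpow_mult nn_integral_cmult ennpow_ennpow) (use u in simp)
next
  case top
  show ?thesis
  proof (cases "c = 0")
    case True
    have "esssup M (\<lambda>x. 0::ennreal) \<le> 0" by (intro esssup_I) auto
    then show ?thesis using True top by (simp add: lnorm_top)
  next
    case False
    then have cc: "inverse c * c = 1" using c by (auto simp: ennreal_inverse_mult_self)
    have "c * esssup M g = c * esssup M (\<lambda>x. inverse c * (c * g x))"
      by (simp add: mult.assoc[symmetric] cc)
    also have "\<dots> \<le> c * (inverse c * esssup M (\<lambda>x. c * g x))"
      by (intro mult_left_mono esssup_ennreal_cmult_le) auto
    also have "\<dots> = esssup M (\<lambda>x. c * g x)"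
      by (simp add: mult.assoc[symmetric] cc mult.commute[of c])
    finally show ?thesis using esssup_ennreal_cmult_le[of g M c] by (simp add: top lnorm_top)
  qed
qed

lemma esssup_ennpow_le:
  assumes [measurable]: "g \<in> borel_measurable M" and "0 \<le> d"
  shows "esssup M (\<lambda>x. ennpow (g x) d) \<le> ennpow (esssup M g) d"
  using esssup_AE[of g M] assms(2) by (intro esssup_I) (auto elim!: eventually_mono intro!: ennpow_mono)

text \<open>For d at most p the exponent on the right is at least 1, which opens the way to
  Minkowski's inequality.\<close>

lemma ennpow_lnorm:
  assumes [measurable]: "g \<in> borel_measurable M" and p: "0 < p" and d: "0 < d"
  shows "ennpow (lnorm M p g) d = lnorm M (p / ennreal d) (\<lambda>x. ennpow (g x) d)"
proof (cases p)
  case (real u)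
  then have u: "0 < u" using p by auto
  have *: "p / ennreal d = ennreal (u/d)" using u d real by (simp add: divide_ennreal)
  show ?thesis unfolding * unfolding real(2) using u d by (simp add: lnorm_real ennpow_ennpow)
next
  case top
  have "ennpow (esssup M g) d = ennpow (esssup M (\<lambda>x. ennpow (ennpow (g x) d) (1/d))) d"
    using d by (simp add: ennpow_ennpow)
  also have "\<dots> \<le> ennpow (ennpow (esssup M (\<lambda>x. ennpow (g x) d)) (1/d)) d"
    using d by (intro ennpow_mono esssup_ennpow_le) auto
  also have "\<dots> = esssup M (\<lambda>x. ennpow (g x) d)" using d by (simp add: ennpow_ennpow)
  finally have "ennpow (esssup M g) d = esssup M (\<lambda>x. ennpow (g x) d)"
    using esssup_ennpow_le[of g M d] d by auto
  then show ?thesis using top d by (simp add: lnorm_top ennreal_top_divide)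
qed

text \<open>Young's inequality for the quotient x / l. The free scale l can be optimised after
  integration.\<close>

lemma young_powr:
  fixes x l u :: real
  assumes "0 \<le> x" "0 < l" "1 \<le> u"
  shows "x \<le> (l powr (1-u) / u) * x powr u + (u-1) * l / u"
proof -
  have "(x/l) \<le> (1/u) * (x/l) powr u + (1-1/u)"
    using Youngs_inequality_0[of "1/u" "1-1/u" "(x/l) powr u" 1] assms
    by (cases "x = 0") (auto simp: powr_powr)
  then have "l * (x/l) \<le> l * ((1/u) * (x/l) powr u + (1-1/u))" using assms by (intro mult_left_mono) auto
  also have "\<dots> = (l powr (1-u) / u) * x powr u + (u-1) * l / u"
    using assms by (simp add: powr_divide powr_diff field_simps)
  finally show ?thesis using assms by simp
qed

text \<open>Integrate \<open>young_powr\<close> and choose the scale afterwards. This handles values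
  in [0, \<infinity>] without any integrability of \<open>g\<close>.\<close>

lemma nn_integral_holder:
  assumes [measurable]: "g \<in> borel_measurable M"
    and M: "emeasure M (space M) \<le> ennreal e" and e: "0 < e" and u: "1 \<le> u"
  shows "ennpow (\<integral>\<^sup>+x. g x \<partial>M) u \<le> ennreal (e powr (u-1)) * (\<integral>\<^sup>+x. ennpow (g x) u \<partial>M)"
proof (cases "(\<integral>\<^sup>+x. ennpow (g x) u \<partial>M)")
  case (real i)
  show ?thesis
  proof (cases "i = 0")
    case True
    then have "AE x in M. ennpow (g x) u = 0" using real by (subst nn_integral_0_iff_AE[symmetric]) auto
    then have "(\<integral>\<^sup>+x. g x \<partial>M) = (\<integral>\<^sup>+x. 0 \<partial>M)" by (intro nn_integral_cong_AE) auto
    then show ?thesis by simp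
  next
    case False
    then have i: "0 < i" using real by auto
    \<comment> \<open>The u-th mean of \<open>g\<close> relative to the mass e; at this scale the
      integrated inequality is sharpest.\<close>
    define l where "l = (i/e) powr (1/u)"
    have l: "0 < l" using i e by (simp add: l_def)
    have lu: "l powr u = i/e" using i e u by (simp add: l_def powr_powr)
    have pt: "g x \<le> ennreal (l powr (1-u) / u) * ennpow (g x) u + ennreal ((u-1)*l/u)" for x
    proof (cases "g x")
      case (real y)
      then show ?thesis using young_powr[of y l u] l u
        by (auto simp: ennpow_ennreal simp flip: ennreal_mult ennreal_plus)
    next
      case top
      then show ?thesis using l u by (simp add: ennreal_mult_top)
    qed
    have "(\<integral>\<^sup>+x. g x \<partial>M) \<le> (\<integral>\<^sup>+x. ennreal (l powr (1-u) / u) * ennpow (g x) u + ennreal ((u-1)*l/u) \<partial>M)"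
      by (intro nn_integral_mono pt)
    also have "\<dots> = ennreal (l powr (1-u) / u) * ennreal i + ennreal ((u-1)*l/u) * emeasure M (space M)"
      by (simp add: nn_integral_add nn_integral_cmult real)
    also have "\<dots> \<le> ennreal (l powr (1-u) / u) * ennreal i + ennreal ((u-1)*l/u) * ennreal e"
      by (intro add_left_mono mult_left_mono M) auto
    also have "\<dots> = ennreal (l powr (1-u) / u * i + (u-1)*l/u * e)"
      using l u i e by (simp flip: ennreal_mult ennreal_plus)
    also have "l powr (1-u) / u * i + (u-1)*l/u * e = l * e"
      using l u i e by (simp add: powr_diff lu field_simps)
    finally have "ennpow (\<integral>\<^sup>+x. g x \<partial>M) u \<le> ennpow (ennreal (l*e)) u" using u by (intro ennpow_mono) auto
    also have "\<dots> = ennreal (e powr (u-1) * i)"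
      using l e u i by (simp add: ennpow_ennreal powr_mult lu powr_diff field_simps)
    also have "\<dots> = ennreal (e powr (u-1)) * ennreal i" using i by (simp add: ennreal_mult)
    finally show ?thesis using real by simp
  qed
next
  case top
  then show ?thesis using e by (simp add: ennreal_mult_top)
qed

lemma lnorm_holder:
  assumes [measurable]: "g \<in> borel_measurable M"
    and M: "emeasure M (space M) \<le> ennreal e" and e: "0 < e" and p: "1 \<le> p"
  shows "(\<integral>\<^sup>+x. g x \<partial>M) \<le> ennreal (e powr (1 - enn2real (1/p))) * lnorm M p g"
proof (cases p)
  case (real u)
  then have u: "1 \<le> u" using p by auto
  have "(\<integral>\<^sup>+x. g x \<partial>M) = ennpow (ennpow (\<integral>\<^sup>+x. g x \<partial>M) u) (1/u)" using u by (simp add: ennpow_ennpow)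
  also have "\<dots> \<le> ennpow (ennreal (e powr (u-1)) * (\<integral>\<^sup>+x. ennpow (g x) u \<partial>M)) (1/u)"
    using u by (intro ennpow_mono nn_integral_holder M e) auto
  also have "\<dots> = ennreal (e powr (1-1/u)) * lnorm M p g"
    using u e by (simp add: real ennpow_mult lnorm_real ennpow_ennreal powr_powr diff_divide_distrib)
  also have "1/u = enn2real (1/p)" using u real by (simp add: divide_ennreal flip: ennreal_1)
  finally show ?thesis .
next
  case top
  have "(\<integral>\<^sup>+x. g x \<partial>M) \<le> (\<integral>\<^sup>+x. esssup M g \<partial>M)" by (intro nn_integral_mono_AE esssup_AE)
  also have "\<dots> = esssup M g * emeasure M (space M)" by simp
  also have "\<dots> \<le> esssup M g * ennreal e" by (intro mult_left_mono M) auto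
  finally show ?thesis using top e by (simp add: lnorm_top mult.commute)
qed

text \<open>Pointwise, g^v is at most c^(v - u) g^u: the supremum bound pays for the excess
  exponent.\<close>

lemma lnorm_interpolate:
  assumes [measurable]: "g \<in> borel_measurable M"
    and p: "0 < p" "p \<le> s" and inf: "\<And>x. x \<in> space M \<Longrightarrow> g x \<le> c" and "lnorm M p g \<le> c"
  shows "lnorm M s g \<le> c"
proof (cases s)
  case top
  then show ?thesis using inf by (auto simp: lnorm_top intro!: esssup_I)
next
  case (real v)
  then obtain u where pu: "p = ennreal u" "0 < u" "u \<le> v" using p by (cases p) (auto simp: top_unique)
  have v: "0 < v" using pu by simp
  show ?thesis
  proof (cases "v = u")
    case True then show ?thesis using assms real pu by simp
  next
    case False
    then have uv: "u < v" using pu by simp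
    have *: "ennpow (g x) v \<le> ennpow c (v-u) * ennpow (g x) u" if "x \<in> space M" for x
    proof (cases "g x = 0")
      case False
      have "ennpow (g x) v = ennpow (g x) (v-u) * ennpow (g x) u" using False ennpow_add[of "g x" "v-u" u] by simp
      also have "\<dots> \<le> ennpow c (v-u) * ennpow (g x) u" using uv inf[OF that] by (intro mult_right_mono ennpow_mono) auto
      finally show ?thesis .
    qed simp
    have "(\<integral>\<^sup>+x. ennpow (g x) v \<partial>M) \<le> (\<integral>\<^sup>+x. ennpow c (v-u) * ennpow (g x) u \<partial>M)"
      by (intro nn_integral_mono *)
    also have "\<dots> = ennpow c (v-u) * ennpow (lnorm M p g) u"
      by (simp add: nn_integral_cmult pu lnorm_real_pow)
    also have "\<dots> \<le> ennpow c (v-u) * ennpow c u" using pu assms by (intro mult_left_mono ennpow_mono) auto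
    also have "\<dots> \<le> ennpow c v" by (cases "c = 0") (use ennpow_add[of c "v-u" u] in auto)
    finally have "ennpow (lnorm M s g) v \<le> ennpow c v" using v real by (simp add: lnorm_real_pow)
    then show ?thesis using v by (simp add: ennpow_le_iff)
  qed
qed

text \<open>The essential supremum of a section exceeds y exactly if the set where the section
  exceeds y has positive measure, and measures of sections depend measurably on x.\<close>

lemma borel_measurable_esssup:
  fixes f :: "'a \<Rightarrow> 'b \<Rightarrow> ennreal"
  assumes "sigma_finite_measure N"
    and f [measurable]: "case_prod f \<in> borel_measurable (M \<Otimes>\<^sub>M N)"
  shows "(\<lambda>x. esssup N (f x)) \<in> borel_measurable M"
proof -
  interpret N: sigma_finite_measure N by fact
  have [measurable]: "f x \<in> borel_measurable N" if "x \<in> space M" for x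
    using measurable_compose[OF measurable_Pair1'[OF that] f] by simp
  show ?thesis
  proof (rule borel_measurableI_greater)
    fix y
    have "(\<lambda>x. emeasure N (Pair x -` {z \<in> space (M \<Otimes>\<^sub>M N). y < case_prod f z})) \<in> borel_measurable M"
      by (rule N.measurable_emeasure_Pair) simp
    then have [measurable]: "(\<lambda>x. emeasure N {z \<in> space N. y < f x z}) \<in> borel_measurable M"
      by (rule measurable_cong[THEN iffD1, rotated])
         (auto intro!: arg_cong[where f="emeasure N"] simp: space_pair_measure)
    have "{x \<in> space M. y < esssup N (f x)} = {x \<in> space M. emeasure N {z \<in> space N. y < f x z} \<noteq> 0}"
    proof (intro Collect_cong conj_cong refl)
      fix x assume x: "x \<in> space M"
      have "esssup N (f x) \<le> y \<longleftrightarrow> emeasure N {z \<in> space N. y < f x z} = 0"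
      proof
        assume "esssup N (f x) \<le> y"
        moreover have "AE z in N. f x z \<le> esssup N (f x)" by (rule esssup_AE)
        ultimately have "AE z in N. \<not> y < f x z" by (auto elim!: eventually_mono)
        then show "emeasure N {z \<in> space N. y < f x z} = 0"
          using x by (subst (asm) AE_iff_measurable[OF _ refl]) auto
      next
        assume "emeasure N {z \<in> space N. y < f x z} = 0"
        then have "AE z in N. \<not> y < f x z"
          using x by (subst AE_iff_measurable[OF _ refl]) auto
        then show "esssup N (f x) \<le> y" using x by (intro esssup_I) (auto simp: not_less)
      qed
      then show "(y < esssup N (f x)) = (emeasure N {z \<in> space N. y < f x z} \<noteq> 0)" by (auto simp: not_le[symmetric])
    qed
    also have "\<dots> \<in> sets M" by measurable
    finally show "{x \<in> space M. y < esssup N (f x)} \<in> sets M" .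
  qed
qed

lemma borel_measurable_lnorm:
  assumes "sigma_finite_measure N" and [measurable]: "case_prod f \<in> borel_measurable (M \<Otimes>\<^sub>M N)"
  shows "(\<lambda>x. lnorm N p (f x)) \<in> borel_measurable M"
proof -
  interpret N: sigma_finite_measure N by fact
  show ?thesis
  proof (cases "p = top")
    case True
    then show ?thesis using assms by (simp add: lnorm_top borel_measurable_esssup)
  next
    case False
    have "(\<lambda>x. \<integral>\<^sup>+y. ennpow (f x y) (enn2real p) \<partial>N) \<in> borel_measurable M" by measurable
    then show ?thesis using False by (simp add: lnorm_def)
  qed
qed

text \<open>No duality is involved. The norm \<open>A y\<close> of the slice at y serves as a
  density on the second space. By Hoelder's inequality for this density, of mass at most e, the u-th
  power of the inner integral is at most e^(u - 1) times the integral of A (f / A)^u; integrated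
  over x, the latter is at most the mass of A by Fubini.\<close>

lemma lnorm_minkowski:
  fixes f :: "'a \<Rightarrow> 'b \<Rightarrow> ennreal"
  assumes "sigma_finite_measure M" "sigma_finite_measure N"
    and f [measurable]: "case_prod f \<in> borel_measurable (M \<Otimes>\<^sub>M N)" and p: "1 \<le> p"
  shows "lnorm M p (\<lambda>x. \<integral>\<^sup>+y. f x y \<partial>N) \<le> (\<integral>\<^sup>+y. lnorm M p (\<lambda>x. f x y) \<partial>N)"
proof -
  interpret M: sigma_finite_measure M by fact
  interpret N: sigma_finite_measure N by fact
  interpret P: pair_sigma_finite M N ..
  have f2 [measurable]: "(\<lambda>(y,x). f x y) \<in> borel_measurable (N \<Otimes>\<^sub>M M)"
    using measurable_pair_swap[OF f] by (simp add: case_prod_beta')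
  define A where "A y = lnorm M p (\<lambda>x. f x y)" for y
  have A [measurable]: "A \<in> borel_measurable N"
    unfolding A_def by (rule borel_measurable_lnorm) (use assms in auto)
  have [measurable]: "f x \<in> borel_measurable N" if "x \<in> space M" for x
    using measurable_compose[OF measurable_Pair1'[OF that] f] by simp
  have [measurable]: "(\<lambda>x. f x y) \<in> borel_measurable M" if "y \<in> space N" for y
    using measurable_compose[OF measurable_Pair1'[OF that] f2] by simp
  show ?thesis
  proof (cases p)
    case top
    have "AE y in N. AE x in M. f x y \<le> A y" by (auto simp: A_def top lnorm_top esssup_AE)
    then have "AE x in M. AE y in N. f x y \<le> A y"
      by (subst P.AE_commute) auto
    then have "AE x in M. (\<integral>\<^sup>+y. f x y \<partial>N) \<le> (\<integral>\<^sup>+y. A y \<partial>N)"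
      by (auto elim!: eventually_mono intro!: nn_integral_mono_AE)
    then show ?thesis unfolding A_def[symmetric] by (simp add: top lnorm_top esssup_I)
  next
    case (real u)
    then have u: "1 \<le> u" using p by auto
    \<comment> \<open>Where \<open>A\<close> vanishes the quotient f / A carries no information;
      there f itself vanishes almost everywhere, so f = A (f / A) survives.\<close>
    have "AE y in N. AE x in M. A y = 0 \<longrightarrow> f x y = 0"
    proof (rule AE_I2)
      fix y assume y: "y \<in> space N"
      show "AE x in M. A y = 0 \<longrightarrow> f x y = 0"
      proof (cases "A y = 0")
        case True
        then have "(\<integral>\<^sup>+x. ennpow (f x y) u \<partial>M) = 0" using real u by (simp add: A_def lnorm_real)
        then have "AE x in M. ennpow (f x y) u = 0" using y by (subst nn_integral_0_iff_AE[symmetric]) auto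
        then show ?thesis by auto
      qed auto
    qed
    then have A0: "AE x in M. AE y in N. A y = 0 \<longrightarrow> f x y = 0" by (subst P.AE_commute) auto
    show ?thesis unfolding A_def[symmetric]
    proof (rule ennreal_le_epsilon)
      fix \<epsilon> :: real assume "(\<integral>\<^sup>+y. A y \<partial>N) < top" and \<epsilon>: "0 < \<epsilon>"
      then obtain S where S: "(\<integral>\<^sup>+y. A y \<partial>N) = ennreal S" "0 \<le> S" by (cases "\<integral>\<^sup>+y. A y \<partial>N") auto
      \<comment> \<open>The summand \<epsilon> keeps the mass bound positive even if the right-hand
        side is 0.\<close>
      define e where "e = S + \<epsilon>"
      have e: "0 < e" using S \<epsilon> by (simp add: e_def)
      have AT: "AE y in N. A y \<noteq> top" using S nn_integral_PInf_AE[of A N] by auto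
      define N' where "N' = density N A"
      have N': "emeasure N' (space N') \<le> ennreal e"
        using \<epsilon> S by (simp add: N'_def emeasure_density S e_def cong: nn_integral_cong)
      have H: "AE x in M. ennpow (\<integral>\<^sup>+y. f x y \<partial>N) u \<le> ennreal (e powr (u-1)) * (\<integral>\<^sup>+y. A y * ennpow (f x y / A y) u \<partial>N)"
        using A0 AE_space
      proof eventually_elim
        case (elim x)
        then have [measurable]: "f x \<in> borel_measurable N" by simp
        have "(\<integral>\<^sup>+y. f x y \<partial>N) = (\<integral>\<^sup>+y. A y * (f x y / A y) \<partial>N)"
        proof (rule nn_integral_cong_AE)
          show "AE y in N. f x y = A y * (f x y / A y)" using elim(1) AT
          proof eventually_elim
            case (elim y)
            then show ?case
              by (cases "A y = 0") (auto simp: ennreal_mult_divide_cancel)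
          qed
        qed
        also have "\<dots> = (\<integral>\<^sup>+y. f x y / A y \<partial>N')" unfolding N'_def by (subst nn_integral_density) auto
        finally have "ennpow (\<integral>\<^sup>+y. f x y \<partial>N) u = ennpow (\<integral>\<^sup>+y. f x y / A y \<partial>N') u" by simp
        also have "\<dots> \<le> ennreal (e powr (u-1)) * (\<integral>\<^sup>+y. ennpow (f x y / A y) u \<partial>N')"
          by (rule nn_integral_holder[OF _ N' e u]) (simp add: N'_def)
        also have "(\<integral>\<^sup>+y. ennpow (f x y / A y) u \<partial>N') = (\<integral>\<^sup>+y. A y * ennpow (f x y / A y) u \<partial>N)"
          unfolding N'_def by (subst nn_integral_density) auto
        finally show ?case .
      qed
      have "(\<integral>\<^sup>+x. ennpow (\<integral>\<^sup>+y. f x y \<partial>N) u \<partial>M) \<le> (\<integral>\<^sup>+x. ennreal (e powr (u-1)) * (\<integral>\<^sup>+y. A y * ennpow (f x y / A y) u \<partial>N) \<partial>M)"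
        by (rule nn_integral_mono_AE[OF H])
      also have "\<dots> = ennreal (e powr (u-1)) * (\<integral>\<^sup>+x. (\<integral>\<^sup>+y. A y * ennpow (f x y / A y) u \<partial>N) \<partial>M)"
        by (rule nn_integral_cmult) measurable
      also have "(\<integral>\<^sup>+x. (\<integral>\<^sup>+y. A y * ennpow (f x y / A y) u \<partial>N) \<partial>M) = (\<integral>\<^sup>+y. (\<integral>\<^sup>+x. A y * ennpow (f x y / A y) u \<partial>M) \<partial>N)"
        by (rule P.Fubini'[symmetric]) measurable
      also have "\<dots> \<le> (\<integral>\<^sup>+y. A y \<partial>N)"
      proof (rule nn_integral_mono)
        fix y assume y: "y \<in> space N"
        then have [measurable]: "(\<lambda>x. f x y) \<in> borel_measurable M" by simp
        have *: "(\<integral>\<^sup>+x. ennpow (f x y) u \<partial>M) = ennpow (A y) u" using real u by (simp add: A_def lnorm_real_pow)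
        show "(\<integral>\<^sup>+x. A y * ennpow (f x y / A y) u \<partial>M) \<le> A y"
        proof (cases "A y = 0 \<or> A y = top")
          case False
          have "(\<integral>\<^sup>+x. A y * ennpow (f x y / A y) u \<partial>M) = A y * ennpow (inverse (A y)) u * ennpow (A y) u"
            by (simp add: divide_ennreal_def ennpow_mult nn_integral_cmult nn_integral_multc * mult_ac)
          also have "\<dots> = A y * ennpow (inverse (A y) * A y) u" by (simp add: ennpow_mult mult_ac)
          also have "inverse (A y) * A y = 1" using False by (auto simp: ennreal_inverse_mult_self)
          finally show ?thesis by (simp add: ennpow_def)
        qed auto
      qed
      also have "ennreal (e powr (u-1)) * (\<integral>\<^sup>+y. A y \<partial>N) \<le> ennreal (e powr (u-1)) * ennreal e"
        using S \<epsilon> by (intro mult_left_mono) (auto simp: e_def)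
      also have "\<dots> = ennreal (e powr u)" using e by (simp add: powr_diff flip: ennreal_mult)
      also have "\<dots> = ennpow (ennreal e) u" using e by (simp add: ennpow_ennreal)
      finally have "lnorm M p (\<lambda>x. \<integral>\<^sup>+y. f x y \<partial>N) \<le> ennreal e"
        using u real by (subst ennpow_le_iff[of u, symmetric]) (auto simp: lnorm_real_pow mult_left_mono)
      then show "lnorm M p (\<lambda>x. \<integral>\<^sup>+y. f x y \<partial>N) \<le> (\<integral>\<^sup>+y. A y \<partial>N) + ennreal \<epsilon>"
        using S \<epsilon> by (simp add: e_def)
    qed
  qed
qed

lemma ennpow_indicator_id [simp]: "ennpow (indicator A t) a = indicator A t"
  by (simp add: indicator_def ennpow_def)

text \<open>The integral form of Minkowski's inequality over a space with two points.\<close>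

lemma lnorm_add:
  assumes "sigma_finite_measure M" and [measurable]: "f \<in> borel_measurable M" "g \<in> borel_measurable M" and p: "1 \<le> p"
  shows "lnorm M p (\<lambda>x. f x + g x) \<le> lnorm M p f + lnorm M p g"
proof -
  have "lnorm M p (\<lambda>x. \<integral>\<^sup>+b. (if b then f x else g x) \<partial>count_space (UNIV::bool set))
      \<le> (\<integral>\<^sup>+b. lnorm M p (\<lambda>x. if b then f x else g x) \<partial>count_space (UNIV::bool set))"
  proof (rule lnorm_minkowski)
    show "(\<lambda>(x, y). if y then f x else g x) \<in> borel_measurable (M \<Otimes>\<^sub>M count_space UNIV)"
      by measurable
  qed (use assms in \<open>auto intro: sigma_finite_measure_count_space_countable\<close>)
  then show ?thesis by (simp add: nn_integral_count_space_finite UNIV_bool add.commute)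
qed

lemma lnorm_indicator_le:
  assumes [measurable]: "A \<in> sets M" and "emeasure M A \<le> ennreal a" "0 < a" and p: "1 \<le> p"
  shows "lnorm M p (indicator A) \<le> ennreal (a powr enn2real (1/p))"
proof (cases p)
  case (real u)
  then have u: "1 \<le> u" using p by auto
  have "(\<integral>\<^sup>+x. ennpow (indicator A x) u \<partial>M) = (\<integral>\<^sup>+x. indicator A x \<partial>M)"
    by (intro nn_integral_cong) (auto simp: indicator_def ennpow_def)
  then have "lnorm M p (indicator A) = ennpow (emeasure M A) (1/u)" using u by (simp add: real lnorm_real)
  also have "\<dots> \<le> ennpow (ennreal a) (1/u)" using u assms by (intro ennpow_mono) auto
  also have "\<dots> = ennreal (a powr enn2real (1/p))"
    using u real assms by (simp add: ennpow_ennreal divide_ennreal flip: ennreal_1)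
  finally show ?thesis .
next
  case top
  have "esssup M (indicator A) \<le> (1::ennreal)" by (intro esssup_I) (auto split: split_indicator)
  then show ?thesis using top assms by (simp add: lnorm_top)
qed

lemma lnorm_density_le:
  assumes [measurable]: "g \<in> borel_measurable M" "f \<in> borel_measurable M" and "\<And>x. f x \<le> 1"
  shows "lnorm (density M f) p g \<le> lnorm M p (g::_\<Rightarrow>ennreal)"
proof (cases "p = top")
  case True
  have "AE x in density M f. g x \<le> esssup M g" using esssup_AE[of g M] by (auto simp: AE_density elim: eventually_mono)
  then show ?thesis using True by (auto simp: lnorm_top)
next
  case False
  have "(\<integral>\<^sup>+x. ennpow (g x) (enn2real p) \<partial>density M f) = (\<integral>\<^sup>+x. f x * ennpow (g x) (enn2real p) \<partial>M)"
    by (rule nn_integral_density) auto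
  also have "\<dots> \<le> (\<integral>\<^sup>+x. 1 * ennpow (g x) (enn2real p) \<partial>M)" using assms by (intro nn_integral_mono mult_right_mono) auto
  finally show ?thesis using False by (simp add: lnorm_def ennpow_mono)
qed

lemma lnorm_density_indicator_le:
  assumes [measurable]: "g \<in> borel_measurable M" "A \<in> sets M"
  shows "lnorm (density M (indicator A)) p g \<le> lnorm M p (\<lambda>x. g x * indicator A x)"
proof -
  have "lnorm (density M (indicator A)) p g = lnorm (density M (indicator A)) p (\<lambda>x. g x * indicator A x)"
    by (rule lnorm_cong_AE) (auto simp: AE_density indicator_def)
  also have "\<dots> \<le> lnorm M p (\<lambda>x. g x * indicator A x)"
    by (rule lnorm_density_le) (auto split: split_indicator)
  finally show ?thesis .
qed

section \<open>Affine substitutions and norms of sequences\<close>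

lemma esssup_real_affine:
  fixes g :: "real \<Rightarrow> ennreal"
  assumes [measurable]: "g \<in> borel_measurable borel" and c: "c \<noteq> 0"
  shows "esssup lborel (\<lambda>t. g (b + c * t)) = esssup lborel g"
proof -
  have le: "esssup lborel (\<lambda>t. h (b + c * t)) \<le> esssup lborel h" if [measurable]: "h \<in> borel_measurable borel" and "c \<noteq> 0"
    for h :: "real \<Rightarrow> ennreal" and b c
    using that(2) by (intro esssup_I AE_borel_affine) (auto simp: esssup_AE)
  show ?thesis
  proof (rule antisym)
    show "esssup lborel (\<lambda>t. g (b + c * t)) \<le> esssup lborel g" by (rule le) (use c in auto)
    have "esssup lborel (\<lambda>t. g (b + c * (- b / c + 1/c * t))) \<le> esssup lborel (\<lambda>t. g (b + c * t))"
      by (rule le) (use c in auto)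
    then show "esssup lborel g \<le> esssup lborel (\<lambda>t. g (b + c * t))" using c by (simp add: field_simps)
  qed
qed

lemma lnorm_real_affine:
  fixes g :: "real \<Rightarrow> ennreal"
  assumes [measurable]: "g \<in> borel_measurable borel" and c: "0 < c" and p: "0 < p"
  shows "lnorm lborel p (\<lambda>t. g (b + c * t)) = ennreal (c powr (- enn2real (1/p))) * lnorm lborel p g"
proof (cases p)
  case (real u)
  then have u: "0 < u" using p by auto
  have "(\<integral>\<^sup>+x. ennpow (g x) u \<partial>lborel) = ennreal c * (\<integral>\<^sup>+x. ennpow (g (b + c * x)) u \<partial>lborel)"
    using c by (subst nn_integral_real_affine[where c=c and t=b]) auto
  then have "ennreal (1/c) * (\<integral>\<^sup>+x. ennpow (g x) u \<partial>lborel) = (\<integral>\<^sup>+x. ennpow (g (b + c * x)) u \<partial>lborel)"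
    using c by (simp add: mult.assoc[symmetric] flip: ennreal_mult)
  then have "lnorm lborel p (\<lambda>t. g (b + c * t)) = ennpow (ennreal (1/c) * (\<integral>\<^sup>+x. ennpow (g x) u \<partial>lborel)) (1/u)"
    using u by (simp add: real lnorm_real)
  also have "\<dots> = ennreal ((1/c) powr (1/u)) * lnorm lborel p g"
    using c u by (simp add: ennpow_mult ennpow_ennreal real lnorm_real)
  also have "(1/c) powr (1/u) = c powr (- enn2real (1/p))"
    using c u real by (simp add: powr_minus powr_divide field_simps divide_ennreal flip: ennreal_1)
  finally show ?thesis .
next
  case top
  then show ?thesis using c by (simp add: lnorm_top esssup_real_affine)
qed

lemma esssup_count_space:
  fixes f :: "'a \<Rightarrow> ennreal"
  shows "esssup (count_space UNIV) f = (SUP k. f k)"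
proof (rule antisym)
  show "esssup (count_space UNIV) f \<le> (SUP k. f k)"
    by (rule esssup_I) (auto simp: AE_count_space intro: SUP_upper)
  have "AE k in count_space UNIV. f k \<le> esssup (count_space UNIV) f" by (rule esssup_AE)
  then show "(SUP k. f k) \<le> esssup (count_space UNIV) f" by (auto simp: AE_count_space intro!: SUP_least)
qed

lemma lnorm_count_ge:
  assumes "0 < p"
  shows "f k \<le> lnorm (count_space UNIV) p f"
proof (cases p)
  case (real u)
  then have u: "0 < u" using assms by auto
  have "ennpow (f k) u = (\<integral>\<^sup>+j. ennpow (f j) u * indicator {k} j \<partial>count_space UNIV)"
    by (subst nn_integral_count_space'[of "{k}"]) auto
  also have "\<dots> \<le> (\<integral>\<^sup>+j. ennpow (f j) u \<partial>count_space UNIV)"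
    by (intro nn_integral_mono) (auto split: split_indicator)
  also have "\<dots> = ennpow (lnorm (count_space UNIV) p f) u" using u real by (simp add: lnorm_real_pow)
  finally show ?thesis using u by (simp add: ennpow_le_iff)
next
  case top
  then show ?thesis by (simp add: lnorm_top esssup_count_space SUP_upper)
qed

lemma lnorm_count_shift:
  "lnorm (count_space UNIV) p (\<lambda>k. f (k + j)) = lnorm (count_space UNIV) p (f :: int \<Rightarrow> ennreal)"
proof -
  have bij: "bij_betw (\<lambda>k. k + j) UNIV (UNIV::int set)" by (rule bij_betwI[where g="\<lambda>k. k - j"]) auto
  have "(SUP k. f (k + j)) = (SUP k\<in>(\<lambda>k. k + j) ` UNIV. f k)" by (simp only: image_image)
  also have "(\<lambda>k. k + j) ` UNIV = (UNIV::int set)" using bij by (rule bij_betw_imp_surj_on)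
  finally have "(SUP k. f (k + j)) = (SUP k. f k)" .
  moreover have "(\<integral>\<^sup>+k. ennpow (f (k + j)) u \<partial>count_space UNIV) = (\<integral>\<^sup>+k. ennpow (f k) u \<partial>count_space UNIV)" for u
    by (rule nn_integral_bij_count_space[OF bij])
  ultimately show ?thesis by (simp add: lnorm_def esssup_count_space)
qed

lemma nn_integral_geometric_int:
  assumes "0 < c"
  shows "(\<integral>\<^sup>+k. ennreal (2 powr (- c * \<bar>of_int k\<bar>)) \<partial>count_space (UNIV::int set)) < top"
proof -
  define x where "x = 2 powr (-c)"
  have x: "0 < x" "x < 1" using assms by (auto simp: x_def powr_less_one)
  have xp: "2 powr (- c * real n) = x ^ n" for n by (simp add: x_def powr_power mult.commute)
  have "(\<integral>\<^sup>+k. ennreal (2 powr (- c * \<bar>of_int k\<bar>)) \<partial>count_space (UNIV::int set))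
     \<le> (\<integral>\<^sup>+k. (\<Sum>n. ennreal (x^n) * (indicator {int n} k + indicator {- int n} k)) \<partial>count_space (UNIV::int set))"
  proof (rule nn_integral_mono)
    fix k :: int
    have "ennreal (2 powr (- c * \<bar>of_int k\<bar>)) \<le> ennreal (x^(nat \<bar>k\<bar>)) * (indicator {int (nat \<bar>k\<bar>)} k + indicator {- int (nat \<bar>k\<bar>)} k)"
    proof (cases "0 \<le> k")
      case True
      then show ?thesis using xp[of "nat \<bar>k\<bar>"] by (auto simp: indicator_def mult_left_mono algebra_simps)
    next
      case False
      then show ?thesis using xp[of "nat \<bar>k\<bar>"] by (auto simp: indicator_def)
    qed
    also have "\<dots> \<le> (\<Sum>n. ennreal (x^n) * (indicator {int n} k + indicator {- int n} k))"
      using sum_le_suminf[where I="{nat \<bar>k\<bar>}" and f="\<lambda>n. ennreal (x^n) * (indicator {int n} k + indicator {- int n} k)"] by simp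
    finally show "ennreal (2 powr (- c * \<bar>of_int k\<bar>)) \<le> (\<Sum>n. ennreal (x^n) * (indicator {int n} k + indicator {- int n} k))" .
  qed
  also have "\<dots> = (\<Sum>n. \<integral>\<^sup>+k. ennreal (x^n) * (indicator {int n} k + indicator {- int n} k) \<partial>count_space (UNIV::int set))"
    by (rule nn_integral_suminf) auto
  also have "\<dots> = (\<Sum>n. ennreal (x^n) * 2)"
    by (simp add: nn_integral_cmult nn_integral_add)
  also have "\<dots> = (\<Sum>n. ennreal (2 * x^n))"
    using x by (intro suminf_cong) (simp add: ennreal_mult mult.commute)
  also have "\<dots> < top"
    using x by (subst suminf_ennreal2) (auto intro!: summable_mult summable_geometric)
  finally show ?thesis .
qed

lemma lnorm_geometric_int:
  assumes "0 < c" "0 < p"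
  shows "lnorm (count_space (UNIV::int set)) p (\<lambda>k. ennreal (2 powr (- c * \<bar>of_int k\<bar>))) < top"
proof (cases p)
  case (real u)
  then have u: "0 < u" using assms by auto
  have "(\<integral>\<^sup>+k. ennpow (ennreal (2 powr (- c * \<bar>of_int k\<bar>))) u \<partial>count_space (UNIV::int set)) < top"
    using nn_integral_geometric_int[of "c*u"] assms u by (simp add: ennpow_ennreal powr_powr mult_ac)
  then show ?thesis using real u by (simp add: lnorm_real top.not_eq_extremum[symmetric])
next
  case top
  have "(SUP k::int. ennreal (2 powr (- c * \<bar>of_int k\<bar>))) \<le> 1"
  proof (intro SUP_least)
    fix k :: int
    have "2 powr (- c * \<bar>of_int k\<bar>) \<le> 2 powr (0::real)" using assms by (intro powr_mono) auto
    then show "ennreal (2 powr (- c * \<bar>of_int k\<bar>)) \<le> 1" by simp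
  qed
  also have "\<dots> < top" by simp
  finally show ?thesis using top by (simp add: lnorm_top esssup_count_space)
qed

subsection \<open>Herz quasi-norms of Borel functions\<close>

lemma dyadic_shell_powr: "dyadic_shell k = {t. 2 powr (of_int k - 1) \<le> \<bar>t\<bar> \<and> \<bar>t\<bar> < 2 powr (of_int k)}"
  unfolding dyadic_shell_def by (simp flip: powr_real_of_int')

lemma dyadic_shell_sets [measurable]: "dyadic_shell k \<in> sets borel"
  unfolding dyadic_shell_def by measurable

lemma emeasure_dyadic_shell: "emeasure lborel (dyadic_shell k) \<le> ennreal (2 powr of_int k)"
proof -
  let ?a = "2 powr (of_int k - 1) :: real"
  have b: "2 powr of_int k = 2 * ?a" by (simp add: powr_diff)
  have "emeasure lborel (dyadic_shell k) \<le> emeasure lborel ({-2*?a .. -?a} \<union> {?a .. 2*?a})"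
    by (intro emeasure_mono) (auto simp: dyadic_shell_powr b)
  also have "\<dots> \<le> emeasure lborel {-2*?a .. -?a} + emeasure lborel {?a .. 2*?a}"
    by (rule emeasure_subadditive) auto
  also have "\<dots> = ennreal (2 powr of_int k)" by (simp add: b flip: ennreal_plus)
  finally show ?thesis .
qed

lemma dyadic_shell_unique: "t \<noteq> 0 \<Longrightarrow> \<exists>!k. t \<in> dyadic_shell k"
proof -
  assume t: "t \<noteq> 0"
  have *: "t \<in> dyadic_shell k \<longleftrightarrow> k = \<lfloor>log 2 \<bar>t\<bar>\<rfloor> + 1" for k
  proof -
    have "t \<in> dyadic_shell k \<longleftrightarrow> of_int k - 1 \<le> log 2 \<bar>t\<bar> \<and> log 2 \<bar>t\<bar> < of_int k"
      using t by (simp add: dyadic_shell_powr le_log_iff log_less_iff)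
    also have "\<dots> \<longleftrightarrow> k = \<lfloor>log 2 \<bar>t\<bar>\<rfloor> + 1" by linarith
    finally show ?thesis .
  qed
  show ?thesis by (simp add: *)
qed

lemma nn_integral_indicator_dyadic_shell:
  assumes "t \<noteq> 0"
  shows "(\<integral>\<^sup>+k. c * indicator (dyadic_shell k) t \<partial>count_space UNIV) = c"
proof -
  obtain k where k: "t \<in> dyadic_shell k" "\<And>j. t \<in> dyadic_shell j \<Longrightarrow> j = k"
    using dyadic_shell_unique[OF assms] by (elim ex1E) blast
  have "(\<integral>\<^sup>+j. c * indicator (dyadic_shell j) t \<partial>count_space UNIV) = (\<Sum>j\<in>{k}. c * indicator (dyadic_shell j) t)"
  proof (rule nn_integral_count_space')
    fix j assume "j \<notin> {k}"
    then have "t \<notin> dyadic_shell j" using k(2) by blast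
    then show "c * indicator (dyadic_shell j) t = 0" by simp
  qed auto
  then show ?thesis using k(1) by simp
qed

text \<open>The Herz quasi-norm over Borel measure instead of its completion, where product
  measurability and Fubini's theorem apply; \<open>herz_qnorm_eq_hz\<close> shows agreement on Borel
  functions.\<close>

definition hz :: "ennreal \<Rightarrow> real \<Rightarrow> ennreal \<Rightarrow> (real \<Rightarrow> ennreal) \<Rightarrow> ennreal" where
  "hz p \<alpha> q g = lnorm (count_space UNIV) q
     (\<lambda>k. ennreal (2 powr (of_int k * \<alpha>)) * lnorm lborel p (\<lambda>t. g t * indicator (dyadic_shell k) t))"

lemma Lp_qnorm_eq_lnorm:
  assumes [measurable]: "g \<in> borel_measurable borel"
  shows "Lp_qnorm p g = lnorm lborel p g"
proof -
  have 1: "g \<in> borel_measurable lborel" "g \<in> borel_measurable lebesgue" by (auto intro: measurable_completion)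
  have "esssup lebesgue g = esssup lborel g"
    unfolding esssup_eq_AE[OF 1(1)] esssup_eq_AE[OF 1(2)] AE_completion_iff ..
  then show ?thesis by (simp add: Lp_qnorm_def lnorm_def nn_integral_completion)
qed

lemma herz_qnorm_eq_hz:
  assumes [measurable]: "g \<in> borel_measurable borel" and q: "0 < q"
  shows "herz_qnorm p \<alpha> q g = hz p \<alpha> q g"
proof (cases q)
  case (real u)
  then have u: "0 < u" using q by auto
  show ?thesis using u
    by (simp add: herz_qnorm_def hz_def real lnorm_real Lp_qnorm_eq_lnorm infsum_int_nn ennpow_mult ennpow_ennreal powr_powr)
next
  case top
  then show ?thesis by (simp add: herz_qnorm_def hz_def lnorm_top esssup_count_space Lp_qnorm_eq_lnorm)
qed

lemma hz_mono:
  assumes [measurable]: "g \<in> borel_measurable borel" and "\<And>t. g t \<le> h t"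
  shows "hz p \<alpha> q g \<le> hz p \<alpha> q h"
  unfolding hz_def using assms by (intro lnorm_mono mult_left_mono mult_right_mono) auto

lemma hz_cmult:
  assumes [measurable]: "g \<in> borel_measurable borel" and "0 < p" "0 < q" and c: "c < top"
  shows "hz p \<alpha> q (\<lambda>t. c * g t) = c * hz p \<alpha> q g"
  unfolding hz_def using assms by (simp add: lnorm_cmult mult.assoc mult.left_commute[of _ c])

lemma ennpow_hz:
  assumes [measurable]: "g \<in> borel_measurable borel" and "0 < p" "0 < q" and d: "0 < d"
  shows "ennpow (hz p \<alpha> q g) d = hz (p / ennreal d) (d * \<alpha>) (q / ennreal d) (\<lambda>t. ennpow (g t) d)"
  unfolding hz_def using assms
  by (simp add: ennpow_lnorm ennpow_mult ennpow_ennreal powr_powr mult_ac)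

lemma borel_measurable_hz:
  assumes [measurable]: "case_prod f \<in> borel_measurable (M \<Otimes>\<^sub>M borel)"
  shows "(\<lambda>x. hz p \<alpha> q (f x)) \<in> borel_measurable M"
proof -
  have [measurable]: "(\<lambda>x. lnorm lborel p (\<lambda>t. f x t * indicator (dyadic_shell k) t)) \<in> borel_measurable M" for k
    by (rule borel_measurable_lnorm) (auto intro: lborel.sigma_finite_measure_axioms)
  have "(\<lambda>(k,x). ennreal (2 powr (of_int k * \<alpha>)) * lnorm lborel p (\<lambda>t. f x t * indicator (dyadic_shell k) t))
     \<in> borel_measurable (count_space UNIV \<Otimes>\<^sub>M M)"
    by (rule measurable_pair_measure_countable1) auto
  from measurable_pair_swap[OF this]
  show ?thesis unfolding hz_def
    by (intro borel_measurable_lnorm) (auto simp: case_prod_beta' intro: sigma_finite_measure_count_space_countable)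
qed

text \<open>Minkowski's inequality twice: in the variable within a shell, then in the index of the
  shell.\<close>

lemma hz_minkowski:
  assumes N: "sigma_finite_measure N" and f [measurable]: "case_prod f \<in> borel_measurable (borel \<Otimes>\<^sub>M N)"
    and p: "1 \<le> p" and q: "1 \<le> q"
  shows "hz p \<alpha> q (\<lambda>s. \<integral>\<^sup>+t. f s t \<partial>N) \<le> (\<integral>\<^sup>+t. hz p \<alpha> q (\<lambda>s. f s t) \<partial>N)"
proof -
  interpret N: sigma_finite_measure N by fact
  have f2 [measurable]: "(\<lambda>(t,s). f s t) \<in> borel_measurable (N \<Otimes>\<^sub>M borel)"
    using measurable_pair_swap[OF f] by (simp add: case_prod_beta')
  define a where "a k t = ennreal (2 powr (of_int k * \<alpha>)) * lnorm lborel p (\<lambda>s. f s t * indicator (dyadic_shell k) s)" for k t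
  have m0 [measurable]: "(\<lambda>t. lnorm lborel p (\<lambda>s. f s t * indicator (dyadic_shell k) s)) \<in> borel_measurable N" for k
    by (rule borel_measurable_lnorm) (auto intro: lborel.sigma_finite_measure_axioms)
  have m1: "(\<lambda>(k,t). a k t) \<in> borel_measurable (count_space UNIV \<Otimes>\<^sub>M N)"
    unfolding a_def by (rule measurable_pair_measure_countable1) auto
  have "ennreal (2 powr (of_int k * \<alpha>)) * lnorm lborel p (\<lambda>s. (\<integral>\<^sup>+t. f s t \<partial>N) * indicator (dyadic_shell k) s)
     \<le> (\<integral>\<^sup>+t. a k t \<partial>N)" for k
  proof -
    have "lnorm lborel p (\<lambda>s. (\<integral>\<^sup>+t. f s t \<partial>N) * indicator (dyadic_shell k) s)
       = lnorm lborel p (\<lambda>s. \<integral>\<^sup>+t. f s t * indicator (dyadic_shell k) s \<partial>N)"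
      by (intro lnorm_cong nn_integral_multc[symmetric]) measurable
    also have "\<dots> \<le> (\<integral>\<^sup>+t. lnorm lborel p (\<lambda>s. f s t * indicator (dyadic_shell k) s) \<partial>N)"
      by (rule lnorm_minkowski[OF _ N]) (auto intro: lborel.sigma_finite_measure_axioms p)
    finally show ?thesis by (simp add: a_def nn_integral_cmult mult_left_mono)
  qed
  then have "hz p \<alpha> q (\<lambda>s. \<integral>\<^sup>+t. f s t \<partial>N) \<le> lnorm (count_space UNIV) q (\<lambda>k. \<integral>\<^sup>+t. a k t \<partial>N)"
    unfolding hz_def by (intro lnorm_mono) auto
  also have "\<dots> \<le> (\<integral>\<^sup>+t. lnorm (count_space UNIV) q (\<lambda>k. a k t) \<partial>N)"
    by (rule lnorm_minkowski[OF _ N m1 q]) (auto intro: sigma_finite_measure_count_space_countable)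
  finally show ?thesis by (simp add: hz_def a_def)
qed

lemma dyadic_shell_scale: "2 powr (- of_int j) * t \<in> dyadic_shell k \<longleftrightarrow> t \<in> dyadic_shell (k + j)"
proof -
  define c where "c = 2 powr (of_int j :: real)"
  have c: "0 < c" by (simp add: c_def)
  have 1: "\<bar>2 powr (- of_int j) * t\<bar> = \<bar>t\<bar> / c" by (simp add: abs_mult powr_minus c_def divide_inverse mult.commute)
  have 2: "2 powr (of_int (k + j) - 1) = 2 powr (of_int k - 1) * c" "2 powr (of_int (k + j)) = 2 powr (of_int k) * c"
    by (simp_all add: c_def flip: powr_add) (simp add: algebra_simps)
  show ?thesis
    unfolding dyadic_shell_powr mem_Collect_eq 1 2 using c by (simp add: pos_le_divide_eq pos_divide_less_eq)
qed

text \<open>A dilation by a power of two carries shells exactly onto shells, so scaling is an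
  identity and costs no constant that could depend on j.\<close>

lemma hz_scale:
  fixes j :: int
  assumes [measurable]: "g \<in> borel_measurable borel" and p: "0 < p" and q: "0 < q"
  shows "hz p \<alpha> q (\<lambda>t. g (2 powr (- of_int j) * t)) = ennreal (2 powr (of_int j * (\<alpha> + enn2real (1/p)))) * hz p \<alpha> q g"
proof -
  let ?a = "\<lambda>k. ennreal (2 powr (of_int k * \<alpha>)) * lnorm lborel p (\<lambda>t. g t * indicator (dyadic_shell k) t)"
  have "hz p \<alpha> q (\<lambda>t. g (2 powr (- of_int j) * t))
    = lnorm (count_space UNIV) q (\<lambda>k. ennreal (2 powr (of_int (k + j) * \<alpha>)) *
         lnorm lborel p (\<lambda>t. g (2 powr (- of_int j) * t) * indicator (dyadic_shell (k + j)) t))"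
    unfolding hz_def by (subst lnorm_count_shift[where j=j, symmetric]) simp
  also have "\<dots> = lnorm (count_space UNIV) q (\<lambda>k. ennreal (2 powr (of_int j * (\<alpha> + enn2real (1/p)))) * ?a k)"
  proof (rule lnorm_cong)
    fix k :: int
    have "lnorm lborel p (\<lambda>t. g (2 powr (- of_int j) * t) * indicator (dyadic_shell (k + j)) t)
       = lnorm lborel p (\<lambda>t. (\<lambda>u. g u * indicator (dyadic_shell k) u) (0 + 2 powr (- of_int j) * t))"
      by (rule lnorm_cong) (auto simp: indicator_def dyadic_shell_scale)
    also have "\<dots> = ennreal ((2 powr (- of_int j)) powr (- enn2real (1/p))) * lnorm lborel p (\<lambda>u. g u * indicator (dyadic_shell k) u)"
      by (rule lnorm_real_affine) (use p in auto)
    also have "(2 powr (- of_int j)) powr (- enn2real (1/p)) = 2 powr (of_int j * enn2real (1/p))" by (simp add: powr_powr)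
    finally have *: "lnorm lborel p (\<lambda>t. g (2 powr (- of_int j) * t) * indicator (dyadic_shell (k + j)) t)
      = ennreal (2 powr (of_int j * enn2real (1/p))) * lnorm lborel p (\<lambda>u. g u * indicator (dyadic_shell k) u)" .
    have "2 powr (of_int (k + j) * \<alpha>) * 2 powr (of_int j * enn2real (1/p))
       = 2 powr (of_int j * (\<alpha> + enn2real (1/p))) * 2 powr (of_int k * \<alpha>)"
      by (simp add: algebra_simps flip: powr_add)
    then have "ennreal (2 powr (of_int (k + j) * \<alpha>)) * ennreal (2 powr (of_int j * enn2real (1/p)))
       = ennreal (2 powr (of_int j * (\<alpha> + enn2real (1/p)))) * ennreal (2 powr (of_int k * \<alpha>))"
      by (simp only: ennreal_mult[symmetric] powr_ge_zero)
    then show "ennreal (2 powr (of_int (k + j) * \<alpha>)) *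
         lnorm lborel p (\<lambda>t. g (2 powr (- of_int j) * t) * indicator (dyadic_shell (k + j)) t) =
         ennreal (2 powr (of_int j * (\<alpha> + enn2real (1/p)))) * ?a k"
      unfolding * by (simp only: mult.assoc[symmetric])
  qed
  also have "\<dots> = ennreal (2 powr (of_int j * (\<alpha> + enn2real (1/p)))) * hz p \<alpha> q g"
    unfolding hz_def by (rule lnorm_cmult) (use q in auto)
  finally show ?thesis .
qed

text \<open>Covers \<open>c = top\<close> too, which occurs when the constant is itself a possibly
  infinite norm.\<close>

lemma lnorm_cmult_le:
  assumes [measurable]: "g \<in> borel_measurable M" and p: "0 < p"
  shows "lnorm M p (\<lambda>x. c * g x) \<le> c * lnorm M p g"
proof (cases p)
  case (real u)
  then have u: "0 < u" using p by auto
  show ?thesis unfolding real(2) lnorm_real[OF u]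
    by (simp add: ennpow_mult nn_integral_cmult ennpow_ennpow) (use u in simp)
next
  case top
  then show ?thesis by (simp add: lnorm_top esssup_ennreal_cmult_le)
qed

subsection \<open>The one-dimensional embedding\<close>

definition wt :: "real \<Rightarrow> real \<Rightarrow> real" where "wt N y = (1 + \<bar>y\<bar>) powr (- N)"

lemma wt_nonneg [simp]: "0 \<le> wt N y" by (simp add: wt_def)

lemma wt_le_1: "0 \<le> N \<Longrightarrow> wt N y \<le> 1"
  using powr_mono[of "-N" 0 "1 + \<bar>y\<bar>"] by (simp add: wt_def split: if_splits)

lemma wt_measurable [measurable]: "wt N \<in> borel_measurable borel"
  unfolding wt_def by measurable

lemma wt_integral:
  assumes "2 \<le> N"
  obtains E where "1 \<le> E" "(\<integral>\<^sup>+y. ennreal (wt N y) \<partial>lborel) \<le> ennreal E"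
proof -
  have "integrable lborel (\<lambda>x::real. inverse (1 + x^2))"
    using integrable_inverse_1_plus_square by (simp add: set_integrable_def)
  then have "(\<integral>\<^sup>+y. ennreal (norm (inverse (1 + y^2) :: real)) \<partial>lborel) < top"
    unfolding integrable_iff_bounded by simp
  moreover have "(\<integral>\<^sup>+y. ennreal (wt N y) \<partial>lborel) \<le> (\<integral>\<^sup>+y. ennreal (norm (inverse (1 + y^2) :: real)) \<partial>lborel)"
  proof (intro nn_integral_mono ennreal_leI)
    fix y :: real
    have "wt N y \<le> (1 + \<bar>y\<bar>) powr (-2)" unfolding wt_def using assms by (intro powr_mono) auto
    also have "\<dots> = inverse ((1 + \<bar>y\<bar>)^2)" by (simp add: powr_minus powr_realpow)
    also have "\<dots> \<le> inverse (1 + y^2)"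
      by (intro le_imp_inverse_le) (auto simp: power2_eq_square algebra_simps add_pos_nonneg)
    finally show "wt N y \<le> norm (inverse (1 + y^2))" by simp
  qed
  ultimately have fin: "(\<integral>\<^sup>+y. ennreal (wt N y) \<partial>lborel) < top" by (rule le_less_trans[rotated])
  show ?thesis
  proof (rule that)
    have "(\<integral>\<^sup>+y. ennreal (wt N y) \<partial>lborel) = ennreal (enn2real (\<integral>\<^sup>+y. ennreal (wt N y) \<partial>lborel))"
      using fin by simp
    also have "\<dots> \<le> ennreal (1 + enn2real (\<integral>\<^sup>+y. ennreal (wt N y) \<partial>lborel))" by (intro ennreal_leI) simp
    finally show "(\<integral>\<^sup>+y. ennreal (wt N y) \<partial>lborel) \<le> \<dots>" .
  qed simp
qed

text \<open>If the indices of the two shells differ by at least 2, then \<bar>y - t\<bar> is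
  comparable to the larger radius; for radii up to 4 the summand 1 in the weight suffices. What is
  excluded are neighbouring shells with \<open>1 \<le> k\<close>.\<close>

lemma wt_far:
  assumes N: "0 \<le> N" and t: "t \<in> dyadic_shell k" and y: "y \<in> dyadic_shell m" and km: "\<not> (1 \<le> k \<and> \<bar>k - m\<bar> \<le> 1)"
  shows "wt N (y - t) \<le> 4 powr N * 2 powr (- N * of_int (max (max k m) 0))"
proof -
  define u where "u = max (max k m) 0"
  have "2 powr (of_int u) / 4 \<le> 1 + \<bar>y - t\<bar>"
  proof (cases "u \<le> 2")
    case True
    then have "2 powr (of_int u) \<le> 2 powr (2::real)" by (intro powr_mono) auto
    then have "2 powr (of_int u) / 4 \<le> (1::real)" by simp
    also have "1 \<le> 1 + \<bar>y - t\<bar>" by simp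
    finally show ?thesis .
  next
    case False
    have aux: "2 powr (of_int u) / 4 \<le> \<bar>b - a\<bar>" if "a \<in> dyadic_shell i" "b \<in> dyadic_shell u" "i \<le> u - 2" for a b :: real and i
    proof -
      have "\<bar>a\<bar> < 2 powr (of_int i)" using that by (simp add: dyadic_shell_powr)
      also have "\<dots> \<le> 2 powr (of_int u - 2)" using that by (intro powr_mono) auto
      also have "\<dots> = 2 powr (of_int u) / 4" by (simp add: powr_diff)
      finally have 1: "\<bar>a\<bar> < 2 powr (of_int u) / 4" .
      have "2 powr (of_int u) / 2 \<le> \<bar>b\<bar>" using that by (simp add: dyadic_shell_powr powr_diff)
      with 1 show ?thesis by linarith
    qed
    have "(u = k \<and> m \<le> u - 2) \<or> (u = m \<and> k \<le> u - 2)" using False km by (auto simp: u_def max_def split: if_splits)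
    then show ?thesis
    proof (elim disjE conjE)
      assume u: "u = k" "m \<le> u - 2"
      have "2 powr (of_int u) / 4 \<le> \<bar>t - y\<bar>" by (rule aux[OF y _ u(2)]) (use t u(1) in \<open>simp only:\<close>)
      then show ?thesis by linarith
    next
      assume u: "u = m" "k \<le> u - 2"
      have "2 powr (of_int u) / 4 \<le> \<bar>y - t\<bar>" by (rule aux[OF t _ u(2)]) (use y u(1) in \<open>simp only:\<close>)
      then show ?thesis by linarith
    qed
  qed
  then have "(1 + \<bar>y - t\<bar>) powr (-N) \<le> (2 powr (of_int u) / 4) powr (-N)" using N by (intro powr_mono2') auto
  also have "\<dots> = 4 powr N * 2 powr (- N * of_int u)"
  proof -
    have "(2 powr (of_int u) / 4) powr (-N) = (2 powr (of_int u)) powr (-N) / 4 powr (-N)"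
      by (rule powr_divide)
    also have "(2 powr (of_int u)) powr (-N) = 2 powr (- N * real_of_int u)" by (simp add: powr_powr mult.commute)
    also have "4 powr (-N) = inverse (4 powr N)" by (rule powr_minus)
    finally show ?thesis by (simp only: divide_inverse inverse_inverse_eq mult.commute)
  qed
  finally show ?thesis unfolding wt_def u_def .
qed

lemma nn_integral_shell_holder:
  assumes [measurable]: "g \<in> borel_measurable borel" and p: "1 \<le> p"
  shows "(\<integral>\<^sup>+y. g y * indicator (dyadic_shell m) y \<partial>lborel)
    \<le> ennreal (2 powr (of_int m * (1 - enn2real (1/p)))) * lnorm lborel p (\<lambda>y. g y * indicator (dyadic_shell m) y)"
proof -
  let ?M = "density lborel (indicator (dyadic_shell m))"
  have "emeasure ?M (space ?M) \<le> ennreal (2 powr of_int m)"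
    using emeasure_dyadic_shell[of m] by (simp add: emeasure_density)
  have "(\<integral>\<^sup>+y. g y * indicator (dyadic_shell m) y \<partial>lborel) = (\<integral>\<^sup>+y. g y \<partial>?M)"
    by (subst nn_integral_density) (auto simp: mult.commute)
  also have "\<dots> \<le> ennreal ((2 powr of_int m) powr (1 - enn2real (1/p))) * lnorm ?M p g"
    by (rule lnorm_holder) (use p \<open>emeasure ?M (space ?M) \<le> _\<close> in auto)
  also have "\<dots> \<le> ennreal ((2 powr of_int m) powr (1 - enn2real (1/p))) * lnorm lborel p (\<lambda>y. g y * indicator (dyadic_shell m) y)"
    by (intro mult_left_mono lnorm_density_indicator_le) auto
  finally show ?thesis by (simp add: powr_powr)
qed

text \<open>On such a pair of shells the weight may be replaced by a constant. What remains is
  Hoelder's inequality on the source shell and the measure of the target shell.\<close>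

lemma convolution_far_bound:
  assumes [measurable]: "g \<in> borel_measurable borel" and p: "1 \<le> p" and s: "1 \<le> s" and N: "0 \<le> N"
    and km: "\<not> (1 \<le> k \<and> \<bar>k - m\<bar> \<le> 1)"
  shows "lnorm lborel s (\<lambda>t. indicator (dyadic_shell k) t * (\<integral>\<^sup>+y. g y * indicator (dyadic_shell m) y * ennreal (wt N (y - t)) \<partial>lborel))
    \<le> ennreal (4 powr N * 2 powr (of_int k * enn2real (1/s) + of_int m * (1 - enn2real (1/p)) - N * of_int (max (max k m) 0)))
       * lnorm lborel p (\<lambda>y. g y * indicator (dyadic_shell m) y)"
proof -
  let ?a = "lnorm lborel p (\<lambda>y. g y * indicator (dyadic_shell m) y)"
  define c where "c = 4 powr N * 2 powr (- N * of_int (max (max k m) 0))"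
  let ?h = "2 powr (of_int m * (1 - enn2real (1/p)))"
  have "indicator (dyadic_shell k) t * (\<integral>\<^sup>+y. g y * indicator (dyadic_shell m) y * ennreal (wt N (y - t)) \<partial>lborel)
      \<le> ennreal c * (ennreal ?h * ?a) * indicator (dyadic_shell k) t" for t
  proof (cases "t \<in> dyadic_shell k")
    case True
    have "(\<integral>\<^sup>+y. g y * indicator (dyadic_shell m) y * ennreal (wt N (y - t)) \<partial>lborel)
       \<le> (\<integral>\<^sup>+y. g y * indicator (dyadic_shell m) y * ennreal c \<partial>lborel)"
      using wt_far[OF N True _ km]
      by (intro nn_integral_mono) (auto simp: indicator_def c_def intro!: mult_left_mono ennreal_leI)
    also have "\<dots> = ennreal c * (\<integral>\<^sup>+y. g y * indicator (dyadic_shell m) y \<partial>lborel)"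
      by (subst nn_integral_multc) (auto simp: mult.commute)
    also have "\<dots> \<le> ennreal c * (ennreal ?h * ?a)"
      by (intro mult_left_mono nn_integral_shell_holder) (use p in auto)
    finally show ?thesis using True by simp
  qed simp
  then have "lnorm lborel s (\<lambda>t. indicator (dyadic_shell k) t * (\<integral>\<^sup>+y. g y * indicator (dyadic_shell m) y * ennreal (wt N (y - t)) \<partial>lborel))
    \<le> lnorm lborel s (\<lambda>t. ennreal c * (ennreal ?h * ?a) * indicator (dyadic_shell k) t)"
    by (intro lnorm_mono) auto
  also have "\<dots> \<le> ennreal c * (ennreal ?h * ?a) * lnorm lborel s (indicator (dyadic_shell k))"
    by (rule lnorm_cmult_le) (use s in \<open>auto intro: less_le_trans[OF zero_less_one]\<close>)
  also have "\<dots> \<le> ennreal c * (ennreal ?h * ?a) * ennreal ((2 powr of_int k) powr enn2real (1/s))"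
    by (intro mult_left_mono lnorm_indicator_le emeasure_dyadic_shell) (use s in auto)
  also have "\<dots> = ennreal (c * ?h * (2 powr of_int k) powr enn2real (1/s)) * ?a"
    by (simp add: ennreal_mult c_def mult_ac)
  also have "c * ?h * (2 powr of_int k) powr enn2real (1/s) =
     4 powr N * 2 powr (of_int k * enn2real (1/s) + of_int m * (1 - enn2real (1/p)) - N * of_int (max (max k m) 0))"
    unfolding c_def by (simp add: powr_powr powr_add powr_diff powr_minus divide_inverse)
  finally show ?thesis .
qed

text \<open>Young's convolution inequality from its endpoints: Hoelder's inequality against the
  weight bounds the supremum, Minkowski's inequality bounds the norm with the same exponent, and
  interpolation gives the exponents between.\<close>

lemma convolution_near_bound:
  assumes [measurable]: "g \<in> borel_measurable borel" and p: "1 \<le> p" "p \<le> s" and N: "0 \<le> N"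
    and E: "1 \<le> E" "(\<integral>\<^sup>+y. ennreal (wt N y) \<partial>lborel) \<le> ennreal E"
  shows "lnorm lborel s (\<lambda>t. \<integral>\<^sup>+y. g y * ennreal (wt N (y - t)) \<partial>lborel) \<le> ennreal E * lnorm lborel p g"
proof (rule lnorm_interpolate[OF _ _ p(2)])
  have p0: "0 < p" using p(1) by (rule less_le_trans[OF zero_less_one])
  show "0 < p" by fact
  fix t :: real
  let ?M = "density lborel (\<lambda>y. ennreal (wt N (y - t)))"
  have "emeasure ?M (space ?M) = (\<integral>\<^sup>+y. ennreal (wt N (y - t)) \<partial>lborel)" by (simp add: emeasure_density)
  also have "\<dots> = (\<integral>\<^sup>+y. ennreal (wt N y) \<partial>lborel)"
    by (subst nn_integral_real_affine[where c=1 and t=t]) auto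
  finally have M: "emeasure ?M (space ?M) \<le> ennreal E" using E by simp
  have "(\<integral>\<^sup>+y. g y * ennreal (wt N (y - t)) \<partial>lborel) = (\<integral>\<^sup>+y. g y \<partial>?M)"
    by (subst nn_integral_density) (auto simp: mult.commute)
  also have "\<dots> \<le> ennreal (E powr (1 - enn2real (1/p))) * lnorm ?M p g"
    by (rule lnorm_holder[OF _ M]) (use E p in auto)
  also have "\<dots> \<le> ennreal E * lnorm lborel p g"
  proof (intro mult_mono lnorm_density_le ennreal_leI)
    show "E powr (1 - enn2real (1/p)) \<le> E" using powr_mono[of "1 - enn2real (1/p)" 1 E] E by simp
  qed (use wt_le_1[OF N] in auto)
  finally show "(\<integral>\<^sup>+y. g y * ennreal (wt N (y - t)) \<partial>lborel) \<le> ennreal E * lnorm lborel p g" .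
next
  have p0: "0 < p" using p(1) by (rule less_le_trans[OF zero_less_one])
  have "(\<integral>\<^sup>+y. g y * ennreal (wt N (y - t)) \<partial>lborel) = (\<integral>\<^sup>+y. ennreal (wt N y) * g (y + t) \<partial>lborel)" for t
    by (subst nn_integral_real_affine[where c=1 and t=t]) (auto simp: mult.commute add.commute)
  then have "lnorm lborel p (\<lambda>t. \<integral>\<^sup>+y. g y * ennreal (wt N (y - t)) \<partial>lborel)
     = lnorm lborel p (\<lambda>t. \<integral>\<^sup>+y. ennreal (wt N y) * g (y + t) \<partial>lborel)" by simp
  also have "\<dots> \<le> (\<integral>\<^sup>+y. lnorm lborel p (\<lambda>t. ennreal (wt N y) * g (y + t)) \<partial>lborel)"
    by (rule lnorm_minkowski) (auto intro: lborel.sigma_finite_measure_axioms p)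
  also have "\<dots> = (\<integral>\<^sup>+y. ennreal (wt N y) * lnorm lborel p g \<partial>lborel)"
    using lnorm_real_affine[of g 1 p] p0 by (simp add: lnorm_cmult)
  also have "\<dots> = (\<integral>\<^sup>+y. ennreal (wt N y) \<partial>lborel) * lnorm lborel p g"
    by (simp add: nn_integral_multc)
  also have "\<dots> \<le> ennreal E * lnorm lborel p g" using E by (intro mult_right_mono) auto
  finally show "lnorm lborel p (\<lambda>t. \<integral>\<^sup>+y. g y * ennreal (wt N (y - t)) \<partial>lborel) \<le> ennreal E * lnorm lborel p g" .
qed simp

lemma three_ennreal: "x + (x + x) = 3 * (x::ennreal)"
proof -
  have "(3::ennreal) = 1 + 1 + 1" by simp
  then show ?thesis by (simp only: distrib_right mult_1 add.assoc)
qed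

text \<open>For a positive index k, changing the growth 2^(k a) into the decay 2^(-k a) costs 2 k a
  in the exponent. This is the origin of the factor 2 in the hypothesis on \<open>N\<close>.\<close>

lemma exponent_bound:
  fixes a b N :: real and k m :: int
  assumes "0 \<le> a" "0 \<le> b" "2 * (a + b) \<le> N"
  shows "of_int k * a + of_int m * b - N * of_int (max (max k m) 0) \<le> - a * \<bar>of_int k\<bar> - b * \<bar>of_int m\<bar>"
proof -
  define u where "u = real_of_int (max (max k m) 0)"
  have u: "0 \<le> u" "real_of_int k + \<bar>of_int k\<bar> \<le> 2 * u" "real_of_int m + \<bar>of_int m\<bar> \<le> 2 * u"
    by (auto simp: u_def)
  have "(real_of_int k + \<bar>of_int k\<bar>) * a \<le> 2 * u * a" "(real_of_int m + \<bar>of_int m\<bar>) * b \<le> 2 * u * b"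
    using u assms by (auto intro: mult_right_mono)
  moreover have "2 * (a + b) * u \<le> N * u" using u assms by (intro mult_right_mono) auto
  ultimately show ?thesis unfolding u_def[symmetric] by (simp add: algebra_simps)
qed

text \<open>On shell k the function is estimated by its pieces on all shells m. Away from
  neighbouring shells the coefficient factorises into a decay in k, summable because A > 0, and a
  decay in m, summable because \<gamma> > 0; there the pieces enter only through their supremum. On
  neighbouring shells the two weights are compared directly, and the factor with \<delta> is what
  remains.\<close>

lemma hz_embedding_unit:
  assumes p: "1 \<le> p" "p \<le> s" and r: "1 \<le> r" and \<theta>: "1 \<le> \<theta>"
    and a: "0 < \<alpha>1 + enn2real (1/s)" and b: "\<alpha>2 + enn2real (1/p) < 1"
    and \<alpha>: "\<alpha>1 \<le> \<alpha>2" "\<alpha>1 = \<alpha>2 \<Longrightarrow> \<theta> = r"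
    and N: "2 \<le> N" "2 * (\<alpha>1 + enn2real (1/s) + (1 - enn2real (1/p) - \<alpha>2)) \<le> N"
  shows "\<exists>K>0. \<forall>G\<in>borel_measurable borel.
    (\<forall>t. G t \<le> ennreal C * (\<integral>\<^sup>+y. G (t + y) * ennreal (wt N y) \<partial>lborel)) \<longrightarrow>
    hz s \<alpha>1 r G \<le> ennreal K * hz p \<alpha>2 \<theta> G"
proof -
  obtain E where E: "1 \<le> E" "(\<integral>\<^sup>+y. ennreal (wt N y) \<partial>lborel) \<le> ennreal E"
    using wt_integral[OF N(1)] by blast
  define \<gamma> where "\<gamma> = 1 - enn2real (1/p) - \<alpha>2"
  define \<delta> where "\<delta> = \<alpha>2 - \<alpha>1"
  define A where "A = \<alpha>1 + enn2real (1/s)"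
  have pos: "0 < A" "0 < \<gamma>" "0 \<le> \<delta>" using assms by (auto simp: A_def \<gamma>_def \<delta>_def)
  have s1: "1 \<le> s" using p by (rule order_trans)
  have r0: "0 < r" and \<theta>0: "0 < \<theta>" using r \<theta> by (auto intro: less_le_trans[OF zero_less_one])
  \<comment> \<open>The summands belong to the far and the near estimate; in the latter, exchanging
    m for k with \<bar>k - m\<bar> \<le> 1 in the weight costs
    \<open>2 powr \<bar>\<alpha>2\<bar>\<close>.\<close>
  define K1 where "K1 = 4 powr N + E * 2 powr \<bar>\<alpha>2\<bar>"
  have K1: "0 < K1" using E by (simp add: K1_def add_pos_pos)
  let ?Z = "count_space (UNIV :: int set)"
  have sfZ: "sigma_finite_measure ?Z" by (auto intro: sigma_finite_measure_count_space_countable)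
  define S where "S = (\<integral>\<^sup>+k. ennreal (2 powr (- \<gamma> * \<bar>of_int k\<bar>)) \<partial>?Z)"
  \<comment> \<open>For \<delta> = 0 there is no decay to spend; source and target then have the
    same sequence norm, and the constant is 1.\<close>
  define Q where "Q = (if \<delta> = 0 then 1 else lnorm ?Z r (\<lambda>k. ennreal (2 powr (- \<delta> * \<bar>of_int k\<bar>))))"
  define A' where "A' = lnorm ?Z r (\<lambda>k. ennreal (2 powr (- A * \<bar>of_int k\<bar>)))"
  have S: "S < top" unfolding S_def using pos by (rule_tac nn_integral_geometric_int)
  have A': "A' < top" unfolding A'_def using pos r0 by (intro lnorm_geometric_int) auto
  have Q: "Q < top" using lnorm_geometric_int[of \<delta> r] pos r0 by (auto simp: Q_def)
  define KK where "KK = ennreal (C * K1) * (S * A' + 3 * Q)"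
  have KK: "KK < top" using S A' Q by (simp add: KK_def ennreal_mult_less_top)
  have main: "hz s \<alpha>1 r G \<le> KK * hz p \<alpha>2 \<theta> G"
    if [measurable]: "G \<in> borel_measurable borel"
    and G: "\<And>t. G t \<le> ennreal C * (\<integral>\<^sup>+y. G (t + y) * ennreal (wt N y) \<partial>lborel)" for G
  proof (cases "0 \<le> C")
    case C: True
    define am where "am m = lnorm lborel p (\<lambda>y. G y * indicator (dyadic_shell m) y)" for m
    define bm where "bm m = ennreal (2 powr (of_int m * \<alpha>2)) * am m" for m
    define B where "B = lnorm ?Z \<theta> bm"
    have B: "hz p \<alpha>2 \<theta> G = B" by (simp add: hz_def B_def bm_def[abs_def] am_def)
    have bB: "bm m \<le> B" for m unfolding B_def by (rule lnorm_count_ge[OF \<theta>0])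
    define ek where "ek k = ennreal (2 powr (of_int k * \<alpha>1)) * lnorm lborel s (\<lambda>t. G t * indicator (dyadic_shell k) t)" for k
    define U where "U k m = lnorm lborel s (\<lambda>t. indicator (dyadic_shell k) t *
        (\<integral>\<^sup>+y. G y * indicator (dyadic_shell m) y * ennreal (wt N (y - t)) \<partial>lborel))" for k m
    have Gdec: "G t \<le> ennreal C * (\<integral>\<^sup>+m. \<integral>\<^sup>+y. G y * indicator (dyadic_shell m) y * ennreal (wt N (y - t)) \<partial>lborel \<partial>?Z)" for t
    proof -
      have "(\<integral>\<^sup>+y. G (t + y) * ennreal (wt N y) \<partial>lborel) = (\<integral>\<^sup>+y. G y * ennreal (wt N (y - t)) \<partial>lborel)"
        by (subst (2) nn_integral_real_affine[where c=1 and t=t]) auto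
      also have "\<dots> = (\<integral>\<^sup>+y. (\<integral>\<^sup>+m. G y * indicator (dyadic_shell m) y * ennreal (wt N (y - t)) \<partial>?Z) \<partial>lborel)"
      proof (rule nn_integral_cong_AE)
        \<comment> \<open>The origin lies in no shell.\<close>
        have "AE y in lborel. y \<noteq> (0::real)" by (rule AE_lborel_singleton)
        then show "AE y in lborel. G y * ennreal (wt N (y - t)) = (\<integral>\<^sup>+m. G y * indicator (dyadic_shell m) y * ennreal (wt N (y - t)) \<partial>?Z)"
        proof eventually_elim
          case (elim y)
          have "(\<integral>\<^sup>+m. G y * indicator (dyadic_shell m) y * ennreal (wt N (y - t)) \<partial>?Z)
            = (\<integral>\<^sup>+m. (G y * ennreal (wt N (y - t))) * indicator (dyadic_shell m) y \<partial>?Z)" by (simp add: mult_ac)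
          then show ?case using nn_integral_indicator_dyadic_shell[OF elim] by simp
        qed
      qed
      also have "\<dots> = (\<integral>\<^sup>+m. \<integral>\<^sup>+y. G y * indicator (dyadic_shell m) y * ennreal (wt N (y - t)) \<partial>lborel \<partial>?Z)"
        by (rule nn_integral_count_space_nn_integral) auto
      finally show ?thesis using G[of t] by simp
    qed
    have e1: "ek k \<le> ennreal C * (\<integral>\<^sup>+m. ennreal (2 powr (of_int k * \<alpha>1)) * U k m \<partial>?Z)" for k
    proof -
      have [measurable]: "(\<lambda>(t, m). \<integral>\<^sup>+y. G y * indicator (dyadic_shell m) y * ennreal (wt N (y - t)) \<partial>lborel)
          \<in> borel_measurable (lborel \<Otimes>\<^sub>M ?Z)"
      proof -
        have "(\<lambda>(m, t). \<integral>\<^sup>+y. G y * indicator (dyadic_shell m) y * ennreal (wt N (y - t)) \<partial>lborel)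
          \<in> borel_measurable (?Z \<Otimes>\<^sub>M lborel)"
          by (rule measurable_pair_measure_countable1) auto
        from measurable_pair_swap[OF this] show ?thesis by (simp add: case_prod_beta')
      qed
      have "lnorm lborel s (\<lambda>t. G t * indicator (dyadic_shell k) t)
        \<le> lnorm lborel s (\<lambda>t. ennreal C * (\<integral>\<^sup>+m. indicator (dyadic_shell k) t * (\<integral>\<^sup>+y. G y * indicator (dyadic_shell m) y * ennreal (wt N (y - t)) \<partial>lborel) \<partial>?Z))"
        using Gdec by (intro lnorm_mono) (auto simp: indicator_def)
      also have "\<dots> \<le> ennreal C * lnorm lborel s (\<lambda>t. \<integral>\<^sup>+m. indicator (dyadic_shell k) t * (\<integral>\<^sup>+y. G y * indicator (dyadic_shell m) y * ennreal (wt N (y - t)) \<partial>lborel) \<partial>?Z)"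
      proof (rule lnorm_cmult_le)
        interpret Z: sigma_finite_measure ?Z by (rule sfZ)
        show "(\<lambda>t. \<integral>\<^sup>+m. indicator (dyadic_shell k) t * (\<integral>\<^sup>+y. G y * indicator (dyadic_shell m) y * ennreal (wt N (y - t)) \<partial>lborel) \<partial>?Z) \<in> borel_measurable lborel"
          by measurable
      qed (use s1 in \<open>auto intro: less_le_trans[OF zero_less_one]\<close>)
      also have "\<dots> \<le> ennreal C * (\<integral>\<^sup>+m. U k m \<partial>?Z)"
        unfolding U_def
        by (intro mult_left_mono lnorm_minkowski sfZ s1) (auto intro: lborel.sigma_finite_measure_axioms)
      finally have "lnorm lborel s (\<lambda>t. G t * indicator (dyadic_shell k) t) \<le> ennreal C * (\<integral>\<^sup>+m. U k m \<partial>?Z)" .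
      then have "ek k \<le> ennreal (2 powr (of_int k * \<alpha>1)) * (ennreal C * (\<integral>\<^sup>+m. U k m \<partial>?Z))"
        unfolding ek_def by (intro mult_left_mono) auto
      also have "\<dots> = ennreal C * (\<integral>\<^sup>+m. ennreal (2 powr (of_int k * \<alpha>1)) * U k m \<partial>?Z)"
        by (simp add: nn_integral_cmult mult.left_commute)
      finally show ?thesis .
    qed
    define nr where "nr k m = (if \<bar>k - m\<bar> \<le> 1 then 1 else 0 :: ennreal)" for k m :: int
    have am: "ennreal x * am m = ennreal (x * 2 powr (- of_int m * \<alpha>2)) * bm m" if "0 \<le> x" for x m
    proof -
      have "x * 2 powr (- of_int m * \<alpha>2) * 2 powr (of_int m * \<alpha>2) = x" by (simp add: powr_minus)
      then show ?thesis unfolding bm_def using that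
        by (simp only: mult.assoc[symmetric] ennreal_mult[symmetric] powr_ge_zero mult_nonneg_nonneg)
    qed
    have u1: "ennreal (2 powr (of_int k * \<alpha>1)) * U k m \<le>
       ennreal K1 * (ennreal (2 powr (- A * \<bar>of_int k\<bar>)) * (ennreal (2 powr (- \<gamma> * \<bar>of_int m\<bar>)) * bm m)
          + ennreal (2 powr (- \<delta> * \<bar>of_int k\<bar>)) * (nr k m * bm m))" for k m
    proof (cases "1 \<le> k \<and> \<bar>k - m\<bar> \<le> 1")
      \<comment> \<open>By \<open>1 \<le> k\<close> the exponent k (\<alpha>1 - \<alpha>2) is -
        \<delta> \<bar>k\<bar>, a decay.\<close>
      case True
      have "U k m \<le> lnorm lborel s (\<lambda>t. \<integral>\<^sup>+y. G y * indicator (dyadic_shell m) y * ennreal (wt N (y - t)) \<partial>lborel)"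
        unfolding U_def by (intro lnorm_mono) (auto simp: indicator_def)
      also have "\<dots> \<le> ennreal E * am m" unfolding am_def
        by (rule convolution_near_bound) (use p N E in auto)
      finally have "ennreal (2 powr (of_int k * \<alpha>1)) * U k m \<le> ennreal (2 powr (of_int k * \<alpha>1)) * (ennreal E * am m)"
        by (intro mult_left_mono) auto
      also have "\<dots> = ennreal (2 powr (of_int k * \<alpha>1) * E) * am m"
        using E by (simp add: ennreal_mult mult.assoc)
      also have "\<dots> = ennreal (2 powr (of_int k * \<alpha>1) * E * 2 powr (- of_int m * \<alpha>2)) * bm m"
        by (rule am) (use E in auto)
      also have "2 powr (of_int k * \<alpha>1) * E * 2 powr (- of_int m * \<alpha>2) \<le> K1 * 2 powr (- \<delta> * \<bar>of_int k\<bar>)"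
      proof -
        have "of_int (k - m) * \<alpha>2 \<le> \<bar>of_int (k - m)\<bar> * \<bar>\<alpha>2\<bar>" by (metis abs_ge_self abs_mult)
        also have "\<dots> \<le> 1 * \<bar>\<alpha>2\<bar>" using True by (intro mult_right_mono) (auto simp: abs_if split: if_splits)
        finally have "of_int k * \<alpha>1 + - of_int m * \<alpha>2 \<le> - \<delta> * \<bar>of_int k\<bar> + \<bar>\<alpha>2\<bar>"
          using True by (simp add: \<delta>_def algebra_simps)
        then have "2 powr (of_int k * \<alpha>1 + - of_int m * \<alpha>2) \<le> 2 powr (- \<delta> * \<bar>of_int k\<bar> + \<bar>\<alpha>2\<bar>)"
          by (intro powr_mono) auto
        then have "E * (2 powr (of_int k * \<alpha>1) * 2 powr (- of_int m * \<alpha>2)) \<le> E * (2 powr \<bar>\<alpha>2\<bar> * 2 powr (- \<delta> * \<bar>of_int k\<bar>))"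
          using E unfolding powr_add by (intro mult_left_mono) (auto simp: mult.commute)
        also have "\<dots> \<le> K1 * 2 powr (- \<delta> * \<bar>of_int k\<bar>)" by (simp add: K1_def algebra_simps)
        finally show ?thesis by (simp add: mult_ac)
      qed
      also have "ennreal (K1 * 2 powr (- \<delta> * \<bar>of_int k\<bar>)) * bm m = ennreal K1 * (ennreal (2 powr (- \<delta> * \<bar>of_int k\<bar>)) * (nr k m * bm m))"
        using True K1 by (simp add: nr_def ennreal_mult mult.assoc)
      also have "\<dots> \<le> ennreal K1 * (ennreal (2 powr (- A * \<bar>of_int k\<bar>)) * (ennreal (2 powr (- \<gamma> * \<bar>of_int m\<bar>)) * bm m)
          + ennreal (2 powr (- \<delta> * \<bar>of_int k\<bar>)) * (nr k m * bm m))"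
        by (intro mult_left_mono) auto
      finally show ?thesis by (auto simp: mult_right_mono ennreal_leI)
    next
      case False
      let ?e = "of_int k * enn2real (1/s) + of_int m * (1 - enn2real (1/p)) - N * of_int (max (max k m) 0)"
      have "U k m \<le> ennreal (4 powr N * 2 powr ?e) * am m" unfolding U_def am_def
        by (rule convolution_far_bound) (use p s1 N False in auto)
      then have "ennreal (2 powr (of_int k * \<alpha>1)) * U k m \<le> ennreal (2 powr (of_int k * \<alpha>1)) * (ennreal (4 powr N * 2 powr ?e) * am m)"
        by (intro mult_left_mono) auto
      also have "\<dots> = ennreal (2 powr (of_int k * \<alpha>1) * (4 powr N * 2 powr ?e)) * am m"
        by (simp add: ennreal_mult mult.assoc)
      also have "\<dots> = ennreal (2 powr (of_int k * \<alpha>1) * (4 powr N * 2 powr ?e) * 2 powr (- of_int m * \<alpha>2)) * bm m"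
        by (rule am) auto
      also have "2 powr (of_int k * \<alpha>1) * (4 powr N * 2 powr ?e) * 2 powr (- of_int m * \<alpha>2)
          \<le> K1 * (2 powr (- A * \<bar>of_int k\<bar>) * 2 powr (- \<gamma> * \<bar>of_int m\<bar>))"
      proof -
        have "of_int k * \<alpha>1 + ?e + - of_int m * \<alpha>2 = of_int k * A + of_int m * \<gamma> - N * of_int (max (max k m) 0)"
          by (simp add: A_def \<gamma>_def algebra_simps)
        also have "\<dots> \<le> - A * \<bar>of_int k\<bar> - \<gamma> * \<bar>of_int m\<bar>"
          by (rule exponent_bound) (use pos N in \<open>auto simp: A_def \<gamma>_def\<close>)
        finally have "2 powr (of_int k * \<alpha>1 + ?e + - of_int m * \<alpha>2) \<le> 2 powr (- A * \<bar>of_int k\<bar> + - \<gamma> * \<bar>of_int m\<bar>)"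
          by (intro powr_mono) auto
        then have "4 powr N * (2 powr (of_int k * \<alpha>1) * 2 powr ?e * 2 powr (- of_int m * \<alpha>2))
          \<le> 4 powr N * (2 powr (- A * \<bar>of_int k\<bar>) * 2 powr (- \<gamma> * \<bar>of_int m\<bar>))"
          unfolding powr_add by (intro mult_left_mono) auto
        also have "\<dots> \<le> K1 * (2 powr (- A * \<bar>of_int k\<bar>) * 2 powr (- \<gamma> * \<bar>of_int m\<bar>))"
          unfolding K1_def using E by (intro mult_right_mono) auto
        finally show ?thesis by (simp only: mult_ac)
      qed
      also have "ennreal (K1 * (2 powr (- A * \<bar>of_int k\<bar>) * 2 powr (- \<gamma> * \<bar>of_int m\<bar>))) * bm m
        = ennreal K1 * (ennreal (2 powr (- A * \<bar>of_int k\<bar>)) * (ennreal (2 powr (- \<gamma> * \<bar>of_int m\<bar>)) * bm m))"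
        using K1 by (simp add: ennreal_mult mult.assoc)
      also have "\<dots> \<le> ennreal K1 * (ennreal (2 powr (- A * \<bar>of_int k\<bar>)) * (ennreal (2 powr (- \<gamma> * \<bar>of_int m\<bar>)) * bm m)
          + ennreal (2 powr (- \<delta> * \<bar>of_int k\<bar>)) * (nr k m * bm m))"
        by (intro mult_left_mono) auto
      finally show ?thesis by (auto simp: mult_right_mono ennreal_leI)
    qed
    define V where "V k = ennreal (2 powr (- \<delta> * \<bar>of_int k\<bar>)) * (bm (k - 1) + (bm k + bm (k + 1)))" for k
    have e2: "ek k \<le> ennreal (C * K1) * ((S * B) * ennreal (2 powr (- A * \<bar>of_int k\<bar>)) + V k)" for k
    proof -
      have nrs: "(\<integral>\<^sup>+m. nr k m * bm m \<partial>?Z) = bm (k - 1) + (bm k + bm (k + 1))"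
      proof -
        have "(\<integral>\<^sup>+m. nr k m * bm m \<partial>?Z) = (\<Sum>m\<in>{k-1,k,k+1}. nr k m * bm m)"
          by (rule nn_integral_count_space') (auto simp: nr_def)
        also have "\<dots> = bm (k - 1) + (bm k + bm (k + 1))" by (simp add: nr_def)
        finally show ?thesis .
      qed
      have "(\<integral>\<^sup>+m. ennreal (2 powr (- \<gamma> * \<bar>of_int m\<bar>)) * bm m \<partial>?Z) \<le> (\<integral>\<^sup>+m. ennreal (2 powr (- \<gamma> * \<bar>of_int m\<bar>)) * B \<partial>?Z)"
        by (intro nn_integral_mono mult_left_mono bB) auto
      also have "\<dots> = S * B" by (simp add: S_def nn_integral_multc)
      finally have s: "(\<integral>\<^sup>+m. ennreal (2 powr (- \<gamma> * \<bar>of_int m\<bar>)) * bm m \<partial>?Z) \<le> S * B" .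
      have "ek k \<le> ennreal C * (\<integral>\<^sup>+m. ennreal (2 powr (of_int k * \<alpha>1)) * U k m \<partial>?Z)" by (rule e1)
      also have "\<dots> \<le> ennreal C * (\<integral>\<^sup>+m. ennreal K1 * (ennreal (2 powr (- A * \<bar>of_int k\<bar>)) * (ennreal (2 powr (- \<gamma> * \<bar>of_int m\<bar>)) * bm m)
          + ennreal (2 powr (- \<delta> * \<bar>of_int k\<bar>)) * (nr k m * bm m)) \<partial>?Z)"
        by (intro mult_left_mono nn_integral_mono u1) auto
      also have "\<dots> = ennreal C * (ennreal K1 * (ennreal (2 powr (- A * \<bar>of_int k\<bar>)) * (\<integral>\<^sup>+m. ennreal (2 powr (- \<gamma> * \<bar>of_int m\<bar>)) * bm m \<partial>?Z) + V k))"
        by (simp add: nn_integral_cmult nn_integral_add nrs V_def)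
      also have "\<dots> \<le> ennreal C * (ennreal K1 * (ennreal (2 powr (- A * \<bar>of_int k\<bar>)) * (S * B) + V k))"
        by (intro mult_left_mono add_right_mono s) auto
      also have "\<dots> = ennreal (C * K1) * ((S * B) * ennreal (2 powr (- A * \<bar>of_int k\<bar>)) + V k)"
        using C K1 by (simp add: ennreal_mult mult.assoc mult.commute)
      finally show ?thesis .
    qed
    have V: "lnorm ?Z r V \<le> 3 * Q * B"
    proof (cases "\<delta> = 0")
      case True
      then have \<theta>r: "\<theta> = r" using \<alpha> by (simp add: \<delta>_def)
      have "lnorm ?Z r V = lnorm ?Z r (\<lambda>k. bm (k + -1) + (bm (k + 0) + bm (k + 1)))"
        using True by (intro lnorm_cong) (simp add: V_def)
      also have "\<dots> \<le> lnorm ?Z r (\<lambda>k. bm (k + -1)) + lnorm ?Z r (\<lambda>k. bm (k + 0) + bm (k + 1))"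
        by (rule lnorm_add[OF sfZ]) (use r in auto)
      also have "lnorm ?Z r (\<lambda>k. bm (k + 0) + bm (k + 1)) \<le> lnorm ?Z r (\<lambda>k. bm (k + 0)) + lnorm ?Z r (\<lambda>k. bm (k + 1))"
        by (rule lnorm_add[OF sfZ]) (use r in auto)
      finally have "lnorm ?Z r V \<le> B + (B + B)"
        unfolding lnorm_count_shift by (auto simp: B_def \<theta>r add_left_mono)
      also have "\<dots> = 3 * B" by (rule three_ennreal)
      finally show ?thesis using True by (simp add: Q_def)
    next
      case False
      have "V k \<le> (3 * B) * ennreal (2 powr (- \<delta> * \<bar>of_int k\<bar>))" for k
      proof -
        have "bm (k - 1) + (bm k + bm (k + 1)) \<le> B + (B + B)" by (intro add_mono bB)
        also have "\<dots> = 3 * B" by (rule three_ennreal)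
        finally show ?thesis unfolding V_def by (subst mult.commute) (rule mult_right_mono, auto)
      qed
      then have "lnorm ?Z r V \<le> lnorm ?Z r (\<lambda>k. (3 * B) * ennreal (2 powr (- \<delta> * \<bar>of_int k\<bar>)))"
        by (intro lnorm_mono) auto
      also have "\<dots> \<le> (3 * B) * Q" using False r0 by (simp add: Q_def lnorm_cmult_le)
      finally show ?thesis by (simp add: mult_ac)
    qed
    have "hz s \<alpha>1 r G = lnorm ?Z r ek" by (simp add: hz_def ek_def[abs_def])
    also have "\<dots> \<le> lnorm ?Z r (\<lambda>k. ennreal (C * K1) * ((S * B) * ennreal (2 powr (- A * \<bar>of_int k\<bar>)) + V k))"
      by (intro lnorm_mono e2) auto
    also have "\<dots> \<le> ennreal (C * K1) * lnorm ?Z r (\<lambda>k. (S * B) * ennreal (2 powr (- A * \<bar>of_int k\<bar>)) + V k)"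
      by (rule lnorm_cmult_le) (use r0 in auto)
    also have "\<dots> \<le> ennreal (C * K1) * (lnorm ?Z r (\<lambda>k. (S * B) * ennreal (2 powr (- A * \<bar>of_int k\<bar>))) + lnorm ?Z r V)"
      by (intro mult_left_mono lnorm_add sfZ r) auto
    also have "\<dots> \<le> ennreal (C * K1) * ((S * B) * A' + 3 * Q * B)"
      unfolding A'_def by (intro mult_left_mono add_mono V lnorm_cmult_le r0) auto
    also have "\<dots> = KK * hz p \<alpha>2 \<theta> G" by (simp add: KK_def B algebra_simps)
    finally show ?thesis .
  next
    case False
    \<comment> \<open>A negative \<open>C\<close> becomes 0 under \<open>ennreal\<close>, so the
      hypothesis annihilates \<open>G\<close>.\<close>
    then have "G = (\<lambda>t. 0)" using G by (auto simp: fun_eq_iff ennreal_neg)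
    then have "hz s \<alpha>1 r G = hz s \<alpha>1 r (\<lambda>t. 0 * G t)" by simp
    also have "\<dots> = 0 * hz s \<alpha>1 r G"
      by (rule hz_cmult) (use r0 s1 in \<open>auto intro: less_le_trans[OF zero_less_one]\<close>)
    finally show ?thesis by simp
  qed
  show ?thesis
  proof (intro exI[of _ "enn2real KK + 1"] conjI ballI impI)
    fix G :: "real \<Rightarrow> ennreal"
    assume "G \<in> borel_measurable borel" "\<forall>t. G t \<le> ennreal C * (\<integral>\<^sup>+y. G (t + y) * ennreal (wt N y) \<partial>lborel)"
    then have "hz s \<alpha>1 r G \<le> KK * hz p \<alpha>2 \<theta> G" by (intro main) auto
    also have "KK = ennreal (enn2real KK)" using KK by simp
    also have "ennreal (enn2real KK) \<le> ennreal (enn2real KK + 1)" by (intro ennreal_leI) simp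
    finally show "hz s \<alpha>1 r G \<le> ennreal (enn2real KK + 1) * hz p \<alpha>2 \<theta> G" by (simp add: mult_right_mono)
  qed (simp add: add_nonneg_pos)
qed

text \<open>The estimate at unit scale is applied to the dilate t |-> G(2^(-j) t); the exact scaling
  of both sides produces the power of 2^j.\<close>

lemma hz_embedding:
  assumes p: "1 \<le> p" "p \<le> s" and r: "1 \<le> r" and \<theta>: "1 \<le> \<theta>"
    and a: "0 < \<alpha>1 + enn2real (1/s)" and b: "\<alpha>2 + enn2real (1/p) < 1"
    and \<alpha>: "\<alpha>1 \<le> \<alpha>2" "\<alpha>1 = \<alpha>2 \<Longrightarrow> \<theta> = r"
    and N: "2 \<le> N" "2 * (\<alpha>1 + enn2real (1/s) + (1 - enn2real (1/p) - \<alpha>2)) \<le> N"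
  shows "\<exists>K>0. \<forall>(j::int). \<forall>G\<in>borel_measurable borel.
    (\<forall>t. G t \<le> ennreal C * (\<integral>\<^sup>+y. G (t + 2 powr (- of_int j) * y) * ennreal (wt N y) \<partial>lborel)) \<longrightarrow>
    hz s \<alpha>1 r G \<le> ennreal (K * 2 powr (of_int j * (\<alpha>2 + enn2real (1/p) - \<alpha>1 - enn2real (1/s)))) * hz p \<alpha>2 \<theta> G"
proof -
  obtain K where K: "0 < K" and KG: "\<And>G. G \<in> borel_measurable borel \<Longrightarrow>
    (\<forall>t. G t \<le> ennreal C * (\<integral>\<^sup>+y. G (t + y) * ennreal (wt N y) \<partial>lborel)) \<Longrightarrow>
    hz s \<alpha>1 r G \<le> ennreal K * hz p \<alpha>2 \<theta> G"
    using hz_embedding_unit[OF assms, of C] by blast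
  have pos: "0 < p" "0 < s" "0 < r" "0 < \<theta>" using p r \<theta> by (auto intro: less_le_trans[OF zero_less_one])
  show ?thesis
  proof (intro exI[of _ K] conjI K allI ballI impI)
    fix j :: int and G :: "real \<Rightarrow> ennreal"
    assume [measurable]: "G \<in> borel_measurable borel"
      and G: "\<forall>t. G t \<le> ennreal C * (\<integral>\<^sup>+y. G (t + 2 powr (- of_int j) * y) * ennreal (wt N y) \<partial>lborel)"
    define c where "c = (2::real) powr (- of_int j)"
    have "hz s \<alpha>1 r (\<lambda>t. G (c * t)) \<le> ennreal K * hz p \<alpha>2 \<theta> (\<lambda>t. G (c * t))"
    proof (rule KG)
      show "\<forall>t. G (c * t) \<le> ennreal C * (\<integral>\<^sup>+y. G (c * (t + y)) * ennreal (wt N y) \<partial>lborel)"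
        using G unfolding c_def[symmetric] by (simp add: distrib_left)
    qed simp
    then have *: "ennreal (2 powr (of_int j * (\<alpha>1 + enn2real (1/s)))) * hz s \<alpha>1 r G \<le>
        ennreal K * (ennreal (2 powr (of_int j * (\<alpha>2 + enn2real (1/p)))) * hz p \<alpha>2 \<theta> G)"
      unfolding c_def using pos by (simp add: hz_scale)
    have "hz s \<alpha>1 r G = ennreal (2 powr (- of_int j * (\<alpha>1 + enn2real (1/s)))) * (ennreal (2 powr (of_int j * (\<alpha>1 + enn2real (1/s)))) * hz s \<alpha>1 r G)"
      by (simp add: mult.assoc[symmetric] powr_minus flip: ennreal_mult)
    also have "\<dots> \<le> ennreal (2 powr (- of_int j * (\<alpha>1 + enn2real (1/s)))) * (ennreal K * (ennreal (2 powr (of_int j * (\<alpha>2 + enn2real (1/p)))) * hz p \<alpha>2 \<theta> G))"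
      by (intro mult_left_mono *) auto
    also have "\<dots> = ennreal (2 powr (- of_int j * (\<alpha>1 + enn2real (1/s))) * (K * 2 powr (of_int j * (\<alpha>2 + enn2real (1/p))))) * hz p \<alpha>2 \<theta> G"
      using K by (simp only: ennreal_mult' powr_ge_zero mult.assoc less_imp_le)
    also have "2 powr (- of_int j * (\<alpha>1 + enn2real (1/s))) * (K * 2 powr (of_int j * (\<alpha>2 + enn2real (1/p))))
       = K * (2 powr (- of_int j * (\<alpha>1 + enn2real (1/s))) * 2 powr (of_int j * (\<alpha>2 + enn2real (1/p))))" by (simp only: mult_ac)
    also have "\<dots> = K * 2 powr (of_int j * (\<alpha>2 + enn2real (1/p) - \<alpha>1 - enn2real (1/s)))"
      unfolding powr_add[symmetric] by (simp add: algebra_simps)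
    finally show "hz s \<alpha>1 r G \<le> ennreal (K * 2 powr (of_int j * (\<alpha>2 + enn2real (1/p) - \<alpha>1 - enn2real (1/s)))) * hz p \<alpha>2 \<theta> G" .
  qed
qed

subsection \<open>Mixed quasi-norms\<close>

definition upd :: "real ^ 'n \<Rightarrow> 'n::finite \<Rightarrow> real \<Rightarrow> real ^ 'n" where
  "upd x i t = (\<chi> j. if j = i then t else x $ j)"

lemma upd_nth [simp]: "upd x i t $ j = (if j = i then t else x $ j)"
  by (simp add: upd_def)

lemma upd_commute: "i \<noteq> j \<Longrightarrow> upd (upd x i t) j s = upd (upd x j s) i t"
  by (auto simp: vec_eq_iff)

lemma upd_add: "upd x i (x $ i + s) = x + s *\<^sub>R axis i 1"
  by (auto simp: vec_eq_iff axis_def)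

lemma continuous_on_upd [continuous_intros]:
  fixes f :: "'a::topological_space \<Rightarrow> real ^ 'n::finite"
  assumes "continuous_on S f" "continuous_on S g"
  shows "continuous_on S (\<lambda>z. upd (f z) i (g z))"
proof -
  have "continuous_on S (\<lambda>z. if j = i then g z else f z $ j)" for j
    using assms by (cases "j = i") (auto intro: continuous_intros)
  then show ?thesis unfolding upd_def by (rule continuous_on_vec_lambda)
qed

lemma upd_measurable [measurable]:
  assumes [measurable]: "f \<in> borel_measurable M" "g \<in> borel_measurable M"
  shows "(\<lambda>z. upd (f z :: real ^ 'n::finite) i (g z)) \<in> borel_measurable M"
proof -
  have "continuous_on UNIV (\<lambda>z. upd (fst z :: real ^ 'n) i (snd z))" by (intro continuous_intros)
  then have "(\<lambda>z. upd (fst z :: real ^ 'n) i (snd z)) \<in> borel_measurable borel" by (rule borel_measurable_continuous_onI)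
  then have *: "(\<lambda>z. upd (fst z :: real ^ 'n) i (snd z)) \<in> borel_measurable (borel \<Otimes>\<^sub>M borel)" by (simp add: borel_prod)
  have "(\<lambda>z. (f z, g z)) \<in> M \<rightarrow>\<^sub>M borel \<Otimes>\<^sub>M borel" by measurable
  from measurable_compose[OF this *] show ?thesis by simp
qed

definition hstep ::
  "ennreal ^ 'n \<Rightarrow> real ^ 'n \<Rightarrow> ennreal ^ 'n \<Rightarrow> 'n::finite \<Rightarrow>
   (real ^ 'n \<Rightarrow> ennreal) \<Rightarrow> real ^ 'n \<Rightarrow> ennreal" where
  "hstep p \<alpha> q i F = (\<lambda>x. hz (p $ i) (\<alpha> $ i) (q $ i) (\<lambda>t. F (upd x i t)))"

lemma hstep_measurable:
  assumes [measurable]: "F \<in> borel_measurable borel"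
  shows "hstep p \<alpha> q i F \<in> borel_measurable borel"
  unfolding hstep_def by (rule borel_measurable_hz) measurable

lemma herz_step_eq_hstep:
  assumes [measurable]: "F \<in> borel_measurable borel" and "0 < q $ i"
  shows "herz_step p \<alpha> q i F = hstep p \<alpha> q i F"
  unfolding herz_step_def hstep_def upd_def[symmetric]
  by (intro ext herz_qnorm_eq_hz) (use assms in auto)

lemma fold_herz_step_eq_hstep:
  assumes "\<And>i. 0 < q $ i"
  shows "F \<in> borel_measurable borel \<Longrightarrow> fold (herz_step p \<alpha> q) is F = fold (hstep p \<alpha> q) is F"
  by (induction "is" arbitrary: F) (auto simp: herz_step_eq_hstep assms hstep_measurable)

lemma hstep_mono:
  assumes [measurable]: "F \<in> borel_measurable borel" and "\<And>x. F x \<le> G x"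
  shows "hstep p \<alpha> q i F x \<le> hstep p \<alpha> q i G x"
  unfolding hstep_def by (rule hz_mono) (use assms in auto)

lemma fold_hstep_mono:
  assumes "F \<in> borel_measurable borel" "G \<in> borel_measurable borel" "\<And>x. F x \<le> G x"
  shows "fold (hstep p \<alpha> q) is F x \<le> fold (hstep p \<alpha> q) is G x"
  using assms
proof (induction "is" arbitrary: F G)
  case (Cons i "is")
  then show ?case by (simp add: hstep_measurable hstep_mono)
qed simp

lemma hstep_cmult:
  assumes [measurable]: "F \<in> borel_measurable borel" and "\<And>i. 0 < p $ i" "\<And>i. 0 < q $ i" "c < top"
  shows "hstep p \<alpha> q i (\<lambda>x. c * F x) = (\<lambda>x. c * hstep p \<alpha> q i F x)"
  unfolding hstep_def by (intro ext hz_cmult) (use assms in auto)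

lemma fold_hstep_cmult:
  assumes "F \<in> borel_measurable borel" "\<And>i. 0 < p $ i" "\<And>i. 0 < q $ i" "c < top"
  shows "fold (hstep p \<alpha> q) is (\<lambda>x. c * F x) = (\<lambda>x. c * fold (hstep p \<alpha> q) is F x)"
  using assms(1)
  by (induction "is" arbitrary: F) (simp_all add: hstep_cmult assms hstep_measurable)

definition scale_exps :: "real \<Rightarrow> ennreal ^ 'n \<Rightarrow> ennreal ^ 'n::finite" where
  "scale_exps d p = (\<chi> i. p $ i / ennreal d)"

lemma ennpow_hstep:
  assumes [measurable]: "F \<in> borel_measurable borel" and "\<And>i. 0 < p $ i" "\<And>i. 0 < q $ i" "0 < d"
  shows "ennpow (hstep p \<alpha> q i F x) d = hstep (scale_exps d p) (d *\<^sub>R \<alpha>) (scale_exps d q) i (\<lambda>x. ennpow (F x) d) x"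
  unfolding hstep_def scale_exps_def by (subst ennpow_hz) (use assms in auto)

lemma ennpow_fold_hstep:
  assumes "F \<in> borel_measurable borel" "\<And>i. 0 < p $ i" "\<And>i. 0 < q $ i" "0 < d"
  shows "ennpow (fold (hstep p \<alpha> q) is F x) d
    = fold (hstep (scale_exps d p) (d *\<^sub>R \<alpha>) (scale_exps d q)) is (\<lambda>x. ennpow (F x) d) x"
  using assms(1)
proof (induction "is" arbitrary: F)
  case (Cons i "is")
  have "ennpow (fold (hstep p \<alpha> q) (i # is) F x) d
     = fold (hstep (scale_exps d p) (d *\<^sub>R \<alpha>) (scale_exps d q)) is (\<lambda>x. ennpow (hstep p \<alpha> q i F x) d) x"
    using Cons by (simp add: hstep_measurable)
  also have "(\<lambda>x. ennpow (hstep p \<alpha> q i F x) d) = hstep (scale_exps d p) (d *\<^sub>R \<alpha>) (scale_exps d q) i (\<lambda>x. ennpow (F x) d)"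
    by (intro ext ennpow_hstep) (use assms Cons in auto)
  finally show ?case by simp
qed simp

text \<open>The hypothesis that replaces band-limitedness: it is satisfied by a small power of the modulus of
  a band-limited function, and it is inherited by quasi-norms with respect to the other variables.\<close>

definition submean :: "real \<Rightarrow> real \<Rightarrow> int \<Rightarrow> 'n::finite \<Rightarrow> (real ^ 'n \<Rightarrow> ennreal) \<Rightarrow> bool" where
  "submean C N j i F \<longleftrightarrow> (\<forall>x. F x \<le> ennreal C *
     (\<integral>\<^sup>+y. F (upd x i (x $ i + 2 powr (- of_int j) * y)) * ennreal (wt N y) \<partial>lborel))"

text \<open>The hypothesis in the variable i is an inequality between functions of the variable i',
  and the norm in i' passes under the integral by Minkowski's inequality. This is where the
  exponents have to be at least 1.\<close>

lemma submean_hstep: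
  assumes [measurable]: "F \<in> borel_measurable borel" and ne: "i \<noteq> i'" and p: "1 \<le> p $ i'" and q: "1 \<le> q $ i'"
    and F: "submean C N j i F"
  shows "submean C N j i (hstep p \<alpha> q i' F)"
  unfolding submean_def
proof
  fix x :: "real ^ 'a"
  define z where "z y = upd x i (x $ i + 2 powr (- of_int j) * y)" for y
  have [measurable]: "z \<in> borel_measurable borel" unfolding z_def by measurable
  have pq: "0 < p $ i'" "0 < q $ i'" using p q by (auto intro: less_le_trans[OF zero_less_one])
  have [measurable]: "hstep p \<alpha> q i' F \<in> borel_measurable borel" by (rule hstep_measurable) measurable
  have "hstep p \<alpha> q i' F x \<le> hz (p $ i') (\<alpha> $ i') (q $ i') (\<lambda>t. \<integral>\<^sup>+y. (ennreal C * ennreal (wt N y)) * F (upd (z y) i' t) \<partial>lborel)"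
    unfolding hstep_def
  proof (rule hz_mono)
    fix t
    have "F (upd x i' t) \<le> ennreal C * (\<integral>\<^sup>+y. F (upd (upd x i' t) i (upd x i' t $ i + 2 powr (- of_int j) * y)) * ennreal (wt N y) \<partial>lborel)"
      using F unfolding submean_def by blast
    also have "\<dots> = (\<integral>\<^sup>+y. (ennreal C * ennreal (wt N y)) * F (upd (z y) i' t) \<partial>lborel)"
      using ne by (simp add: nn_integral_cmult[symmetric] z_def upd_commute mult_ac)
    finally show "F (upd x i' t) \<le> (\<integral>\<^sup>+y. (ennreal C * ennreal (wt N y)) * F (upd (z y) i' t) \<partial>lborel)" .
  qed measurable
  also have "\<dots> \<le> (\<integral>\<^sup>+y. hz (p $ i') (\<alpha> $ i') (q $ i') (\<lambda>t. (ennreal C * ennreal (wt N y)) * F (upd (z y) i' t)) \<partial>lborel)"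
    by (rule hz_minkowski) (use p q in \<open>auto intro: lborel.sigma_finite_measure_axioms\<close>)
  also have "\<dots> = (\<integral>\<^sup>+y. (ennreal C * ennreal (wt N y)) * hstep p \<alpha> q i' F (z y) \<partial>lborel)"
    unfolding hstep_def by (intro nn_integral_cong hz_cmult) (use pq in \<open>auto simp: ennreal_mult_less_top\<close>)
  also have "\<dots> = ennreal C * (\<integral>\<^sup>+y. hstep p \<alpha> q i' F (z y) * ennreal (wt N y) \<partial>lborel)"
    by (simp add: nn_integral_cmult[symmetric] mult_ac)
  finally show "hstep p \<alpha> q i' F x \<le> ennreal C * (\<integral>\<^sup>+y. hstep p \<alpha> q i' F (upd x i (x $ i + 2 powr (- of_int j) * y)) * ennreal (wt N y) \<partial>lborel)"
    by (simp add: z_def)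
qed

text \<open>The innermost quasi-norm is exchanged first. The result, an \<open>hstep\<close> with
  source parameters, still satisfies the hypothesis in the remaining variables, so the induction
  applies to it; monotonicity and homogeneity carry the factor through the outer
  quasi-norms.\<close>

lemma fold_hstep_embedding:
  fixes p s r \<theta> :: "ennreal ^ 'n::finite" and \<alpha>1 \<alpha>2 :: "real ^ 'n"
  assumes p: "\<And>i. 1 \<le> p $ i" "\<And>i. p $ i \<le> s $ i" and r: "\<And>i. 1 \<le> r $ i" and \<theta>: "\<And>i. 1 \<le> \<theta> $ i"
    and a: "\<And>i. 0 < \<alpha>1 $ i + enn2real (1/s $ i)" and b: "\<And>i. \<alpha>2 $ i + enn2real (1/p $ i) < 1"
    and \<alpha>: "\<And>i. \<alpha>1 $ i \<le> \<alpha>2 $ i" "\<And>i. \<alpha>1 $ i = \<alpha>2 $ i \<Longrightarrow> \<theta> $ i = r $ i"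
    and N: "2 \<le> N" "\<And>i. 2 * (\<alpha>1 $ i + enn2real (1/s $ i) + (1 - enn2real (1/p $ i) - \<alpha>2 $ i)) \<le> N"
    and "distinct is"
  shows "\<exists>K>0. \<forall>(j::int). \<forall>F\<in>borel_measurable borel. (\<forall>i\<in>set is. submean C N j i F) \<longrightarrow>
    (\<forall>x. fold (hstep s \<alpha>1 r) is F x \<le>
      ennreal (K * 2 powr (of_int j * (\<Sum>i\<in>set is. \<alpha>2 $ i + enn2real (1/p $ i) - \<alpha>1 $ i - enn2real (1/s $ i))))
        * fold (hstep p \<alpha>2 \<theta>) is F x)"
  using \<open>distinct is\<close>
proof (induction "is")
  case Nil
  show ?case by (intro exI[of _ 1]) auto
next
  case (Cons i "is")
  have s: "1 \<le> s $ i" for i using p by (rule order_trans)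
  have pos: "0 < p $ i" "0 < s $ i" "0 < r $ i" "0 < \<theta> $ i" for i
    using p r \<theta> s by (auto intro: less_le_trans[OF zero_less_one])
  let ?e = "\<lambda>i. \<alpha>2 $ i + enn2real (1/p $ i) - \<alpha>1 $ i - enn2real (1/s $ i)"
  obtain K where K: "0 < K" "\<And>(j::int) F x. F \<in> borel_measurable borel \<Longrightarrow> (\<forall>i\<in>set is. submean C N j i F) \<Longrightarrow>
      fold (hstep s \<alpha>1 r) is F x \<le>
      ennreal (K * 2 powr (of_int j * (\<Sum>i\<in>set is. ?e i))) * fold (hstep p \<alpha>2 \<theta>) is F x"
    using Cons by auto
  obtain L where L: "0 < L" "\<And>(j::int) G. G\<in>borel_measurable borel \<Longrightarrow>
    (\<forall>t. G t \<le> ennreal C * (\<integral>\<^sup>+y. G (t + 2 powr (- of_int j) * y) * ennreal (wt N y) \<partial>lborel)) \<Longrightarrow>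
    hz (s $ i) (\<alpha>1 $ i) (r $ i) G \<le> ennreal (L * 2 powr (of_int j * ?e i)) * hz (p $ i) (\<alpha>2 $ i) (\<theta> $ i) G"
    using hz_embedding[of "p $ i" "s $ i" "r $ i" "\<theta> $ i" "\<alpha>1 $ i" "\<alpha>2 $ i" N C] assms by auto
  show ?case
  proof (intro exI[of _ "K * L"] conjI allI ballI impI)
    show "0 < K * L" using K L by simp
    fix j :: int and F :: "real ^ 'n \<Rightarrow> ennreal" and x
    assume F [measurable]: "F \<in> borel_measurable borel" and sm: "\<forall>i\<in>set (i # is). submean C N j i F"
    let ?c = "ennreal (L * 2 powr (of_int j * ?e i))"
    have step: "hstep s \<alpha>1 r i F y \<le> ?c * hstep p \<alpha>2 \<theta> i F y" for y
      unfolding hstep_def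
    proof (rule L(2))
      show "\<forall>t. F (upd y i t) \<le> ennreal C * (\<integral>\<^sup>+u. F (upd y i (t + 2 powr (- of_int j) * u)) * ennreal (wt N u) \<partial>lborel)"
      proof
        fix t
        have "upd (upd y i t) i u = upd y i u" for u by (simp add: vec_eq_iff)
        then show "F (upd y i t) \<le> ennreal C * (\<integral>\<^sup>+u. F (upd y i (t + 2 powr (- of_int j) * u)) * ennreal (wt N u) \<partial>lborel)"
          using sm unfolding submean_def by (auto dest!: spec[of _ "upd y i t"])
      qed
    qed measurable
    have m: "hstep p \<alpha>2 \<theta> i F \<in> borel_measurable borel" "hstep s \<alpha>1 r i F \<in> borel_measurable borel"
      by (auto intro: hstep_measurable)
    have "fold (hstep s \<alpha>1 r) (i # is) F x = fold (hstep s \<alpha>1 r) is (hstep s \<alpha>1 r i F) x" by simp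
    also have "\<dots> \<le> fold (hstep s \<alpha>1 r) is (\<lambda>y. ?c * hstep p \<alpha>2 \<theta> i F y) x"
      by (intro fold_hstep_mono step) (use m in auto)
    also have "\<dots> = ?c * fold (hstep s \<alpha>1 r) is (hstep p \<alpha>2 \<theta> i F) x"
      by (subst fold_hstep_cmult) (use m pos in auto)
    also have "\<dots> \<le> ?c * (ennreal (K * 2 powr (of_int j * (\<Sum>i\<in>set is. ?e i))) * fold (hstep p \<alpha>2 \<theta>) is (hstep p \<alpha>2 \<theta> i F) x)"
    proof (intro mult_left_mono K(2) m ballI submean_hstep F)
      fix i' assume "i' \<in> set is"
      then show "i' \<noteq> i" "submean C N j i' F" using Cons.prems sm by auto
    qed (use p \<theta> in auto)
    also have "\<dots> = ennreal ((L * 2 powr (of_int j * ?e i)) * (K * 2 powr (of_int j * (\<Sum>i\<in>set is. ?e i)))) * fold (hstep p \<alpha>2 \<theta>) (i # is) F x"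
      using K L by (simp add: ennreal_mult mult.assoc)
    also have "(L * 2 powr (of_int j * ?e i)) * (K * 2 powr (of_int j * (\<Sum>i\<in>set is. ?e i)))
      = K * L * (2 powr (of_int j * ?e i) * 2 powr (of_int j * (\<Sum>i\<in>set is. ?e i)))" by (simp only: mult_ac)
    also have "2 powr (of_int j * ?e i) * 2 powr (of_int j * (\<Sum>i\<in>set is. ?e i)) = 2 powr (of_int j * (\<Sum>i\<in>set (i # is). ?e i))"
      using Cons.prems by (simp add: powr_add[symmetric] distrib_left[symmetric])
    finally show "fold (hstep s \<alpha>1 r) (i # is) F x \<le> ennreal (K * L * 2 powr (of_int j * (\<Sum>i\<in>set (i # is). ?e i))) * fold (hstep p \<alpha>2 \<theta>) (i # is) F x" .
  qed
qed

subsection \<open>Invariance under modification on null sets\<close>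

text \<open>Translation invariance replaces a splitting of Lebesgue measure into coordinates: the
  measures of all translates of the null set along the i-th axis are 0, and exchanging the integrals
  makes almost every line meet the set in a null set.\<close>

lemma AE_slice:
  fixes P :: "real ^ 'n::finite \<Rightarrow> bool"
  assumes "AE x in lborel. P x"
  shows "AE x in lborel. AE t in lborel. P (upd x i t)"
proof -
  obtain N where N: "{x. \<not> P x} \<subseteq> N" "N \<in> sets borel" "emeasure lborel N = 0"
    using assms by (auto elim!: AE_E)
  note [measurable] = N(2)
  have shift: "(\<integral>\<^sup>+x. indicator N (x + c) \<partial>lborel) = 0" for c :: "real ^ 'n"
  proof -
    have "(\<integral>\<^sup>+x. indicator N (x + c) \<partial>lborel) = (\<integral>\<^sup>+x. indicator N x \<partial>distr lborel borel ((+) c))"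
      by (subst nn_integral_distr) (auto simp: add.commute)
    then show ?thesis using N by (simp add: lborel_distr_plus)
  qed
  have "(\<integral>\<^sup>+x. \<integral>\<^sup>+s. indicator N (x + s *\<^sub>R axis i 1) \<partial>lborel \<partial>lborel) = (\<integral>\<^sup>+s. \<integral>\<^sup>+x. indicator N (x + s *\<^sub>R axis i 1) \<partial>lborel \<partial>(lborel::real measure))"
    by (rule lborel_pair.Fubini') measurable
  also have "\<dots> = 0" by (simp add: shift)
  finally have "AE x in lborel. (\<integral>\<^sup>+s. indicator N (x + s *\<^sub>R axis i 1) \<partial>(lborel::real measure)) = 0"
    by (subst (asm) nn_integral_0_iff_AE) auto
  then show ?thesis
  proof eventually_elim
    case (elim x)
    then have "AE s in (lborel::real measure). indicator N (x + s *\<^sub>R axis i 1) = (0::ennreal)"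
      by (subst (asm) nn_integral_0_iff_AE) auto
    then have "AE s in lborel. upd x i (x $ i + s) \<notin> N"
      by (simp add: upd_add indicator_eq_0_iff)
    then have "AE t in lborel. upd x i (x $ i + (- x $ i + 1 * t)) \<notin> N"
      by (rule AE_borel_affine[rotated 2]) auto
    then show ?case using N(1) by (auto elim!: eventually_mono)
  qed
qed

lemma borel_measurable_lebesgue_AE:
  assumes "g \<in> borel_measurable lebesgue" "AE x in lborel. g x = h x"
  shows "h \<in> borel_measurable (lebesgue :: real measure)"
proof (rule measurableI)
  fix A :: "'a set" assume A: "A \<in> sets borel"
  have 1: "g -` A \<inter> space lebesgue \<in> sets lebesgue" by (rule measurable_sets[OF assms(1) A])
  have 2: "AE x in lebesgue. x \<in> g -` A \<inter> space lebesgue \<longleftrightarrow> x \<in> h -` A \<inter> space lebesgue"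
    using AE_completion[OF assms(2)] by (auto elim!: eventually_mono)
  show "h -` A \<inter> space lebesgue \<in> sets (lebesgue :: real measure)"
    by (rule completion.in_sets_AE[OF 2 1]) auto
qed auto

lemma Lp_qnorm_cong_AE:
  assumes "AE t in lborel. g t = h t"
  shows "Lp_qnorm p g = Lp_qnorm p h"
proof -
  have AE: "AE t in lebesgue. g t = h t" using assms by (rule AE_completion)
  have "esssup lebesgue g = esssup lebesgue h"
  proof (cases "g \<in> borel_measurable lebesgue")
    case True
    then show ?thesis using borel_measurable_lebesgue_AE[OF True assms] AE by (intro esssup_AE_cong)
  next
    \<comment> \<open>\<open>esssup\<close> takes a default value on nonmeasurable functions, so the
      two functions must be measurable or nonmeasurable together; completeness of the measure
      ensures this.\<close>
    case False
    have "h \<notin> borel_measurable lebesgue"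
      using False borel_measurable_lebesgue_AE[of h g] assms by (auto simp: eq_commute)
    then show ?thesis using False by (simp add: esssup_non_measurable)
  qed
  moreover have "(\<integral>\<^sup>+t. ennpow (g t) u \<partial>lebesgue) = (\<integral>\<^sup>+t. ennpow (h t) u \<partial>lebesgue)" for u
    using AE by (intro nn_integral_cong_AE) (auto elim: eventually_mono)
  ultimately show ?thesis by (simp add: Lp_qnorm_def)
qed

lemma herz_step_AE:
  fixes F G :: "real ^ 'n::finite \<Rightarrow> ennreal"
  assumes "AE x in lborel. F x = G x"
  shows "AE x in lborel. herz_step p \<alpha> q i F x = herz_step p \<alpha> q i G x"
  using AE_slice[OF assms, of i]
proof eventually_elim
  case (elim x)
  have "Lp_qnorm (p $ i) (\<lambda>t. F (upd x i t) * indicator (dyadic_shell k) t) = Lp_qnorm (p $ i) (\<lambda>t. G (upd x i t) * indicator (dyadic_shell k) t)" for k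
    using elim by (intro Lp_qnorm_cong_AE) (auto elim: eventually_mono)
  then show ?case unfolding herz_step_def upd_def[symmetric] herz_qnorm_def by simp
qed

lemma fold_herz_step_AE:
  fixes F G :: "real ^ 'n::finite \<Rightarrow> ennreal"
  assumes "AE x in lborel. F x = G x"
  shows "AE x in lborel. fold (herz_step p \<alpha> q) is F x = fold (herz_step p \<alpha> q) is G x"
  using assms
proof (induction "is" arbitrary: F G)
  case (Cons i "is")
  then show ?case using herz_step_AE[OF Cons.prems] by simp
qed simp

text \<open>Equality almost everywhere passes through each step as a statement on functions of the
  full vector. At the end both functions are constant, so a single point of agreement decides the
  value at 0.\<close>

lemma mixed_herz_qnorm_cong_AE:
  fixes f g :: "real ^ 'n::{finite,linorder} \<Rightarrow> complex"
  assumes "AE x in lborel. f x = g x"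
  shows "mixed_herz_qnorm p \<alpha> q f = mixed_herz_qnorm p \<alpha> q g"
proof -
  let ?F = "\<lambda>f. fold (herz_step p \<alpha> q) (sorted_list_of_set UNIV) (\<lambda>x. ennreal (norm (f x)))"
  have ae: "AE x in lborel. ?F f x = ?F g x"
    using assms by (intro fold_herz_step_AE) (auto elim: eventually_mono)
  have "\<exists>x. ?F f x = ?F g x"
  proof (rule ccontr)
    assume *: "\<nexists>x. ?F f x = ?F g x"
    have "AE x in (lborel :: (real ^ 'n::{finite,linorder}) measure). False"
      using ae by (rule eventually_mono) (use * in blast)
    then show False
      by (subst (asm) AE_iff_measurable[OF _ refl]) (auto simp: emeasure_lborel_UNIV)
  qed
  then obtain x where x: "?F f x = ?F g x" by blast
  have "?F f 0 = ?F f x" by (rule fold_herz_step_const)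
  also note x
  also have "?F g x = ?F g 0" by (rule fold_herz_step_const)
  finally show ?thesis unfolding mixed_herz_qnorm_def .
qed

subsection \<open>Smooth functions of one variable\<close>

definition vd :: "(real \<Rightarrow> complex) \<Rightarrow> real \<Rightarrow> complex" where
  "vd g = (\<lambda>t. vector_derivative g (at t))"

definition smooth1 :: "(real \<Rightarrow> complex) \<Rightarrow> bool" where
  "smooth1 g \<longleftrightarrow> (\<forall>n t. (vd ^^ n) g differentiable (at t))"

lemma vd_eqI: "(\<And>t. (g has_vector_derivative g' t) (at t)) \<Longrightarrow> vd g = g'"
  by (auto simp: vd_def vector_derivative_at)

lemma vd_at: "(g has_vector_derivative g') (at t) \<Longrightarrow> vd g t = g'"
  by (simp add: vd_def vector_derivative_at)

lemma smooth1_deriv: "smooth1 g \<Longrightarrow> ((vd ^^ n) g has_vector_derivative (vd ^^ Suc n) g t) (at t)"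
  by (simp add: smooth1_def vd_def vector_derivative_works[symmetric])

lemma smooth1_deriv0: "smooth1 g \<Longrightarrow> (g has_vector_derivative vd g t) (at t)"
  using smooth1_deriv[of g 0] by simp

lemma smooth1_vd: "smooth1 g \<Longrightarrow> smooth1 (vd g)"
  unfolding smooth1_def by (metis funpow_swap1 funpow.simps(2) comp_apply)

lemma smooth1_vdn: "smooth1 g \<Longrightarrow> smooth1 ((vd ^^ n) g)"
  by (induction n) (auto intro: smooth1_vd)

lemma vdn_Suc: "(vd ^^ Suc n) g = (vd ^^ n) (vd g)"
  by (metis funpow_swap1 funpow.simps(2) comp_apply)

lemma vdn_eq:
  assumes "D 0 = g" "\<And>n t. (D n has_vector_derivative D (Suc n) t) (at t)"
  shows "(vd ^^ n) g = D n"
  by (induction n) (auto simp: assms vd_eqI[OF assms(2)])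

lemma smooth1I:
  assumes "D 0 = g" "\<And>n t. (D n has_vector_derivative D (Suc n) t) (at t)"
  shows "smooth1 g"
  unfolding smooth1_def vdn_eq[OF assms] using assms(2) by (blast intro: differentiableI_vector)

lemma smooth1_continuous: "smooth1 g \<Longrightarrow> continuous_on S ((vd ^^ n) g)"
  by (meson continuous_at_imp_continuous_on has_vector_derivative_continuous smooth1_deriv)

lemma smooth1_continuous0: "smooth1 g \<Longrightarrow> continuous_on S g"
  using smooth1_continuous[of g S 0] by simp

lemma vdn_add:
  assumes "smooth1 f" "smooth1 g"
  shows "(vd ^^ n) (\<lambda>t. f t + g t) = (\<lambda>t. (vd ^^ n) f t + (vd ^^ n) g t)"
  by (rule vdn_eq) (auto intro!: has_vector_derivative_add smooth1_deriv simp del: funpow.simps(2) simp: assms)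

lemma smooth1_add:
  assumes "smooth1 f" "smooth1 g"
  shows "smooth1 (\<lambda>t. f t + g t)"
  by (rule smooth1I[where D="\<lambda>n t. (vd ^^ n) f t + (vd ^^ n) g t"])
     (auto intro!: has_vector_derivative_add smooth1_deriv simp del: funpow.simps(2) simp: assms)

lemma vdn_cmult:
  assumes "smooth1 f"
  shows "(vd ^^ n) (\<lambda>t. c * f t) = (\<lambda>t. c * (vd ^^ n) f t)"
  by (rule vdn_eq) (auto intro!: has_vector_derivative_mult_right smooth1_deriv simp del: funpow.simps(2) simp: assms)

lemma smooth1_cmult:
  assumes "smooth1 f"
  shows "smooth1 (\<lambda>t. c * f t)"
  by (rule smooth1I[where D="\<lambda>n t. c * (vd ^^ n) f t"])
     (auto intro!: has_vector_derivative_mult_right smooth1_deriv simp del: funpow.simps(2) simp: assms)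

lemma affine_deriv:
  assumes "smooth1 f"
  shows "((\<lambda>t. of_real (a ^ n) * (vd ^^ n) f (a * t + b)) has_vector_derivative
    of_real (a ^ Suc n) * (vd ^^ Suc n) f (a * t + b)) (at t)"
proof -
  have "((\<lambda>t. a * t + b) has_vector_derivative a) (at t)"
    by (auto intro!: derivative_eq_intros simp: has_real_derivative_iff_has_vector_derivative[symmetric])
  from vector_diff_chain_at[OF this smooth1_deriv[OF assms, of n]]
  have "((\<lambda>t. (vd ^^ n) f (a * t + b)) has_vector_derivative a *\<^sub>R (vd ^^ Suc n) f (a * t + b)) (at t)"
    by (simp add: o_def)
  from has_vector_derivative_mult_right[OF this, of "of_real (a ^ n)"]
  show ?thesis by (simp add: scaleR_conv_of_real mult_ac)
qed

lemma
  assumes "smooth1 f"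
  shows smooth1_affine: "smooth1 (\<lambda>t. f (a * t + b))"
    and vdn_affine: "(vd ^^ n) (\<lambda>t. f (a * t + b)) = (\<lambda>t. of_real (a ^ n) * (vd ^^ n) f (a * t + b))"
proof -
  let ?D = "\<lambda>n t. of_real (a ^ n) * (vd ^^ n) f (a * t + b)"
  have 0: "?D 0 = (\<lambda>t. f (a * t + b))" by simp
  have 1: "(?D n has_vector_derivative ?D (Suc n) t) (at t)" for n t by (rule affine_deriv[OF assms])
  show "smooth1 (\<lambda>t. f (a * t + b))" by (rule smooth1I[OF 0 1])
  show "(vd ^^ n) (\<lambda>t. f (a * t + b)) = ?D n" by (rule vdn_eq[OF 0 1])
qed

text \<open>Finite orders of differentiability, because the product rule gives smoothness of
  products by induction on the order.\<close>

definition diffk :: "nat \<Rightarrow> (real \<Rightarrow> complex) \<Rightarrow> bool" where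
  "diffk n g \<longleftrightarrow> (\<forall>k\<le>n. \<forall>t. (vd ^^ k) g differentiable (at t))"

lemma smooth1_iff_diffk: "smooth1 g \<longleftrightarrow> (\<forall>n. diffk n g)"
  by (auto simp: smooth1_def diffk_def)

lemma diffk_Suc: "diffk (Suc n) g \<longleftrightarrow> (\<forall>t. g differentiable (at t)) \<and> diffk n (vd g)"
proof -
  have "(\<forall>k\<le>Suc n. \<forall>t. (vd ^^ k) g differentiable (at t)) \<longleftrightarrow>
    (\<forall>t. (vd ^^ 0) g differentiable (at t)) \<and> (\<forall>k\<le>n. \<forall>t. (vd ^^ Suc k) g differentiable (at t))"
    by (metis Suc_le_mono le0 not0_implies_Suc)
  then show ?thesis by (simp only: diffk_def vdn_Suc) simp
qed

lemma diffk_mono: "diffk n g \<Longrightarrow> m \<le> n \<Longrightarrow> diffk m g"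
  by (auto simp: diffk_def)

lemma diffk_differentiable: "diffk n g \<Longrightarrow> (g has_vector_derivative vd g t) (at t)"
  unfolding diffk_def vd_def vector_derivative_works[symmetric] by (metis funpow_0 le0)

lemma diffk_add: "diffk n f \<Longrightarrow> diffk n g \<Longrightarrow> diffk n (\<lambda>t. f t + g t)"
proof (induction n arbitrary: f g)
  case 0
  then show ?case by (auto simp: diffk_def)
next
  case (Suc n)
  have "vd (\<lambda>t. f t + g t) = (\<lambda>t. vd f t + vd g t)"
    by (rule vd_eqI) (auto intro!: has_vector_derivative_add diffk_differentiable Suc.prems)
  then show ?case using Suc by (auto simp: diffk_Suc)
qed

lemma vd_mult:
  assumes "diffk n f" "diffk n g"
  shows "vd (\<lambda>t. f t * g t) = (\<lambda>t. f t * vd g t + vd f t * g t)"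
  by (rule vd_eqI) (auto intro!: has_vector_derivative_mult diffk_differentiable assms)

lemma diffk_mult: "diffk n f \<Longrightarrow> diffk n g \<Longrightarrow> diffk n (\<lambda>t. f t * g t)"
proof (induction n arbitrary: f g)
  case 0
  then show ?case by (auto simp: diffk_def)
next
  case (Suc n)
  have "diffk n (\<lambda>t. f t * vd g t + vd f t * g t)"
    using Suc.prems diffk_mono[of "Suc n" _ n]
    by (intro diffk_add Suc.IH) (auto simp: diffk_Suc)
  then show ?case using Suc.prems by (auto simp: diffk_Suc[of n "\<lambda>t. f t * g t"] vd_mult) (auto simp: diffk_Suc)
qed

lemma smooth1_mult: "smooth1 f \<Longrightarrow> smooth1 g \<Longrightarrow> smooth1 (\<lambda>t. f t * g t)"
  by (simp add: smooth1_iff_diffk diffk_mult)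

text \<open>Each use of the product rule doubles the number of terms; \<open>2 ^ n\<close> is the
  sum of the binomial coefficients.\<close>

lemma vdn_mult_bound:
  assumes "smooth1 f" "smooth1 g" "0 \<le> A"
    and "\<And>m. m \<le> n \<Longrightarrow> norm ((vd ^^ m) f t) \<le> A" and "\<And>m. m \<le> n \<Longrightarrow> norm ((vd ^^ m) g t) \<le> B"
  shows "norm ((vd ^^ n) (\<lambda>t. f t * g t) t) \<le> 2 ^ n * A * B"
  using assms
proof (induction n arbitrary: f g)
  case 0
  then show ?case using mult_mono[of "norm (f t)" A "norm (g t)" B] by (force simp: norm_mult)
next
  case (Suc n)
  have sm: "smooth1 (vd f)" "smooth1 (vd g)" using Suc.prems smooth1_vd by auto
  have vdf: "norm ((vd ^^ m) (vd f) t) \<le> A" "norm ((vd ^^ m) (vd g) t) \<le> B" if "m \<le> n" for m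
    using Suc.prems(4)[of "Suc m"] Suc.prems(5)[of "Suc m"] that by (simp_all only: vdn_Suc Suc_le_mono)
  have "(vd ^^ Suc n) (\<lambda>t. f t * g t) = (vd ^^ n) (\<lambda>t. f t * vd g t + vd f t * g t)"
    unfolding vdn_Suc using Suc.prems by (subst vd_mult[of 0]) (auto simp: smooth1_iff_diffk)
  also have "\<dots> = (\<lambda>t. (vd ^^ n) (\<lambda>t. f t * vd g t) t + (vd ^^ n) (\<lambda>t. vd f t * g t) t)"
    using Suc.prems sm by (intro vdn_add smooth1_mult) auto
  finally have "norm ((vd ^^ Suc n) (\<lambda>t. f t * g t) t) \<le>
      norm ((vd ^^ n) (\<lambda>t. f t * vd g t) t) + norm ((vd ^^ n) (\<lambda>t. vd f t * g t) t)"
    by (simp add: norm_triangle_ineq)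
  also have "\<dots> \<le> 2 ^ n * A * B + 2 ^ n * A * B"
    using Suc.prems sm vdf by (intro add_mono Suc.IH) auto
  finally show ?case by (simp add: mult_ac)
qed

lemma vdn_zero_on_open:
  assumes "open S" "\<And>t. t \<in> S \<Longrightarrow> g t = 0" "t \<in> S"
  shows "(vd ^^ n) g t = 0"
  using assms(3)
proof (induction n arbitrary: t)
  case (Suc n)
  have "((vd ^^ n) g has_vector_derivative 0) (at t)"
    by (rule has_vector_derivative_transform_within_open[OF has_vector_derivative_const assms(1)]) (use Suc in auto)
  then show ?case by (simp add: vd_at)
qed (use assms in auto)

lemma smooth1_const: "smooth1 (\<lambda>t. c)"
proof (rule smooth1I)
  show "((\<lambda>t. if n = 0 then c else 0) has_vector_derivative (if Suc n = 0 then c else 0)) (at t)" for n t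
    by simp
qed simp

lemma smooth1_of_real: "smooth1 of_real"
proof (rule smooth1I)
  show "((\<lambda>t. if n = 0 then of_real t else if n = 1 then 1 else (0::complex)) has_vector_derivative
    (if Suc n = 0 then of_real t else if Suc n = 1 then 1 else 0)) (at t)" for n t
    by (cases n) (auto intro!: has_vector_derivative_of_real[of "\<lambda>t. t" 1, simplified] derivative_eq_intros)
qed simp

section \<open>Compactly supported smooth functions and Schwartz functions of one variable\<close>

definition cc :: "(real \<Rightarrow> complex) \<Rightarrow> bool" where
  "cc g \<longleftrightarrow> smooth1 g \<and> (\<exists>M. \<forall>t. M < \<bar>t\<bar> \<longrightarrow> g t = 0)"

text \<open>One number bounds the order of differentiation and the order of the weight, to match
  \<open>schwartz_norm\<close>.\<close>

definition sbound :: "nat \<Rightarrow> real \<Rightarrow> (real \<Rightarrow> complex) \<Rightarrow> bool" where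
  "sbound N B g \<longleftrightarrow> (\<forall>n\<le>N. \<forall>t. (1 + \<bar>t\<bar>) ^ N * norm ((vd ^^ n) g t) \<le> B)"

definition schw :: "(real \<Rightarrow> complex) \<Rightarrow> bool" where
  "schw g \<longleftrightarrow> smooth1 g \<and> (\<forall>N. \<exists>B. sbound N B g)"

lemma ccI: "smooth1 g \<Longrightarrow> (\<And>t. M < \<bar>t\<bar> \<Longrightarrow> g t = 0) \<Longrightarrow> cc g"
  by (auto simp: cc_def)

lemma cc_smooth: "cc g \<Longrightarrow> smooth1 g" by (simp add: cc_def)
lemma schw_smooth: "schw g \<Longrightarrow> smooth1 g" by (simp add: schw_def)

lemma cc_supp:
  assumes "cc g"
  shows "\<exists>M>0. \<forall>n t. M < \<bar>t\<bar> \<longrightarrow> (vd ^^ n) g t = 0"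
proof -
  obtain M where M: "\<And>t. M < \<bar>t\<bar> \<Longrightarrow> g t = 0" using assms by (auto simp: cc_def)
  have "open {t. max M 1 < \<bar>t :: real\<bar>}" by (intro open_Collect_less continuous_intros)
  then have "(vd ^^ n) g t = 0" if "max M 1 < \<bar>t\<bar>" for n t
    by (rule vdn_zero_on_open) (use M that in auto)
  then show ?thesis by (intro exI[of _ "max M 1"]) auto
qed

lemma cc_mult: "cc f \<Longrightarrow> smooth1 g \<Longrightarrow> cc (\<lambda>t. f t * g t)"
  by (auto simp: cc_def smooth1_mult)

lemma cc_mult2: "cc f \<Longrightarrow> smooth1 g \<Longrightarrow> cc (\<lambda>t. g t * f t)"
  by (auto simp: cc_def smooth1_mult)

lemma cc_vdn: "cc g \<Longrightarrow> cc ((vd ^^ n) g)"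
proof -
  assume g: "cc g"
  obtain M where "0 < M" and M: "\<And>n t. M < \<bar>t\<bar> \<Longrightarrow> (vd ^^ n) g t = 0" using cc_supp[OF g] by blast
  show ?thesis by (rule ccI[OF smooth1_vdn[OF cc_smooth[OF g]]]) (rule M)
qed

lemma cc_add: "cc f \<Longrightarrow> cc g \<Longrightarrow> cc (\<lambda>t. f t + g t)"
proof -
  assume fg: "cc f" "cc g"
  obtain M1 where M1: "\<And>t. M1 < \<bar>t\<bar> \<Longrightarrow> f t = 0" using fg by (auto simp: cc_def)
  obtain M2 where M2: "\<And>t. M2 < \<bar>t\<bar> \<Longrightarrow> g t = 0" using fg by (auto simp: cc_def)
  show ?thesis by (rule ccI[where M="max M1 M2"]) (use M1 M2 fg in \<open>auto intro: smooth1_add simp: cc_smooth\<close>)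
qed

lemma cc_cmult: "cc f \<Longrightarrow> cc (\<lambda>t. c * f t)"
  by (auto simp: cc_def smooth1_cmult)

lemma cc_diff: "cc f \<Longrightarrow> cc g \<Longrightarrow> cc (\<lambda>t. f t - g t)"
  using cc_add[of f "\<lambda>t. -1 * g t"] cc_cmult[of g "-1"] by simp

lemma cc_affine:
  assumes f: "cc f" and a: "a \<noteq> 0"
  shows "cc (\<lambda>t. f (a * t + b))"
proof -
  obtain M where M: "\<And>t. M < \<bar>t\<bar> \<Longrightarrow> f t = 0" using f by (auto simp: cc_def)
  show ?thesis
  proof (rule ccI[where M="(M + \<bar>b\<bar>) / \<bar>a\<bar>"])
    fix t assume "(M + \<bar>b\<bar>) / \<bar>a\<bar> < \<bar>t\<bar>"
    then have "M + \<bar>b\<bar> < \<bar>a * t\<bar>" using a by (simp add: pos_divide_less_eq abs_mult mult.commute)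
    then have "M < \<bar>a * t + b\<bar>" by linarith
    then show "f (a * t + b) = 0" by (rule M)
  qed (use f in \<open>auto intro: smooth1_affine simp: cc_smooth\<close>)
qed

lemma sbound_mono: "sbound N B g \<Longrightarrow> M \<le> N \<Longrightarrow> B \<le> C \<Longrightarrow> sbound M C g"
  unfolding sbound_def
proof (intro allI impI)
  fix n t assume *: "\<forall>n\<le>N. \<forall>t. (1 + \<bar>t\<bar>) ^ N * norm ((vd ^^ n) g t) \<le> B" "M \<le> N" "B \<le> C" "n \<le> M"
  have "(1 + \<bar>t\<bar>) ^ M * norm ((vd ^^ n) g t) \<le> (1 + \<bar>t\<bar>) ^ N * norm ((vd ^^ n) g t)"
    by (intro mult_right_mono power_increasing) (use * in auto)
  also have "\<dots> \<le> B" using *(1)[rule_format, of n t] *(2,4) by simp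
  also note \<open>B \<le> C\<close>
  finally show "(1 + \<bar>t\<bar>) ^ M * norm ((vd ^^ n) g t) \<le> C" .
qed

lemma schw_sbound:
  assumes "schw g"
  obtains B where "0 < B" "sbound N B g"
proof -
  obtain B where "sbound N B g" using assms unfolding schw_def by blast
  then have "sbound N (max B 1) g" by (rule sbound_mono) auto
  then show ?thesis by (rule that[rotated]) simp
qed

lemma schw_bound:
  assumes "schw g"
  obtains B where "0 < B" "\<And>t. (1 + \<bar>t\<bar>) ^ N * norm ((vd ^^ n) g t) \<le> B"
proof -
  obtain B where B: "0 < B" "sbound (max N n) B g" using schw_sbound[OF assms] by blast
  have "(1 + \<bar>t\<bar>) ^ N * norm ((vd ^^ n) g t) \<le> (1 + \<bar>t\<bar>) ^ max N n * norm ((vd ^^ n) g t)" for t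
    by (intro mult_right_mono power_increasing) auto
  also have "(1 + \<bar>t\<bar>) ^ max N n * norm ((vd ^^ n) g t) \<le> B" for t using B by (auto simp: sbound_def)
  finally show ?thesis using B that by blast
qed

lemma schwI:
  assumes "smooth1 g" "\<And>N n. \<exists>B. \<forall>t. (1 + \<bar>t\<bar>) ^ N * norm ((vd ^^ n) g t) \<le> B"
  shows "schw g"
  unfolding schw_def
proof (intro conjI allI)
  fix N
  have "\<forall>n. \<exists>B. \<forall>t. (1 + \<bar>t\<bar>) ^ N * norm ((vd ^^ n) g t) \<le> B" using assms(2)[of N] by blast
  from choice[OF this] obtain B where B: "\<And>n t. (1 + \<bar>t\<bar>) ^ N * norm ((vd ^^ n) g t) \<le> B n" by blast
  have "B n \<le> (\<Sum>n\<le>N. \<bar>B n\<bar>)" if "n \<le> N" for n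
    using member_le_sum[of n "{..N}" "\<lambda>n. \<bar>B n\<bar>"] that by force
  then have "sbound N (\<Sum>n\<le>N. \<bar>B n\<bar>) g" unfolding sbound_def using order_trans[OF B] by blast
  then show "\<exists>B. sbound N B g" by blast
qed fact

lemma schw_sboundI: "smooth1 g \<Longrightarrow> (\<And>N. \<exists>B. sbound N B g) \<Longrightarrow> schw g"
  by (simp add: schw_def)

lemma cc_schw:
  assumes "cc g" shows "schw g"
proof (rule schwI)
  show sm: "smooth1 g" using assms by (rule cc_smooth)
  fix N n
  obtain M where M: "0 < M" "\<And>n t. M < \<bar>t\<bar> \<Longrightarrow> (vd ^^ n) g t = 0" using cc_supp[OF assms] by blast
  let ?h = "\<lambda>t. (1 + \<bar>t\<bar>) ^ N * norm ((vd ^^ n) g t)"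
  have "compact (?h ` {-M..M})"
    by (intro compact_continuous_image continuous_intros smooth1_continuous sm) auto
  from compact_imp_bounded[OF this] obtain B where B: "\<And>t. t \<in> {-M..M} \<Longrightarrow> norm (?h t) \<le> B"
    unfolding bounded_iff by blast
  show "\<exists>B. \<forall>t. ?h t \<le> B"
  proof (intro exI allI)
    fix t
    show "?h t \<le> max B 0"
    proof (cases "M < \<bar>t\<bar>")
      case True then show ?thesis using M by simp
    next
      case False
      then have "t \<in> {-M..M}" by auto
      from B[OF this] show ?thesis by auto
    qed
  qed
qed

lemma sbound_add: "smooth1 f \<Longrightarrow> smooth1 g \<Longrightarrow> sbound N A f \<Longrightarrow> sbound N B g \<Longrightarrow> sbound N (A + B) (\<lambda>t. f t + g t)"
  unfolding sbound_def vdn_add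
proof (intro allI impI)
  fix n t assume *: "\<forall>n\<le>N. \<forall>t. (1 + \<bar>t\<bar>) ^ N * norm ((vd ^^ n) f t) \<le> A"
    "\<forall>n\<le>N. \<forall>t. (1 + \<bar>t\<bar>) ^ N * norm ((vd ^^ n) g t) \<le> B" "n \<le> N"
  have "(1 + \<bar>t\<bar>) ^ N * norm ((vd ^^ n) f t + (vd ^^ n) g t) \<le> (1 + \<bar>t\<bar>) ^ N * (norm ((vd ^^ n) f t) + norm ((vd ^^ n) g t))"
    by (intro mult_left_mono norm_triangle_ineq) auto
  also have "\<dots> \<le> A + B" using * by (auto simp: distrib_left intro: add_mono)
  finally show "(1 + \<bar>t\<bar>) ^ N * norm ((vd ^^ n) f t + (vd ^^ n) g t) \<le> A + B" .
qed

lemma sbound_cmult: "smooth1 f \<Longrightarrow> sbound N A f \<Longrightarrow> sbound N (norm c * A) (\<lambda>t. c * f t)"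
  unfolding sbound_def vdn_cmult by (auto simp: norm_mult mult.left_commute intro!: mult_left_mono)

lemma schw_add: "schw f \<Longrightarrow> schw g \<Longrightarrow> schw (\<lambda>t. f t + g t)"
proof (rule schw_sboundI)
  fix N assume fg: "schw f" "schw g"
  obtain A where A: "sbound N A f" using schw_sbound[OF fg(1)] by blast
  obtain B where "sbound N B g" using schw_sbound[OF fg(2)] by blast
  with A show "\<exists>B. sbound N B (\<lambda>t. f t + g t)" using sbound_add[OF fg[THEN schw_smooth]] by blast
qed (simp add: smooth1_add schw_smooth)

lemma schw_cmult: "schw f \<Longrightarrow> schw (\<lambda>t. c * f t)"
proof (rule schw_sboundI)
  fix N assume f: "schw f"
  obtain A where "sbound N A f" using schw_sbound[OF f] by blast
  then show "\<exists>B. sbound N B (\<lambda>t. c * f t)" using sbound_cmult[OF schw_smooth[OF f]] by blast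
qed (simp add: smooth1_cmult schw_smooth)

lemma schw_diff: "schw f \<Longrightarrow> schw g \<Longrightarrow> schw (\<lambda>t. f t - g t)"
  using schw_add[of f "\<lambda>t. -1 * g t"] schw_cmult[of g "-1"] by simp

text \<open>From 1 + \<bar>t\<bar> \<le> (1 + \<bar>b\<bar>) (1 + \<bar>t - b\<bar>). The cost is
  polynomial in the translation, hence uniform for translations in a bounded set.\<close>

lemma sbound_shift:
  assumes "smooth1 f" "sbound N B f"
  shows "sbound N ((1 + \<bar>b\<bar>) ^ N * B) (\<lambda>t. f (t - b))"
  unfolding sbound_def
proof (intro allI impI)
  fix n t assume n: "n \<le> N"
  have e: "(vd ^^ n) (\<lambda>t. f (t - b)) t = (vd ^^ n) f (t - b)"
    using vdn_affine[OF assms(1), of n 1 "-b"] by (simp add: fun_eq_iff)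
  have "1 + \<bar>t\<bar> \<le> (1 + \<bar>b\<bar>) * (1 + \<bar>t - b\<bar>)"
  proof -
    have "\<bar>t\<bar> \<le> \<bar>b\<bar> + \<bar>t - b\<bar>" by linarith
    moreover have "0 \<le> \<bar>b\<bar> * \<bar>t - b\<bar>" by simp
    moreover have "(1 + \<bar>b\<bar>) * (1 + \<bar>t - b\<bar>) = 1 + \<bar>b\<bar> + \<bar>t - b\<bar> + \<bar>b\<bar> * \<bar>t - b\<bar>"
      by (simp only: distrib_left distrib_right mult_1 mult_1_right)
    ultimately show ?thesis by linarith
  qed
  then have "(1 + \<bar>t\<bar>) ^ N \<le> ((1 + \<bar>b\<bar>) * (1 + \<bar>t - b\<bar>)) ^ N" by (intro power_mono) auto
  then have "(1 + \<bar>t\<bar>) ^ N * norm ((vd ^^ n) f (t - b)) \<le> ((1 + \<bar>b\<bar>) * (1 + \<bar>t - b\<bar>)) ^ N * norm ((vd ^^ n) f (t - b))"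
    by (intro mult_right_mono) auto
  also have "\<dots> = (1 + \<bar>b\<bar>) ^ N * ((1 + \<bar>t - b\<bar>) ^ N * norm ((vd ^^ n) f (t - b)))" by (simp add: power_mult_distrib)
  also have "\<dots> \<le> (1 + \<bar>b\<bar>) ^ N * B" using assms(2) n by (intro mult_left_mono) (auto simp: sbound_def)
  finally show "(1 + \<bar>t\<bar>) ^ N * norm ((vd ^^ n) (\<lambda>t. f (t - b)) t) \<le> (1 + \<bar>b\<bar>) ^ N * B" by (simp only: e)
qed

lemma schw_shift: "schw f \<Longrightarrow> schw (\<lambda>t. f (t - b))"
proof (rule schw_sboundI)
  assume f: "schw f"
  show "smooth1 (\<lambda>t. f (t - b))" using smooth1_affine[OF schw_smooth[OF f], of 1 "-b"] by simp
  fix N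
  obtain B where "sbound N B f" using schw_sbound[OF f] by blast
  from sbound_shift[OF schw_smooth[OF f] this] show "\<exists>B. sbound N B (\<lambda>t. f (t - b))" by blast
qed

subsection \<open>A smooth step\<close>

lemma tendsto_poly_exp: "((\<lambda>x. x ^ k * poly q x * exp (- x)) \<longlongrightarrow> (0::real)) at_top"
proof (induction q arbitrary: k)
  case (pCons a q)
  have "((\<lambda>x::real. a * (x ^ k / exp x) + x ^ Suc k * poly q x * exp (- x)) \<longlongrightarrow> a * 0 + 0) at_top"
    by (intro tendsto_intros tendsto_power_div_exp_0 pCons.IH)
  then show ?case by (simp add: exp_minus field_simps)
qed simp

text \<open>For t > 0 the n-th derivative of exp(-1/t) is P_n(1/t) exp(-1/t). As 1/t has derivative
  -1/t^2, the polynomials satisfy P_(n+1)(x) = x^2 (P_n(x) - P_n'(x)).\<close>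

primrec flat_poly :: "nat \<Rightarrow> real poly" where
  "flat_poly 0 = 1"
| "flat_poly (Suc n) = [:0, 0, 1:] * (flat_poly n - pderiv (flat_poly n))"

definition flat :: "nat \<Rightarrow> real \<Rightarrow> real" where
  "flat n t = (if t \<le> 0 then 0 else poly (flat_poly n) (1 / t) * exp (- (1 / t)))"

lemma flat_deriv: "(flat n has_real_derivative flat (Suc n) t) (at t)"
proof -
  consider "t < 0" | "t = 0" | "0 < t" by linarith
  then show ?thesis
  proof cases
    case 1
    have "(flat n has_real_derivative 0) (at t)"
      by (rule has_field_derivative_transform_within_open[OF DERIV_const, where S="{..<0}"]) (use 1 in \<open>auto simp: flat_def\<close>)
    then show ?thesis using 1 by (simp add: flat_def)
  next
    case 2
    \<comment> \<open>With x = 1/h this is the right-hand difference quotient at 0.\<close>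
    have "((\<lambda>x. x ^ 1 * poly (flat_poly n) x * exp (- x)) \<longlongrightarrow> 0) at_top" by (rule tendsto_poly_exp)
    from filterlim_compose[OF this filterlim_inverse_at_top_right]
    have r: "((\<lambda>h. inverse h * poly (flat_poly n) (inverse h) * exp (- inverse h)) \<longlongrightarrow> 0) (at_right 0)" by simp
    have "((\<lambda>h. (flat n (0 + h) - flat n 0) / h) \<longlongrightarrow> 0) (at_right 0)"
      by (rule Lim_transform_eventually[OF r])
         (auto simp: eventually_at_filter flat_def divide_inverse mult_ac)
    moreover have "((\<lambda>h. (flat n (0 + h) - flat n 0) / h) \<longlongrightarrow> 0) (at_left 0)"
      by (rule Lim_transform_eventually[OF tendsto_const]) (auto simp: eventually_at_filter flat_def)
    ultimately show ?thesis using 2 unfolding DERIV_def by (simp add: filterlim_at_split flat_def)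
  next
    case 3
    have "((\<lambda>t. poly (flat_poly n) (1 / t) * exp (- (1 / t))) has_real_derivative
      poly (flat_poly (Suc n)) (1 / t) * exp (- (1 / t))) (at t)"
      using 3 by (auto intro!: derivative_eq_intros poly_DERIV DERIV_chain2[OF poly_DERIV] simp: field_simps power2_eq_square)
    then have "(flat n has_real_derivative poly (flat_poly (Suc n)) (1 / t) * exp (- (1 / t))) (at t)"
      by (rule has_field_derivative_transform_within_open[where S="{0<..}"]) (use 3 in \<open>auto simp: flat_def\<close>)
    then show ?thesis using 3 by (simp add: flat_def)
  qed
qed

definition flat_bump :: "real \<Rightarrow> complex" where
  "flat_bump t = of_real (flat 0 (t + 1/4)) * of_real (flat 0 (1/4 - t))"

lemma smooth1_flat_bump: "smooth1 flat_bump"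
proof -
  have s: "smooth1 (\<lambda>t. of_real (flat 0 t))"
    by (rule smooth1I[where D="\<lambda>n t. of_real (flat n t)"])
       (auto intro!: has_vector_derivative_of_real flat_deriv simp: has_real_derivative_iff_has_vector_derivative[symmetric])
  have "smooth1 (\<lambda>t. of_real (flat 0 (1 * t + 1/4)) * of_real (flat 0 (-1 * t + 1/4)))"
    by (intro smooth1_mult smooth1_affine[OF s])
  then show ?thesis by (simp add: flat_bump_def[abs_def])
qed

lemma flat_bump_0: "1/4 \<le> \<bar>t\<bar> \<Longrightarrow> flat_bump t = 0"
  by (auto simp: flat_bump_def flat_def)

definition flat_mass :: complex where "flat_mass = integral {-1..1} flat_bump"

lemma flat_mass_nz: "flat_mass \<noteq> 0"
proof
  assume 0: "flat_mass = 0"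
  define g where "g t = flat 0 (t + 1/4) * flat 0 (1/4 - t)" for t
  have fb: "flat_bump t = of_real (g t)" for t by (simp add: flat_bump_def g_def)
  have "continuous_on UNIV (flat 0)"
    using flat_deriv by (intro continuous_at_imp_continuous_on) (auto intro: DERIV_isCont)
  then have cg: "continuous_on {-1..1} g"
    unfolding g_def
    by (intro continuous_on_mult; rule continuous_on_compose2[of UNIV "flat 0"]) (auto intro: continuous_intros)
  have "(g has_integral integral {-1..1} g) {-1..1}" using cg by (simp add: integrable_continuous_real integrable_integral)
  then have "(flat_bump has_integral of_real (integral {-1..1} g)) {-1..1}"
    unfolding fb[abs_def] by (rule has_integral_of_real)
  then have "integral {-1..1} g = 0" using 0 by (simp add: flat_mass_def integral_unique)
  moreover have "0 \<le> g t" for t by (simp add: g_def flat_def)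
  ultimately have "\<forall>t\<in>{-1..1}. g t = 0"
    using integral_eq_0_iff[OF cg] by auto
  then have "g 0 = 0" by simp
  then show False by (simp add: g_def flat_def)
qed

definition sstep :: "real \<Rightarrow> complex" where
  "sstep t = integral {-1..t} flat_bump / flat_mass"

lemma sstep_deriv: "(sstep has_vector_derivative (1 / flat_mass) * flat_bump t) (at t)"
proof (cases "t < - 1/2")
  \<comment> \<open>The integral starts at -1 and degenerates further left, so the fundamental
    theorem is used only from -1/2 on; left of that point the function is constant.\<close>
  case True
  have "sstep s = 0" if "s < -1/2" for s
  proof -
    have "integral {-1..s} flat_bump = integral {-1..s} (\<lambda>_. 0)" by (rule integral_cong) (use that flat_bump_0 in auto)
    then show ?thesis by (simp add: sstep_def)
  qed
  then have "(sstep has_vector_derivative 0) (at t)"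
    by (intro has_vector_derivative_transform_within_open[OF has_vector_derivative_const, of "{..< -1/2}"]) (use True in auto)
  then show ?thesis using True flat_bump_0[of t] by simp
next
  case False
  have "((\<lambda>u. integral {-1..u} flat_bump) has_vector_derivative flat_bump t) (at t within {-1..t+1})"
    by (rule integral_has_vector_derivative) (use False smooth1_continuous0[OF smooth1_flat_bump] in auto)
  then have "((\<lambda>u. integral {-1..u} flat_bump) has_vector_derivative flat_bump t) (at t)"
    using False by (subst (asm) at_within_interior) auto
  from has_vector_derivative_mult_right[OF this, of "1 / flat_mass"]
  show ?thesis by (simp add: sstep_def[abs_def])
qed

lemma smooth1_sstep: "smooth1 sstep"
proof -
  let ?b = "\<lambda>t. (1 / flat_mass) * flat_bump t"
  have sb: "smooth1 ?b" by (intro smooth1_cmult smooth1_flat_bump)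
  show ?thesis
  proof (rule smooth1I[where D="\<lambda>n. case n of 0 \<Rightarrow> sstep | Suc n \<Rightarrow> (vd ^^ n) ?b"])
    fix n t
    show "((case n of 0 \<Rightarrow> sstep | Suc n \<Rightarrow> (vd ^^ n) ?b) has_vector_derivative
      (case Suc n of 0 \<Rightarrow> sstep | Suc n \<Rightarrow> (vd ^^ n) ?b) t) (at t)"
      using sstep_deriv smooth1_deriv[OF sb] by (cases n) (auto simp del: funpow.simps(2))
  qed simp
qed

lemma sstep_0: "t \<le> - 1/4 \<Longrightarrow> sstep t = 0"
proof -
  assume t: "t \<le> - 1/4"
  have "integral {-1..t} flat_bump = integral {-1..t} (\<lambda>_. 0)" by (rule integral_cong) (use t flat_bump_0 in auto)
  then show ?thesis by (simp add: sstep_def)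
qed

lemma sstep_1: "1/4 \<le> t \<Longrightarrow> sstep t = 1"
proof -
  assume t: "1/4 \<le> t"
  have ii: "flat_bump integrable_on {a..b}" for a b
    by (intro integrable_continuous_real smooth1_continuous0 smooth1_flat_bump)
  have eq: "integral {-1..s} flat_bump = integral {-1..1/4} flat_bump" if "1/4 \<le> s" for s
  proof -
    have "integral {-1..1/4} flat_bump + integral {1/4..s} flat_bump = integral {-1..s} flat_bump"
      by (rule Henstock_Kurzweil_Integration.integral_combine) (use that ii in auto)
    moreover have "integral {1/4..s} flat_bump = integral {1/4..s} (\<lambda>_. 0)" by (rule integral_cong) (use flat_bump_0 in auto)
    ultimately show ?thesis by simp
  qed
  show ?thesis using eq[OF t] eq[of 1] flat_mass_nz by (simp add: sstep_def flat_mass_def)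
qed

text \<open>It is 1 for \<bar>t\<bar> up to a - 1/4 and 0 from a + 1/4 on. The cutoff functions
  below are plateaus with parameters 1, 3/2 and 5/2.\<close>

definition plateau :: "real \<Rightarrow> real \<Rightarrow> complex" where
  "plateau a t = sstep (t + a) - sstep (t - a)"

lemma smooth1_plateau: "smooth1 (plateau a)"
proof -
  have "smooth1 (\<lambda>t. sstep (1 * t + a) + -1 * sstep (1 * t + -a))"
    by (intro smooth1_add smooth1_cmult smooth1_affine smooth1_sstep)
  then show ?thesis by (simp add: plateau_def[abs_def])
qed

lemma plateau_1: "\<bar>t\<bar> \<le> a - 1/4 \<Longrightarrow> plateau a t = 1"
  by (simp add: plateau_def sstep_1 sstep_0)

lemma plateau_0: "0 \<le> a \<Longrightarrow> a + 1/4 \<le> \<bar>t\<bar> \<Longrightarrow> plateau a t = 0"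
  unfolding plateau_def by (cases "0 \<le> t") (auto simp: sstep_1 sstep_0)

lemma cc_plateau: "0 \<le> a \<Longrightarrow> cc (plateau a)"
  by (rule ccI[OF smooth1_plateau, of "a + 1/4"]) (auto simp: plateau_0)

subsection \<open>The Fourier transform of \<open>C\<^sub>c\<^sup>\<infinity>(\<real>)\<close>\<close>

definition FT1 :: "(real \<Rightarrow> complex) \<Rightarrow> real \<Rightarrow> complex" where
  "FT1 g y = of_real ((2 * pi) powr (- 1 / 2)) * (LINT t|lborel. cis (- (t * y)) * g t)"

lemma cc_integrable:
  assumes "cc g" "continuous_on UNIV h"
  shows "integrable lborel (\<lambda>t. h t * g t :: complex)"
proof -
  obtain M where M: "0 < M" "\<And>n t. M < \<bar>t\<bar> \<Longrightarrow> (vd ^^ n) g t = 0" using cc_supp[OF assms(1)] by blast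
  have M0: "g t = 0" if "M < \<bar>t\<bar>" for t using M(2)[of t 0] that by simp
  have "set_integrable lborel {-M..M} (\<lambda>t. h t * g t)"
    by (intro borel_integrable_atLeastAtMost' continuous_on_mult smooth1_continuous0 cc_smooth assms
          continuous_on_subset[OF assms(2)]) auto
  then show ?thesis unfolding set_integrable_def
    by (rule Bochner_Integration.integrable_cong[THEN iffD1, OF refl, rotated]) (use M0 in \<open>force simp: indicator_def\<close>)
qed

lemma FT1_eq_integral:
  assumes g: "cc g" and M: "\<And>t. M < \<bar>t\<bar> \<Longrightarrow> g t = 0"
  shows "FT1 g y = of_real ((2 * pi) powr (- 1 / 2)) * integral {-M..M} (\<lambda>t. cis (- (t * y)) * g t)"
proof -
  have "set_integrable lborel {-M..M} (\<lambda>t. cis (- (t * y)) * g t)"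
    by (intro borel_integrable_atLeastAtMost' continuous_intros smooth1_continuous0 cc_smooth g)
  from set_borel_integral_eq_integral(2)[OF this]
  have "integral {-M..M} (\<lambda>t. cis (- (t * y)) * g t) = (LINT t:{-M..M}|lborel. cis (- (t * y)) * g t)" ..
  also have "\<dots> = (LINT t|lborel. cis (- (t * y)) * g t)"
    unfolding set_lebesgue_integral_def
    by (rule Bochner_Integration.integral_cong) (use M in \<open>force simp: indicator_def\<close>)+
  finally show ?thesis by (simp add: FT1_def)
qed

lemma cis_deriv: "((\<lambda>t. cis (a * t)) has_vector_derivative \<i> * of_real a * cis (a * t)) (at t within S)"
proof -
  have "((\<lambda>z. exp ((\<i> * of_real a) * z)) has_field_derivative (\<i> * of_real a) * exp ((\<i> * of_real a) * of_real t)) (at (of_real t))"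
    by (auto intro!: derivative_eq_intros)
  from has_vector_derivative_real_field[OF this, of S]
  show ?thesis by (simp add: cis_conv_exp mult_ac)
qed

lemma smooth1_cis: "smooth1 (\<lambda>t. cis (a * t))"
proof (rule smooth1I)
  show "((\<lambda>t. (\<i> * of_real a) ^ n * cis (a * t)) has_vector_derivative (\<i> * of_real a) ^ Suc n * cis (a * t)) (at t)" for n t
    using has_vector_derivative_mult_right[OF cis_deriv[of a t UNIV], of "(\<i> * of_real a) ^ n"] by (simp add: mult_ac)
qed simp

text \<open>Differentiation of a Fourier transform multiplies the original function by this
  factor.\<close>

definition mulid :: "(real \<Rightarrow> complex) \<Rightarrow> real \<Rightarrow> complex" where
  "mulid g t = (- \<i> * of_real t) * g t"

lemma cc_mulid: "cc g \<Longrightarrow> cc (mulid g)"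
  using cc_mult2[of g "\<lambda>t. - \<i> * of_real t"] smooth1_cmult[OF smooth1_of_real, of "- \<i>"]
  by (simp add: mulid_def[abs_def])

lemma cc_mulidn: "cc g \<Longrightarrow> cc ((mulid ^^ n) g)"
  by (induction n) (auto intro: cc_mulid)

lemma mulidn_0: "g t = 0 \<Longrightarrow> (mulid ^^ n) g t = 0"
  by (induction n) (auto simp: mulid_def)

lemma FT1_deriv:
  assumes g: "cc g"
  shows "(FT1 g has_vector_derivative FT1 (mulid g) y) (at y)"
proof -
  obtain M where M0: "0 < M" "\<And>n t. M < \<bar>t\<bar> \<Longrightarrow> (vd ^^ n) g t = 0" using cc_supp[OF assms(1)] by blast
  have M: "g t = 0" "mulid g t = 0" if "M < \<bar>t\<bar>" for t using M0(2)[of t 0] that by (simp_all add: mulid_def)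
  note cg = smooth1_continuous0[OF cc_smooth[OF g]]
  have "((\<lambda>y. integral (cbox (-M) M) (\<lambda>t. cis (- (t * y)) * g t)) has_vector_derivative
      integral (cbox (-M) M) (\<lambda>t. cis (- (t * y)) * mulid g t)) (at y within UNIV)"
  proof (rule leibniz_rule_vector_derivative)
    fix y t :: real
    show "((\<lambda>y. cis (- (t * y)) * g t) has_vector_derivative cis (- (t * y)) * mulid g t) (at y within UNIV)"
      using has_vector_derivative_mult_left[OF cis_deriv[of "-t" y UNIV], of "g t"] by (simp add: mulid_def mult_ac)
  next
    show "(\<lambda>t. cis (- (t * y)) * g t) integrable_on cbox (- M) M" for y
      by (intro integrable_continuous continuous_intros cg)
    have *: "continuous_on (UNIV \<times> cbox (- M) M) (\<lambda>z. cis (- (snd z * fst z)) * mulid g (snd z))"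
      unfolding mulid_def
      by (intro continuous_intros continuous_on_compose2[OF cg[of UNIV]]) auto
    show "continuous_on (UNIV \<times> cbox (- M) M) (\<lambda>(y, t). cis (- (t * y)) * mulid g t)"
      using * by (simp add: case_prod_beta')
  qed auto
  from has_vector_derivative_mult_right[OF this, of "of_real ((2 * pi) powr (- 1 / 2))"]
  have d: "((\<lambda>y. of_real ((2 * pi) powr (- 1 / 2)) * integral {-M..M} (\<lambda>t. cis (- (t * y)) * g t)) has_vector_derivative
    of_real ((2 * pi) powr (- 1 / 2)) * integral {-M..M} (\<lambda>t. cis (- (t * y)) * mulid g t)) (at y)" by simp
  have "((\<lambda>y. of_real ((2 * pi) powr (- 1 / 2)) * integral {-M..M} (\<lambda>t. cis (- (t * y)) * g t)) has_vector_derivative FT1 (mulid g) y) (at y)"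
  proof -
    have "FT1 (mulid g) y = of_real ((2 * pi) powr (- 1 / 2)) * integral {-M..M} (\<lambda>t. cis (- (t * y)) * mulid g t)"
      by (intro FT1_eq_integral cc_mulid g M)
    then show ?thesis using d by simp
  qed
  moreover have "FT1 g = (\<lambda>y. of_real ((2 * pi) powr (- 1 / 2)) * integral {-M..M} (\<lambda>t. cis (- (t * y)) * g t))"
    by (intro ext FT1_eq_integral g M)
  ultimately show ?thesis by simp
qed

lemma smooth1_FT1: "cc g \<Longrightarrow> smooth1 (FT1 g)"
  and vdn_FT1: "cc g \<Longrightarrow> (vd ^^ n) (FT1 g) = FT1 ((mulid ^^ n) g)"
proof -
  assume g: "cc g"
  let ?D = "\<lambda>n. FT1 ((mulid ^^ n) g)"
  have 0: "?D 0 = FT1 g" by simp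
  have 1: "(?D n has_vector_derivative ?D (Suc n) t) (at t)" for n t
    using FT1_deriv[OF cc_mulidn[OF g]] by simp
  show "smooth1 (FT1 g)" by (rule smooth1I[OF 0 1])
  show "(vd ^^ n) (FT1 g) = ?D n" by (rule vdn_eq[OF 0 1])
qed

lemma FT1_vd:
  assumes g: "cc g"
  shows "FT1 (vd g) y = \<i> * of_real y * FT1 g y"
proof -
  obtain M where M0: "0 < M" "\<And>n t. M < \<bar>t\<bar> \<Longrightarrow> (vd ^^ n) g t = 0" using cc_supp[OF g] by blast
  \<comment> \<open>The support bound is strict; one unit more makes the function and its derivative
    vanish at the endpoints as well, so no boundary terms remain.\<close>
  define M' where "M' = M + 1"
  have M: "g t = 0" "vd g t = 0" if "M' \<le> \<bar>t\<bar>" for t using M0(2)[of t 0] M0(2)[of t 1] that by (simp_all add: M'_def)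
  have cvd: "cc (vd g)" using cc_vdn[OF g, of 1] by simp
  note cg = smooth1_continuous0[OF cc_smooth[OF g]] smooth1_continuous0[OF cc_smooth[OF cvd]]
  have d: "((\<lambda>t. cis (- y * t) * g t) has_vector_derivative
     cis (- y * t) * vd g t + (\<i> * of_real (-y) * cis (-y * t)) * g t) (at t within {-M'..M'})" for t
    by (intro has_vector_derivative_mult cis_deriv has_vector_derivative_at_within[OF smooth1_deriv0] cc_smooth g)
  have "((\<lambda>t. cis (- y * t) * vd g t + (\<i> * of_real (-y) * cis (-y * t)) * g t) has_integral
     cis (- y * M') * g M' - cis (- y * (-M')) * g (-M')) {-M'..M'}"
    using fundamental_theorem_of_calculus[OF _ d] M0 by (simp add: M'_def)
  then have "integral {-M'..M'} (\<lambda>t. cis (- y * t) * vd g t + (- \<i> * of_real y) * (cis (-y * t) * g t)) = 0"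
    using M[of M'] M[of "-M'"] M0 by (simp add: integral_unique mult_ac M'_def)
  moreover have "integral {-M'..M'} (\<lambda>t. cis (- y * t) * vd g t + (- \<i> * of_real y) * (cis (-y * t) * g t)) =
     integral {-M'..M'} (\<lambda>t. cis (- y * t) * vd g t) + (- \<i> * of_real y) * integral {-M'..M'} (\<lambda>t. cis (-y * t) * g t)"
    by (subst Henstock_Kurzweil_Integration.integral_add)
       (auto intro!: integrable_continuous_real continuous_intros cg)
  ultimately have "integral {-M'..M'} (\<lambda>t. cis (- y * t) * vd g t) = (\<i> * of_real y) * integral {-M'..M'} (\<lambda>t. cis (-y * t) * g t)"
    by (simp add: add_eq_0_iff)
  moreover have "g t = 0" "vd g t = 0" if "M' < \<bar>t\<bar>" for t using M that by auto
  ultimately show ?thesis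
    by (subst (1 2) FT1_eq_integral[where M=M']) (auto simp: g cvd mult_ac)
qed

lemma FT1_vdn: "cc g \<Longrightarrow> FT1 ((vd ^^ n) g) y = (\<i> * of_real y) ^ n * FT1 g y"
  by (induction n) (simp_all add: FT1_vd cc_vdn mult_ac)

lemma FT1_bounded:
  assumes g: "cc g"
  shows "\<exists>B. \<forall>y. norm (FT1 g y) \<le> B"
proof -
  have "norm (FT1 g y) \<le> (2 * pi) powr (- 1 / 2) * (LINT t|lborel. norm (g t))" for y
  proof -
    have "norm (LINT t|lborel. cis (- (t * y)) * g t) \<le> (LINT t|lborel. norm (cis (- (t * y)) * g t))"
      by (rule integral_norm_bound)
    then show ?thesis by (simp add: FT1_def norm_mult mult_left_mono)
  qed
  then show ?thesis by blast
qed

text \<open>The transform of the N-th derivative is bounded and equals (i y)^N times the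
  transform.\<close>

lemma FT1_decay:
  assumes g: "cc g"
  shows "\<exists>B>0. \<forall>y. (1 + \<bar>y\<bar>) ^ N * norm (FT1 g y) \<le> B"
proof -
  obtain A where A: "\<And>y. norm (FT1 g y) \<le> A" using FT1_bounded[OF g] by blast
  obtain B where B: "\<And>y. norm (FT1 ((vd ^^ N) g) y) \<le> B" using FT1_bounded[OF cc_vdn[OF g]] by blast
  have "(1 + \<bar>y\<bar>) ^ N * norm (FT1 g y) \<le> max 1 (2 ^ N * (A + B))" for y
  proof -
    have "(1 + \<bar>y\<bar>) ^ N \<le> 2 ^ N * (1 + \<bar>y\<bar> ^ N)"
    proof (cases "\<bar>y\<bar> \<le> 1")
      case True
      then have "(1 + \<bar>y\<bar>) ^ N \<le> 2 ^ N" by (intro power_mono) auto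
      also have "2 ^ N * 1 \<le> 2 ^ N * (1 + \<bar>y\<bar> ^ N)" by (intro mult_left_mono) auto
      finally show ?thesis by simp
    next
      case False
      then have "(1 + \<bar>y\<bar>) ^ N \<le> (2 * \<bar>y\<bar>) ^ N" by (intro power_mono) auto
      also have "\<dots> \<le> 2 ^ N * (1 + \<bar>y\<bar> ^ N)" by (simp add: power_mult_distrib)
      finally show ?thesis .
    qed
    then have "(1 + \<bar>y\<bar>) ^ N * norm (FT1 g y) \<le> 2 ^ N * (1 + \<bar>y\<bar> ^ N) * norm (FT1 g y)" by (intro mult_right_mono) auto
    also have "\<dots> = 2 ^ N * (norm (FT1 g y) + norm (FT1 ((vd ^^ N) g) y))"
      by (simp add: FT1_vdn[OF g] norm_mult norm_power distrib_left distrib_right mult.assoc)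
    also have "\<dots> \<le> 2 ^ N * (A + B)" by (intro mult_left_mono add_mono A B) auto
    finally show ?thesis by simp
  qed
  then show ?thesis by (intro exI[of _ "max 1 (2 ^ N * (A + B))"]) simp
qed

lemma schw_FT1: "cc g \<Longrightarrow> schw (FT1 g)"
proof (rule schwI)
  assume g: "cc g"
  show "smooth1 (FT1 g)" by (rule smooth1_FT1[OF g])
  fix N n
  show "\<exists>B. \<forall>t. (1 + \<bar>t\<bar>) ^ N * norm ((vd ^^ n) (FT1 g) t) \<le> B"
    unfolding vdn_FT1[OF g] using FT1_decay[OF cc_mulidn[OF g], of N n] by blast
qed

lemma FT1_integrable: "cc g \<Longrightarrow> integrable lborel (\<lambda>t. cis (- (t * y)) * g t)"
  by (rule cc_integrable) (auto intro!: continuous_intros)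

lemma FT1_add: "cc f \<Longrightarrow> cc g \<Longrightarrow> FT1 (\<lambda>t. f t + g t) y = FT1 f y + FT1 g y"
proof -
  assume fg: "cc f" "cc g"
  have "(LINT t|lborel. cis (- (t * y)) * f t + cis (- (t * y)) * g t) =
     (LINT t|lborel. cis (- (t * y)) * f t) + (LINT t|lborel. cis (- (t * y)) * g t)"
    by (intro Bochner_Integration.integral_add FT1_integrable fg)
  then show ?thesis by (simp only: FT1_def distrib_left)
qed

lemma FT1_cmult: "FT1 (\<lambda>t. c * f t) y = c * FT1 f y"
  unfolding FT1_def by (simp add: mult.left_commute[of _ c])

lemma FT1_diff: "cc f \<Longrightarrow> cc g \<Longrightarrow> FT1 (\<lambda>t. f t - g t) y = FT1 f y - FT1 g y"
  using FT1_add[of f "\<lambda>t. -1 * g t" y] cc_cmult[of g "-1"] FT1_cmult[of "-1" g y] by simp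

lemma FT1_cis: "FT1 (\<lambda>t. cis (b * t) * g t) y = FT1 g (y - b)"
proof -
  have "cis (- (t * y)) * cis (b * t) = cis (- (t * (y - b)))" for t
    by (simp add: cis_mult algebra_simps)
  then show ?thesis unfolding FT1_def by (simp only: mult.assoc[symmetric])
qed

lemma FT1_scale:
  assumes "0 < a"
  shows "FT1 (\<lambda>t. g (t / a)) y = of_real a * FT1 g (a * y)"
proof -
  have "(LINT t|lborel. cis (- (t * y)) * g (t / a)) = \<bar>a\<bar> *\<^sub>R (LINT t|lborel. cis (- ((0 + a * t) * y)) * g ((0 + a * t) / a))"
    by (rule lborel_integral_real_affine) (use assms in auto)
  then show ?thesis using assms by (simp add: FT1_def scaleR_conv_of_real mult_ac)
qed

lemma FT1_sum: "finite I \<Longrightarrow> (\<And>i. i \<in> I \<Longrightarrow> cc (f i)) \<Longrightarrow> FT1 (\<lambda>t. \<Sum>i\<in>I. f i t) y = (\<Sum>i\<in>I. FT1 (f i) y) \<and> cc (\<lambda>t. \<Sum>i\<in>I. f i t)"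
proof (induction I rule: finite_induct)
  case empty
  then show ?case by (auto simp: FT1_def intro!: ccI[of _ 0] smooth1_const)
next
  case (insert i I)
  then show ?case by (auto simp: FT1_add intro!: cc_add)
qed

subsection \<open>Pointwise convergence of Fourier series\<close>

lemma integral_cis_int:
  "integral {-pi..pi} (\<lambda>t. cis (of_int n * t)) = (if n = 0 then 2 * pi else 0)"
proof (cases "n = 0")
  case False
  have "((\<lambda>t. cis (of_int n * t)) has_integral
     cis (of_int n * pi) / (\<i> * of_int n) - cis (of_int n * (- pi)) / (\<i> * of_int n)) {-pi..pi}"
  proof (rule fundamental_theorem_of_calculus)
    fix t :: real
    have "((\<lambda>t. (1 / (\<i> * of_int n)) * cis (of_int n * t)) has_vector_derivative
       (1 / (\<i> * of_int n)) * (\<i> * of_real (of_int n) * cis (of_int n * t))) (at t within {-pi..pi})"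
      by (intro has_vector_derivative_mult_right cis_deriv)
    then show "((\<lambda>t. cis (of_int n * t) / (\<i> * of_int n)) has_vector_derivative cis (of_int n * t)) (at t within {-pi..pi})"
      using False by simp
  qed simp
  moreover have "cis (of_int n * pi) = cis (of_int n * (- pi))"
    by (simp add: complex_eq_iff sin_zero_iff_int2)
  ultimately show ?thesis using False by (simp add: integral_unique)
qed (simp add: scaleR_conv_of_real)

text \<open>The coefficients are not normalised, so the best approximation by a multiple v S of
  their trigonometric sum has v = 1/(2 pi). The inequality says that the mean square error is
  nonnegative.\<close>

lemma bessel:
  fixes G :: "real \<Rightarrow> complex"
  assumes G: "continuous_on {-pi..pi} G" and F: "finite F"
  defines "c \<equiv> \<lambda>k::int. integral {-pi..pi} (\<lambda>t. G t * cis (- of_int k * t))"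
  shows "(\<Sum>k\<in>F. (norm (c k))\<^sup>2) \<le> 2 * pi * integral {-pi..pi} (\<lambda>t. (norm (G t))\<^sup>2)"
proof -
  define S where "S t = (\<Sum>k\<in>F. c k * cis (of_int k * t))" for t
  have ii: "(\<lambda>t. f t) integrable_on {-pi..pi}" if "continuous_on {-pi..pi} f" for f :: "real \<Rightarrow> complex"
    using that by (rule integrable_continuous_real)
  have cS: "continuous_on A S" for A unfolding S_def by (intro continuous_intros)
  have cnj_cont: "continuous_on A (\<lambda>t. cnj (f t))" if "continuous_on A f" for f :: "real \<Rightarrow> complex" and A
    using that by (rule continuous_on_cnj)
  have cSc: "cnj (S t) = (\<Sum>k\<in>F. cnj (c k) * cis (- of_int k * t))" for t
    by (simp add: S_def cis_cnj)
  have GS: "integral {-pi..pi} (\<lambda>t. G t * cnj (S t)) = (\<Sum>k\<in>F. cnj (c k) * c k)"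
  proof -
    have "integral {-pi..pi} (\<lambda>t. G t * cnj (S t)) = integral {-pi..pi} (\<lambda>t. \<Sum>k\<in>F. cnj (c k) * (G t * cis (- of_int k * t)))"
      by (simp add: cSc sum_distrib_left mult_ac)
    also have "\<dots> = (\<Sum>k\<in>F. integral {-pi..pi} (\<lambda>t. cnj (c k) * (G t * cis (- of_int k * t))))"
      by (intro integral_sum F ii continuous_intros G)
    finally show ?thesis by (simp add: c_def)
  qed
  have SS: "integral {-pi..pi} (\<lambda>t. S t * cnj (S t)) = 2 * pi * (\<Sum>k\<in>F. cnj (c k) * c k)"
  proof -
    have "integral {-pi..pi} (\<lambda>t. S t * cnj (S t)) = integral {-pi..pi} (\<lambda>t. \<Sum>k\<in>F. \<Sum>l\<in>F. c k * cnj (c l) * cis (of_int (k - l) * t))"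
    proof (rule integral_cong)
      fix t
      have *: "c k * cis (of_int k * t) * (cnj (c l) * cis (- of_int l * t)) = c k * cnj (c l) * cis (of_int (k - l) * t)" for k l
      proof -
        have "cis (of_int k * t) * cis (- of_int l * t) = cis (of_int (k - l) * t)"
          by (simp add: cis_mult left_diff_distrib)
        then show ?thesis by (metis (no_types) mult.assoc mult.left_commute)
      qed
      show "S t * cnj (S t) = (\<Sum>k\<in>F. \<Sum>l\<in>F. c k * cnj (c l) * cis (of_int (k - l) * t))"
        unfolding cSc unfolding S_def sum_product * ..
    qed
    also have "\<dots> = (\<Sum>k\<in>F. integral {-pi..pi} (\<lambda>t. \<Sum>l\<in>F. c k * cnj (c l) * cis (of_int (k - l) * t)))"
      by (intro integral_sum F ii continuous_intros)
    also have "\<dots> = (\<Sum>k\<in>F. \<Sum>l\<in>F. integral {-pi..pi} (\<lambda>t. c k * cnj (c l) * cis (of_int (k - l) * t)))"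
      by (intro sum.cong refl integral_sum F ii continuous_intros)
    also have "\<dots> = (\<Sum>k\<in>F. \<Sum>l\<in>F. c k * cnj (c l) * integral {-pi..pi} (\<lambda>t. cis (of_int (k - l) * t)))"
      by simp
    also have "\<dots> = (\<Sum>k\<in>F. \<Sum>l\<in>F. if k = l then c k * cnj (c l) * (2 * pi) else 0)"
      by (intro sum.cong refl) (simp add: integral_cis_int del: of_int_diff)
    also have "\<dots> = (\<Sum>k\<in>F. c k * cnj (c k) * (2 * pi))" using F by (simp add: sum.delta)
    finally show ?thesis by (simp add: sum_distrib_left mult_ac)
  qed
  define Q where "Q = (\<Sum>k\<in>F. (norm (c k))\<^sup>2)"
  have Q: "(\<Sum>k\<in>F. cnj (c k) * c k) = of_real Q"
    unfolding Q_def of_real_sum complex_norm_square by (simp only: mult.commute)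
  have SG: "integral {-pi..pi} (\<lambda>t. S t * cnj (G t)) = of_real Q"
  proof -
    have "integral {-pi..pi} (\<lambda>t. cnj (G t * cnj (S t))) = cnj (integral {-pi..pi} (\<lambda>t. G t * cnj (S t)))"
      by (rule integral_cnj[symmetric])
    moreover have "(\<lambda>t. cnj (G t * cnj (S t))) = (\<lambda>t. S t * cnj (G t))" by (simp add: mult.commute)
    ultimately show ?thesis by (simp only: GS Q complex_cnj_complex_of_real)
  qed
  define R where "R = integral {-pi..pi} (\<lambda>t. (norm (G t))\<^sup>2)"
  have GG: "integral {-pi..pi} (\<lambda>t. G t * cnj (G t)) = of_real R"
  proof -
    have "(\<lambda>t. (norm (G t))\<^sup>2) integrable_on {-pi..pi}" by (intro integrable_continuous_real continuous_intros G)
    then have "((\<lambda>t. complex_of_real ((norm (G t))\<^sup>2)) has_integral of_real R) {-pi..pi}"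
      unfolding R_def by (intro has_integral_of_real integrable_integral)
    then show ?thesis unfolding complex_norm_square by (rule integral_unique)
  qed
  define v where "v = 1 / (2 * pi)"
  have "(\<lambda>t. (norm (G t - v *\<^sub>R S t))\<^sup>2) integrable_on {-pi..pi}"
    by (intro integrable_continuous_real continuous_intros G cS)
  then have i1: "((\<lambda>t. complex_of_real ((norm (G t - v *\<^sub>R S t))\<^sup>2)) has_integral
      of_real (integral {-pi..pi} (\<lambda>t. (norm (G t - v *\<^sub>R S t))\<^sup>2))) {-pi..pi}"
    by (intro has_integral_of_real integrable_integral)
  have e: "complex_of_real ((norm (G t - v *\<^sub>R S t))\<^sup>2) =
     G t * cnj (G t) + (- of_real v) * (G t * cnj (S t)) + (- of_real v) * (S t * cnj (G t)) + (of_real (v^2)) * (S t * cnj (S t))" for t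
    unfolding complex_norm_square by (simp add: scaleR_conv_of_real algebra_simps power2_eq_square)
  have hi: "((\<lambda>t. f t) has_integral integral {-pi..pi} f) {-pi..pi}" if "continuous_on {-pi..pi} f" for f :: "real \<Rightarrow> complex"
    using ii[OF that] by (rule integrable_integral)
  have h1: "((\<lambda>t. G t * cnj (G t)) has_integral of_real R) {-pi..pi}"
    unfolding GG[symmetric] by (intro hi continuous_on_mult G cnj_cont)
  have h2: "((\<lambda>t. G t * cnj (S t)) has_integral of_real Q) {-pi..pi}"
    unfolding Q[symmetric] GS[symmetric] by (intro hi continuous_on_mult G cS cnj_cont)
  have h3: "((\<lambda>t. S t * cnj (G t)) has_integral of_real Q) {-pi..pi}"
    unfolding SG[symmetric] by (intro hi continuous_on_mult G cS cnj_cont)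
  have "integral {-pi..pi} (\<lambda>t. S t * cnj (S t)) = of_real (2 * pi * Q)" using SS Q by simp
  then have h4: "((\<lambda>t. S t * cnj (S t)) has_integral of_real (2 * pi * Q)) {-pi..pi}"
    using hi[of "\<lambda>t. S t * cnj (S t)"] by (simp add: continuous_on_mult cS cnj_cont)
  have "((\<lambda>t. G t * cnj (G t) + (- of_real v) * (G t * cnj (S t)) + (- of_real v) * (S t * cnj (G t)) + (of_real (v^2)) * (S t * cnj (S t))) has_integral
     (of_real R + (- of_real v) * of_real Q + (- of_real v) * of_real Q + of_real (v^2) * of_real (2 * pi * Q))) {-pi..pi}"
    by (intro has_integral_add has_integral_mult_right h1 h2 h3 h4)
  then have "((\<lambda>t. complex_of_real ((norm (G t - v *\<^sub>R S t))\<^sup>2)) has_integral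
     of_real (R + (- v) * Q + (- v) * Q + v^2 * (2 * pi * Q))) {-pi..pi}"
    unfolding e by simp
  then have "complex_of_real (integral {-pi..pi} (\<lambda>t. (norm (G t - v *\<^sub>R S t))\<^sup>2)) =
     of_real (R + (- v) * Q + (- v) * Q + v^2 * (2 * pi * Q))"
    using has_integral_unique[OF i1] by blast
  then have "integral {-pi..pi} (\<lambda>t. (norm (G t - v *\<^sub>R S t))\<^sup>2) = R + (- v) * Q + (- v) * Q + v^2 * (2 * pi * Q)"
    by (simp only: of_real_eq_iff)
  moreover have "0 \<le> integral {-pi..pi} (\<lambda>t. (norm (G t - v *\<^sub>R S t))\<^sup>2)"
    by (intro integral_nonneg integrable_continuous_real continuous_intros G cS) auto
  moreover have "v^2 * (2 * pi * Q) = v * Q" by (simp add: v_def power2_eq_square)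
  ultimately have "v * Q \<le> R" by linarith
  then show ?thesis unfolding Q_def[symmetric] R_def[symmetric] v_def by (simp add: field_simps)
qed

text \<open>Bessel's inequality makes the coefficients square summable. Continuity suffices for
  this, and it is all that will be shown of the quotient to which the lemma is applied.\<close>

lemma riemann_lebesgue_int:
  fixes G :: "real \<Rightarrow> complex"
  assumes G: "continuous_on {-pi..pi} G"
  shows "(\<lambda>n. integral {-pi..pi} (\<lambda>t. G t * cis (- of_int (int n) * t))) \<longlonglongrightarrow> 0" (is ?A)
    and "(\<lambda>n. integral {-pi..pi} (\<lambda>t. G t * cis (- of_int (- int n) * t))) \<longlonglongrightarrow> 0" (is ?B)
proof -
  define c where "c = (\<lambda>k::int. integral {-pi..pi} (\<lambda>t. G t * cis (- of_int k * t)))"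
  have main: "(\<lambda>n. c (\<sigma> * int n)) \<longlonglongrightarrow> 0" if "\<sigma> \<noteq> 0" for \<sigma>
  proof -
    have "summable (\<lambda>n. (norm (c (\<sigma> * int n)))\<^sup>2)"
    proof (rule summableI_nonneg_bounded)
      fix n
      have "(\<Sum>i<n. (norm (c (\<sigma> * int i)))\<^sup>2) = (\<Sum>k\<in>(\<lambda>i. \<sigma> * int i) ` {..<n}. (norm (c k))\<^sup>2)"
        by (subst sum.reindex) (use that in \<open>auto simp: inj_on_def\<close>)
      also have "\<dots> \<le> 2 * pi * integral {-pi..pi} (\<lambda>t. (norm (G t))\<^sup>2)"
        unfolding c_def by (rule bessel[OF G]) auto
      finally show "(\<Sum>i<n. (norm (c (\<sigma> * int i)))\<^sup>2) \<le> 2 * pi * integral {-pi..pi} (\<lambda>t. (norm (G t))\<^sup>2)" .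
    qed auto
    from tendsto_real_sqrt[OF summable_LIMSEQ_zero[OF this]]
    have "(\<lambda>n. norm (c (\<sigma> * int n))) \<longlonglongrightarrow> 0" by simp
    then show ?thesis by (rule tendsto_norm_zero_cancel)
  qed
  show ?A using main[of 1] by (simp add: c_def)
  show ?B using main[of "-1"] by (simp add: c_def)
qed

lemma cis_eq_1_small: "cis x = 1 \<Longrightarrow> \<bar>x\<bar> < 2 * pi \<Longrightarrow> x = 0"
proof -
  assume "cis x = 1" and x: "\<bar>x\<bar> < 2 * pi"
  then have "cos x = 1" by (simp add: complex_eq_iff)
  then obtain n :: int where n: "x = of_int n * 2 * pi" by (auto simp: cos_one_2pi_int)
  with x have "\<bar>of_int n\<bar> * (2 * pi) < 1 * (2 * pi)" by (simp add: abs_mult)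
  then have "\<bar>real_of_int n\<bar> < 1" using mult_less_cancel_right_pos[of "2*pi"] by (simp del: of_int_abs)
  then have "n = 0" by linarith
  then show "x = 0" using n by simp
qed

lemma vector_derivative_quotient:
  fixes h :: "real \<Rightarrow> complex"
  assumes "(h has_vector_derivative D) (at x)"
  shows "((\<lambda>y. (h y - h x) / of_real (y - x)) \<longlongrightarrow> D) (at x)"
  using assms unfolding has_vector_derivative_complex_iff has_field_derivative_iff tendsto_complex_iff
  by (simp only: Re_divide_of_real Im_divide_of_real minus_complex.sel)

lemma sum_int_symmetric_Suc:
  fixes f :: "int \<Rightarrow> 'a::ab_group_add"
  shows "(\<Sum>k\<in>{-int (Suc K)..int (Suc K)}. f k) = (\<Sum>k\<in>{-int K..int K}. f k) + (f (int (Suc K)) + f (- int (Suc K)))"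
proof -
  have "{-int (Suc K)..int (Suc K)} = insert (int (Suc K)) (insert (- int (Suc K)) {-int K..int K})" by auto
  then show ?thesis by (simp add: add_ac)
qed

text \<open>Chernoff's argument: writing \<open>h - h(\<xi>) = (e\<^bsup>i(\<cdot>-\<xi>)\<^esup> - 1) G\<close>, the Fourier coefficients
  telescope.\<close>

lemma fourier_series_smooth:
  fixes h :: "real \<Rightarrow> complex"
  assumes h: "smooth1 h" and \<xi>: "\<bar>\<xi>\<bar> \<le> 3"
  shows "(\<lambda>K. \<Sum>k\<in>{-int K..int K}. integral {-pi..pi} (\<lambda>t. h t * cis (- of_int k * (t - \<xi>)))) \<longlonglongrightarrow> 2 * pi * h \<xi>"
proof -
  \<comment> \<open>The value at \<xi> is the limit of the quotient, because the denominator has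
    derivative i there.\<close>
  define G where "G t = (if t = \<xi> then vd h \<xi> / \<i> else (h t - h \<xi>) / (cis (t - \<xi>) - 1))" for t
  \<comment> \<open>As \<bar>\<xi>\<bar> \<le> 3 < pi, the distance from \<xi> stays below 2 pi on
    the closed period, and \<xi> is the only zero of the denominator.\<close>
  have nz: "cis (t - \<xi>) - 1 \<noteq> 0" if "t \<in> {-pi..pi}" "t \<noteq> \<xi>" for t
  proof
    assume "cis (t - \<xi>) - 1 = 0"
    moreover have "\<bar>t - \<xi>\<bar> < 2 * pi" using that \<xi> pi_gt3 by auto
    ultimately show False using cis_eq_1_small[of "t - \<xi>"] that by simp
  qed
  have fact: "h t - h \<xi> = (cis (t - \<xi>) - 1) * G t" if "t \<in> {-pi..pi}" for t
    using nz[OF that] by (simp add: G_def)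
  have ch: "continuous_on A h" for A by (rule smooth1_continuous0[OF h])
  have contG: "continuous_on {-pi..pi} G"
    unfolding continuous_on_eq_continuous_within
  proof
    fix t assume t: "t \<in> {-pi..pi}"
    show "continuous (at t within {-pi..pi}) G"
    proof (cases "t = \<xi>")
      case False
      have cc: "continuous_on {-pi..pi} (\<lambda>x. cis (x - \<xi>))" by (intro continuous_intros)
      have "continuous (at t within {-pi..pi}) (\<lambda>t. (h t - h \<xi>) / (cis (t - \<xi>) - 1))"
        unfolding continuous_within using t nz[OF t False] ch[of "{-pi..pi}"] cc
        by (intro tendsto_divide tendsto_diff tendsto_const) (auto simp: continuous_on_def)
      then show ?thesis
      proof (rule continuous_transform_within[OF _ _ t])
        show "0 < \<bar>t - \<xi>\<bar>" using False by simp
      next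
        fix x assume "dist x t < \<bar>t - \<xi>\<bar>"
        then have "x \<noteq> \<xi>" by (auto simp: dist_real_def)
        then show "(h x - h \<xi>) / (cis (x - \<xi>) - 1) = G x" by (simp add: G_def)
      qed
    next
      case True
      have 1: "((\<lambda>x. (h x - h \<xi>) / of_real (x - \<xi>)) \<longlongrightarrow> vd h \<xi>) (at \<xi>)"
        by (rule vector_derivative_quotient[OF smooth1_deriv0[OF h]])
      have "((\<lambda>x. cis (x - \<xi>)) has_vector_derivative \<i>) (at \<xi>)"
        using has_vector_derivative_mult_left[OF cis_deriv[of 1 \<xi> UNIV], of "cis (- \<xi>)"]
        by (simp add: cis_mult mult.assoc)
      from vector_derivative_quotient[OF this]
      have 2: "((\<lambda>x. (cis (x - \<xi>) - 1) / of_real (x - \<xi>)) \<longlongrightarrow> \<i>) (at \<xi>)" by simp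
      have "(G \<longlongrightarrow> vd h \<xi> / \<i>) (at \<xi>)"
        by (rule Lim_transform_eventually[OF tendsto_divide[OF 1 2]]) (auto simp: eventually_at_filter G_def)
      then have "isCont G \<xi>" by (simp add: isCont_def G_def)
      then show ?thesis using True by (simp add: continuous_at_imp_continuous_at_within)
    qed
  qed
  define c where "c k = integral {-pi..pi} (\<lambda>t. G t * cis (- of_int k * (t - \<xi>)))" for k :: int
  have ii: "(\<lambda>t. f t) integrable_on {-pi..pi}" if "continuous_on {-pi..pi} f" for f :: "real \<Rightarrow> complex"
    using that by (rule integrable_continuous_real)
  have shift: "cis (- of_int k * (t - \<xi>)) = cis (of_int k * \<xi>) * cis (- of_int k * t)" for k :: int and t
    by (simp add: cis_mult algebra_simps)
  have c_eq: "c k = cis (of_int k * \<xi>) * integral {-pi..pi} (\<lambda>t. G t * cis (- of_int k * t))" for k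
  proof -
    have "(\<lambda>t. G t * (cis (of_int k * \<xi>) * cis (- of_int k * t))) = (\<lambda>t. cis (of_int k * \<xi>) * (G t * cis (- of_int k * t)))"
      by (intro ext) (rule mult.left_commute)
    then show ?thesis unfolding c_def shift by (simp only: integral_mult_right)
  qed
  have c1: "(\<lambda>n. c (int n)) \<longlonglongrightarrow> 0"
    by (rule tendsto_norm_zero_cancel) (use tendsto_norm_zero[OF riemann_lebesgue_int(1)[OF contG]] in \<open>simp add: c_eq norm_mult\<close>)
  have c2: "(\<lambda>n. c (- int n)) \<longlonglongrightarrow> 0"
    by (rule tendsto_norm_zero_cancel) (use tendsto_norm_zero[OF riemann_lebesgue_int(2)[OF contG]] in \<open>simp add: c_eq norm_mult\<close>)
  have coeff: "integral {-pi..pi} (\<lambda>t. h t * cis (- of_int k * (t - \<xi>))) =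
      c (k - 1) - c k + (if k = 0 then 2 * pi * h \<xi> else 0)" for k
  proof -
    have "integral {-pi..pi} (\<lambda>t. h t * cis (- of_int k * (t - \<xi>))) =
       integral {-pi..pi} (\<lambda>t. (G t * cis (- of_int (k - 1) * (t - \<xi>)) - G t * cis (- of_int k * (t - \<xi>))) + h \<xi> * cis (of_int k * \<xi>) * cis (of_int (- k) * t))"
    proof (rule integral_cong)
      fix t assume t: "t \<in> {-pi..pi}"
      have s1: "cis (- of_int (k - 1) * (t - \<xi>)) = cis (t - \<xi>) * cis (- of_int k * (t - \<xi>))"
        by (simp add: cis_mult algebra_simps)
      have s2: "cis (of_int k * \<xi>) * cis (of_int (- k) * t) = cis (- of_int k * (t - \<xi>))"
        by (simp only: shift of_int_minus)
      have eq: "h t = (cis (t - \<xi>) - 1) * G t + h \<xi>" using fact[OF t] by (simp add: algebra_simps)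
      have gen: "h t * e = (G t * (cis (t - \<xi>) * e) - G t * e) + h \<xi> * e" for e
        by (subst eq) (simp add: algebra_simps)
      show "h t * cis (- of_int k * (t - \<xi>)) =
        (G t * cis (- of_int (k - 1) * (t - \<xi>)) - G t * cis (- of_int k * (t - \<xi>))) + h \<xi> * cis (of_int k * \<xi>) * cis (of_int (- k) * t)"
        unfolding s1 mult.assoc s2 by (rule gen)
    qed
    also have "\<dots> = integral {-pi..pi} (\<lambda>t. G t * cis (- of_int (k - 1) * (t - \<xi>)) - G t * cis (- of_int k * (t - \<xi>)))
        + integral {-pi..pi} (\<lambda>t. h \<xi> * cis (of_int k * \<xi>) * cis (of_int (- k) * t))"
      by (intro Henstock_Kurzweil_Integration.integral_add ii continuous_intros contG)
    also have "integral {-pi..pi} (\<lambda>t. G t * cis (- of_int (k - 1) * (t - \<xi>)) - G t * cis (- of_int k * (t - \<xi>))) = c (k - 1) - c k"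
      unfolding c_def by (intro Henstock_Kurzweil_Integration.integral_diff ii continuous_intros contG)
    also have "integral {-pi..pi} (\<lambda>t. h \<xi> * cis (of_int k * \<xi>) * cis (of_int (- k) * t)) = (if k = 0 then 2 * pi * h \<xi> else 0)"
      unfolding integral_mult_right integral_cis_int by simp
    finally show ?thesis .
  qed
  have "(\<Sum>k\<in>{-int K..int K}. integral {-pi..pi} (\<lambda>t. h t * cis (- of_int k * (t - \<xi>)))) = c (- int (Suc K)) - c (int K) + 2 * pi * h \<xi>" for K
  proof (induction K)
    case 0
    show ?case using coeff[of 0] by simp
  next
    case (Suc K)
    have e: "int (Suc K) - 1 = int K" "- int (Suc K) - 1 = - int (Suc (Suc K))" by auto
    have nz: "int (Suc K) \<noteq> 0" "- int (Suc K) \<noteq> 0" by auto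
    show ?case unfolding sum_int_symmetric_Suc Suc.IH unfolding coeff e if_not_P[OF nz(1)] if_not_P[OF nz(2)] by simp
  qed
  moreover have "(\<lambda>K. c (- int (Suc K)) - c (int K) + 2 * pi * h \<xi>) \<longlonglongrightarrow> 0 - 0 + 2 * pi * h \<xi>"
    by (intro tendsto_intros c1 LIMSEQ_Suc[OF c2])
  ultimately show ?thesis by simp
qed

lemma plancherel_const: "((2 * pi) powr (- 1 / 2)) * ((2 * pi) powr (- 1 / 2)) = 1 / (2 * pi)"
proof -
  have "((2 * pi) powr (- 1 / 2)) * ((2 * pi) powr (- 1 / 2)) = (2 * pi) powr (- 1 / 2 + - 1 / 2)"
    by (rule powr_add[symmetric])
  also have "(- 1 / 2 + - 1 / 2 :: real) = - 1" by simp
  also have "(2 * pi) powr (- 1) = 1 / (2 * pi)" by (rule powr_neg_one) simp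
  finally show ?thesis .
qed

text \<open>For integer y and \<open>g\<close> supported in (-pi, pi) this is the y-th Fourier
  coefficient of \<open>g\<close>; real arguments accommodate the phase shift.\<close>

definition fcoef :: "(real \<Rightarrow> complex) \<Rightarrow> real \<Rightarrow> complex" where
  "fcoef g y = of_real ((2 * pi) powr (- 1 / 2)) * FT1 g y"

text \<open>The Fourier series of g(t) exp(-i \<tau> t) at \<xi>, multiplied by exp(i \<tau>
  \<xi>).\<close>

lemma fcoef_series:
  assumes g: "cc g" "\<And>t. 3 \<le> \<bar>t\<bar> \<Longrightarrow> g t = 0" and \<xi>: "\<bar>\<xi>\<bar> \<le> 3"
  shows "(\<lambda>K. \<Sum>k\<in>{-int K..int K}. fcoef g (\<tau> + of_int k) * cis ((\<tau> + of_int k) * \<xi>)) \<longlonglongrightarrow> g \<xi>"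
proof -
  define h where "h t = g t * cis (- \<tau> * t)" for t
  have h: "smooth1 h" unfolding h_def by (intro smooth1_mult smooth1_cis cc_smooth g)
  have e: "fcoef g (\<tau> + of_int k) * cis ((\<tau> + of_int k) * \<xi>) =
     (cis (\<tau> * \<xi>) / (2 * pi)) * integral {-pi..pi} (\<lambda>t. h t * cis (- of_int k * (t - \<xi>)))" for k
  proof -
    have "FT1 g (\<tau> + of_int k) = of_real ((2 * pi) powr (- 1 / 2)) * integral {-pi..pi} (\<lambda>t. cis (- (t * (\<tau> + of_int k))) * g t)"
      by (rule FT1_eq_integral) (use g pi_gt3 in auto)
    then have "fcoef g (\<tau> + of_int k) = 1 / (2 * pi) * integral {-pi..pi} (\<lambda>t. cis (- (t * (\<tau> + of_int k))) * g t)"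
      unfolding fcoef_def by (simp only: mult.assoc[symmetric] of_real_mult[symmetric] plancherel_const)
    moreover have "integral {-pi..pi} (\<lambda>t. h t * cis (- of_int k * (t - \<xi>))) = integral {-pi..pi} (\<lambda>t. cis (of_int k * \<xi>) * (cis (- (t * (\<tau> + of_int k))) * g t))"
    proof (rule integral_cong)
      fix t
      have "cis (- \<tau> * t) * cis (- of_int k * (t - \<xi>)) = cis (of_int k * \<xi>) * cis (- (t * (\<tau> + of_int k)))"
        by (simp add: cis_mult algebra_simps)
      then show "h t * cis (- of_int k * (t - \<xi>)) = cis (of_int k * \<xi>) * (cis (- (t * (\<tau> + of_int k))) * g t)"
        unfolding h_def by (metis (no_types) mult.assoc mult.commute)
    qed
    moreover have "cis ((\<tau> + of_int k) * \<xi>) = cis (\<tau> * \<xi>) * cis (of_int k * \<xi>)"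
      by (simp add: cis_mult distrib_right)
    ultimately show ?thesis unfolding integral_mult_right by (simp only: mult_ac divide_inverse mult_1 of_real_inverse)
  qed
  have "(\<lambda>K. (cis (\<tau> * \<xi>) / (2 * pi)) * (\<Sum>k\<in>{-int K..int K}. integral {-pi..pi} (\<lambda>t. h t * cis (- of_int k * (t - \<xi>)))))
     \<longlonglongrightarrow> (cis (\<tau> * \<xi>) / (2 * pi)) * (2 * pi * h \<xi>)"
    by (intro tendsto_mult_left fourier_series_smooth h \<xi>)
  moreover have "(cis (\<tau> * \<xi>) / (2 * pi)) * (2 * pi * h \<xi>) = g \<xi>"
  proof -
    have "cis (\<tau> * \<xi>) * cis (- \<tau> * \<xi>) = 1" by (simp add: cis_mult)
    then have "cis (\<tau> * \<xi>) * h \<xi> = g \<xi>"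
      unfolding h_def by (metis mult.assoc mult.commute mult_1)
    then show ?thesis by simp
  qed
  ultimately show ?thesis unfolding e sum_distrib_left[symmetric] by (simp only:)
qed

subsection \<open>A sampling formula for band-limited functions\<close>

text \<open>\<open>kappa\<close> is \<open>1\<close> on the support of \<open>chi\<close>, and its support lies inside one period \<open>(-\<pi>, \<pi>)\<close>. Hence the
  Fourier series of \<open>kappa\<close>, with any phase shift \<open>\<tau>\<close>, represents \<open>1\<close> on the support of \<open>chi\<close>.\<close>

definition chi :: "real \<Rightarrow> complex" where "chi = plateau (3/2)"
definition kappa :: "real \<Rightarrow> complex" where "kappa = plateau (5/2)"
definition theta :: "real \<Rightarrow> complex" where "theta = fcoef chi"

lemma chi_1: "\<bar>t\<bar> \<le> 5/4 \<Longrightarrow> chi t = 1" by (simp add: chi_def plateau_1)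
lemma chi_0: "7/4 \<le> \<bar>t\<bar> \<Longrightarrow> chi t = 0" by (simp add: chi_def plateau_0)
lemma cc_chi: "cc chi" by (simp add: chi_def cc_plateau)
lemma kappa_1: "\<bar>t\<bar> \<le> 9/4 \<Longrightarrow> kappa t = 1" by (simp add: kappa_def plateau_1)
lemma kappa_0: "3 \<le> \<bar>t\<bar> \<Longrightarrow> kappa t = 0" by (simp add: kappa_def plateau_0)
lemma cc_kappa: "cc kappa" by (simp add: kappa_def cc_plateau)

lemma schw_fcoef: "cc g \<Longrightarrow> schw (fcoef g)"
  unfolding fcoef_def[abs_def] by (intro schw_cmult schw_FT1)

lemma vdn_fcoef: "cc g \<Longrightarrow> (vd ^^ n) (fcoef g) = fcoef ((mulid ^^ n) g)"
  unfolding fcoef_def[abs_def] by (simp add: vdn_cmult smooth1_FT1 vdn_FT1)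

section \<open>Symmetric partial sums of series with quadratic decay\<close>

definition usq :: "int \<Rightarrow> real" where "usq k = 1 / (1 + \<bar>of_int k\<bar>)\<^sup>2"

text \<open>The sum of \<open>usq\<close> over all k with \<bar>k\<bar> > K; the n-th term collects
  k = K + n + 1 and its negative.\<close>

definition utail :: "nat \<Rightarrow> real" where "utail K = (\<Sum>n. 2 / (2 + real (n + K))\<^sup>2)"

lemma summable_usq: "summable (\<lambda>n. 2 / (2 + real n)\<^sup>2)"
proof -
  have "summable (\<lambda>n. inverse ((real (n + 2))\<^sup>2))"
    by (rule summable_ignore_initial_segment) (rule inverse_power_summable, simp)
  from summable_mult[OF this, of 2] show ?thesis by (simp add: divide_inverse add.commute)
qed

lemma utail_tendsto: "utail \<longlonglongrightarrow> 0"
proof -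
  let ?h = "\<lambda>n. 2 / (2 + real n)\<^sup>2"
  have "utail = (\<lambda>K. suminf ?h - sum ?h {..<K})"
    unfolding utail_def[abs_def] by (intro ext suminf_minus_initial_segment[OF summable_usq])
  moreover have "(\<lambda>K. suminf ?h - sum ?h {..<K}) \<longlonglongrightarrow> suminf ?h - suminf ?h"
    by (intro tendsto_intros summable_LIMSEQ summable_usq)
  ultimately show ?thesis by simp
qed

lemma symmetric_sum_diff_bound:
  fixes f :: "int \<Rightarrow> 'a::real_normed_vector"
  assumes f: "\<And>k. norm (f k) \<le> c * usq k"
  shows "norm ((\<Sum>k\<in>{-int (K + m)..int (K + m)}. f k) - (\<Sum>k\<in>{-int K..int K}. f k)) \<le> c * utail K"
proof -
  have c: "0 \<le> c" using order_trans[OF norm_ge_zero f[of 0]] by (simp add: usq_def)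
  have "norm ((\<Sum>k\<in>{-int (K + m)..int (K + m)}. f k) - (\<Sum>k\<in>{-int K..int K}. f k))
      \<le> (\<Sum>n<m. c * (2 / (2 + real (n + K))\<^sup>2))"
  proof (induction m)
    case (Suc m)
    let ?k = "int (Suc (K + m))"
    have "norm (f ?k + f (- ?k)) \<le> c * usq ?k + c * usq (- ?k)"
      by (rule norm_triangle_le) (intro add_mono f)
    also have "\<dots> = c * (2 / (2 + real (m + K))\<^sup>2)" by (simp add: usq_def add_ac)
    finally have 1: "norm (f ?k + f (- ?k)) \<le> c * (2 / (2 + real (m + K))\<^sup>2)" .
    have "(\<Sum>k\<in>{-int (K + Suc m)..int (K + Suc m)}. f k) - (\<Sum>k\<in>{-int K..int K}. f k) =
      ((\<Sum>k\<in>{-int (K + m)..int (K + m)}. f k) - (\<Sum>k\<in>{-int K..int K}. f k)) + (f ?k + f (- ?k))"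
      unfolding add_Suc_right sum_int_symmetric_Suc by simp
    also have "norm \<dots> \<le> (\<Sum>n<m. c * (2 / (2 + real (n + K))\<^sup>2)) + c * (2 / (2 + real (m + K))\<^sup>2)"
      by (rule norm_triangle_le) (intro add_mono Suc.IH 1)
    finally show ?case by simp
  qed simp
  also have "\<dots> = c * (\<Sum>n<m. 2 / (2 + real (n + K))\<^sup>2)" by (simp add: sum_distrib_left)
  also have "\<dots> \<le> c * utail K" unfolding utail_def
    by (intro mult_left_mono c sum_le_suminf summable_ignore_initial_segment[OF summable_usq]) auto
  finally show ?thesis .
qed

lemma symmetric_sum_limit_bound:
  fixes f :: "int \<Rightarrow> 'a::real_normed_vector"
  assumes f: "\<And>k. norm (f k) \<le> c * usq k" and lim: "(\<lambda>K. \<Sum>k\<in>{-int K..int K}. f k) \<longlonglongrightarrow> s"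
  shows "norm (s - (\<Sum>k\<in>{-int K..int K}. f k)) \<le> c * utail K"
proof (rule Lim_norm_ubound[OF sequentially_bot])
  show "(\<lambda>m. (\<Sum>k\<in>{-int (K + m)..int (K + m)}. f k) - (\<Sum>k\<in>{-int K..int K}. f k)) \<longlonglongrightarrow> s - (\<Sum>k\<in>{-int K..int K}. f k)"
    using LIMSEQ_ignore_initial_segment[OF lim, of K] by (intro tendsto_diff tendsto_const) (simp add: add.commute)
qed (intro always_eventually allI symmetric_sum_diff_bound f)

lemma symmetric_sum_bound:
  fixes f :: "int \<Rightarrow> 'a::real_normed_vector"
  assumes f: "\<And>k. norm (f k) \<le> c * usq k"
  shows "norm (\<Sum>k\<in>{-int K..int K}. f k) \<le> c * (1 + utail 0)"
proof -
  have "norm ((\<Sum>k\<in>{-int K..int K}. f k) - f 0) \<le> c * utail 0"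
    using symmetric_sum_diff_bound[of f c 0 K, OF f] by simp
  moreover have "norm (f 0) \<le> c" using f[of 0] by (simp add: usq_def)
  ultimately show ?thesis
    using norm_triangle_sub[of "\<Sum>k\<in>{-int K..int K}. f k" "f 0"] by (simp add: distrib_left)
qed

lemma one_plus_abs_add: "1 + \<bar>a + b :: real\<bar> \<le> (1 + \<bar>a\<bar>) * (1 + \<bar>b\<bar>)"
proof -
  have "1 + \<bar>a + b\<bar> \<le> 1 + \<bar>a\<bar> + \<bar>b\<bar> + \<bar>a\<bar> * \<bar>b\<bar>"
    using abs_triangle_ineq[of a b] mult_nonneg_nonneg[OF abs_ge_zero[of a] abs_ge_zero[of b]] by linarith
  then show ?thesis by (simp add: algebra_simps)
qed

lemma usq_shift:
  assumes "0 \<le> \<tau>" "\<tau> \<le> 1"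
  shows "1 / (1 + \<bar>\<tau> + of_int k\<bar>)\<^sup>2 \<le> 4 * usq k"
proof -
  have "1 + \<bar>real_of_int k\<bar> = 1 + \<bar>(\<tau> + of_int k) + (- \<tau>)\<bar>" by simp
  also have "\<dots> \<le> (1 + \<bar>\<tau> + of_int k\<bar>) * (1 + \<bar>- \<tau>\<bar>)" by (rule one_plus_abs_add)
  also have "\<dots> \<le> (1 + \<bar>\<tau> + of_int k\<bar>) * 2" using assms by (intro mult_left_mono) auto
  finally have "(1 + \<bar>real_of_int k\<bar>)\<^sup>2 \<le> ((1 + \<bar>\<tau> + of_int k\<bar>) * 2)\<^sup>2" by (intro power_mono) auto
  also have "\<dots> = 4 * (1 + \<bar>\<tau> + of_int k\<bar>)\<^sup>2" unfolding power_mult_distrib by simp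
  finally have "(1 + \<bar>real_of_int k\<bar>)\<^sup>2 \<le> 4 * (1 + \<bar>\<tau> + of_int k\<bar>)\<^sup>2" .
  moreover have "0 < (1 + \<bar>\<tau> + of_int k\<bar>)\<^sup>2" "0 < (1 + \<bar>real_of_int k\<bar>)\<^sup>2" by (simp_all add: add_pos_nonneg)
  ultimately show ?thesis by (simp add: usq_def divide_simps mult.commute)
qed

lemma fcoef_decay:
  assumes "cc g"
  shows "\<exists>B>0. \<forall>y. norm (fcoef g y) \<le> B / (1 + \<bar>y\<bar>) ^ N"
proof -
  obtain B where B: "0 < B" "\<And>t. (1 + \<bar>t\<bar>) ^ N * norm ((vd ^^ 0) (fcoef g) t) \<le> B"
    by (rule schw_bound[OF schw_fcoef[OF assms], of N 0]) blast
  have "norm (fcoef g y) \<le> B / (1 + \<bar>y\<bar>) ^ N" for y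
    using B(2)[of y] by (simp add: pos_le_divide_eq mult.commute add_pos_nonneg)
  with B(1) show ?thesis by blast
qed

lemma fcoef_usq:
  assumes g: "cc g"
  shows "\<exists>B>0. \<forall>\<tau> k. 0 \<le> \<tau> \<longrightarrow> \<tau> \<le> 1 \<longrightarrow> norm (fcoef g (\<tau> + of_int k)) \<le> B * usq k"
proof -
  obtain B where B: "0 < B" "\<And>y. norm (fcoef g y) \<le> B / (1 + \<bar>y\<bar>) ^ 2" using fcoef_decay[OF g, of 2] by blast
  have "norm (fcoef g (\<tau> + of_int k)) \<le> (4 * B) * usq k" if "0 \<le> \<tau>" "\<tau> \<le> 1" for \<tau> k
  proof -
    have "norm (fcoef g (\<tau> + of_int k)) \<le> B * (1 / (1 + \<bar>\<tau> + of_int k\<bar>) ^ 2)" using B(2)[of "\<tau> + of_int k"] by simp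
    also have "\<dots> \<le> B * (4 * usq k)" using B by (intro mult_left_mono usq_shift that) auto
    finally show ?thesis by simp
  qed
  then show ?thesis using B(1) by (intro exI[of _ "4 * B"]) auto
qed

lemma sampling_tendsto:
  assumes g: "cc g" and supp: "\<And>t. 9/4 < \<bar>t\<bar> \<Longrightarrow> g t = 0" and \<tau>: "0 \<le> \<tau>" "\<tau> \<le> 1"
  shows "(\<lambda>K. \<Sum>k\<in>{-int K..int K}. fcoef kappa (\<tau> + of_int k) * fcoef g (y - (\<tau> + of_int k))) \<longlonglongrightarrow> fcoef g y"
proof -
  define P where "P K t = (\<Sum>k\<in>{-int K..int K}. fcoef kappa (\<tau> + of_int k) * cis ((\<tau> + of_int k) * t))" for K t
  obtain B where B: "0 < B" "\<And>k. norm (fcoef kappa (\<tau> + of_int k)) \<le> B * usq k" using fcoef_usq[OF cc_kappa] \<tau> by blast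
  have P_bound: "norm (P K t) \<le> B * (1 + utail 0)" for K t
    unfolding P_def by (rule symmetric_sum_bound) (use B in \<open>simp add: norm_mult\<close>)
  have P_lim: "(\<lambda>K. P K t * g t) \<longlonglongrightarrow> g t" for t
  proof (cases "9/4 < \<bar>t\<bar>")
    case False
    have "(\<lambda>K. P K t) \<longlonglongrightarrow> kappa t" unfolding P_def
      by (rule fcoef_series[OF cc_kappa]) (use False in \<open>auto simp: kappa_0\<close>)
    then show ?thesis using tendsto_mult_right[of _ 1 _ "g t"] False by (simp add: kappa_1)
  qed (simp add: supp)
  have "(\<lambda>K. LINT t|lborel. cis (- (t * y)) * (P K t * g t)) \<longlonglongrightarrow> (LINT t|lborel. cis (- (t * y)) * g t)"
  proof (rule integral_dominated_convergence[where w="\<lambda>t. B * (1 + utail 0) * norm (g t)"])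
    have "integrable lborel g" using cc_integrable[OF g, of "\<lambda>_. 1"] by simp
    then show "integrable lborel (\<lambda>t. B * (1 + utail 0) * norm (g t))" by (intro integrable_mult_right integrable_norm)
    have [measurable]: "g \<in> borel_measurable lborel" using \<open>integrable lborel g\<close> by simp
    show "(\<lambda>t. cis (- (t * y)) * g t) \<in> borel_measurable lborel" using FT1_integrable[OF g] by simp
    have "continuous_on UNIV (\<lambda>t. cis (- (t * y)) * P K t)" for K unfolding P_def by (intro continuous_intros)
    from borel_measurable_continuous_onI[OF this]
    have [measurable]: "(\<lambda>t. cis (- (t * y)) * P K t) \<in> borel_measurable lborel" for K by simp
    have "(\<lambda>t. (cis (- (t * y)) * P K t) * g t) \<in> borel_measurable lborel" for K by measurable
    then show "(\<lambda>t. cis (- (t * y)) * (P K t * g t)) \<in> borel_measurable lborel" for K by (simp add: mult.assoc)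
    show "AE t in lborel. (\<lambda>K. cis (- (t * y)) * (P K t * g t)) \<longlonglongrightarrow> cis (- (t * y)) * g t"
      by (intro always_eventually allI tendsto_mult_left P_lim)
    show "AE t in lborel. norm (cis (- (t * y)) * (P K t * g t)) \<le> B * (1 + utail 0) * norm (g t)" for K
      by (intro always_eventually allI) (simp add: norm_mult mult_right_mono P_bound)
  qed
  then have "(\<lambda>K. FT1 (\<lambda>t. P K t * g t) y) \<longlonglongrightarrow> FT1 g y" unfolding FT1_def by (rule tendsto_mult_left)
  moreover have "FT1 (\<lambda>t. P K t * g t) y = (\<Sum>k\<in>{-int K..int K}. fcoef kappa (\<tau> + of_int k) * FT1 g (y - (\<tau> + of_int k)))" for K
  proof -
    have "FT1 (\<lambda>t. P K t * g t) y = FT1 (\<lambda>t. \<Sum>k\<in>{-int K..int K}. fcoef kappa (\<tau> + of_int k) * (cis ((\<tau> + of_int k) * t) * g t)) y"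
      by (simp add: P_def sum_distrib_right mult.assoc)
    also have "\<dots> = (\<Sum>k\<in>{-int K..int K}. FT1 (\<lambda>t. fcoef kappa (\<tau> + of_int k) * (cis ((\<tau> + of_int k) * t) * g t)) y)"
      by (intro FT1_sum[THEN conjunct1] cc_cmult cc_mult2 g smooth1_cis) simp
    also have "\<dots> = (\<Sum>k\<in>{-int K..int K}. fcoef kappa (\<tau> + of_int k) * FT1 g (y - (\<tau> + of_int k)))"
      by (simp add: FT1_cmult FT1_cis)
    finally show ?thesis .
  qed
  ultimately have "(\<lambda>K. \<Sum>k\<in>{-int K..int K}. fcoef kappa (\<tau> + of_int k) * FT1 g (y - (\<tau> + of_int k))) \<longlonglongrightarrow> FT1 g y" by simp
  from tendsto_mult_left[OF this, of "of_real ((2 * pi) powr (- 1 / 2))"]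
  show ?thesis by (simp add: fcoef_def[of g] sum_distrib_left mult.left_commute)
qed

section \<open>Convergence of the sampling series in the Schwartz seminorms\<close>

lemma smooth1_vdn_sum:
  "finite I \<Longrightarrow> (\<And>i. i \<in> I \<Longrightarrow> smooth1 (f i)) \<Longrightarrow>
    smooth1 (\<lambda>t. \<Sum>i\<in>I. f i t) \<and> (vd ^^ n) (\<lambda>t. \<Sum>i\<in>I. f i t) = (\<lambda>t. \<Sum>i\<in>I. (vd ^^ n) (f i) t)"
proof (induction I rule: finite_induct)
  case empty
  have "(vd ^^ n) (\<lambda>t. 0) = (\<lambda>t. 0)" by (intro ext vdn_zero_on_open[of UNIV]) auto
  then show ?case by (simp add: smooth1_const)
next
  case (insert i I)
  then show ?case by (simp add: smooth1_add vdn_add)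
qed

lemma vdn_diff:
  assumes "smooth1 f" "smooth1 g"
  shows "(vd ^^ n) (\<lambda>t. f t - g t) = (\<lambda>t. (vd ^^ n) f t - (vd ^^ n) g t)"
  using vdn_add[OF assms(1) smooth1_cmult[OF assms(2), of "-1"], of n] by (simp add: vdn_cmult[OF assms(2), of n "-1", simplified] vdn_cmult[OF assms(2)])

definition sampling_error :: "real \<Rightarrow> nat \<Rightarrow> real \<Rightarrow> complex" where
  "sampling_error \<tau> K y = theta y - (\<Sum>k\<in>{-int K..int K}. fcoef kappa (\<tau> + of_int k) * theta (y - (\<tau> + of_int k)))"

lemma schw_theta: "schw theta" by (simp add: theta_def schw_fcoef cc_chi)

text \<open>A tempered distribution may be applied term by term only if the series converges in the
  seminorms. The derivatives have the same sampling formula, and the weight (1 + \<bar>y\<bar>)^N is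
  split between the translate of \<open>theta\<close> and the coefficient.\<close>

lemma sampling_error_sbound:
  assumes \<tau>: "0 \<le> \<tau>" "\<tau> \<le> 1"
  shows "\<exists>c. \<forall>K. sbound N (c * utail K) (sampling_error \<tau> K)"
proof -
  obtain A where A: "0 < A" "sbound N A theta" by (rule schw_sbound[OF schw_theta])
  \<comment> \<open>Decay of order N pays for the share of the weight that falls on the shift, two
    further orders for the summation over k.\<close>
  obtain B where B: "0 < B" "\<And>y. norm (fcoef kappa y) \<le> B / (1 + \<bar>y\<bar>) ^ (N + 2)" using fcoef_decay[OF cc_kappa, of "N+2"] by blast
  note sm = schw_smooth[OF schw_theta]
  have sm_shift: "smooth1 (\<lambda>y. theta (y - b))" for b using smooth1_affine[OF sm, of 1 "-b"] by simp
  have vd_shift: "(vd ^^ n) (\<lambda>y. theta (y - b)) = (\<lambda>y. (vd ^^ n) theta (y - b))" for b n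
    using vdn_affine[OF sm, of n 1 "-b"] by simp
  have "sbound N (4 * A * B * utail K) (sampling_error \<tau> K)" for K
    unfolding sbound_def
  proof (intro allI impI)
    fix n y assume n: "n \<le> N"
    define f where "f k = fcoef kappa (\<tau> + of_int k) * (vd ^^ n) theta (y - (\<tau> + of_int k))" for k :: int
    have "(vd ^^ n) (sampling_error \<tau> K) = (vd ^^ n) (\<lambda>y. theta y - (\<Sum>k\<in>{-int K..int K}. fcoef kappa (\<tau> + of_int k) * theta (y - (\<tau> + of_int k))))"
      by (simp add: sampling_error_def[abs_def])
    also have "\<dots> = (\<lambda>y. (vd ^^ n) theta y - (\<Sum>k\<in>{-int K..int K}. fcoef kappa (\<tau> + of_int k) * (vd ^^ n) theta (y - (\<tau> + of_int k))))"
    proof -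
      have s: "smooth1 (\<lambda>y. fcoef kappa (\<tau> + of_int k) * theta (y - (\<tau> + of_int k)))" for k
        by (intro smooth1_cmult sm_shift)
      have "smooth1 (\<lambda>y. \<Sum>k\<in>{-int K..int K}. fcoef kappa (\<tau> + of_int k) * theta (y - (\<tau> + of_int k)))"
        by (rule smooth1_vdn_sum[THEN conjunct1]) (auto intro: s)
      moreover have "(vd ^^ n) (\<lambda>y. \<Sum>k\<in>{-int K..int K}. fcoef kappa (\<tau> + of_int k) * theta (y - (\<tau> + of_int k)))
         = (\<lambda>y. \<Sum>k\<in>{-int K..int K}. (vd ^^ n) (\<lambda>y. fcoef kappa (\<tau> + of_int k) * theta (y - (\<tau> + of_int k))) y)"
        by (rule smooth1_vdn_sum[THEN conjunct2]) (auto intro: s)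
      ultimately show ?thesis by (simp add: vdn_diff vdn_cmult sm sm_shift vd_shift)
    qed
    finally have e: "(vd ^^ n) (sampling_error \<tau> K) y = (vd ^^ n) theta y - (\<Sum>k\<in>{-int K..int K}. f k)"
      by (simp add: f_def)
    have lim: "(\<lambda>K. \<Sum>k\<in>{-int K..int K}. f k) \<longlonglongrightarrow> (vd ^^ n) theta y"
      unfolding f_def theta_def vdn_fcoef[OF cc_chi]
      by (rule sampling_tendsto[OF cc_mulidn[OF cc_chi] _ \<tau>]) (auto intro!: mulidn_0 chi_0)
    have "norm (f k) \<le> (4 * A * B / (1 + \<bar>y\<bar>) ^ N) * usq k" for k
    proof -
      let ?s = "\<tau> + of_int k"
      have pos: "0 < (1 + \<bar>y - ?s\<bar>) ^ N" "0 < (1 + \<bar>y\<bar>) ^ N" "0 < (1 + \<bar>?s\<bar>) ^ N" "0 < (1 + \<bar>?s\<bar>) ^ 2" by (simp_all add: add_pos_nonneg)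
      have "(1 + \<bar>y\<bar>) ^ N \<le> ((1 + \<bar>y - ?s\<bar>) * (1 + \<bar>?s\<bar>)) ^ N"
        using one_plus_abs_add[of "y - ?s" ?s] by (intro power_mono) auto
      then have p: "(1 + \<bar>y\<bar>) ^ N \<le> (1 + \<bar>y - ?s\<bar>) ^ N * (1 + \<bar>?s\<bar>) ^ N" by (simp add: power_mult_distrib)
      have t: "norm ((vd ^^ n) theta (y - ?s)) \<le> A / (1 + \<bar>y - ?s\<bar>) ^ N"
        using A n pos by (simp add: sbound_def pos_le_divide_eq mult.commute)
      have "norm (f k) \<le> (B / (1 + \<bar>?s\<bar>) ^ (N + 2)) * (A / (1 + \<bar>y - ?s\<bar>) ^ N)"
        unfolding f_def norm_mult using A B by (intro mult_mono t B) auto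
      also have "\<dots> = (A * B) * (1 / ((1 + \<bar>y - ?s\<bar>) ^ N * (1 + \<bar>?s\<bar>) ^ N)) * (1 / (1 + \<bar>?s\<bar>) ^ 2)"
        unfolding power_add divide_inverse inverse_mult_distrib by (simp only: mult_ac mult_1)
      also have "\<dots> \<le> (A * B) * (1 / (1 + \<bar>y\<bar>) ^ N) * (4 * usq k)"
        using A B p pos by (intro mult_mono mult_left_mono divide_left_mono usq_shift \<tau>) auto
      finally show ?thesis by (simp add: mult_ac)
    qed
    from symmetric_sum_limit_bound[of f, OF this lim, of K]
    have "(1 + \<bar>y\<bar>) ^ N * norm ((vd ^^ n) theta y - (\<Sum>k\<in>{-int K..int K}. f k))
      \<le> (1 + \<bar>y\<bar>) ^ N * (4 * A * B / (1 + \<bar>y\<bar>) ^ N * utail K)" by (intro mult_left_mono) auto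
    also have "\<dots> = 4 * A * B * utail K"
    proof -
      have "(1 + \<bar>y\<bar>) ^ N \<noteq> 0" by (simp add: add_nonneg_eq_0_iff)
      then show ?thesis by simp
    qed
    finally show "(1 + \<bar>y\<bar>) ^ N * norm ((vd ^^ n) (sampling_error \<tau> K) y) \<le> 4 * A * B * utail K"
      unfolding e .
  qed
  then show ?thesis by blast
qed

section \<open>Integrability and total mass of \<open>theta\<close>\<close>

lemma theta_integrable: "integrable lborel theta"
proof -
  obtain B where B: "0 < B" "\<And>y. norm (theta y) \<le> B / (1 + \<bar>y\<bar>) ^ 2"
    using fcoef_decay[OF cc_chi, of 2] unfolding theta_def by blast
  have i: "integrable lborel (\<lambda>x::real. B * inverse (1 + x^2))"
    using integrable_inverse_1_plus_square by (simp add: set_integrable_def)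
  have "norm (theta y) \<le> norm (B * inverse (1 + y^2))" for y
  proof -
    have "norm (theta y) \<le> B * inverse ((1 + \<bar>y\<bar>) ^ 2)" using B(2)[of y] by (simp add: divide_inverse)
    also have "\<dots> \<le> B * inverse (1 + y^2)"
      using B by (intro mult_left_mono le_imp_inverse_le) (auto simp: power2_eq_square algebra_simps add_pos_nonneg)
    finally show ?thesis using B by simp
  qed
  moreover have "theta \<in> borel_measurable lborel"
    using smooth1_continuous0[OF schw_smooth[OF schw_theta], of UNIV] borel_measurable_continuous_onI by simp
  ultimately show ?thesis by (intro Bochner_Integration.integrable_bound[OF i]) auto
qed

text \<open>Instead of Fourier inversion: the periodisation of \<open>theta\<close> at t is the
  series for \<open>chi\<close> at 0 with phase shift t, hence equal to \<open>chi 0 = 1\<close>.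
  Its integral over [0, 1) is the integral of \<open>theta\<close> over the line.\<close>

lemma theta_mass: "(LINT t|lborel. theta t) = 1"
proof -
  note cont = smooth1_continuous0[OF schw_smooth[OF schw_theta]]
  have m [measurable]: "theta \<in> borel_measurable borel" by (rule borel_measurable_continuous_onI[OF cont])
  have "(\<lambda>K. LINT t|lborel. indicator {- real K..<real K + 1} t *\<^sub>R theta t) \<longlonglongrightarrow> (LINT t|lborel. theta t)"
  proof (rule integral_dominated_convergence[where w="\<lambda>t. norm (theta t)"])
    show "AE t in lborel. (\<lambda>K. indicator {- real K..<real K + 1} t *\<^sub>R theta t) \<longlonglongrightarrow> theta t"
    proof (intro always_eventually allI)
      fix t :: real
      obtain K0 :: nat where K0: "\<bar>t\<bar> \<le> real K0" using real_arch_simple by blast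
      have "\<forall>\<^sub>F K in sequentially. theta t = indicator {- real K..<real K + 1} t *\<^sub>R theta t"
        using eventually_ge_at_top[of K0] by eventually_elim (use K0 in \<open>auto simp: indicator_def\<close>)
      then show "(\<lambda>K. indicator {- real K..<real K + 1} t *\<^sub>R theta t) \<longlonglongrightarrow> theta t"
        by (rule Lim_transform_eventually[OF tendsto_const])
    qed
  qed (use theta_integrable in \<open>auto simp: indicator_def\<close>)
  moreover have "(LINT t|lborel. indicator {- real K..<real K + 1} t *\<^sub>R theta t) =
     (LINT t|lborel. indicator {0..<1} t *\<^sub>R (\<Sum>k\<in>{-int K..int K}. theta (t + of_int k)))" for K
  proof -
    have int: "integrable lborel (\<lambda>t. indicator A t *\<^sub>R theta (t + b))" if [measurable]: "A \<in> sets borel" for A b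
    proof -
      have "integrable lborel (\<lambda>t. theta (b + 1 * t))"
        by (rule lborel_integrable_real_affine[OF theta_integrable]) simp
      then show ?thesis by (intro integrable_real_mult_indicator integrable_mult_indicator) (auto simp: add.commute)
    qed
    have "(LINT t|lborel. indicator {0..<1} t *\<^sub>R (\<Sum>k\<in>{-int K..int K}. theta (t + of_int k)))
       = (\<Sum>k\<in>{-int K..int K}. LINT t|lborel. indicator {0..<1} t *\<^sub>R theta (t + of_int k))"
      unfolding scaleR_sum_right by (rule Bochner_Integration.integral_sum) (intro int, simp)
    also have "\<dots> = (\<Sum>k\<in>{-int K..int K}. LINT t|lborel. indicator {of_int k..<of_int k + 1} t *\<^sub>R theta t)"
    proof (rule sum.cong[OF refl])
      fix k :: int
      have "(LINT t|lborel. indicator {of_int k..<of_int k + 1} t *\<^sub>R theta t)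
         = \<bar>1\<bar> *\<^sub>R (LINT t|lborel. indicator {of_int k..<of_int k + 1} (of_int k + 1 * t) *\<^sub>R theta (of_int k + 1 * t))"
        by (rule lborel_integral_real_affine) simp
      also have "\<dots> = (LINT t|lborel. indicator {0..<1} t *\<^sub>R theta (t + of_int k))"
        by (simp add: indicator_def add.commute)
      finally show "(LINT t|lborel. indicator {0..<1} t *\<^sub>R theta (t + of_int k)) = (LINT t|lborel. indicator {of_int k..<of_int k + 1} t *\<^sub>R theta t)" ..
    qed
    also have "\<dots> = (LINT t|lborel. (\<Sum>k\<in>{-int K..int K}. indicator {of_int k..<of_int k + 1} t *\<^sub>R theta t))"
      using int[of _ 0] by (intro Bochner_Integration.integral_sum[symmetric]) simp
    also have "\<dots> = (LINT t|lborel. indicator {- real K..<real K + 1} t *\<^sub>R theta t)"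
    proof (rule Bochner_Integration.integral_cong[OF refl])
      fix t :: real
      have "(\<Sum>k\<in>{-int K..int K}. indicator {of_int k..<of_int k + 1} t :: real) = indicator {- real K..<real K + 1} t"
      proof -
        have "(\<Sum>k\<in>{-int K..int K}. indicator {of_int k..<of_int k + 1} t :: real) = (\<Sum>k\<in>{-int K..int K}. if k = \<lfloor>t\<rfloor> then 1 else 0)"
        proof (intro sum.cong refl)
          fix k :: int
          have "of_int k \<le> t \<and> t < of_int k + 1 \<longleftrightarrow> k = \<lfloor>t\<rfloor>" by linarith
          then show "indicator {of_int k..<of_int k + 1} t = (if k = \<lfloor>t\<rfloor> then 1 else 0 :: real)" by (simp add: indicator_def)
        qed
        also have "\<dots> = (if \<lfloor>t\<rfloor> \<in> {-int K..int K} then 1 else 0)" by (simp add: sum.delta)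
        also have "\<lfloor>t\<rfloor> \<in> {-int K..int K} \<longleftrightarrow> t \<in> {- real K..<real K + 1}" by (auto simp: le_floor_iff floor_le_iff)
        finally show ?thesis by (simp add: indicator_def)
      qed
      then show "(\<Sum>k\<in>{-int K..int K}. indicator {of_int k..<of_int k + 1} t *\<^sub>R theta t) = indicator {- real K..<real K + 1} t *\<^sub>R theta t"
        by (simp flip: scaleR_sum_left)
    qed
    finally show ?thesis by simp
  qed
  moreover have "(\<lambda>K. LINT t|lborel. indicator {0..<1} t *\<^sub>R (\<Sum>k\<in>{-int K..int K}. theta (t + of_int k))) \<longlonglongrightarrow> (LINT t|lborel. indicator {0..<1} (t::real) *\<^sub>R 1)"
  proof -
    obtain B where B: "0 < B" "\<And>\<tau> k. 0 \<le> \<tau> \<Longrightarrow> \<tau> \<le> 1 \<Longrightarrow> norm (theta (\<tau> + of_int k)) \<le> B * usq k"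
      using fcoef_usq[OF cc_chi] unfolding theta_def by blast
    show ?thesis
    proof (rule integral_dominated_convergence[where w="\<lambda>t. indicator {0..<1} t *\<^sub>R (B * (1 + utail 0))"])
      show "AE t in lborel. (\<lambda>K. indicator {0..<1} t *\<^sub>R (\<Sum>k\<in>{-int K..int K}. theta (t + of_int k))) \<longlonglongrightarrow> indicator {0..<1} t *\<^sub>R 1"
      proof (intro always_eventually allI tendsto_scaleR tendsto_const)
        fix t
        show "(\<lambda>K. \<Sum>k\<in>{-int K..int K}. theta (t + of_int k)) \<longlonglongrightarrow> 1"
          using fcoef_series[OF cc_chi, of 0 t] by (simp add: chi_0 chi_1 theta_def)
      qed
      show "AE t in lborel. norm (indicator {0..<1} t *\<^sub>R (\<Sum>k\<in>{-int K..int K}. theta (t + of_int k))) \<le> indicator {0..<1} t *\<^sub>R (B * (1 + utail 0))" for K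
      proof (intro always_eventually allI)
        fix t :: real
        show "norm (indicator {0..<1} t *\<^sub>R (\<Sum>k\<in>{-int K..int K}. theta (t + of_int k))) \<le> indicator {0..<1} t *\<^sub>R (B * (1 + utail 0))"
          using symmetric_sum_bound[of "\<lambda>k. theta (t + of_int k)" B K] B(2)[of t] by (auto simp: indicator_def)
      qed
    qed auto
  qed
  ultimately have "(LINT t|lborel. theta t) = (LINT t|lborel. indicator {0..<1} (t::real) *\<^sub>R (1::complex))"
    using LIMSEQ_unique by auto
  then show ?thesis by simp
qed

subsection \<open>Tensor products\<close>

definition tens :: "('n \<Rightarrow> real \<Rightarrow> complex) \<Rightarrow> real ^ 'n::finite \<Rightarrow> complex" where
  "tens G x = (\<Prod>j\<in>UNIV. G j (x $ j))"

text \<open>Isolates one factor. Arguments on tensor products alter one coordinate at a time, by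
  function update.\<close>

lemma tens_upd: "tens (G(i := u)) x = u (x $ i) * (\<Prod>j\<in>UNIV - {i}. G j (x $ j))"
  unfolding tens_def by (subst prod.remove[of UNIV i]) (auto intro!: prod.cong)

lemma tens_deriv:
  assumes "\<And>j. smooth1 (G j)"
  shows "(tens G has_derivative (\<lambda>h. \<Sum>i\<in>UNIV. (h $ i) *\<^sub>R tens (G(i := vd (G i))) x)) (at x)"
proof -
  have "((\<lambda>x. \<Prod>i\<in>UNIV. G i (x $ i)) has_derivative
     (\<lambda>h. \<Sum>i\<in>UNIV. ((h $ i) *\<^sub>R vd (G i) (x $ i)) * (\<Prod>j\<in>UNIV - {i}. G j (x $ j)))) (at x)"
  proof (rule has_derivative_prod)
    fix i :: 'a
    have 1: "((\<lambda>x. x $ i) has_derivative (\<lambda>h. h $ i)) (at x)"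
      by (rule bounded_linear_imp_has_derivative) (rule bounded_linear_vec_nth)
    have "(G i has_derivative (\<lambda>t. t *\<^sub>R vd (G i) (x $ i))) (at (x $ i))"
      using smooth1_deriv0[OF assms] by (simp add: has_vector_derivative_def)
    from has_derivative_compose[OF 1 this]
    show "((\<lambda>x. G i (x $ i)) has_derivative (\<lambda>h. (h $ i) *\<^sub>R vd (G i) (x $ i))) (at x)" .
  qed
  then show ?thesis unfolding tens_upd unfolding tens_def[abs_def] by simp
qed

lemma partial_deriv_tens:
  assumes "\<And>j. smooth1 (G j)"
  shows "partial_deriv i (tens G) = tens (G(i := vd (G i)))"
proof
  fix x
  have "partial_deriv i (tens G) x = (\<Sum>k\<in>UNIV. (axis i 1 $ k) *\<^sub>R tens (G(k := vd (G k))) x)"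
    unfolding partial_deriv_def frechet_derivative_at[OF tens_deriv[OF assms], symmetric] ..
  also have "\<dots> = (\<Sum>k\<in>UNIV. if k = i then tens (G(k := vd (G k))) x else 0)"
    by (intro sum.cong refl) (simp add: axis_def)
  finally show "partial_deriv i (tens G) x = tens (G(i := vd (G i))) x" by (simp add: sum.delta)
qed

text \<open>Derivatives in different coordinates act on different factors, so a list of coordinates
  enters only through its multiplicities.\<close>

lemma partials_tens:
  "(\<And>j. smooth1 (G j)) \<Longrightarrow> partials is (tens G) = tens (\<lambda>j. (vd ^^ count_list is j) (G j))"
proof (induction "is" arbitrary: G)
  case Nil
  then show ?case by (simp add: partials_def)
next
  case (Cons i "is")
  let ?G = "G(i := vd (G i))"
  have "partials (i # is) (tens G) = partials is (tens ?G)"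
    by (simp add: partials_def partial_deriv_tens Cons.prems)
  also have "\<dots> = tens (\<lambda>j. (vd ^^ count_list is j) (?G j))"
    by (rule Cons.IH) (simp add: Cons.prems smooth1_vd)
  also have "(\<lambda>j. (vd ^^ count_list is j) (?G j)) = (\<lambda>j. (vd ^^ count_list (i # is) j) (G j))"
    by (rule ext) (simp add: vdn_Suc[symmetric] del: funpow.simps(2))
  finally show ?case .
qed

lemma smooth_fun_tens: "(\<And>j. smooth1 (G j)) \<Longrightarrow> smooth_fun (tens G)"
  unfolding smooth_fun_def
  by (auto simp: partials_tens intro!: differentiableI tens_deriv smooth1_vdn)

lemma one_plus_sum_le_prod:
  fixes a :: "'a \<Rightarrow> real"
  assumes "finite S" "\<And>i. i \<in> S \<Longrightarrow> 0 \<le> a i"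
  shows "1 + (\<Sum>i\<in>S. a i) \<le> (\<Prod>i\<in>S. 1 + a i)"
  using assms
proof (induction S rule: finite_induct)
  case (insert i S)
  have s: "0 \<le> (\<Sum>i\<in>S. a i)" using insert.prems by (intro sum_nonneg) auto
  have ih: "1 + (\<Sum>i\<in>S. a i) \<le> (\<Prod>i\<in>S. 1 + a i)" using insert by auto
  have ai: "0 \<le> a i" using insert.prems by auto
  have "1 + (a i + (\<Sum>i\<in>S. a i)) \<le> (1 + a i) * (1 + (\<Sum>i\<in>S. a i))"
    using mult_nonneg_nonneg[OF ai s] by (simp add: algebra_simps)
  also have "\<dots> \<le> (1 + a i) * (\<Prod>i\<in>S. 1 + a i)" using ih ai by (intro mult_left_mono) auto
  finally show ?case using insert by simp
qed simp

lemma one_plus_norm_le_prod: "1 + norm (x :: real ^ 'n::finite) \<le> (\<Prod>j\<in>UNIV. 1 + \<bar>x $ j\<bar>)"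
  using norm_le_l1_cart[of x] one_plus_sum_le_prod[of UNIV "\<lambda>j. \<bar>x $ j\<bar>"] by simp

lemma sbound_nonneg: "sbound N B g \<Longrightarrow> 0 \<le> B"
  unfolding sbound_def by (metis le0 mult_nonneg_nonneg norm_ge_zero order_trans zero_le_power abs_ge_zero add_nonneg_nonneg zero_le_one)

text \<open>The weight is distributed over the factors, since 1 + norm x is at most the product of
  the numbers 1 + \<bar>x_j\<bar>.\<close>

lemma partials_tens_bound:
  assumes "\<And>j. smooth1 (G j)" "\<And>j. sbound N (B j) (G j)" "length is \<le> N"
  shows "(1 + norm x) ^ N * norm (partials is (tens G) x) \<le> (\<Prod>j\<in>UNIV. B j)"
proof -
  have "(1 + norm x) ^ N * norm (partials is (tens G) x)
     \<le> (\<Prod>j\<in>UNIV. 1 + \<bar>x $ j\<bar>) ^ N * norm (partials is (tens G) x)"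
    by (intro mult_right_mono power_mono one_plus_norm_le_prod) auto
  also have "\<dots> = (\<Prod>j\<in>UNIV. (1 + \<bar>x $ j\<bar>) ^ N * norm ((vd ^^ count_list is j) (G j) (x $ j)))"
    by (simp add: partials_tens assms tens_def prod_norm[symmetric] prod_power_distrib prod.distrib)
  also have "\<dots> \<le> (\<Prod>j\<in>UNIV. B j)"
  proof (rule prod_mono)
    fix j
    have "count_list is j \<le> N" using count_le_length[of "is" j] assms(3) by simp
    then show "0 \<le> (1 + \<bar>x $ j\<bar>) ^ N * norm ((vd ^^ count_list is j) (G j) (x $ j)) \<and>
      (1 + \<bar>x $ j\<bar>) ^ N * norm ((vd ^^ count_list is j) (G j) (x $ j)) \<le> B j"
      using assms(2)[of j] by (auto simp: sbound_def)
  qed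
  finally show ?thesis .
qed

lemma tens_schwartz:
  assumes "\<And>j. schw (G j)"
  shows "tens G \<in> schwartz_space"
  unfolding schwartz_space_def
proof (intro CollectI conjI allI)
  show "smooth_fun (tens G)" by (intro smooth_fun_tens schw_smooth assms)
  fix N and "is" :: "'a list"
  let ?M = "max N (length is)"
  have "\<forall>j. \<exists>B. sbound ?M B (G j)" using assms by (simp add: schw_def)
  from choice[OF this] obtain B where B: "\<And>j. sbound ?M (B j) (G j)" by blast
  have "norm ((1 + norm x) ^ N * norm (partials is (tens G) x)) \<le> (\<Prod>j\<in>UNIV. B j)" for x
  proof -
    have "norm ((1 + norm x) ^ N * norm (partials is (tens G) x)) = (1 + norm x) ^ N * norm (partials is (tens G) x)"
      by (simp add: abs_mult)
    also have "\<dots> \<le> (1 + norm x) ^ ?M * norm (partials is (tens G) x)"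
      by (intro mult_right_mono power_increasing) auto
    also have "\<dots> \<le> (\<Prod>j\<in>UNIV. B j)" by (rule partials_tens_bound) (auto simp: schw_smooth assms B)
    finally show ?thesis .
  qed
  then show "bounded (range (\<lambda>x. (1 + norm x) ^ N * norm (partials is (tens G) x)))"
    unfolding bounded_iff by blast
qed

lemma schwartz_norm_tens:
  assumes "\<And>j. smooth1 (G j)" "\<And>j. sbound N (B j) (G j)"
  shows "schwartz_norm N (tens G) \<le> (\<Prod>j\<in>UNIV. B j)"
  unfolding schwartz_norm_def
proof (rule cSUP_least)
  show "{is. length is \<le> N} \<times> UNIV \<noteq> {}" by (auto intro: exI[of _ "[]"])
  fix z :: "'a list \<times> (real ^ 'a)" assume "z \<in> {is. length is \<le> N} \<times> UNIV"
  then show "(case z of (is, x) \<Rightarrow> (1 + norm x) ^ N * norm (partials is (tens G) x)) \<le> (\<Prod>j\<in>UNIV. B j)"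
    using partials_tens_bound[OF assms] by auto
qed

lemma tens_supp:
  assumes "\<And>j t. M < \<bar>t\<bar> \<Longrightarrow> G j t = 0"
  shows "closure {x. tens G x \<noteq> 0} \<subseteq> {x. \<forall>j. \<bar>x $ j\<bar> \<le> M}" "compact (closure {x. tens G x \<noteq> 0})"
proof -
  let ?C = "cbox (\<chi> j. - M) (\<chi> j. M) :: (real ^ 'a) set"
  have "\<bar>t\<bar> \<le> M \<longleftrightarrow> - M \<le> t \<and> t \<le> M" for t by linarith
  then have C: "?C = {x. \<forall>j. \<bar>x $ j\<bar> \<le> M}" by (simp add: mem_box_cart set_eq_iff)
  have "{x. tens G x \<noteq> 0} \<subseteq> ?C"
    unfolding C tens_def using assms by (auto simp: not_le[symmetric])
  then have "closure {x. tens G x \<noteq> 0} \<subseteq> ?C" by (intro closure_minimal closed_cbox)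
  then show "closure {x. tens G x \<noteq> 0} \<subseteq> {x. \<forall>j. \<bar>x $ j\<bar> \<le> M}" "compact (closure {x. tens G x \<noteq> 0})"
    unfolding C[symmetric] by (auto intro: bounded_subset compact_imp_bounded[OF compact_cbox] simp: compact_eq_bounded_closed)
qed

lemma cc_uniform_supp:
  fixes G :: "'n::finite \<Rightarrow> real \<Rightarrow> complex"
  assumes "\<And>j. cc (G j)"
  shows "\<exists>M>0. \<forall>j t. M < \<bar>t\<bar> \<longrightarrow> G j t = 0"
proof -
  have "\<exists>M>0. \<forall>t. M < \<bar>t\<bar> \<longrightarrow> G j t = 0" for j
  proof -
    obtain M where "0 < M" "\<And>n t. M < \<bar>t\<bar> \<Longrightarrow> (vd ^^ n) (G j) t = 0" using cc_supp[OF assms[of j]] by blast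
    then show ?thesis by (intro exI[of _ M] conjI allI impI) (metis funpow_0)+
  qed
  then have "\<forall>j. \<exists>M. 0 < M \<and> (\<forall>t. M < \<bar>t\<bar> \<longrightarrow> G j t = 0)" by blast
  from choice[OF this] obtain M where M: "\<And>j. 0 < M j" "\<And>j t. M j < \<bar>t\<bar> \<Longrightarrow> G j t = 0" by blast
  have "M j \<le> (\<Sum>j\<in>UNIV. M j)" for j using M by (intro member_le_sum) (auto intro: less_imp_le)
  then have "G j t = 0" if "(\<Sum>j\<in>UNIV. M j) < \<bar>t\<bar>" for j t
    using M(2)[of j t] that by (meson le_less_trans)
  moreover have "0 < (\<Sum>j\<in>UNIV. M j)" using M by (intro sum_pos) auto
  ultimately show ?thesis by blast
qed

lemma tens_test_function:
  assumes "\<And>j. cc (G j)"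
  shows "tens G \<in> test_functions UNIV"
proof -
  obtain M where "\<forall>j t. M < \<bar>t\<bar> \<longrightarrow> G j t = 0" using cc_uniform_supp[of G, OF assms] by blast
  then have "compact (closure {x. tens G x \<noteq> 0})" by (intro tens_supp(2)[of M]) auto
  then show ?thesis by (simp add: test_functions_def smooth_fun_tens cc_smooth assms)
qed

text \<open>\<open>lborel\<close> is the image of a product measure indexed by \<open>Basis\<close>;
  the basis vectors are reindexed by the coordinates.\<close>

lemma lborel_integral_tens:
  fixes h :: "'n::finite \<Rightarrow> real \<Rightarrow> complex"
  assumes h: "\<And>j. integrable lborel (h j)"
  shows "(LINT x|lborel. tens h x) = (\<Prod>j\<in>UNIV. LINT t|lborel. h j t)"
proof -
  have [measurable]: "h j \<in> borel_measurable borel" for j using h[of j] by simp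
  interpret product_sigma_finite "\<lambda>b::real ^ 'n. lborel :: real measure" by standard
  let ?B = "Basis :: (real ^ 'n) set"
  let ?e = "\<lambda>j::'n. axis j (1::real)"
  have inj: "inj ?e" by (auto simp: inj_def axis_eq_axis)
  have B: "?B = range ?e" by (auto simp: Basis_vec_def)
  have meas: "(\<lambda>x. tens h x) \<in> borel_measurable borel" unfolding tens_def by measurable
  have nth: "(\<Sum>b\<in>?B. f b *\<^sub>R b) $ j = f (?e j)" for f :: "real ^ 'n \<Rightarrow> real" and j
    unfolding B by (subst sum.reindex[OF inj]) (simp add: axis_def if_distrib[of "\<lambda>x. _ * x"] cong: if_cong)
  define h' where "h' b = h (inv ?e b)" for b
  have h'e: "h' (?e j) = h j" for j by (simp add: h'_def inv_f_f[OF inj])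
  have "(LINT x|lborel. tens h x) = (LINT f|(\<Pi>\<^sub>M b\<in>?B. lborel). tens h (\<Sum>b\<in>?B. f b *\<^sub>R b))"
    unfolding lborel_def[where 'a="real ^ 'n"] lborel_eq_real[symmetric]
    by (rule integral_distr[OF _ meas]) measurable
  also have "\<dots> = (LINT f|(\<Pi>\<^sub>M b\<in>?B. lborel). (\<Prod>b\<in>?B. h' b (f b)))"
    unfolding tens_def nth unfolding B prod.reindex[OF inj] by (simp add: h'e)
  also have "\<dots> = (\<Prod>b\<in>?B. LINT t|lborel. h' b t)"
    by (rule product_integral_prod) (auto simp: B h'e h)
  also have "\<dots> = (\<Prod>j\<in>UNIV. LINT t|lborel. h j t)"
    unfolding B prod.reindex[OF inj] by (simp add: h'e)
  finally show ?thesis .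
qed

lemma cis_sum: "finite S \<Longrightarrow> cis (\<Sum>i\<in>S. f i) = (\<Prod>i\<in>S. cis (f i))"
  by (induction S rule: finite_induct) (auto simp: cis_mult[symmetric])

lemma fourier_tens:
  fixes g :: "'n::finite \<Rightarrow> real \<Rightarrow> complex"
  assumes "\<And>j. cc (g j)"
  shows "fourier (tens g) = tens (\<lambda>j. FT1 (g j))"
proof
  fix \<xi> :: "real ^ 'n"
  have "cis (- (x \<bullet> \<xi>)) * tens g x = tens (\<lambda>j t. cis (- (t * \<xi> $ j)) * g j t) x" for x
    by (simp add: tens_def prod.distrib inner_vec_def cis_sum sum_negf[symmetric])
  then have "(LINT x|lborel. cis (- (x \<bullet> \<xi>)) * tens g x) = (\<Prod>j\<in>UNIV. LINT t|lborel. cis (- (t * \<xi> $ j)) * g j t)"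
    by (simp only: lborel_integral_tens FT1_integrable assms)
  moreover have "(2 * pi) powr (- real CARD('n) / 2) = (\<Prod>j\<in>(UNIV::'n set). (2 * pi) powr (- 1 / 2))"
    by (simp add: powr_realpow[symmetric] powr_powr)
  ultimately show "fourier (tens g) \<xi> = tens (\<lambda>j. FT1 (g j)) \<xi>"
    by (simp add: fourier_def FT1_def tens_def prod.distrib)
qed

subsection \<open>Tempered distributions on tensor products\<close>

locale tempered =
  fixes T :: "(real ^ 'n::finite \<Rightarrow> complex) \<Rightarrow> complex"
  assumes tempered: "tempered_distribution T"
begin

lemma T_linear:
  assumes "\<phi> \<in> schwartz_space" "\<psi> \<in> schwartz_space"
  shows "T (\<lambda>x. a * \<phi> x + b * \<psi> x) = a * T \<phi> + b * T \<psi>"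
  using tempered assms unfolding tempered_distribution_def by blast

lemma T_tens_add:
  assumes "\<And>j. schw (G j)" "schw u" "schw v"
  shows "T (tens (G(i := (\<lambda>t. a * u t + b * v t)))) = a * T (tens (G(i := u))) + b * T (tens (G(i := v)))"
proof -
  have "tens (G(i := (\<lambda>t. a * u t + b * v t))) = (\<lambda>x. a * tens (G(i := u)) x + b * tens (G(i := v)) x)"
    by (rule ext) (simp add: tens_upd algebra_simps)
  then show ?thesis using T_linear[of "tens (G(i := u))" "tens (G(i := v))" a b] assms by (simp add: tens_schwartz)
qed

lemma T_tens_cmult:
  assumes "\<And>j. schw (G j)" "schw u"
  shows "T (tens (G(i := (\<lambda>t. a * u t)))) = a * T (tens (G(i := u)))"
  using T_tens_add[of G u u i a 0, OF assms assms(2)] by simp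

lemma T_tens_diff:
  assumes "\<And>j. schw (G j)" "schw u" "schw v"
  shows "T (tens (G(i := (\<lambda>t. u t - v t)))) = T (tens (G(i := u))) - T (tens (G(i := v)))"
  using T_tens_add[of G u v i 1 "-1", OF assms] by simp

lemma T_tens_0: "T (\<lambda>x. 0) = 0"
proof -
  have "schw (\<lambda>t. 0)" by (rule cc_schw, rule ccI[of _ 0]) (auto intro: smooth1_const)
  then have "tens (\<lambda>j t. 0) \<in> schwartz_space" by (intro tens_schwartz)
  from T_linear[OF this this, of 0 0] show ?thesis by simp
qed

lemma T_tens_sum:
  assumes "finite I" "\<And>j. schw (G j)" "\<And>k. schw (u k)"
  shows "T (tens (G(i := (\<lambda>t. \<Sum>k\<in>I. u k t)))) = (\<Sum>k\<in>I. T (tens (G(i := u k)))) \<and> schw (\<lambda>t. \<Sum>k\<in>I. u k t)"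
  using assms(1)
proof (induction I rule: finite_induct)
  case empty
  have "tens (G(i := (\<lambda>t. 0))) = (\<lambda>x. 0)" by (rule ext) (simp add: tens_upd)
  moreover have "schw (\<lambda>t. 0)" by (rule cc_schw, rule ccI[of _ 0]) (auto intro: smooth1_const)
  ultimately show ?case by (simp only: sum.empty T_tens_0)
next
  case (insert k I)
  then have sI: "schw (\<lambda>t. \<Sum>k\<in>I. u k t)" by blast
  have e: "(\<lambda>t. \<Sum>k\<in>insert k I. u k t) = (\<lambda>t. 1 * u k t + 1 * (\<Sum>k\<in>I. u k t))"
    using insert.hyps by simp
  have "T (tens (G(i := (\<lambda>t. \<Sum>k\<in>insert k I. u k t)))) = T (tens (G(i := u k))) + T (tens (G(i := (\<lambda>t. \<Sum>k\<in>I. u k t))))"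
    unfolding e using T_tens_add[of G "u k" "\<lambda>t. \<Sum>k\<in>I. u k t" i 1 1, OF assms(2) assms(3) sI] by (simp only: mult_1)
  also have "T (tens (G(i := (\<lambda>t. \<Sum>k\<in>I. u k t)))) = (\<Sum>k\<in>I. T (tens (G(i := u k))))" using insert.IH by blast
  finally have "T (tens (G(i := (\<lambda>t. \<Sum>k\<in>insert k I. u k t)))) = (\<Sum>k\<in>insert k I. T (tens (G(i := u k))))"
    unfolding sum.insert[OF insert.hyps] .
  moreover have "schw (\<lambda>t. \<Sum>k\<in>insert k I. u k t)" unfolding e using schw_add[OF assms(3) sI] by simp
  ultimately show ?case by blast
qed

text \<open>Continuity at 0 bounds T on a ball of some seminorm, and scaling a single factor moves
  any tensor product into this ball.\<close>

lemma T_tens_bound: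
  "\<exists>N. \<exists>C>0. \<forall>G B. (\<forall>j. schw (G j)) \<longrightarrow> (\<forall>j. sbound N (B j) (G j)) \<longrightarrow> norm (T (tens G)) \<le> C * (\<Prod>j\<in>UNIV. B j)"
proof -
  have z: "schw (\<lambda>t. 0)" by (rule cc_schw, rule ccI[of _ 0]) (auto intro: smooth1_const)
  have t0: "tens (\<lambda>j t. 0) = (\<lambda>x::real ^ 'n. 0)" by (rule ext) (simp add: tens_def)
  have "(\<lambda>x::real ^ 'n. 0) \<in> schwartz_space" using tens_schwartz[of "(\<lambda>j t. 0) :: 'n \<Rightarrow> real \<Rightarrow> complex", OF z] unfolding t0 .
  moreover have "\<forall>\<phi>\<in>schwartz_space. \<forall>\<epsilon>>0. \<exists>N. \<exists>\<delta>>0. \<forall>\<psi>\<in>schwartz_space.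
        schwartz_norm N (\<lambda>x. \<psi> x - \<phi> x) < \<delta> \<longrightarrow> norm (T \<psi> - T \<phi>) < \<epsilon>"
    using tempered unfolding tempered_distribution_def by (rule conjunct2)
  ultimately have "\<forall>\<epsilon>>0. \<exists>N. \<exists>\<delta>>0. \<forall>\<psi>\<in>schwartz_space. schwartz_norm N (\<lambda>x. \<psi> x - 0) < \<delta> \<longrightarrow> norm (T \<psi> - T (\<lambda>x. 0)) < \<epsilon>"
    by (rule bspec[rotated])
  from this[rule_format, OF zero_less_one]
  have "\<exists>N. \<exists>\<delta>>0. \<forall>\<psi>\<in>schwartz_space. schwartz_norm N (\<lambda>x. \<psi> x - 0) < \<delta> \<longrightarrow> norm (T \<psi> - T (\<lambda>x. 0)) < 1" .
  then obtain N \<delta> where \<delta>: "0 < \<delta>" "\<And>\<psi>. \<psi> \<in> schwartz_space \<Longrightarrow> schwartz_norm N (\<lambda>x. \<psi> x - 0) < \<delta> \<Longrightarrow> norm (T \<psi> - T (\<lambda>x. 0)) < 1"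
    by blast
  show ?thesis
  proof (intro exI[of _ N] exI[of _ "2 / \<delta>"] conjI allI impI)
    show "0 < 2 / \<delta>" using \<delta> by simp
    fix G :: "'n \<Rightarrow> real \<Rightarrow> complex" and B
    assume G: "\<forall>j. schw (G j)" and B: "\<forall>j. sbound N (B j) (G j)"
    define P where "P = (\<Prod>j\<in>UNIV. B j)"
    have P: "0 \<le> P" unfolding P_def using B by (intro prod_nonneg) (auto intro: sbound_nonneg)
    have "norm (T (tens G)) \<le> 2 / \<delta> * P + \<epsilon>" if \<epsilon>: "0 < \<epsilon>" for \<epsilon>
    proof -
      obtain i :: 'n where True by blast
      \<comment> \<open>The scaled seminorm a P falls below \<delta>, while 1 / a is the claimed
        bound up to \<epsilon>. The term with \<epsilon> keeps the denominator positive for P =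
        0.\<close>
      define a where "a = \<delta> / (2 * P + \<epsilon> * \<delta>)"
      have den: "0 < 2 * P + \<epsilon> * \<delta>" using P \<epsilon> \<delta> by (simp add: add_nonneg_pos)
      have a: "0 < a" using den \<delta> by (simp add: a_def)
      let ?G = "G(i := (\<lambda>t. of_real a * G i t))"
      let ?B = "B(i := norm (of_real a :: complex) * B i)"
      have "schwartz_norm N (tens ?G) \<le> (\<Prod>j\<in>UNIV. ?B j)"
      proof (rule schwartz_norm_tens)
        show "smooth1 (?G j)" for j using G by (simp add: smooth1_cmult schw_smooth)
        show "sbound N (?B j) (?G j)" for j
          using sbound_cmult[OF schw_smooth, of "G j" N "B j" "of_real a"] G B by (cases "j = i") simp_all
      qed
      also have "\<dots> = a * P" unfolding P_def using a
        by (subst (1 2) prod.remove[of UNIV i]) (auto simp: mult.assoc intro!: prod.cong)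
      also have "\<dots> < \<delta>"
      proof -
        have "\<delta> * P < \<delta> * (2 * P + \<epsilon> * \<delta>)" using P \<epsilon> \<delta> by (intro mult_strict_left_mono) (auto simp: add_nonneg_pos)
        then show ?thesis using den by (simp add: a_def divide_less_eq)
      qed
      finally have "norm (T (tens ?G)) < 1"
        using \<delta>(2)[of "tens ?G"] G by (simp add: T_tens_0 tens_schwartz schw_cmult)
      moreover have "T (tens ?G) = of_real a * T (tens G)"
        using T_tens_cmult[of G "G i" i "of_real a"] G by (simp add: fun_upd_triv)
      ultimately have "a * norm (T (tens G)) < 1" using a by (simp add: norm_mult)
      then have "norm (T (tens G)) < 1 / a" using a by (simp add: field_simps)
      also have "1 / a = 2 / \<delta> * P + \<epsilon>" using \<delta> by (simp add: a_def field_simps)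
      finally show ?thesis by simp
    qed
    then show "norm (T (tens G)) \<le> 2 / \<delta> * (\<Prod>j\<in>UNIV. B j)" unfolding P_def[symmetric] by (rule field_le_epsilon)
  qed
qed

end

section \<open>Dependence of a distribution on test spectra near the support of its Fourier
  transform only\<close>

definition bump_part :: "int \<Rightarrow> real \<Rightarrow> complex" where
  "bump_part k t = sstep (t - of_int k) - sstep (t - of_int (k + 1))"

lemma smooth1_bump_part: "smooth1 (\<lambda>t. bump_part k (t / \<delta>))"
proof -
  have "smooth1 (\<lambda>t. sstep (1/\<delta> * t + - of_int k) + -1 * sstep (1/\<delta> * t + - of_int (k + 1)))"
    by (intro smooth1_add smooth1_cmult smooth1_affine smooth1_sstep)
  moreover have "(\<lambda>t. sstep (1/\<delta> * t + - of_int k) + -1 * sstep (1/\<delta> * t + - of_int (k + 1))) = (\<lambda>t. bump_part k (t / \<delta>))"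
    by (rule ext) (simp add: bump_part_def algebra_simps)
  ultimately show ?thesis by simp
qed

lemma bump_part_0: "bump_part k t \<noteq> 0 \<Longrightarrow> of_int k - 1/4 < t \<and> t < of_int k + 5/4"
proof (rule ccontr)
  assume "bump_part k t \<noteq> 0" "\<not> (of_int k - 1/4 < t \<and> t < of_int k + 5/4)"
  then show False by (auto simp: bump_part_def sstep_0 sstep_1 not_less)
qed

lemma bump_part_sum: "(\<Sum>k\<in>{-int m..<int m}. bump_part k t) = sstep (t + real m) - sstep (t - real m)"
proof (induction m)
  case (Suc m)
  have "{-int (Suc m)..<int (Suc m)} = insert (int m) (insert (- int (Suc m)) {-int m..<int m})" by auto
  then have "(\<Sum>k\<in>{-int (Suc m)..<int (Suc m)}. bump_part k t) = (\<Sum>k\<in>insert (int m) (insert (- int (Suc m)) {-int m..<int m}). bump_part k t)"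
    by simp
  also have "\<dots> = bump_part (int m) t + (bump_part (- int (Suc m)) t + (\<Sum>k\<in>{-int m..<int m}. bump_part k t))"
    by (subst sum.insert; (subst sum.insert)?; simp)
  also have "\<dots> = sstep (t + real (Suc m)) - sstep (t - real (Suc m))"
    unfolding Suc.IH by (simp add: bump_part_def algebra_simps)
  finally show ?case .
qed simp

context tempered begin

text \<open>A partition of unity at a scale given by the Lebesgue number of the covering.\<close>

lemma T_fourier_tens_eq_0:
  assumes supp: "distr_support (fourier_distr T) \<subseteq> {\<xi>. norm \<xi> \<le> R}" and R: "R < R'"
    and g: "\<And>j. cc (g j)" and gi: "\<And>t. \<bar>t\<bar> \<le> R' \<Longrightarrow> g i t = 0"
  shows "T (tens (\<lambda>j. FT1 (g j))) = 0"
proof -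
  define \<V> where "\<V> = {V. open V \<and> (\<forall>\<phi>\<in>test_functions V. fourier_distr T \<phi> = 0)}"
  obtain M where M: "0 < M" "\<And>j t. M < \<bar>t\<bar> \<Longrightarrow> g j t = 0" using cc_uniform_supp[of g, OF g] by blast
  \<comment> \<open>All points where the product is nonzero lie here: the i-th factor vanishes up to
    R', so such points have norm at least R' > R, and open sets on which the transform of T vanishes
    cover them.\<close>
  define K :: "(real ^ 'n) set" where "K = cbox (\<chi> j. - M) (\<chi> j. M) \<inter> {x. R' \<le> \<bar>x $ i\<bar>}"
  have "compact K" unfolding K_def
    by (intro compact_Int_closed compact_cbox closed_Collect_le continuous_intros)
  moreover have "K \<subseteq> \<Union>\<V>"
  proof
    fix x assume "x \<in> K"
    then have "R' \<le> norm x" using component_le_norm_cart[of x i] by (auto simp: K_def)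
    then have "x \<notin> distr_support (fourier_distr T)" using supp R by auto
    then show "x \<in> \<Union>\<V>" by (auto simp: distr_support_def \<V>_def)
  qed
  moreover have "\<And>V. V \<in> \<V> \<Longrightarrow> open V" by (simp add: \<V>_def)
  ultimately have "\<exists>e>0. \<forall>x\<in>K. \<exists>V\<in>\<V>. ball x e \<subseteq> V"
    by (rule Heine_Borel_lemma) auto
  then obtain e where e: "0 < e" "\<And>x. x \<in> K \<Longrightarrow> \<exists>V\<in>\<V>. ball x e \<subseteq> V" by blast
  \<comment> \<open>Two points at which a piece is nonzero differ by at most 2 \<delta> in each
    coordinate, hence by at most e / 2 in norm.\<close>
  define \<delta> where "\<delta> = e / (4 * real CARD('n))"
  have \<delta>: "0 < \<delta>" using e by (simp add: \<delta>_def)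
  define p where "p j k = (\<lambda>t. g j t * bump_part k (t / \<delta>))" for j k
  have p: "cc (p j k)" for j k unfolding p_def by (intro cc_mult g smooth1_bump_part)
  have piece: "T (tens (\<lambda>j. FT1 (p j (\<kappa> j)))) = 0" for \<kappa> :: "'n \<Rightarrow> int"
  proof (cases "\<exists>x. tens (\<lambda>j. p j (\<kappa> j)) x \<noteq> 0")
    case False
    then have "tens (\<lambda>j. p j (\<kappa> j)) = (\<lambda>x. 0)" by auto
    then have "tens (\<lambda>j. FT1 (p j (\<kappa> j))) = (\<lambda>x. 0)"
      using fourier_tens[of "\<lambda>j. p j (\<kappa> j)", OF p] by (simp add: fourier_def[abs_def])
    then show ?thesis by (simp add: T_tens_0)
  next
    case True
    then obtain x where x: "tens (\<lambda>j. p j (\<kappa> j)) x \<noteq> 0" by blast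
    have nz: "g j (y $ j) \<noteq> 0" "bump_part (\<kappa> j) (y $ j / \<delta>) \<noteq> 0" if "tens (\<lambda>j. p j (\<kappa> j)) y \<noteq> 0" for y j
      using that by (auto simp: tens_def p_def)
    have "- M \<le> x $ j \<and> x $ j \<le> M" for j
    proof -
      have "\<not> M < \<bar>x $ j\<bar>" using nz(1)[OF x, of j] M(2)[of "x $ j" j] by blast
      then show ?thesis by linarith
    qed
    moreover have "R' \<le> \<bar>x $ i\<bar>" using nz(1)[OF x, of i] gi[of "x $ i"] by linarith
    ultimately have "x \<in> K" by (simp add: K_def mem_box_cart)
    then obtain V where V: "V \<in> \<V>" "ball x e \<subseteq> V" using e by blast
    have "{y. tens (\<lambda>j. p j (\<kappa> j)) y \<noteq> 0} \<subseteq> cball x (e / 2)"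
    proof
      fix y assume "y \<in> {y. tens (\<lambda>j. p j (\<kappa> j)) y \<noteq> 0}"
      then have y: "tens (\<lambda>j. p j (\<kappa> j)) y \<noteq> 0" by simp
      have "\<bar>(x - y) $ j\<bar> \<le> 2 * \<delta>" for j
      proof -
        have "\<bar>x $ j / \<delta> - y $ j / \<delta>\<bar> \<le> 2"
          using bump_part_0[OF nz(2)[OF x, of j]] bump_part_0[OF nz(2)[OF y, of j]] by (simp add: abs_le_iff)
        then show ?thesis using \<delta> by (simp add: diff_divide_distrib[symmetric] abs_divide pos_divide_le_eq)
      qed
      then have "norm (x - y) \<le> (\<Sum>j\<in>(UNIV::'n set). 2 * \<delta>)"
        by (intro order_trans[OF norm_le_l1_cart] sum_mono)
      also have "\<dots> = e / 2" by (simp add: \<delta>_def)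
      finally show "y \<in> cball x (e / 2)" by (simp add: dist_norm)
    qed
    then have "closure {y. tens (\<lambda>j. p j (\<kappa> j)) y \<noteq> 0} \<subseteq> cball x (e / 2)" by (intro closure_minimal closed_cball)
    also have "\<dots> \<subseteq> ball x e" using e by auto
    also note V(2)
    finally have "tens (\<lambda>j. p j (\<kappa> j)) \<in> test_functions V"
      using tens_test_function[of "\<lambda>j. p j (\<kappa> j)", OF p] by (simp add: test_functions_def)
    then have "fourier_distr T (tens (\<lambda>j. p j (\<kappa> j))) = 0" using V by (simp add: \<V>_def)
    then show ?thesis by (simp add: fourier_distr_def fourier_tens p)
  qed
  \<comment> \<open>The extra unit puts both arguments of \<open>sstep\<close> outside its
    transition zone wherever a factor can be nonzero, so the telescoped sum is 1 there.\<close>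
  obtain m :: nat where m: "M / \<delta> + 1 \<le> real m" using real_arch_simple by blast
  let ?I = "{-int m..<int m}"
  have gsum: "g j = (\<lambda>t. \<Sum>k\<in>?I. p j k t)" for j
  proof
    fix t
    show "g j t = (\<Sum>k\<in>?I. p j k t)"
    proof (cases "M < \<bar>t\<bar>")
      case False
      then have "\<bar>t / \<delta>\<bar> \<le> M / \<delta>" using \<delta> by (simp add: abs_divide divide_right_mono)
      then have t: "\<bar>t / \<delta>\<bar> \<le> real m - 1" using m by linarith
      then have "sstep (t / \<delta> + real m) = 1" "sstep (t / \<delta> - real m) = 0" by (intro sstep_1 sstep_0; linarith)+
      then show ?thesis by (simp add: p_def sum_distrib_left[symmetric] bump_part_sum)
    qed (simp add: M p_def)
  qed
  have FTsum: "FT1 (g j) = (\<lambda>y. \<Sum>k\<in>?I. FT1 (p j k) y)" for j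
    by (rule ext, subst gsum, rule FT1_sum[THEN conjunct1]) (auto intro: p)
  \<comment> \<open>The factors are reassembled one coordinate at a time. The statement is for all
    \<kappa> because each step sums over one entry of \<kappa>.\<close>
  have "\<forall>\<kappa>. T (tens (\<lambda>j. if j \<in> J then FT1 (g j) else FT1 (p j (\<kappa> j)))) = 0" if "finite J" for J
    using that
  proof (induction J rule: finite_induct)
    case empty
    then show ?case by (simp add: piece)
  next
    case (insert i J)
    show ?case
    proof
      fix \<kappa>
      let ?G = "\<lambda>\<kappa> j. if j \<in> J then FT1 (g j) else FT1 (p j (\<kappa> j))"
      have G: "schw (?G \<kappa> j)" for \<kappa> j by (simp add: schw_FT1 g p)
      have "(\<lambda>j. if j \<in> insert i J then FT1 (g j) else FT1 (p j (\<kappa> j))) = (?G \<kappa>)(i := (\<lambda>y. \<Sum>k\<in>?I. FT1 (p i k) y))"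
        by (auto simp: fun_eq_iff FTsum)
      then have "T (tens (\<lambda>j. if j \<in> insert i J then FT1 (g j) else FT1 (p j (\<kappa> j)))) = (\<Sum>k\<in>?I. T (tens ((?G \<kappa>)(i := FT1 (p i k)))))"
        using T_tens_sum[of ?I "?G \<kappa>" "\<lambda>k. FT1 (p i k)" i] G by (simp add: schw_FT1 p)
      also have "\<dots> = (\<Sum>k\<in>?I. T (tens (?G (\<kappa>(i := k)))))"
      proof (rule sum.cong[OF refl])
        fix k
        have "(?G \<kappa>)(i := FT1 (p i k)) = ?G (\<kappa>(i := k))" using insert.hyps by (auto simp: fun_eq_iff)
        then show "T (tens ((?G \<kappa>)(i := FT1 (p i k)))) = T (tens (?G (\<kappa>(i := k))))" by simp
      qed
      also have "\<dots> = 0" using insert.IH by simp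
      finally show "T (tens (\<lambda>j. if j \<in> insert i J then FT1 (g j) else FT1 (p j (\<kappa> j)))) = 0" .
    qed
  qed
  from this[of UNIV] show ?thesis by simp
qed

text \<open>Factors are exchanged one at a time; each difference is a product with one factor that
  vanishes up to R'.\<close>

lemma T_fourier_tens_cong:
  assumes supp: "distr_support (fourier_distr T) \<subseteq> {\<xi>. norm \<xi> \<le> R}" and R: "R < R'"
    and g: "\<And>j. cc (g j)" "\<And>j. cc (h j)" and gh: "\<And>j t. \<bar>t\<bar> \<le> R' \<Longrightarrow> g j t = h j t"
  shows "T (tens (\<lambda>j. FT1 (g j))) = T (tens (\<lambda>j. FT1 (h j)))"
proof -
  have "T (tens (\<lambda>j. FT1 (if j \<in> J then g j else h j))) = T (tens (\<lambda>j. FT1 (h j)))" if "finite J" for J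
    using that
  proof (induction J rule: finite_induct)
    case (insert i J)
    let ?G = "\<lambda>j. if j \<in> J then g j else h j"
    have G: "cc (?G j)" for j using g by simp
    have e1: "(\<lambda>j. FT1 (if j \<in> insert i J then g j else h j)) = (\<lambda>j. FT1 (?G j))(i := FT1 (g i))"
      "(\<lambda>j. FT1 (?G j)) = (\<lambda>j. FT1 (?G j))(i := FT1 (h i))"
      using insert.hyps by (auto simp: fun_eq_iff)
    have "T (tens ((\<lambda>j. FT1 (?G j))(i := FT1 (g i)))) - T (tens ((\<lambda>j. FT1 (?G j))(i := FT1 (h i))))
       = T (tens ((\<lambda>j. FT1 (?G j))(i := (\<lambda>t. FT1 (g i) t - FT1 (h i) t))))"
      by (rule T_tens_diff[symmetric]) (auto intro: schw_FT1 g)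
    also have "(\<lambda>j. FT1 (?G j))(i := (\<lambda>t. FT1 (g i) t - FT1 (h i) t)) = (\<lambda>j. FT1 ((?G(i := (\<lambda>t. g i t - h i t))) j))"
      by (auto simp: fun_eq_iff FT1_diff g)
    also have "T (tens \<dots>) = 0"
      by (rule T_fourier_tens_eq_0[OF supp R, where i=i]) (auto simp: G gh intro: cc_diff g)
    finally have "T (tens ((\<lambda>j. FT1 (?G j))(i := FT1 (g i)))) = T (tens ((\<lambda>j. FT1 (?G j))(i := FT1 (h i))))"
      by (rule eq_iff_diff_eq_0[THEN iffD2])
    also have "\<dots> = T (tens (\<lambda>j. FT1 (?G j)))"
      using arg_cong[OF e1(2), of "\<lambda>F. T (tens F)"] by (rule sym)
    also have "\<dots> = T (tens (\<lambda>j. FT1 (h j)))" by (rule insert.IH)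
    finally show ?case unfolding e1(1) .
  qed simp
  from this[of UNIV] show ?thesis by simp
qed

end

subsection \<open>The band-limited representative\<close>

definition dil :: "real \<Rightarrow> real \<Rightarrow> complex" where "dil a y = of_real a * theta (a * y)"

text \<open>The spectrum of the translate by b of \<open>dil a\<close>: the translation becomes a
  modulation, and the dilation stretches \<open>chi\<close> by a.\<close>

definition dil_spec :: "real \<Rightarrow> real \<Rightarrow> real \<Rightarrow> complex" where
  "dil_spec a b t = of_real ((2 * pi) powr (- 1 / 2)) * (cis (b * t) * chi (t / a))"

lemma cc_dil_spec: "0 < a \<Longrightarrow> cc (dil_spec a b)"
  unfolding dil_spec_def[abs_def]
  using cc_affine[OF cc_chi, of "1/a" 0] by (intro cc_cmult cc_mult2 smooth1_cis) simp

lemma dil_eq_FT1: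
  assumes "0 < a"
  shows "(\<lambda>y. dil a (y - b)) = FT1 (dil_spec a b)"
proof
  fix y
  have "FT1 (dil_spec a b) y = of_real ((2 * pi) powr (- 1 / 2)) * (of_real a * FT1 chi (a * (y - b)))"
    unfolding dil_spec_def FT1_cmult FT1_cis by (simp only: FT1_scale[OF assms])
  then show "dil a (y - b) = FT1 (dil_spec a b) y"
    by (simp only: dil_def theta_def fcoef_def mult.left_commute)
qed

lemma schw_dil: "0 < a \<Longrightarrow> schw (\<lambda>y. dil a (y - b))"
  by (simp add: dil_eq_FT1 schw_FT1 cc_dil_spec)

lemma smooth1_dil: "smooth1 (dil a)"
  unfolding dil_def[abs_def] using smooth1_affine[OF schw_smooth[OF schw_theta], of a 0] by (intro smooth1_cmult) simp

lemma vdn_dil: "(vd ^^ n) (dil a) = (\<lambda>y. of_real (a ^ Suc n) * (vd ^^ n) theta (a * y))"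
proof -
  have s: "smooth1 (\<lambda>y. theta (a * y))" using smooth1_affine[OF schw_smooth[OF schw_theta], of a 0] by simp
  show ?thesis unfolding dil_def[abs_def] vdn_cmult[OF s]
    using vdn_affine[OF schw_smooth[OF schw_theta], of n a 0] by (simp add: mult.assoc)
qed

section \<open>The truncated kernel and its distance from the dilates of
  \<open>theta\<close>\<close>

definition cutoff :: "real \<Rightarrow> complex" where "cutoff = plateau 1"

lemma cutoff_1: "\<bar>t\<bar> \<le> 3/4 \<Longrightarrow> cutoff t = 1" by (simp add: cutoff_def plateau_1)
lemma cutoff_0: "5/4 \<le> \<bar>t\<bar> \<Longrightarrow> cutoff t = 0" by (simp add: cutoff_def plateau_0)
lemma cc_cutoff: "cc cutoff" by (simp add: cutoff_def cc_plateau)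

text \<open>The distribution is known to be integration against f only on test functions, and
  \<open>dil a\<close> has no compact support; this truncation stands in for it.\<close>

definition ker :: "real \<Rightarrow> real \<Rightarrow> complex" where "ker a y = dil a y * cutoff y"

lemma cc_ker: "cc (ker a)"
  unfolding ker_def[abs_def] by (intro cc_mult2 cc_cutoff smooth1_dil)

lemma vdn_bounded:
  assumes "schw g"
  shows "\<exists>B>0. \<forall>n\<le>N. \<forall>t. norm ((vd ^^ n) g t) \<le> B"
proof -
  obtain B where B: "0 < B" "sbound N B g" by (rule schw_sbound[OF assms])
  have "norm ((vd ^^ n) g t) \<le> B" if "n \<le> N" for n t
  proof -
    have "1 * norm ((vd ^^ n) g t) \<le> (1 + \<bar>t\<bar>) ^ N * norm ((vd ^^ n) g t)"
      by (intro mult_right_mono one_le_power) auto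
    also have "\<dots> \<le> B" using B that by (auto simp: sbound_def)
    finally show ?thesis by simp
  qed
  with B show ?thesis by blast
qed

text \<open>The order L of decay is independent of N, so that truncation can gain arbitrary powers
  of a.\<close>

lemma dil_deriv_bound:
  "\<exists>B>0. \<forall>a\<ge>1. \<forall>n\<le>N. \<forall>y. norm ((vd ^^ n) (dil a) y) \<le> B * a ^ (N + 1) / (1 + a * \<bar>y\<bar>) ^ L"
proof -
  obtain B where B: "0 < B" "sbound (max N L) B theta" by (rule schw_sbound[OF schw_theta])
  have "norm ((vd ^^ n) (dil a) y) \<le> B * a ^ (N + 1) / (1 + a * \<bar>y\<bar>) ^ L" if a: "1 \<le> a" and n: "n \<le> N" for a n y
  proof -
    have ay: "\<bar>a * y\<bar> = a * \<bar>y\<bar>" using a by (simp add: abs_mult)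
    have pos: "0 < (1 + a * \<bar>y\<bar>) ^ L" using a by (simp add: add_pos_nonneg)
    have "(1 + \<bar>a * y\<bar>) ^ L * norm ((vd ^^ n) theta (a * y)) \<le> (1 + \<bar>a * y\<bar>) ^ max N L * norm ((vd ^^ n) theta (a * y))"
      by (intro mult_right_mono power_increasing) auto
    also have "\<dots> \<le> B" using B n by (auto simp: sbound_def)
    finally have 1: "norm ((vd ^^ n) theta (a * y)) \<le> B / (1 + a * \<bar>y\<bar>) ^ L"
      using pos by (simp add: ay pos_le_divide_eq mult.commute)
    have "norm ((vd ^^ n) (dil a) y) = a ^ Suc n * norm ((vd ^^ n) theta (a * y))"
      unfolding vdn_dil norm_mult norm_of_real using a by simp
    also have "\<dots> \<le> a ^ (N + 1) * (B / (1 + a * \<bar>y\<bar>) ^ L)"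
      using a n by (intro mult_mono 1 power_increasing) auto
    finally show ?thesis by (simp add: mult.commute)
  qed
  with B(1) show ?thesis by blast
qed

lemma mult_divide_cancel_pos: "0 < q \<Longrightarrow> q * (b / q) = (b::real)"
  by simp

lemma sbound_dil: "\<exists>C>0. \<forall>a\<ge>1. sbound N (C * a ^ (N + 1)) (dil a)"
proof -
  obtain B where B: "0 < B" "\<And>a n y. 1 \<le> a \<Longrightarrow> n \<le> N \<Longrightarrow> norm ((vd ^^ n) (dil a) y) \<le> B * a ^ (N + 1) / (1 + a * \<bar>y\<bar>) ^ N"
    using dil_deriv_bound[of N N] by blast
  have "sbound N (B * a ^ (N + 1)) (dil a)" if a: "1 \<le> a" for a
    unfolding sbound_def
  proof (intro allI impI)
    fix n y assume n: "n \<le> N"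
    have pos: "0 < (1 + a * \<bar>y\<bar>) ^ N" using a by (simp add: add_pos_nonneg)
    have "\<bar>y\<bar> \<le> a * \<bar>y\<bar>" using a mult_right_mono[of 1 a "\<bar>y\<bar>"] by simp
    then have "(1 + \<bar>y\<bar>) ^ N * norm ((vd ^^ n) (dil a) y) \<le> (1 + a * \<bar>y\<bar>) ^ N * (B * a ^ (N + 1) / (1 + a * \<bar>y\<bar>) ^ N)"
      using a B n by (intro mult_mono power_mono) auto
    also have "\<dots> = B * a ^ (N + 1)" by (rule mult_divide_cancel_pos[OF pos])
    finally show "(1 + \<bar>y\<bar>) ^ N * norm ((vd ^^ n) (dil a) y) \<le> B * a ^ (N + 1)" .
  qed
  with B(1) show ?thesis by blast
qed

lemma sbound_ker: "\<exists>C>0. \<forall>a\<ge>1. sbound N (C * a ^ (N + 1)) (ker a)"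
proof -
  obtain B where B: "0 < B" "\<And>a n y. 1 \<le> a \<Longrightarrow> n \<le> N \<Longrightarrow> norm ((vd ^^ n) (dil a) y) \<le> B * a ^ (N + 1) / (1 + a * \<bar>y\<bar>) ^ N"
    using dil_deriv_bound[of N N] by blast
  obtain D where D: "0 < D" "\<And>n t. n \<le> N \<Longrightarrow> norm ((vd ^^ n) cutoff t) \<le> D"
    using vdn_bounded[OF cc_schw[OF cc_cutoff], of N] by blast
  have "sbound N (2 ^ N * B * D * a ^ (N + 1)) (ker a)" if a: "1 \<le> a" for a
    unfolding sbound_def
  proof (intro allI impI)
    fix n y assume n: "n \<le> N"
    have pos: "0 < (1 + a * \<bar>y\<bar>) ^ N" using a by (simp add: add_pos_nonneg)
    let ?X = "B * a ^ (N + 1) / (1 + a * \<bar>y\<bar>) ^ N"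
    have X: "0 \<le> ?X" using B a pos by simp
    have "norm ((vd ^^ n) (ker a) y) \<le> 2 ^ n * ?X * D" unfolding ker_def[abs_def]
      by (rule vdn_mult_bound) (use a n B D X in \<open>auto intro: smooth1_dil cc_smooth cc_cutoff\<close>)
    also have "\<dots> \<le> 2 ^ N * ?X * D" using n D X by (intro mult_right_mono power_increasing) auto
    finally have 1: "norm ((vd ^^ n) (ker a) y) \<le> 2 ^ N * ?X * D" .
    have "\<bar>y\<bar> \<le> a * \<bar>y\<bar>" using a mult_right_mono[of 1 a "\<bar>y\<bar>"] by simp
    then have "(1 + \<bar>y\<bar>) ^ N * norm ((vd ^^ n) (ker a) y) \<le> (1 + a * \<bar>y\<bar>) ^ N * (2 ^ N * ?X * D)"
      using a 1 by (intro mult_mono power_mono) auto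
    also have "\<dots> = ((1 + a * \<bar>y\<bar>) ^ N * ?X) * (2 ^ N * D)" by (simp only: mult_ac)
    also have "(1 + a * \<bar>y\<bar>) ^ N * ?X = B * a ^ (N + 1)" by (rule mult_divide_cancel_pos[OF pos])
    also have "B * a ^ (N + 1) * (2 ^ N * D) = 2 ^ N * B * D * a ^ (N + 1)" by (simp only: mult_ac)
    finally show "(1 + \<bar>y\<bar>) ^ N * norm ((vd ^^ n) (ker a) y) \<le> 2 ^ N * B * D * a ^ (N + 1)" .
  qed
  with B(1) D(1) show ?thesis by (intro exI[of _ "2 ^ N * B * D"]) auto
qed

text \<open>The difference vanishes for \<bar>y\<bar> < 3/4, and elsewhere the decay of
  \<open>theta\<close> at a y supplies any negative power of a.\<close>

lemma sbound_dil_minus_ker: "\<exists>C>0. \<forall>a\<ge>1. sbound N (C / a ^ M) (\<lambda>y. dil a y - ker a y)"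
proof -
  \<comment> \<open>Large enough for the weight of order N, for the factor a^(N + 1) caused by
    differentiation, and for the gain M.\<close>
  define L where "L = N + (N + 1) + M"
  obtain B where B: "0 < B" "\<And>a n y. 1 \<le> a \<Longrightarrow> n \<le> N \<Longrightarrow> norm ((vd ^^ n) (dil a) y) \<le> B * a ^ (N + 1) / (1 + a * \<bar>y\<bar>) ^ L"
    using dil_deriv_bound[of N L] by blast
  obtain D where D: "0 < D" "\<And>n t. n \<le> N \<Longrightarrow> norm ((vd ^^ n) cutoff t) \<le> D"
    using vdn_bounded[OF cc_schw[OF cc_cutoff], of N] by blast
  have sc: "smooth1 (\<lambda>t. 1 - cutoff t)"
    using smooth1_add[OF smooth1_const[of 1] smooth1_cmult[OF cc_smooth[OF cc_cutoff], of "-1"]] by simp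
  have D': "norm ((vd ^^ n) (\<lambda>t. 1 - cutoff t) t) \<le> 1 + D" if "n \<le> N" for n t
  proof -
    have c: "norm ((vd ^^ n) (\<lambda>t. 1 :: complex) t) \<le> 1"
    proof (cases n)
      case (Suc m)
      have "vd (\<lambda>t. 1 :: complex) = (\<lambda>t. 0)" by (rule vd_eqI) simp
      then have "(vd ^^ n) (\<lambda>t. 1 :: complex) = (vd ^^ m) (\<lambda>t. 0)" by (simp only: Suc vdn_Suc)
      then show ?thesis using vdn_zero_on_open[of UNIV "\<lambda>t. 0" t m] by simp
    qed simp
    have "norm ((vd ^^ n) (\<lambda>t. 1 - cutoff t) t) \<le> norm ((vd ^^ n) (\<lambda>t. 1 :: complex) t) + norm ((vd ^^ n) cutoff t)"
      unfolding vdn_diff[OF smooth1_const cc_smooth[OF cc_cutoff]] by (rule norm_triangle_ineq4)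
    then show ?thesis using c D(2)[OF that, of t] by linarith
  qed
  let ?C = "2 ^ N * B * (1 + D) * 3 ^ L"
  have "sbound N (?C / a ^ M) (\<lambda>y. dil a y - ker a y)" if a: "1 \<le> a" for a
    unfolding sbound_def
  proof (intro allI impI)
    fix n y assume n: "n \<le> N"
    have e: "(\<lambda>y. dil a y - ker a y) = (\<lambda>y. dil a y * (1 - cutoff y))" by (simp add: ker_def right_diff_distrib)
    show "(1 + \<bar>y\<bar>) ^ N * norm ((vd ^^ n) (\<lambda>y. dil a y - ker a y) y) \<le> ?C / a ^ M"
    proof (cases "\<bar>y\<bar> < 3/4")
      case True
      have "open {y :: real. \<bar>y\<bar> < 3/4}" by (intro open_Collect_less continuous_intros)
      then have "(vd ^^ n) (\<lambda>y. dil a y - ker a y) y = 0"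
        by (rule vdn_zero_on_open) (use True cutoff_1 in \<open>auto simp: ker_def\<close>)
      then show ?thesis using B D a by simp
    next
      case False
      define X where "X = B * a ^ (N + 1) / (1 + a * \<bar>y\<bar>) ^ L"
      have X: "0 \<le> X" using B a by (simp add: X_def)
      have "norm ((vd ^^ n) (\<lambda>y. dil a y * (1 - cutoff y)) y) \<le> 2 ^ n * X * (1 + D)"
        by (rule vdn_mult_bound) (use a n B D' X sc in \<open>auto intro: smooth1_dil simp: X_def\<close>)
      also have "\<dots> \<le> 2 ^ N * X * (1 + D)" using n D X by (intro mult_right_mono power_increasing) auto
      finally have 1: "norm ((vd ^^ n) (\<lambda>y. dil a y - ker a y) y) \<le> 2 ^ N * X * (1 + D)" unfolding e .
      \<comment> \<open>Away from 0, decay in 1 + a \<bar>y\<bar> is decay in a and in y at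
        once.\<close>
      have y: "0 < 1 + \<bar>y\<bar>" "a * (1 + \<bar>y\<bar>) \<le> 3 * (1 + a * \<bar>y\<bar>)"
      proof -
        have "a * (1 + \<bar>y\<bar>) \<le> a * (3 * \<bar>y\<bar>)" using False a by (intro mult_left_mono) auto
        then show "a * (1 + \<bar>y\<bar>) \<le> 3 * (1 + a * \<bar>y\<bar>)" by simp
      qed simp
      have "(a * (1 + \<bar>y\<bar>)) ^ L \<le> (3 * (1 + a * \<bar>y\<bar>)) ^ L" using a y by (intro power_mono) auto
      then have p: "a ^ L * (1 + \<bar>y\<bar>) ^ L \<le> 3 ^ L * (1 + a * \<bar>y\<bar>) ^ L" by (simp only: power_mult_distrib)
      have pos: "0 < (1 + a * \<bar>y\<bar>) ^ L" "0 < a ^ L" "0 < a ^ M" "0 < a ^ (N + 1)" using a by (simp_all add: add_pos_nonneg)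
      have yL: "(1 + \<bar>y\<bar>) ^ N \<le> (1 + \<bar>y\<bar>) ^ L" unfolding L_def by (intro power_increasing) auto
      have aL: "a ^ (N + 1) * a ^ M \<le> a ^ L" unfolding L_def power_add[symmetric] using a by (intro power_increasing) auto
      have "(1 + \<bar>y\<bar>) ^ N * (a ^ (N + 1) * a ^ M) \<le> (1 + \<bar>y\<bar>) ^ L * a ^ L"
        using a by (intro mult_mono yL aL) auto
      also have "\<dots> \<le> 3 ^ L * (1 + a * \<bar>y\<bar>) ^ L" using p by (simp only: mult.commute)
      finally have q: "(1 + \<bar>y\<bar>) ^ N * (a ^ (N + 1) / (1 + a * \<bar>y\<bar>) ^ L) \<le> 3 ^ L / a ^ M"
        using pos by (simp add: pos_le_divide_eq pos_divide_le_eq mult_ac)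
      have "(1 + \<bar>y\<bar>) ^ N * norm ((vd ^^ n) (\<lambda>y. dil a y - ker a y) y) \<le> (1 + \<bar>y\<bar>) ^ N * (2 ^ N * X * (1 + D))"
        by (intro mult_left_mono 1) auto
      also have "\<dots> = (2 ^ N * B * (1 + D)) * ((1 + \<bar>y\<bar>) ^ N * (a ^ (N + 1) / (1 + a * \<bar>y\<bar>) ^ L))"
        by (simp add: X_def)
      also have "\<dots> \<le> (2 ^ N * B * (1 + D)) * (3 ^ L / a ^ M)" using B D by (intro mult_left_mono q) auto
      finally show ?thesis by simp
    qed
  qed
  moreover have "0 < ?C" using B D by simp
  ultimately show ?thesis by blast
qed

lemma sbound_dilate:
  assumes a: "0 < a" and sme: "smooth1 h" and c: "sbound N D h"
  shows "sbound N (max 1 a ^ (N + 1) * max 1 (1 / a) ^ N * D) (\<lambda>y. of_real a * h (a * y + 0))"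
proof -
  have e0: "(vd ^^ n) (\<lambda>y. of_real a * h (a * y + 0)) = (\<lambda>y. of_real a * (of_real (a ^ n) * (vd ^^ n) h (a * y + 0)))" for n
    unfolding vdn_cmult[OF smooth1_affine[OF sme]] vdn_affine[OF sme] ..
  show ?thesis
    unfolding sbound_def e0
  proof (intro allI impI)
    fix n y assume n: "n \<le> N"
    let ?v = "norm ((vd ^^ n) h (a * y + 0))"
    have "\<bar>y\<bar> = (1 / a) * \<bar>a * y\<bar>" using a by (simp add: abs_mult)
    also have "\<dots> \<le> max 1 (1/a) * \<bar>a * y\<bar>" by (intro mult_right_mono) auto
    finally have "\<bar>y\<bar> \<le> max 1 (1/a) * \<bar>a * y\<bar>" .
    moreover have "1 \<le> max 1 (1/a)" by (rule max.cobounded1)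
    ultimately have "1 + \<bar>y\<bar> \<le> max 1 (1/a) + max 1 (1/a) * \<bar>a * y\<bar>" by (rule add_mono[rotated])
    then have "1 + \<bar>y\<bar> \<le> max 1 (1/a) * (1 + \<bar>a * y + 0\<bar>)"
      by (simp only: distrib_left add_0_right mult_1_right)
    then have "(1 + \<bar>y\<bar>) ^ N \<le> (max 1 (1/a) * (1 + \<bar>a * y + 0\<bar>)) ^ N" by (rule power_mono) simp
    then have 1: "(1 + \<bar>y\<bar>) ^ N \<le> max 1 (1/a) ^ N * (1 + \<bar>a * y + 0\<bar>) ^ N" by (simp only: power_mult_distrib)
    have 2: "a * a ^ n \<le> max 1 a ^ (N + 1)"
    proof -
      have "a ^ (n + 1) \<le> max 1 a ^ (n + 1)" using a by (intro power_mono) auto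
      also have "\<dots> \<le> max 1 a ^ (N + 1)" using n by (intro power_increasing) auto
      finally show ?thesis by simp
    qed
    have 3: "(1 + \<bar>a * y + 0\<bar>) ^ N * ?v \<le> D" using c n unfolding sbound_def by blast
    have "(1 + \<bar>y\<bar>) ^ N * norm (of_real a * (of_real (a ^ n) * (vd ^^ n) h (a * y + 0)))
       = (a * a ^ n) * ((1 + \<bar>y\<bar>) ^ N * ?v)" using a by (simp add: norm_mult norm_power)
    also have "\<dots> \<le> max 1 a ^ (N + 1) * ((max 1 (1/a) ^ N * (1 + \<bar>a * y + 0\<bar>) ^ N) * ?v)"
    proof (rule mult_mono[OF 2])
      show "(1 + \<bar>y\<bar>) ^ N * ?v \<le> (max 1 (1/a) ^ N * (1 + \<bar>a * y + 0\<bar>) ^ N) * ?v"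
        by (rule mult_right_mono[OF 1 norm_ge_zero])
      show "0 \<le> max 1 a ^ (N + 1)" by (rule zero_le_power) simp
      show "0 \<le> (1 + \<bar>y\<bar>) ^ N * ?v" by (intro mult_nonneg_nonneg zero_le_power) auto
    qed
    also have "\<dots> = max 1 a ^ (N + 1) * max 1 (1/a) ^ N * ((1 + \<bar>a * y + 0\<bar>) ^ N * ?v)" by (simp only: mult.assoc)
    also have "\<dots> \<le> max 1 a ^ (N + 1) * max 1 (1/a) ^ N * D"
      by (rule mult_left_mono[OF 3]) (intro mult_nonneg_nonneg zero_le_power, simp_all)
    finally show "(1 + \<bar>y\<bar>) ^ N * norm (of_real a * (of_real (a ^ n) * (vd ^^ n) h (a * y + 0))) \<le> max 1 a ^ (N + 1) * max 1 (1/a) ^ N * D" .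
  qed
qed

context tempered begin

text \<open>For \<open>T = f\<close> this is the convolution of \<open>f\<close> with a dilate of the tensor power of \<^const>\<open>theta\<close>,
  which is an even function.\<close>

definition band :: "real \<Rightarrow> real ^ 'n \<Rightarrow> complex" where
  "band a x = T (tens (\<lambda>j y. dil a (y - x $ j)))"

lemma band_eq_FT1: "0 < a \<Longrightarrow> band a x = T (tens (\<lambda>j. FT1 (dil_spec a (x $ j))))"
  by (simp add: band_def dil_eq_FT1)

text \<open>On \<bar>t\<bar> \<le> 5/4 R both spectra are the same multiple of an exponential, and
  this goes strictly beyond the spectrum of T. The free choice of the scale later permits a limit of
  shrinking kernels without changing the function.\<close>

lemma band_independent:
  assumes supp: "distr_support (fourier_distr T) \<subseteq> {\<xi>. norm \<xi> \<le> R}" and R: "0 < R" "R \<le> a" "R \<le> b"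
  shows "band a x = band b x"
proof -
  have ab: "0 < a" "0 < b" using R by auto
  have eq: "T (tens (\<lambda>j. FT1 (dil_spec a (x $ j)))) = T (tens (\<lambda>j. FT1 (dil_spec b (x $ j))))"
  proof (rule T_fourier_tens_cong[OF supp, of "5/4 * R"])
    show "R < 5/4 * R" using R by simp
    fix t :: real assume t: "\<bar>t\<bar> \<le> 5/4 * R"
    have "chi (t / c) = 1" if "R \<le> c" for c
    proof (rule chi_1)
      have "\<bar>t\<bar> \<le> 5/4 * c" using t that by simp
      then show "\<bar>t / c\<bar> \<le> 5/4" using R that by (simp add: abs_divide pos_divide_le_eq)
    qed
    then show "dil_spec a (x $ j) t = dil_spec b (x $ j) t" for j using R by (simp add: dil_spec_def)
  qed (use ab in \<open>auto intro: cc_dil_spec\<close>)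
  then show ?thesis using ab by (simp add: band_eq_FT1)
qed

lemma T_tens_telescope:
  assumes G: "\<And>j. schw (G j)" "\<And>j. schw (H j)" and e: "\<And>i J. norm (T (tens ((\<lambda>j. if j \<in> J then G j else H j)(i := (\<lambda>t. G i t - H i t))))) \<le> e"
  shows "norm (T (tens G) - T (tens H)) \<le> real CARD('n) * e"
proof -
  have "norm (T (tens (\<lambda>j. if j \<in> J then G j else H j)) - T (tens H)) \<le> real (card J) * e" if "finite J" for J
    using that
  proof (induction J rule: finite_induct)
    case (insert i J)
    let ?K = "\<lambda>j. if j \<in> J then G j else H j"
    have e1: "(\<lambda>j. if j \<in> insert i J then G j else H j) = ?K(i := G i)" "?K = ?K(i := H i)"
      using insert.hyps by (auto simp: fun_eq_iff)
    have "T (tens (?K(i := G i))) - T (tens (?K(i := H i))) = T (tens (?K(i := (\<lambda>t. G i t - H i t))))"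
      by (rule T_tens_diff[symmetric]) (auto intro: G)
    then have "norm (T (tens (?K(i := G i))) - T (tens ?K)) \<le> e" using e[of J i] arg_cong[OF e1(2), of "\<lambda>F. T (tens F)"] by simp
    moreover have "norm (T (tens (?K(i := G i))) - T (tens H)) \<le> norm (T (tens (?K(i := G i))) - T (tens ?K)) + norm (T (tens ?K) - T (tens H))"
      using norm_triangle_ineq[of "T (tens (?K(i := G i))) - T (tens ?K)" "T (tens ?K) - T (tens H)"] by simp
    ultimately have "norm (T (tens (?K(i := G i))) - T (tens H)) \<le> e + real (card J) * e" using insert.IH by linarith
    then show ?case unfolding e1(1) using insert.hyps by (simp add: distrib_right)
  qed simp
  from this[of UNIV] show ?thesis by simp
qed

text \<open>In the telescoping sum over the coordinates one factor is the difference of the kernels,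
  small of any order in a, and the others grow at most like a^(N + 1).\<close>

lemma band_approx:
  "\<exists>C. \<forall>a\<ge>1. \<forall>x. (\<forall>j. \<bar>x $ j\<bar> \<le> X) \<longrightarrow> norm (band a x - T (tens (\<lambda>j y. ker a (y - x $ j)))) \<le> C / a"
proof -
  obtain N C where C: "0 < C" "\<And>G B. (\<And>j. schw (G j)) \<Longrightarrow> (\<And>j. sbound N (B j) (G j)) \<Longrightarrow> norm (T (tens G)) \<le> C * (\<Prod>j\<in>UNIV. B j)"
    using T_tens_bound by blast
  define n where "n = CARD('n)"
  \<comment> \<open>The growth of the other factors is at most a^((N + 1) n); one more power leaves
    1 / a.\<close>
  define M where "M = (N + 1) * n + 1"
  obtain C1 where C1: "0 < C1" "\<And>a. 1 \<le> a \<Longrightarrow> sbound N (C1 * a ^ (N + 1)) (dil a)" using sbound_dil[of N] by blast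
  obtain C2 where C2: "0 < C2" "\<And>a. 1 \<le> a \<Longrightarrow> sbound N (C2 * a ^ (N + 1)) (ker a)" using sbound_ker[of N] by blast
  obtain C3 where C3: "0 < C3" "\<And>a. 1 \<le> a \<Longrightarrow> sbound N (C3 / a ^ M) (\<lambda>y. dil a y - ker a y)" using sbound_dil_minus_ker[of N M] by blast
  define Y where "Y = (1 + \<bar>X\<bar>) ^ N"
  have Y: "1 \<le> Y" unfolding Y_def by (rule one_le_power) simp
  define D where "D = max 1 (max C1 C2)"
  have D: "1 \<le> D" "C1 \<le> D" "C2 \<le> D" by (auto simp: D_def)
  let ?F = "real n * (C * (Y ^ n * D ^ n * C3))"
  have "norm (band a x - T (tens (\<lambda>j y. ker a (y - x $ j)))) \<le> ?F / a" if a: "1 \<le> a" and x: "\<forall>j. \<bar>x $ j\<bar> \<le> X" for a x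
  proof -
    let ?G = "\<lambda>j y. dil a (y - x $ j)" and ?H = "\<lambda>j y. ker a (y - x $ j)"
    have sG: "schw (?G j)" for j using a by (intro schw_dil) auto
    have sH: "schw (?H j)" for j by (intro schw_shift cc_schw cc_ker)
    have Yj: "(1 + \<bar>x $ j\<bar>) ^ N \<le> Y" for j
      unfolding Y_def using x[rule_format, of j] by (intro power_mono) auto
    have aN: "1 \<le> a ^ (N + 1)" using a by (rule one_le_power)
    have bG: "sbound N (Y * (D * a ^ (N + 1))) (?G j)" for j
    proof (rule sbound_mono[OF sbound_shift[OF smooth1_dil C1(2)[OF a]] order_refl])
      show "(1 + \<bar>x $ j\<bar>) ^ N * (C1 * a ^ (N + 1)) \<le> Y * (D * a ^ (N + 1))"
        using Yj[of j] Y D C1 a by (intro mult_mono mult_right_mono) auto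
    qed
    have bH: "sbound N (Y * (D * a ^ (N + 1))) (?H j)" for j
    proof (rule sbound_mono[OF sbound_shift[OF cc_smooth[OF cc_ker] C2(2)[OF a]] order_refl])
      show "(1 + \<bar>x $ j\<bar>) ^ N * (C2 * a ^ (N + 1)) \<le> Y * (D * a ^ (N + 1))"
        using Yj[of j] Y D C2 a by (intro mult_mono mult_right_mono) auto
    qed
    have bD: "sbound N (Y * (C3 / a ^ M)) (\<lambda>y. ?G j y - ?H j y)" for j
    proof -
      have "smooth1 (\<lambda>y. dil a y - ker a y)"
        using smooth1_add[OF smooth1_dil smooth1_cmult[OF cc_smooth[OF cc_ker], of "-1"]] by simp
      moreover have "(1 + \<bar>x $ j\<bar>) ^ N * (C3 / a ^ M) \<le> Y * (C3 / a ^ M)"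
        using C3 a by (intro mult_right_mono Yj) auto
      ultimately show ?thesis by (rule sbound_mono[OF sbound_shift[OF _ C3(2)[OF a]] order_refl])
    qed
    have "norm (T (tens ?G) - T (tens ?H)) \<le> real CARD('n) * (C * (Y ^ n * D ^ n * C3) / a)"
    proof (rule T_tens_telescope[OF sG sH])
      fix i :: 'n and J
      let ?K = "(\<lambda>j. if j \<in> J then ?G j else ?H j)(i := (\<lambda>t. ?G i t - ?H i t))"
      let ?B = "(\<lambda>j. Y * (D * a ^ (N + 1)))(i := Y * (C3 / a ^ M))"
      have Tle: "norm (T (tens ?K)) \<le> C * (\<Prod>j\<in>UNIV. ?B j)"
      proof (rule C(2))
        show "schw (?K j)" for j using sG sH schw_diff[OF sG[of i] sH[of i]] by simp
        show "sbound N (?B j) (?K j)" for j using bG bH bD[of i] by simp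
      qed
      have "(\<Prod>j\<in>UNIV. ?B j) = Y * (C3 / a ^ M) * (Y * (D * a ^ (N + 1))) ^ (n - 1)"
        by (subst prod.remove[of UNIV i]) (auto simp: n_def card_Diff_singleton)
      also have "\<dots> \<le> Y ^ n * D ^ n * C3 / a"
      proof -
        have n: "0 < n" by (simp add: n_def)
        have "Y * (Y * (D * a ^ (N + 1))) ^ (n - 1) \<le> (Y * (D * a ^ (N + 1))) * (Y * (D * a ^ (N + 1))) ^ (n - 1)"
        proof (rule mult_right_mono)
          have "1 * 1 \<le> D * a ^ (N + 1)" using D aN by (intro mult_mono) auto
          then show "Y \<le> Y * (D * a ^ (N + 1))" using Y mult_left_mono[of 1 "D * a ^ (N + 1)" Y] by simp
        qed (use Y D a in auto)
        also have "\<dots> = (Y * (D * a ^ (N + 1))) ^ n" using n by (simp add: power_eq_if)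
        also have "\<dots> = Y ^ n * D ^ n * a ^ ((N + 1) * n)" by (simp only: power_mult_distrib power_mult mult.assoc)
        finally have "Y * (Y * (D * a ^ (N + 1))) ^ (n - 1) * (C3 / a ^ M) \<le> Y ^ n * D ^ n * a ^ ((N + 1) * n) * (C3 / a ^ M)"
          using C3 a by (intro mult_right_mono) auto
        also have "\<dots> = Y ^ n * D ^ n * C3 / a"
          using a unfolding M_def power_add by simp
        finally show ?thesis by (simp only: mult_ac)
      qed
      finally have "C * (\<Prod>j\<in>UNIV. ?B j) \<le> C * (Y ^ n * D ^ n * C3 / a)" using C(1) by (intro mult_left_mono) auto
      with Tle have "norm (T (tens ?K)) \<le> C * (Y ^ n * D ^ n * C3 / a)" by (rule order_trans)
      then show "norm (T (tens ?K)) \<le> C * (Y ^ n * D ^ n * C3) / a" by (simp only: times_divide_eq_right)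
    qed
    then show ?thesis by (simp add: band_def n_def)
  qed
  then show ?thesis by blast
qed

text \<open>The dilated sampling formula is inserted into the i-th factor, where a translation of
  the factor is a translation of the argument of \<open>band\<close>. The limit passes through T
  because the error tends to 0 in the seminorm of \<open>T_tens_bound\<close>.\<close>

lemma band_sampling:
  assumes a: "0 < a" and \<tau>: "0 \<le> \<tau>" "\<tau> \<le> 1"
  shows "(\<lambda>K. \<Sum>k\<in>{-int K..int K}. fcoef kappa (\<tau> + of_int k) * band a (upd x i (x $ i + (\<tau> + of_int k) / a))) \<longlonglongrightarrow> band a x"
proof -
  obtain N C where C: "0 < C" "\<And>G B. (\<And>j. schw (G j)) \<Longrightarrow> (\<And>j. sbound N (B j) (G j)) \<Longrightarrow> norm (T (tens G)) \<le> C * (\<Prod>j\<in>UNIV. B j)"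
    using T_tens_bound by blast
  let ?G = "\<lambda>j y. dil a (y - x $ j)"
  have sG: "schw (?G j)" for j using a by (rule schw_dil)
  obtain c where c: "\<And>K. sbound N (c * utail K) (sampling_error \<tau> K)" using sampling_error_sbound[OF \<tau>] by blast
  define s where "s k = x $ i + (\<tau> + of_int k) / a" for k :: int
  define err where "err K y = of_real a * sampling_error \<tau> K (a * (y - x $ i))" for K y
  have shift: "dil a (y - s k) = of_real a * theta (a * (y - x $ i) - (\<tau> + of_int k))" for y k
  proof -
    have "a * (y - s k) = a * (y - x $ i) - (\<tau> + of_int k)" using a by (simp add: s_def field_simps)
    then show ?thesis by (simp only: dil_def)
  qed
  have dec: "err K = (\<lambda>y. ?G i y - (\<Sum>k\<in>{-int K..int K}. fcoef kappa (\<tau> + of_int k) * dil a (y - s k)))" for K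
  proof
    fix y
    have "dil a (y - x $ i) = of_real a * theta (a * (y - x $ i))" by (rule dil_def)
    moreover have "of_real a * (\<Sum>k\<in>{-int K..int K}. fcoef kappa (\<tau> + of_int k) * theta (a * (y - x $ i) - (\<tau> + of_int k)))
       = (\<Sum>k\<in>{-int K..int K}. fcoef kappa (\<tau> + of_int k) * dil a (y - s k))"
      unfolding shift sum_distrib_left by (intro sum.cong refl mult.left_commute)
    ultimately show "err K y = ?G i y - (\<Sum>k\<in>{-int K..int K}. fcoef kappa (\<tau> + of_int k) * dil a (y - s k))"
      by (simp only: err_def sampling_error_def right_diff_distrib)
  qed
  have sS: "T (tens (?G(i := (\<lambda>y. \<Sum>k\<in>{-int K..int K}. fcoef kappa (\<tau> + of_int k) * dil a (y - s k)))))
      = (\<Sum>k\<in>{-int K..int K}. T (tens (?G(i := (\<lambda>y. fcoef kappa (\<tau> + of_int k) * dil a (y - s k))))))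
     \<and> schw (\<lambda>y. \<Sum>k\<in>{-int K..int K}. fcoef kappa (\<tau> + of_int k) * dil a (y - s k))" for K
    by (rule T_tens_sum) (auto intro!: sG schw_cmult schw_dil a)
  have bk: "T (tens (?G(i := (\<lambda>y. fcoef kappa (\<tau> + of_int k) * dil a (y - s k))))) = fcoef kappa (\<tau> + of_int k) * band a (upd x i (s k))" for k
  proof -
    have "T (tens (?G(i := (\<lambda>y. fcoef kappa (\<tau> + of_int k) * dil a (y - s k))))) = fcoef kappa (\<tau> + of_int k) * T (tens (?G(i := (\<lambda>y. dil a (y - s k)))))"
      by (rule T_tens_cmult) (auto intro!: sG schw_dil a)
    moreover have "?G(i := (\<lambda>y. dil a (y - s k))) = (\<lambda>j y. dil a (y - upd x i (s k) $ j))" by (auto simp: fun_eq_iff)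
    ultimately show ?thesis by (simp add: band_def)
  qed
  have T_err: "T (tens (?G(i := err K))) = band a x - (\<Sum>k\<in>{-int K..int K}. fcoef kappa (\<tau> + of_int k) * band a (upd x i (s k)))" for K
  proof -
    have "T (tens (?G(i := err K))) = T (tens (?G(i := ?G i))) - T (tens (?G(i := (\<lambda>y. \<Sum>k\<in>{-int K..int K}. fcoef kappa (\<tau> + of_int k) * dil a (y - s k)))))"
      unfolding dec using sS[of K] by (intro T_tens_diff sG) auto
    also have "T (tens (?G(i := ?G i))) = band a x"
    proof -
      have "?G(i := ?G i) = ?G" by (auto simp: fun_eq_iff)
      then show ?thesis by (simp only: band_def)
    qed
    also have "T (tens (?G(i := (\<lambda>y. \<Sum>k\<in>{-int K..int K}. fcoef kappa (\<tau> + of_int k) * dil a (y - s k)))))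
       = (\<Sum>k\<in>{-int K..int K}. fcoef kappa (\<tau> + of_int k) * band a (upd x i (s k)))"
      using sS[of K] by (simp only: bk)
    finally show ?thesis .
  qed
  have sm_err: "schw (err K)" for K
    unfolding dec using sS[of K] by (intro schw_diff sG) auto
  \<comment> \<open>The cost of the dilation by a and of the translation by \<open>x $ i\<close>,
    independent of K.\<close>
  define E where "E = max 1 a ^ (N + 1) * (max 1 (1 / a)) ^ N * (1 + \<bar>x $ i\<bar>) ^ N"
  have E_pos: "0 < E" by (simp add: E_def add_pos_nonneg)
  have err_sb: "sbound N (E * (c * utail K)) (err K)" for K
  proof -
    have cK: "0 \<le> c * utail K" by (rule sbound_nonneg[OF c])
    have sme: "smooth1 (sampling_error \<tau> K)"
    proof -
      have "(\<lambda>y. of_real (1/a) * err K (1/a * y + x $ i)) = sampling_error \<tau> K"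
        using a by (simp add: err_def fun_eq_iff)
      then show ?thesis using smooth1_cmult[OF smooth1_affine[OF schw_smooth[OF sm_err[of K]], of "1/a" "x $ i"], of "of_real (1/a)"] by simp
    qed
    note sb = sbound_dilate[OF a sme c[of K]]
    have "smooth1 (\<lambda>y. of_real a * sampling_error \<tau> K (a * y + 0))" by (rule smooth1_cmult[OF smooth1_affine[OF sme]])
    from sbound_shift[OF this sb, of "x $ i"]
    have "sbound N ((1 + \<bar>x $ i\<bar>) ^ N * (max 1 a ^ (N + 1) * max 1 (1 / a) ^ N * (c * utail K))) (err K)"
      by (simp only: err_def[abs_def] add_0_right)
    then show ?thesis by (simp only: E_def mult_ac)
  qed
  obtain B where B: "\<And>j. sbound N (B j) (?G j)"
  proof -
    have "\<forall>j. \<exists>B. sbound N B (?G j)" using sG by (simp add: schw_def)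
    from choice[OF this] show ?thesis using that by blast
  qed
  define P where "P = (\<Prod>j\<in>UNIV - {i}. B j)"
  have "norm (T (tens (?G(i := err K)))) \<le> C * (E * (c * utail K) * P)" for K
  proof -
    have "norm (T (tens (?G(i := err K)))) \<le> C * (\<Prod>j\<in>UNIV. (B(i := E * (c * utail K))) j)"
    proof (rule C(2))
      show "schw ((?G(i := err K)) j)" for j by (cases "j = i") (simp_all only: fun_upd_same fun_upd_other sm_err sG not_False_eq_True)
      show "sbound N ((B(i := E * (c * utail K))) j) ((?G(i := err K)) j)" for j
        by (cases "j = i") (simp_all only: fun_upd_same fun_upd_other B err_sb not_False_eq_True)
    qed
    also have "(\<Prod>j\<in>UNIV. (B(i := E * (c * utail K))) j) = (B(i := E * (c * utail K))) i * (\<Prod>j\<in>UNIV - {i}. (B(i := E * (c * utail K))) j)"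
      by (rule prod.remove) (rule finite, rule UNIV_I)
    also have "(\<Prod>j\<in>UNIV - {i}. (B(i := E * (c * utail K))) j) = P"
      unfolding P_def
    proof (rule prod.cong[OF refl])
      fix j assume "j \<in> UNIV - {i}"
      then have "j \<noteq> i" by blast
      then show "(B(i := E * (c * utail K))) j = B j" by (rule fun_upd_other)
    qed
    also have "(B(i := E * (c * utail K))) i = E * (c * utail K)" by (rule fun_upd_same)
    finally show ?thesis .
  qed
  then have ev: "\<forall>\<^sub>F K in sequentially. norm (T (tens (?G(i := err K)))) \<le> C * (E * (c * utail K) * P)"
    by (intro always_eventually allI)
  have "(\<lambda>K. C * (E * (c * utail K) * P)) \<longlonglongrightarrow> C * (E * (c * 0) * P)"
    by (intro tendsto_intros utail_tendsto)
  then have "(\<lambda>K. C * (E * (c * utail K) * P)) \<longlonglongrightarrow> 0"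
    by (simp only: mult_zero_right mult_zero_left)
  with ev have "(\<lambda>K. T (tens (?G(i := err K)))) \<longlonglongrightarrow> 0" by (rule Lim_null_comparison)
  from tendsto_diff[OF tendsto_const[of "band a x"] this]
  show ?thesis unfolding T_err s_def by (simp only: diff_diff_eq2 diff_zero add_diff_cancel_left')
qed

end

subsection \<open>Identification of the representative\<close>

lemma ker_measurable [measurable]: "ker a \<in> borel_measurable borel"
  by (rule borel_measurable_continuous_onI[OF smooth1_continuous0[OF cc_smooth[OF cc_ker]]])

lemma ker_0: "5/4 \<le> \<bar>t\<bar> \<Longrightarrow> ker a t = 0"
  by (simp add: ker_def cutoff_0)

lemma ker_bounded: "\<exists>B>0. \<forall>t. norm (ker a t) \<le> B"
  using vdn_bounded[OF cc_schw[OF cc_ker[of a]], of 0] by force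

lemma theta_measurable [measurable]: "theta \<in> borel_measurable borel"
  by (rule borel_measurable_continuous_onI[OF smooth1_continuous0[OF schw_smooth[OF schw_theta]]])

lemma cutoff_measurable [measurable]: "cutoff \<in> borel_measurable borel"
  by (rule borel_measurable_continuous_onI[OF smooth1_continuous0[OF cc_smooth[OF cc_cutoff]]])

lemma vec_nth_measurable [measurable (raw)]:
  fixes f :: "'a \<Rightarrow> real ^ 'n::finite"
  assumes "f \<in> borel_measurable M"
  shows "(\<lambda>x. f x $ j) \<in> borel_measurable M"
proof -
  have "(\<lambda>x :: real ^ 'n. x $ j) \<in> borel_measurable borel"
    by (intro borel_measurable_continuous_onI continuous_intros)
  from measurable_compose[OF assms this] show ?thesis .
qed

lemma le_diff_iff_of_small: "\<bar>v\<bar> < \<bar>u - p\<bar> \<Longrightarrow> p \<le> u - v \<longleftrightarrow> p \<le> u" "\<bar>v\<bar> < \<bar>u - q\<bar> \<Longrightarrow> u - v \<le> q \<longleftrightarrow> u \<le> q" for u v p q :: real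
  by (auto simp: abs_if split: if_splits)

text \<open>The convolution of the truncated kernel with the indicator of an interval: the factor
  contributed by one coordinate when a mollification is integrated over a box.\<close>

definition kint :: "real \<Rightarrow> real \<Rightarrow> real \<Rightarrow> real \<Rightarrow> complex" where
  "kint a p q u = (LINT t|lborel. indicator {p..q} t *\<^sub>R ker a (u - t))"

lemma ker_integrable: "integrable lborel (\<lambda>t. indicator {p..q} t *\<^sub>R ker a (u - t))"
proof -
  obtain B where B: "\<And>t. norm (ker a t) \<le> B" using ker_bounded by blast
  have "integrable lborel (\<lambda>t. B * indicator {p..q} t :: real)"
    by (intro integrable_mult_right integrable_real_indicator) (auto simp: emeasure_lborel_Icc_eq)
  then show ?thesis
  proof (rule Bochner_Integration.integrable_bound)
    have "0 \<le> B" using B[of 0] norm_ge_zero order_trans by blast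
    then show "AE t in lborel. norm (indicator {p..q} t *\<^sub>R ker a (u - t)) \<le> norm (B * indicator {p..q} t)"
      using B by (intro always_eventually allI) (auto simp: indicator_def)
  qed measurable
qed

lemma kint_eq:
  assumes "0 < a"
  shows "kint a p q u = (LINT s|lborel. indicator {p..q} (u - s / a) *\<^sub>R (theta s * cutoff (s / a)))"
proof -
  have "kint a p q u = \<bar>- (1 / a)\<bar> *\<^sub>R (LINT s|lborel. indicator {p..q} (u + - (1 / a) * s) *\<^sub>R ker a (u - (u + - (1 / a) * s)))"
    unfolding kint_def by (rule lborel_integral_real_affine) (use assms in auto)
  also have "\<dots> = (LINT s|lborel. indicator {p..q} (u - s / a) *\<^sub>R (theta s * cutoff (s / a)))"
    using assms by (subst integral_scaleR_right[symmetric]) (simp add: ker_def dil_def scaleR_conv_of_real mult_ac)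
  finally show ?thesis .
qed

lemma kint_bounded: "\<exists>A>0. \<forall>a>0. \<forall>p q u. norm (kint a p q u) \<le> A"
proof -
  obtain D where D: "0 < D" "\<And>t. norm (cutoff t) \<le> D"
    using vdn_bounded[OF cc_schw[OF cc_cutoff], of 0] by force
  have "norm (kint a p q u) \<le> D * (LINT s|lborel. norm (theta s)) + 1" if a: "0 < a" for a p q u
  proof -
    have i: "integrable lborel (\<lambda>s. D * norm (theta s))" using theta_integrable by simp
    have b: "norm (indicator {p..q} (u - s / a) *\<^sub>R (theta s * cutoff (s / a))) \<le> D * norm (theta s)" for s
      using D mult_right_mono[OF D(2)[of "s/a"], of "norm (theta s)"] by (auto simp: indicator_def norm_mult mult.commute)
    have "integrable lborel (\<lambda>s. indicator {p..q} (u - s / a) *\<^sub>R (theta s * cutoff (s / a)))"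
    proof (rule Bochner_Integration.integrable_bound[OF i])
      show "AE s in lborel. norm (indicator {p..q} (u - s / a) *\<^sub>R (theta s * cutoff (s / a))) \<le> norm (D * norm (theta s))"
        unfolding real_norm_def by (intro always_eventually allI order_trans[OF b abs_ge_self])
    qed measurable
    from Bochner_Integration.integral_norm_bound_integral[OF this i b]
    have "norm (kint a p q u) \<le> (LINT s|lborel. D * norm (theta s))"
      unfolding kint_eq[OF a] .
    then show ?thesis by simp
  qed
  moreover have "0 < D * (LINT s|lborel. norm (theta s)) + 1" using D by (simp add: add_nonneg_pos)
  ultimately show ?thesis by blast
qed

lemma kint_0: "u < p - 5/4 \<or> q + 5/4 < u \<Longrightarrow> kint a p q u = 0"
  unfolding kint_def
  by (intro integral_eq_zero_AE always_eventually allI) (auto simp: indicator_def intro!: ker_0)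

text \<open>An approximate identity whose mass is given by \<open>theta_mass\<close>. Away from the
  endpoints the vanishing shift s / 2^m does not change the indicator.\<close>

lemma kint_tendsto:
  assumes u: "u \<noteq> p" "u \<noteq> q"
  shows "(\<lambda>m. kint (2 ^ m) p q u) \<longlonglongrightarrow> indicator {p..q} u"
proof -
  obtain D where D: "0 < D" "\<And>t. norm (cutoff t) \<le> D"
    using vdn_bounded[OF cc_schw[OF cc_cutoff], of 0] by force
  have s0: "(\<lambda>m. s / 2 ^ m) \<longlonglongrightarrow> 0" for s :: real
    by (rule LIMSEQ_divide_realpow_zero) simp
  have "(\<lambda>m. LINT s|lborel. indicator {p..q} (u - s / 2 ^ m) *\<^sub>R (theta s * cutoff (s / 2 ^ m))) \<longlonglongrightarrow>
     (LINT s|lborel. indicator {p..q} u *\<^sub>R theta s)"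
  proof (rule integral_dominated_convergence[where w="\<lambda>s. D * norm (theta s)"])
    show "integrable lborel (\<lambda>s. D * norm (theta s))" using theta_integrable by simp
    show "AE s in lborel. norm (indicator {p..q} (u - s / 2 ^ m) *\<^sub>R (theta s * cutoff (s / 2 ^ m))) \<le> D * norm (theta s)" for m
    proof (intro always_eventually allI)
      fix s show "norm (indicator {p..q} (u - s / 2 ^ m) *\<^sub>R (theta s * cutoff (s / 2 ^ m))) \<le> D * norm (theta s)"
        using D mult_right_mono[OF D(2)[of "s/2^m"], of "norm (theta s)"] by (auto simp: indicator_def norm_mult mult.commute)
    qed
    show "AE s in lborel. (\<lambda>m. indicator {p..q} (u - s / 2 ^ m) *\<^sub>R (theta s * cutoff (s / 2 ^ m))) \<longlonglongrightarrow> indicator {p..q} u *\<^sub>R theta s"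
    proof (intro always_eventually allI)
      fix s :: real
      \<comment> \<open>Below 3/4 the cutoff is 1; below the distances of u from the endpoints the
        shift keeps u on the same side of both.\<close>
      define e where "e = min (3/4) (min \<bar>u - p\<bar> \<bar>u - q\<bar>)"
      have "0 < e" using u by (simp add: e_def)
      from tendstoD[OF s0 this, of s]
      have "\<forall>\<^sub>F m in sequentially. \<bar>s / 2 ^ m\<bar> < e" by (simp add: dist_real_def)
      then have "\<forall>\<^sub>F m in sequentially. indicator {p..q} u *\<^sub>R theta s = indicator {p..q} (u - s / 2 ^ m) *\<^sub>R (theta s * cutoff (s / 2 ^ m))"
      proof eventually_elim
        case (elim m)
        then have "cutoff (s / 2 ^ m) = 1" by (intro cutoff_1) (simp add: e_def)
        moreover have "u - s / 2 ^ m \<in> {p..q} \<longleftrightarrow> u \<in> {p..q}"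
          using elim unfolding e_def min_less_iff_conj atLeastAtMost_iff by (simp only: le_diff_iff_of_small)
        ultimately show ?case by (simp add: indicator_def)
      qed
      then show "(\<lambda>m. indicator {p..q} (u - s / 2 ^ m) *\<^sub>R (theta s * cutoff (s / 2 ^ m))) \<longlonglongrightarrow> indicator {p..q} u *\<^sub>R theta s"
        by (rule Lim_transform_eventually[OF tendsto_const])
    qed
  qed measurable
  moreover have "(LINT s|lborel. indicator {p..q} u *\<^sub>R theta s) = indicator {p..q} u"
    by (simp add: theta_mass indicator_def)
  ultimately show ?thesis by (simp add: kint_eq)
qed

lemma prod_norm_le_power:
  fixes h :: "'n::finite \<Rightarrow> complex"
  assumes "\<And>j. norm (h j) \<le> A"
  shows "norm (\<Prod>j\<in>UNIV. h j) \<le> A ^ CARD('n)"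
proof -
  have "norm (\<Prod>j\<in>UNIV. h j) = (\<Prod>j\<in>UNIV. norm (h j))" by (rule prod_norm[symmetric])
  also have "\<dots> \<le> (\<Prod>j\<in>(UNIV::'n set). A)" using assms by (intro prod_mono) auto
  finally show ?thesis by simp
qed

lemma AE_coordinate_neq: "AE x in (lborel :: (real ^ 'n::finite) measure). x $ j \<noteq> c"
proof -
  have "negligible {x :: real ^ 'n. x $ j = c}"
    unfolding cart_eq_inner_axis by (rule negligible_standard_hyperplane) simp
  then have "AE x in (lebesgue :: (real ^ 'n) measure). x \<notin> {x. x $ j = c}"
    by (intro AE_not_in) (simp add: negligible_iff_null_sets)
  then show ?thesis unfolding AE_completion_iff by simp
qed

context tempered begin

context
  fixes g :: "real ^ 'n \<Rightarrow> complex" and R a :: real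
  assumes g_meas [measurable]: "g \<in> borel_measurable borel"
    and g_int: "\<And>p q. integrable lborel (\<lambda>y. indicator (cbox p q) y *\<^sub>R g y)"
    and T_g: "\<And>G. (\<And>j. cc (G j)) \<Longrightarrow> T (tens G) = (LINT y|lborel. g y * tens G y)"
    and supp: "distr_support (fourier_distr T) \<subseteq> {\<xi>. norm \<xi> \<le> R}" and R: "0 < R" "R \<le> a"
begin

text \<open>A convolution of \<open>g\<close> with a compactly supported kernel and also a value of
  T; this links \<open>g\<close> with \<open>band\<close>.\<close>

definition mollified :: "nat \<Rightarrow> real ^ 'n \<Rightarrow> complex" where
  "mollified m x = (LINT y|lborel. g y * (\<Prod>j\<in>UNIV. ker (2 ^ m) (y $ j - x $ j)))"

lemma mollified_eq: "mollified m x = T (tens (\<lambda>j y. ker (2 ^ m) (y - x $ j)))"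
proof -
  have "cc (\<lambda>y. ker (2 ^ m) (y - x $ j))" for j using cc_affine[OF cc_ker, of 1 "2 ^ m" "- x $ j"] by simp
  then show ?thesis by (subst T_g) (auto simp: mollified_def tens_def)
qed

lemma mollified_measurable [measurable]: "mollified m \<in> borel_measurable borel"
    unfolding mollified_def[abs_def] by (rule lborel.borel_measurable_lebesgue_integral) measurable

text \<open>\<open>band a\<close> does not change while the scale grows to 2^m, so it is compared
  with ever narrower truncated kernels. Uniformity on cubes allows integration over boxes.\<close>

lemma band_minus_mollified:
  "\<exists>C. \<exists>m0. \<forall>m\<ge>m0. \<forall>x. (\<forall>j. \<bar>x $ j\<bar> \<le> X) \<longrightarrow> norm (band a x - mollified m x) \<le> C / 2 ^ m"
proof -
  obtain C where C: "\<And>b x. 1 \<le> b \<Longrightarrow> (\<forall>j. \<bar>x $ j\<bar> \<le> X) \<Longrightarrow> norm (band b x - T (tens (\<lambda>j y. ker b (y - x $ j)))) \<le> C / b"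
    using band_approx[of X] by blast
  obtain m0 where m0: "R < 2 ^ m0" using real_arch_pow[of 2 R] by auto
  have "norm (band a x - mollified m x) \<le> C / 2 ^ m" if m: "m0 \<le> m" and x: "\<forall>j. \<bar>x $ j\<bar> \<le> X" for m x
  proof -
    have "(2::real) ^ m0 \<le> 2 ^ m" using m by (intro power_increasing) auto
    then have "R \<le> 2 ^ m" using m0 by linarith
    then have "band a x = band (2 ^ m) x" by (rule band_independent[OF supp R])
    then show ?thesis using C[of "2 ^ m" x] x by (simp add: mollified_eq)
  qed
  then show ?thesis by blast
qed

lemma mollified_tendsto: "(\<lambda>m. mollified m x) \<longlonglongrightarrow> band a x"
proof -
  have "\<forall>j. \<bar>x $ j\<bar> \<le> norm x" by (simp add: component_le_norm_cart)
  then obtain C m0 where "\<And>m. m0 \<le> m \<Longrightarrow> norm (band a x - mollified m x) \<le> C / 2 ^ m"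
    using band_minus_mollified[of "norm x"] by blast
  then have "\<forall>\<^sub>F m in sequentially. norm (band a x - mollified m x) \<le> C / 2 ^ m"
    by (intro eventually_mono[OF eventually_ge_at_top[of m0]])
  moreover have "(\<lambda>m. C / 2 ^ m) \<longlonglongrightarrow> 0"
    by (rule LIMSEQ_divide_realpow_zero) simp
  ultimately have "(\<lambda>m. band a x - mollified m x) \<longlonglongrightarrow> 0" by (rule Lim_null_comparison)
  from tendsto_diff[OF tendsto_const[of "band a x"] this] show ?thesis by simp
qed

lemma band_measurable: "band a \<in> borel_measurable borel"
  by (rule borel_measurable_LIMSEQ_metric[OF mollified_measurable]) (rule mollified_tendsto)

text \<open>Fubini's theorem moves the box onto the kernel, where it splits into one
  \<open>kint\<close> for each coordinate.\<close>

lemma mollified_box: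
  fixes p q :: "real ^ 'n" and m :: nat
  shows "integrable lborel (\<lambda>x. indicator (cbox p q) x *\<^sub>R mollified m x)" (is ?A)
    and "(LINT x|lborel. indicator (cbox p q) x *\<^sub>R mollified m x) = (LINT y|lborel. g y * (\<Prod>j\<in>UNIV. kint (2 ^ m) (p $ j) (q $ j) (y $ j)))" (is ?B)
proof -
  \<comment> \<open>The kernel vanishes beyond 5/4 in each coordinate, so only this enlarged box
    matters and local integrability of \<open>g\<close> suffices.\<close>
  let ?Q = "cbox (\<chi> j. p $ j - 5/4) (\<chi> j. q $ j + 5/4)"
  let ?f = "\<lambda>x y. indicator (cbox p q) x *\<^sub>R (g y * (\<Prod>j\<in>UNIV. ker (2 ^ m) (y $ j - x $ j)))"
  obtain B where B: "0 < B" "\<And>t. norm (ker (2 ^ m) t) \<le> B" using ker_bounded by blast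
  have bound: "norm (?f x y) \<le> indicator (cbox p q) x * (B ^ CARD('n) * norm (indicator ?Q y *\<^sub>R g y))" for x y
  proof (cases "x \<in> cbox p q \<and> y \<notin> ?Q")
    case True
    then obtain j where j: "\<not> (p $ j - 5/4 \<le> y $ j \<and> y $ j \<le> q $ j + 5/4)" by (auto simp: mem_box_cart)
    have "p $ j \<le> x $ j" "x $ j \<le> q $ j" using True by (auto simp: mem_box_cart)
    then have "ker (2 ^ m) (y $ j - x $ j) = 0" using j by (intro ker_0) linarith
    then have z: "(\<Prod>j\<in>UNIV. ker (2 ^ m) (y $ j - x $ j)) = 0" by (intro prod_zero bexI[of _ j]) auto
    show ?thesis unfolding z using B by simp
  next
    case False
    have "norm (\<Prod>j\<in>UNIV. ker (2 ^ m) (y $ j - x $ j)) \<le> B ^ CARD('n)" by (rule prod_norm_le_power) (rule B)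
    then have "norm (g y) * norm (\<Prod>j\<in>UNIV. ker (2 ^ m) (y $ j - x $ j)) \<le> norm (g y) * B ^ CARD('n)" by (intro mult_left_mono) auto
    then show ?thesis using False by (auto simp: norm_mult indicator_def mult.commute)
  qed
  have [measurable]: "(\<lambda>(x, y). ?f x y) \<in> borel_measurable (lborel \<Otimes>\<^sub>M lborel)" by measurable
  have int: "integrable (lborel \<Otimes>\<^sub>M lborel) (\<lambda>(x, y). ?f x y)"
    unfolding integrable_iff_bounded
  proof
    have "(\<integral>\<^sup>+z. ennreal (norm (case z of (x, y) \<Rightarrow> ?f x y)) \<partial>(lborel \<Otimes>\<^sub>M lborel)) = (\<integral>\<^sup>+x. \<integral>\<^sup>+y. ennreal (norm (?f x y)) \<partial>lborel \<partial>lborel)"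
      by (subst lborel.nn_integral_fst[symmetric]) auto
    also have "\<dots> \<le> (\<integral>\<^sup>+x. \<integral>\<^sup>+y. indicator (cbox p q) x * (ennreal (B ^ CARD('n)) * ennreal (norm (indicator ?Q y *\<^sub>R g y))) \<partial>lborel \<partial>(lborel :: (real ^ 'n) measure))"
    proof (intro nn_integral_mono)
      fix x y
      have "ennreal (norm (?f x y)) \<le> ennreal (indicator (cbox p q) x * (B ^ CARD('n) * norm (indicator ?Q y *\<^sub>R g y)))" by (intro ennreal_leI bound)
      also have "\<dots> = indicator (cbox p q) x * (ennreal (B ^ CARD('n)) * ennreal (norm (indicator ?Q y *\<^sub>R g y)))"
        using B by (simp add: ennreal_mult ennreal_indicator)
      finally show "ennreal (norm (?f x y)) \<le> indicator (cbox p q) x * (ennreal (B ^ CARD('n)) * ennreal (norm (indicator ?Q y *\<^sub>R g y)))" .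
    qed
    also have "\<dots> = emeasure lborel (cbox p q) * (ennreal (B ^ CARD('n)) * (\<integral>\<^sup>+y. ennreal (norm (indicator ?Q y *\<^sub>R g y)) \<partial>lborel))"
      by (simp add: nn_integral_cmult nn_integral_multc)
    also have "\<dots> < \<infinity>"
    proof -
      have "(\<integral>\<^sup>+y. ennreal (norm (indicator ?Q y *\<^sub>R g y)) \<partial>lborel) < \<infinity>" using g_int[of "\<chi> j. p $ j - 5/4" "\<chi> j. q $ j + 5/4"] unfolding integrable_iff_bounded by blast
      then show ?thesis using emeasure_lborel_cbox_finite[of p q] by (simp add: ennreal_mult_less_top)
    qed
    finally show "(\<integral>\<^sup>+z. ennreal (norm (case z of (x, y) \<Rightarrow> ?f x y)) \<partial>(lborel \<Otimes>\<^sub>M lborel)) < \<infinity>" .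
  qed measurable
  have m1: "(LINT y|lborel. ?f x y) = indicator (cbox p q) x *\<^sub>R mollified m x" for x
    unfolding mollified_def by (rule integral_scaleR_right)
  show ?A using lborel_pair.integrable_fst'[OF int] by (simp only: prod.case m1)
  have "(LINT x|lborel. indicator (cbox p q) x *\<^sub>R mollified m x) = (LINT x|lborel. LINT y|lborel. ?f x y)" by (simp only: m1)
  also have "\<dots> = (LINT y|lborel. LINT x|lborel. ?f x y)"
    using lborel_pair.Fubini_integral[OF int] by simp
  also have "\<dots> = (LINT y|lborel. g y * (\<Prod>j\<in>UNIV. kint (2 ^ m) (p $ j) (q $ j) (y $ j)))"
  proof (rule Bochner_Integration.integral_cong[OF refl])
    fix y :: "real ^ 'n"
    have "?f x y = g y * tens (\<lambda>j t. indicator {p $ j..q $ j} t *\<^sub>R ker (2 ^ m) (y $ j - t)) x" for x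
    proof (cases "x \<in> cbox p q")
      case True
      then have ind: "indicator {p $ j..q $ j} (x $ j) = (1::real)" for j by (simp add: mem_box_cart)
      show ?thesis unfolding tens_def ind using True by simp
    next
      case False
      then obtain j where "x $ j \<notin> {p $ j..q $ j}" unfolding mem_box_cart atLeastAtMost_iff by blast
      then have "(\<Prod>j\<in>UNIV. indicator {p $ j..q $ j} (x $ j) *\<^sub>R ker (2 ^ m) (y $ j - x $ j)) = 0"
        by (intro prod_zero bexI[of _ j]) (simp_all only: indicator_simps scaleR_zero_left not_False_eq_True finite UNIV_I)
      then show ?thesis unfolding tens_def using False by simp
    qed
    then have "(LINT x|lborel. ?f x y) = g y * (LINT x|lborel. tens (\<lambda>j t. indicator {p $ j..q $ j} t *\<^sub>R ker (2 ^ m) (y $ j - t)) x)"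
      by simp
    also have "\<dots> = g y * (\<Prod>j\<in>UNIV. kint (2 ^ m) (p $ j) (q $ j) (y $ j))"
      by (subst lborel_integral_tens) (auto simp: ker_integrable kint_def)
    finally show "(LINT x|lborel. ?f x y) = g y * (\<Prod>j\<in>UNIV. kint (2 ^ m) (p $ j) (q $ j) (y $ j))" .
  qed
  finally show ?B .
qed

text \<open>The factors are uniformly bounded and converge off the boundary hyperplanes, which are
  null sets. Convergence of these integrals is all that is asked of the mollification.\<close>

lemma mollified_box_tendsto:
  "(\<lambda>m. LINT x|lborel. indicator (cbox p q) x *\<^sub>R mollified m x) \<longlonglongrightarrow> (LINT x|lborel. indicator (cbox p q) x *\<^sub>R g x)"
proof -
  let ?Q = "cbox (\<chi> j. p $ j - 5/4) (\<chi> j. q $ j + 5/4)"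
  obtain A where A: "0 < A" "\<And>a p q u. 0 < a \<Longrightarrow> norm (kint a p q u) \<le> A" using kint_bounded by blast
  have kint_meas [measurable]: "kint b p q \<in> borel_measurable borel" for b p q
    unfolding kint_def[abs_def] by (rule lborel.borel_measurable_lebesgue_integral) measurable
  have "(\<lambda>m. LINT y|lborel. g y * (\<Prod>j\<in>UNIV. kint (2 ^ m) (p $ j) (q $ j) (y $ j))) \<longlonglongrightarrow> (LINT y|lborel. indicator (cbox p q) y *\<^sub>R g y)"
  proof (rule integral_dominated_convergence[where w="\<lambda>y. A ^ CARD('n) * norm (indicator ?Q y *\<^sub>R g y)"])
    show "integrable lborel (\<lambda>y. A ^ CARD('n) * norm (indicator ?Q y *\<^sub>R g y))"
      by (intro integrable_mult_right integrable_norm g_int)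
    show "AE y in lborel. norm (g y * (\<Prod>j\<in>UNIV. kint (2 ^ m) (p $ j) (q $ j) (y $ j))) \<le> A ^ CARD('n) * norm (indicator ?Q y *\<^sub>R g y)" for m
    proof (intro always_eventually allI)
      fix y :: "real ^ 'n"
      show "norm (g y * (\<Prod>j\<in>UNIV. kint (2 ^ m) (p $ j) (q $ j) (y $ j))) \<le> A ^ CARD('n) * norm (indicator ?Q y *\<^sub>R g y)"
      proof (cases "y \<in> ?Q")
        case True
        have "norm (\<Prod>j\<in>UNIV. kint (2 ^ m) (p $ j) (q $ j) (y $ j)) \<le> A ^ CARD('n)" by (rule prod_norm_le_power) (rule A, simp)
        then have "norm (g y) * norm (\<Prod>j\<in>UNIV. kint (2 ^ m) (p $ j) (q $ j) (y $ j)) \<le> norm (g y) * A ^ CARD('n)" by (intro mult_left_mono) auto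
        then show ?thesis using True by (simp add: norm_mult mult.commute)
      next
        case False
        then obtain j where "\<not> (p $ j - 5/4 \<le> y $ j \<and> y $ j \<le> q $ j + 5/4)" by (auto simp: mem_box_cart)
        then have "kint (2 ^ m) (p $ j) (q $ j) (y $ j) = 0" by (intro kint_0) linarith
        then have z: "(\<Prod>j\<in>UNIV. kint (2 ^ m) (p $ j) (q $ j) (y $ j)) = 0" by (intro prod_zero bexI[of _ j]) auto
        show ?thesis unfolding z using A by simp
      qed
    qed
    have "AE y in (lborel :: (real ^ 'n) measure). \<forall>j\<in>UNIV. y $ j \<noteq> p $ j \<and> y $ j \<noteq> q $ j"
      by (intro AE_finite_allI) (auto intro!: AE_conjI AE_coordinate_neq)
    then show "AE y in lborel. (\<lambda>m. g y * (\<Prod>j\<in>UNIV. kint (2 ^ m) (p $ j) (q $ j) (y $ j))) \<longlonglongrightarrow> indicator (cbox p q) y *\<^sub>R g y"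
    proof eventually_elim
      case (elim y)
      have "(\<lambda>m. g y * (\<Prod>j\<in>UNIV. kint (2 ^ m) (p $ j) (q $ j) (y $ j))) \<longlonglongrightarrow> g y * (\<Prod>j\<in>UNIV. indicator {p $ j..q $ j} (y $ j))"
        using elim by (intro tendsto_mult_left tendsto_prod kint_tendsto) auto
      moreover have "(\<Prod>j\<in>UNIV. indicator {p $ j..q $ j} (y $ j)) = (indicator (cbox p q) y :: complex)"
      proof (cases "y \<in> cbox p q")
        case True
        then show ?thesis by (simp add: mem_box_cart)
      next
        case False
        then obtain j where "y $ j \<notin> {p $ j..q $ j}" unfolding mem_box_cart atLeastAtMost_iff by blast
        then have "indicator {p $ j..q $ j} (y $ j) = (0::complex)" by (rule indicator_simps(2))
        then have "(\<Prod>j\<in>UNIV. indicator {p $ j..q $ j} (y $ j)) = (0::complex)" by (intro prod_zero bexI[of _ j]) auto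
        then show ?thesis using False by simp
      qed
      ultimately have "(\<lambda>m. g y * (\<Prod>j\<in>UNIV. kint (2 ^ m) (p $ j) (q $ j) (y $ j))) \<longlonglongrightarrow> g y * indicator (cbox p q) y"
        by (simp only:)
      then show ?case by (cases "y \<in> cbox p q") (simp_all only: indicator_simps mult_1_right mult_zero_right scaleR_one scaleR_zero_left not_False_eq_True)
    qed
  qed measurable
  then show ?thesis by (simp add: mollified_box(2))
qed

text \<open>Both integrals are limits of the box integrals of the mollifications, one by uniform
  approximation and one by \<open>mollified_box_tendsto\<close>.\<close>

lemma band_box:
  shows "integrable lborel (\<lambda>x. indicator (cbox p q) x *\<^sub>R band a x)"
    and "(LINT x|lborel. indicator (cbox p q) x *\<^sub>R band a x) = (LINT x|lborel. indicator (cbox p q) x *\<^sub>R g x)"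
proof -
  note [measurable] = band_measurable
  define X where "X = norm p + norm q"
  have X: "\<forall>j. \<bar>x $ j\<bar> \<le> X" if "x \<in> cbox p q" for x
  proof
    fix j
    have "p $ j \<le> x $ j" "x $ j \<le> q $ j" using that by (auto simp: mem_box_cart)
    moreover have "\<bar>p $ j\<bar> \<le> norm p" "\<bar>q $ j\<bar> \<le> norm q" by (simp_all add: component_le_norm_cart)
    ultimately show "\<bar>x $ j\<bar> \<le> X" unfolding X_def by linarith
  qed
  obtain C m0 where C: "\<And>m x. m0 \<le> m \<Longrightarrow> (\<forall>j. \<bar>x $ j\<bar> \<le> X) \<Longrightarrow> norm (band a x - mollified m x) \<le> C / 2 ^ m"
    using band_minus_mollified[of X] by blast
  have le: "norm (indicator (cbox p q) x *\<^sub>R (band a x - mollified m x)) \<le> (C / 2 ^ m) * indicator (cbox p q) x" if "m0 \<le> m" for m x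
    using C[OF that X, of x] by (auto simp: indicator_def)
  have icb: "integrable lborel (\<lambda>x. c * indicator (cbox p q) x :: real)" for c
    using emeasure_lborel_cbox_finite[of p q] by (intro integrable_mult_right integrable_real_indicator) auto
  have idiff: "integrable lborel (\<lambda>x. indicator (cbox p q) x *\<^sub>R (band a x - mollified m x))" if "m0 \<le> m" for m
  proof (rule Bochner_Integration.integrable_bound[OF icb[of "C / 2 ^ m"]])
    show "AE x in lborel. norm (indicator (cbox p q) x *\<^sub>R (band a x - mollified m x)) \<le> norm (C / 2 ^ m * indicator (cbox p q) x)"
      unfolding real_norm_def by (intro always_eventually allI order_trans[OF le[OF that] abs_ge_self])
  qed measurable
  have "integrable lborel (\<lambda>x. indicator (cbox p q) x *\<^sub>R (band a x - mollified m0 x) + indicator (cbox p q) x *\<^sub>R mollified m0 x)"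
    by (intro Bochner_Integration.integrable_add idiff mollified_box) simp
  then show int: "integrable lborel (\<lambda>x. indicator (cbox p q) x *\<^sub>R band a x)" by (simp add: scaleR_diff_right)
  have "\<forall>\<^sub>F m in sequentially. norm ((LINT x|lborel. indicator (cbox p q) x *\<^sub>R band a x) - (LINT x|lborel. indicator (cbox p q) x *\<^sub>R mollified m x)) \<le> C / 2 ^ m * measure lborel (cbox p q)"
    using eventually_ge_at_top[of m0]
  proof eventually_elim
    case (elim m)
    have "(LINT x|lborel. indicator (cbox p q) x *\<^sub>R band a x) - (LINT x|lborel. indicator (cbox p q) x *\<^sub>R mollified m x)
       = (LINT x|lborel. indicator (cbox p q) x *\<^sub>R (band a x - mollified m x))"
      unfolding scaleR_diff_right by (rule Bochner_Integration.integral_diff[symmetric]) (rule int, rule mollified_box)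
    also have "norm \<dots> \<le> (LINT x|lborel. (C / 2 ^ m) * indicator (cbox p q) x)"
      by (rule Bochner_Integration.integral_norm_bound_integral[OF idiff[OF elim] icb]) (rule le[OF elim])
    finally show ?case by simp
  qed
  moreover have "(\<lambda>m. C / 2 ^ m * measure lborel (cbox p q)) \<longlonglongrightarrow> 0"
    unfolding times_divide_eq_left by (rule LIMSEQ_divide_realpow_zero) simp
  ultimately have "(\<lambda>m. (LINT x|lborel. indicator (cbox p q) x *\<^sub>R band a x) - (LINT x|lborel. indicator (cbox p q) x *\<^sub>R mollified m x)) \<longlonglongrightarrow> 0"
    by (rule Lim_null_comparison)
  moreover have "(\<lambda>m. (LINT x|lborel. indicator (cbox p q) x *\<^sub>R band a x) - (LINT x|lborel. indicator (cbox p q) x *\<^sub>R mollified m x)) \<longlonglongrightarrow>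
     (LINT x|lborel. indicator (cbox p q) x *\<^sub>R band a x) - (LINT x|lborel. indicator (cbox p q) x *\<^sub>R g x)"
    by (intro tendsto_diff tendsto_const mollified_box_tendsto)
  ultimately show "(LINT x|lborel. indicator (cbox p q) x *\<^sub>R band a x) = (LINT x|lborel. indicator (cbox p q) x *\<^sub>R g x)"
    using LIMSEQ_unique by fastforce
qed

text \<open>All box integrals of the difference vanish, so it is 0 almost everywhere by Lebesgue's
  differentiation theorem on cubes.\<close>

lemma band_eq_AE: "AE x in lborel. g x = band a x"
proof -
  define h where "h x = g x - band a x" for x
  have set_int: "set_integrable lborel (cbox p q) h" for p q
    unfolding set_integrable_def h_def scaleR_diff_right by (intro Bochner_Integration.integrable_diff g_int band_box)
  have ion: "h integrable_on cbox p q" for p q by (rule set_borel_integral_eq_integral(1)[OF set_int])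
  have int0: "integral (cbox p q) h = 0" for p q
  proof -
    have "integral (cbox p q) h = (LINT x|lborel. indicator (cbox p q) x *\<^sub>R h x)"
      using set_borel_integral_eq_integral(2)[OF set_int, of p q] by (simp add: set_lebesgue_integral_def)
    also have "\<dots> = 0"
      unfolding h_def scaleR_diff_right by (subst Bochner_Integration.integral_diff) (auto simp: g_int band_box)
    finally show ?thesis .
  qed
  obtain N where N: "negligible N" and lim: "\<And>x e. x \<notin> N \<Longrightarrow> 0 < e \<Longrightarrow>
      \<exists>d>0. \<forall>t. 0 < t \<and> t < d \<longrightarrow> norm (integral (cbox x (x + t *\<^sub>R One)) h /\<^sub>R t ^ DIM(real ^ 'n) - h x) < e"
    using integrable_ccontinuous_explicit[of h, OF ion] by blast
  have "h x = 0" if "x \<notin> N" for x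
  proof (rule ccontr)
    assume "h x \<noteq> 0"
    then have "0 < norm (h x)" by simp
    from lim[OF that this] obtain d where "0 < d" "\<And>t. 0 < t \<Longrightarrow> t < d \<Longrightarrow> norm (integral (cbox x (x + t *\<^sub>R One)) h /\<^sub>R t ^ DIM(real ^ 'n) - h x) < norm (h x)" by blast
    from this(2)[of "d / 2"] this(1) show False by (simp add: int0)
  qed
  moreover have "AE x in lebesgue. x \<notin> N" using N by (intro AE_not_in) (simp add: negligible_iff_null_sets)
  ultimately have "AE x in lebesgue. g x = band a x" by (auto simp: h_def elim!: eventually_mono)
  then show ?thesis by (simp only: AE_completion_iff)
qed

end

end

subsection \<open>The sub-mean value property\<close>

text \<open>Write z^d = z z^(d - 1); the second factor is decreasing for d \<le> 1.\<close>

lemma powr_add_subadditive: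
  fixes x y d :: real
  assumes "0 \<le> x" "0 \<le> y" "d \<le> 1"
  shows "(x + y) powr d \<le> x powr d + y powr d"
proof (cases "x = 0 \<or> y = 0")
  case False
  then have xy: "0 < x" "0 < y" using assms by auto
  have split: "z powr d = z * z powr (d - 1)" if "0 < z" for z :: real
    using that by (simp add: powr_diff)
  have "x * (x + y) powr (d - 1) \<le> x * x powr (d - 1)" "y * (x + y) powr (d - 1) \<le> y * y powr (d - 1)"
    using xy assms by (auto intro!: mult_left_mono powr_mono2')
  from add_mono[OF this] show ?thesis using xy by (simp only: split distrib_right add_pos_pos)
qed auto

lemma powr_sum_subadditive:
  fixes h :: "'a \<Rightarrow> real"
  assumes "finite A" "\<And>i. i \<in> A \<Longrightarrow> 0 \<le> h i" "d \<le> 1"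
  shows "(\<Sum>i\<in>A. h i) powr d \<le> (\<Sum>i\<in>A. h i powr d)"
  using assms(1,2)
proof (induction A)
  case (insert i A)
  have "(h i + (\<Sum>i\<in>A. h i)) powr d \<le> h i powr d + (\<Sum>i\<in>A. h i) powr d"
    by (rule powr_add_subadditive[OF _ sum_nonneg assms(3)]) (simp_all add: insert.prems)
  also have "\<dots> \<le> h i powr d + (\<Sum>i\<in>A. h i powr d)"
    by (rule add_left_mono[OF insert.IH]) (simp add: insert.prems)
  finally show ?case using insert.hyps by simp
qed simp

text \<open>The translates of [0, 1) by distinct integers are disjoint.\<close>

lemma nn_integral_periodized_sum_le:
  fixes u :: "real \<Rightarrow> ennreal"
  assumes [measurable]: "u \<in> borel_measurable borel" and "finite A"
  shows "(\<integral>\<^sup>+\<tau>. indicator {0..<1} \<tau> * (\<Sum>k\<in>A. u (\<tau> + of_int k)) \<partial>lborel) \<le> (\<integral>\<^sup>+y. u y \<partial>lborel)"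
proof -
  have "(\<integral>\<^sup>+\<tau>. indicator {0..<1} \<tau> * (\<Sum>k\<in>A. u (\<tau> + of_int k)) \<partial>lborel)
      = (\<Sum>k\<in>A. \<integral>\<^sup>+\<tau>. indicator {0..<1} \<tau> * u (\<tau> + of_int k) \<partial>lborel)"
    unfolding sum_distrib_left by (rule nn_integral_sum) measurable
  also have "\<dots> = (\<Sum>k\<in>A. \<integral>\<^sup>+y. indicator {of_int k..<of_int k + 1} y * u y \<partial>lborel)"
  proof (rule sum.cong[OF refl])
    fix k :: int
    have m: "(\<lambda>y. indicator {of_int k..<of_int k + 1} y * u y) \<in> borel_measurable borel" by measurable
    have "(\<integral>\<^sup>+y. indicator {of_int k..<of_int k + 1} y * u y \<partial>lborel)
        = ennreal \<bar>1\<bar> * (\<integral>\<^sup>+\<tau>. indicator {of_int k..<of_int k + 1} (of_int k + 1 * \<tau>) * u (of_int k + 1 * \<tau>) \<partial>lborel)"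
      by (rule nn_integral_real_affine[OF m one_neq_zero])
    also have "\<dots> = (\<integral>\<^sup>+\<tau>. indicator {0..<1} \<tau> * u (\<tau> + of_int k) \<partial>lborel)"
      unfolding abs_one ennreal_1 mult_1_left
      by (intro nn_integral_cong) (simp only: indicator_def atLeastLessThan_iff mult_1_left add.commute le_add_same_cancel2 add_less_cancel_right)
    finally show "(\<integral>\<^sup>+\<tau>. indicator {0..<1} \<tau> * u (\<tau> + of_int k) \<partial>lborel) = (\<integral>\<^sup>+y. indicator {of_int k..<of_int k + 1} y * u y \<partial>lborel)" ..
  qed
  also have "\<dots> = (\<integral>\<^sup>+y. (\<Sum>k\<in>A. indicator {of_int k..<of_int k + 1} y * u y) \<partial>lborel)"
    by (rule nn_integral_sum[symmetric]) measurable
  also have "\<dots> \<le> (\<integral>\<^sup>+y. u y \<partial>lborel)"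
  proof (rule nn_integral_mono)
    fix y :: real
    have "(\<Sum>k\<in>A. indicator {of_int k..<of_int k + 1} y * u y) = (\<Sum>k\<in>A. if k = \<lfloor>y\<rfloor> then u y else 0)"
    proof (rule sum.cong[OF refl])
      fix k
      have k: "k = \<lfloor>y\<rfloor> \<longleftrightarrow> y \<in> {of_int k..<of_int k + 1}"
        unfolding eq_commute[of k] floor_eq_iff atLeastLessThan_iff ..
      show "indicator {of_int k..<of_int k + 1} y * u y = (if k = \<lfloor>y\<rfloor> then u y else 0)"
      proof (cases "y \<in> {of_int k..<of_int k + 1}")
        case True
        show ?thesis unfolding indicator_simps(1)[OF True] if_P[OF k[THEN iffD2, OF True]] by (rule mult_1_left)
      next
        case False
        then have "k \<noteq> \<lfloor>y\<rfloor>" using k by blast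
        then show ?thesis by (simp only: indicator_simps(2)[OF False] mult_zero_left if_False)
      qed
    qed
    also have "\<dots> \<le> u y" using \<open>finite A\<close> by (simp add: sum.delta)
    finally show "(\<Sum>k\<in>A. indicator {of_int k..<of_int k + 1} y * u y) \<le> u y" .
  qed
  finally show ?thesis .
qed

lemma fcoef_kappa_powr_decay:
  assumes "0 < d"
  shows "\<exists>C>0. \<forall>y. norm (fcoef kappa y) powr d \<le> C * wt N y"
proof -
  \<comment> \<open>The d-th power reduces decay of order M to order M d, which still has to reach
    N.\<close>
  define M where "M = nat \<lceil>N / d\<rceil>"
  obtain B where B: "0 < B" "\<And>y. norm (fcoef kappa y) \<le> B / (1 + \<bar>y\<bar>) ^ M"
    using fcoef_decay[OF cc_kappa, of M] by blast
  have "N / d \<le> real M" unfolding M_def by linarith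
  then have M: "N \<le> real M * d" using assms by (simp add: pos_divide_le_eq)
  have "norm (fcoef kappa y) powr d \<le> B powr d * wt N y" for y
  proof -
    have "norm (fcoef kappa y) powr d \<le> (B / (1 + \<bar>y\<bar>) ^ M) powr d" using assms by (intro powr_mono2 B) auto
    also have "(1 + \<bar>y\<bar>) ^ M = (1 + \<bar>y\<bar>) powr real M" by (simp add: powr_realpow add_pos_nonneg)
    also have "(B / (1 + \<bar>y\<bar>) powr real M) powr d = B powr d * (1 + \<bar>y\<bar>) powr (- (real M * d))"
      using B by (simp add: powr_divide powr_powr powr_minus_divide)
    also have "\<dots> \<le> B powr d * (1 + \<bar>y\<bar>) powr (- N)" using M by (intro mult_left_mono powr_mono) auto
    finally show ?thesis by (simp only: wt_def)
  qed
  moreover have "0 < B powr d" using B by simp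
  ultimately show ?thesis by blast
qed

text \<open>Sampling holds for every \<tau>, and subadditivity turns it into a bound for the d-th
  power. Integration over \<tau> in [0, 1) unfolds the sum over k to the line; Fatou's lemma handles
  the limit of the partial sums, whose convergence to a finite value is not known.\<close>

lemma (in tempered) band_submean:
  fixes j :: int
  assumes d: "0 < d" "d \<le> 1" and C: "0 \<le> C" "\<And>y. norm (fcoef kappa y) powr d \<le> C * wt N y"
    and [measurable]: "band (2 powr of_int j) \<in> borel_measurable borel"
  shows "submean C N j i (\<lambda>x. ennpow (ennreal (norm (band (2 powr of_int j) x))) d)"
  unfolding submean_def
proof
  fix x :: "real ^ 'n"
  define a where "a = (2::real) powr of_int j"
  have a: "0 < a" by (simp add: a_def)
  have [measurable]: "band a \<in> borel_measurable borel" by (simp add: a_def)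
  define \<Phi> where "\<Phi> z = ennreal (norm (band a z) powr d)" for z
  have [measurable]: "\<Phi> \<in> borel_measurable borel" unfolding \<Phi>_def by measurable
  have \<Phi>: "ennpow (ennreal (norm (band a z))) d = \<Phi> z" for z by (simp add: \<Phi>_def ennpow_ennreal)
  define u where "u y = ennreal (C * wt N y) * \<Phi> (upd x i (x $ i + y / a))" for y
  have [measurable]: "u \<in> borel_measurable borel" unfolding u_def by measurable
  let ?S = "\<lambda>K \<tau>. \<Sum>k\<in>{- int K..int K}. u (\<tau> + of_int k)"
  have pointwise: "\<Phi> x \<le> liminf (\<lambda>K. ?S K \<tau>)" if \<tau>: "0 \<le> \<tau>" "\<tau> < 1" for \<tau>
  proof -
    let ?P = "\<lambda>K. \<Sum>k\<in>{-int K..int K}. fcoef kappa (\<tau> + of_int k) * band a (upd x i (x $ i + (\<tau> + of_int k) / a))"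
    have "?P \<longlonglongrightarrow> band a x" using \<tau> by (intro band_sampling a) auto
    then have "(\<lambda>K. ennreal (norm (?P K) powr d)) \<longlonglongrightarrow> \<Phi> x"
      unfolding \<Phi>_def using d by (intro tendsto_ennrealI tendsto_powr' tendsto_norm tendsto_const) auto
    then have "\<Phi> x = liminf (\<lambda>K. ennreal (norm (?P K) powr d))" by (intro lim_imp_Liminf[symmetric]) auto
    also have "\<dots> \<le> liminf (\<lambda>K. ?S K \<tau>)"
    proof (intro Liminf_mono always_eventually allI)
      fix K
      let ?c = "\<lambda>k. norm (fcoef kappa (\<tau> + of_int k))" and ?b = "\<lambda>k. norm (band a (upd x i (x $ i + (\<tau> + of_int k) / a)))"
      have "norm (?P K) \<le> (\<Sum>k\<in>{-int K..int K}. ?c k * ?b k)"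
        using norm_sum[of "\<lambda>k. fcoef kappa (\<tau> + of_int k) * band a (upd x i (x $ i + (\<tau> + of_int k) / a))" "{-int K..int K}"] by (simp only: norm_mult)
      then have "norm (?P K) powr d \<le> (\<Sum>k\<in>{-int K..int K}. ?c k * ?b k) powr d" using d by (intro powr_mono2) auto
      also have "\<dots> \<le> (\<Sum>k\<in>{-int K..int K}. (?c k * ?b k) powr d)" using d by (intro powr_sum_subadditive) auto
      also have "\<dots> \<le> (\<Sum>k\<in>{-int K..int K}. C * wt N (\<tau> + of_int k) * ?b k powr d)"
        using C by (intro sum_mono) (simp add: powr_mult mult_right_mono)
      finally have "ennreal (norm (?P K) powr d) \<le> ennreal (\<Sum>k\<in>{-int K..int K}. C * wt N (\<tau> + of_int k) * ?b k powr d)"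
        by (rule ennreal_leI)
      also have "\<dots> = (\<Sum>k\<in>{-int K..int K}. ennreal (C * wt N (\<tau> + of_int k) * ?b k powr d))"
        using C by (intro sum_ennreal[symmetric]) auto
      also have "\<dots> = ?S K \<tau>" using C by (intro sum.cong refl) (simp add: u_def \<Phi>_def ennreal_mult)
      finally show "ennreal (norm (?P K) powr d) \<le> ?S K \<tau>" .
    qed
    finally show ?thesis .
  qed
  have "\<Phi> x = (\<integral>\<^sup>+\<tau>. indicator {0..<1::real} \<tau> * \<Phi> x \<partial>lborel)" by (simp add: nn_integral_multc)
  also have "\<dots> \<le> (\<integral>\<^sup>+\<tau>. liminf (\<lambda>K. indicator {0..<1} \<tau> * ?S K \<tau>) \<partial>lborel)"
    using pointwise by (intro nn_integral_mono) (auto simp: indicator_def)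
  also have "\<dots> \<le> liminf (\<lambda>K. \<integral>\<^sup>+\<tau>. indicator {0..<1} \<tau> * ?S K \<tau> \<partial>lborel)" by (rule nn_integral_liminf) measurable
  also have "\<dots> \<le> liminf (\<lambda>K::nat. \<integral>\<^sup>+y. u y \<partial>lborel)"
    by (intro Liminf_mono always_eventually allI nn_integral_periodized_sum_le) auto
  also have "\<dots> = (\<integral>\<^sup>+y. u y \<partial>lborel)" by (rule Liminf_const) simp
  also have "\<dots> = (\<integral>\<^sup>+y. ennreal C * (\<Phi> (upd x i (x $ i + 2 powr (- of_int j) * y)) * ennreal (wt N y)) \<partial>lborel)"
    using C by (intro nn_integral_cong) (simp add: u_def a_def ennreal_mult powr_minus_divide mult_ac)
  also have "\<dots> = ennreal C * (\<integral>\<^sup>+y. \<Phi> (upd x i (x $ i + 2 powr (- of_int j) * y)) * ennreal (wt N y) \<partial>lborel)"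
    by (rule nn_integral_cmult) measurable
  finally show "ennpow (ennreal (norm (band (2 powr of_int j) x))) d \<le> ennreal C *
    (\<integral>\<^sup>+y. ennpow (ennreal (norm (band (2 powr of_int j) (upd x i (x $ i + 2 powr (- of_int j) * y))))) d * ennreal (wt N y) \<partial>lborel)"
    unfolding \<Phi>[unfolded a_def] .
qed

subsection \<open>The embedding\<close>

lemma enn2real_inverse_scaled:
  assumes "0 < x" "0 < d"
  shows "enn2real (1 / (x / ennreal d)) = d * enn2real (1 / x)"
proof (cases x)
  case (real y)
  then have "0 < y" using assms by simp
  then have "1 / (x / ennreal d) = ennreal (d / y)" "1 / x = ennreal (1 / y)"
    using assms real by (simp_all add: divide_ennreal flip: ennreal_1)
  then show ?thesis using assms \<open>0 < y\<close> by simp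
next
  case top
  then show ?thesis by (simp add: ennreal_top_divide)
qed

lemma one_le_scaled:
  assumes "ennreal d \<le> x" "0 < d"
  shows "1 \<le> x / ennreal d"
proof (cases x)
  case (real y)
  then show ?thesis using assms by (simp add: divide_ennreal flip: ennreal_1)
next
  case top
  then show ?thesis by (simp add: ennreal_top_divide)
qed

lemma enn2real_inverse_antimono:
  assumes "0 < x" "x \<le> y"
  shows "enn2real (1 / y) \<le> enn2real (1 / x)"
proof (cases y)
  case (real b)
  then obtain a where a: "x = ennreal a" "0 \<le> a" using assms by (cases x) (auto simp: top_unique)
  then have "0 < a" "a \<le> b" using assms real by (auto simp: ennreal_le_iff)
  moreover from this have "1 / x = ennreal (1 / a)" "1 / y = ennreal (1 / b)"
    using a real by (simp_all add: divide_ennreal flip: ennreal_1)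
  ultimately show ?thesis by (simp add: frac_le)
qed simp

lemma eventually_ennreal_le:
  assumes "0 < x"
  shows "\<forall>\<^sub>F d in at_right 0. ennreal d \<le> x"
proof (cases x)
  case (real y)
  show ?thesis
    by (rule eventually_at_rightI[of _ y]) (use assms real in \<open>auto simp: ennreal_le_iff\<close>)
qed simp

text \<open>Finitely many conditions, each true for all sufficiently small d > 0.\<close>

lemma ex_small_exponent:
  fixes p r \<theta> :: "ennreal ^ 'n::finite" and e :: "'n \<Rightarrow> real"
  assumes "\<And>i. 0 < p $ i" "\<And>i. 0 < r $ i" "\<And>i. 0 < \<theta> $ i"
  shows "\<exists>d>0. d \<le> 1 \<and> (\<forall>i. ennreal d \<le> p $ i \<and> ennreal d \<le> r $ i \<and> ennreal d \<le> \<theta> $ i \<and> d * e i < 1)"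
proof -
  have e: "\<forall>\<^sub>F d in at_right 0. d * e i < 1" for i
  proof -
    have "((\<lambda>d. d * e i) \<longlongrightarrow> 0 * e i) (at_right 0)" by (intro tendsto_intros)
    then show ?thesis by (rule order_tendstoD(2)) simp
  qed
  have "\<forall>\<^sub>F d in at_right 0. 0 < d \<and> d \<le> 1 \<and>
      (\<forall>i\<in>UNIV. ennreal d \<le> p $ i \<and> ennreal d \<le> r $ i \<and> ennreal d \<le> \<theta> $ i \<and> d * e i < 1)"
  proof (intro eventually_conj eventually_ball_finite ballI eventually_ennreal_le assms e finite)
    show "\<forall>\<^sub>F d in at_right (0::real). 0 < d" by (rule eventually_at_right_less)
    show "\<forall>\<^sub>F d in at_right (0::real). d \<le> 1" by (rule eventually_at_rightI[of _ 1]) auto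
  qed
  from eventually_happens'[OF _ this] show ?thesis by auto
qed

lemma ex_borel_representative:
  fixes f :: "real ^ 'n::finite \<Rightarrow> complex"
  assumes [measurable]: "f \<in> borel_measurable lebesgue"
  shows "\<exists>g\<in>borel_measurable borel. AE x in lborel. f x = g x"
proof -
  have "(\<lambda>x. Re (f x)) \<in> borel_measurable (completion lborel)" by measurable
  from completion_ex_borel_measurable_real[OF this]
  obtain u where [measurable]: "u \<in> borel_measurable lborel" and u: "AE x in lborel. Re (f x) = u x" by blast
  have "(\<lambda>x. Im (f x)) \<in> borel_measurable (completion lborel)" by measurable
  from completion_ex_borel_measurable_real[OF this]
  obtain v where [measurable]: "v \<in> borel_measurable lborel" and v: "AE x in lborel. Im (f x) = v x" by blast
  have "(\<lambda>x. of_real (u x) + \<i> * of_real (v x)) \<in> borel_measurable borel" by measurable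
  moreover have "AE x in lborel. f x = of_real (u x) + \<i> * of_real (v x)"
    using u v by eventually_elim (simp add: complex_eq_iff)
  ultimately show ?thesis by (intro bexI)
qed

lemma tens_measurable:
  assumes "\<And>j. cc (G j)"
  shows "tens G \<in> borel_measurable borel"
proof -
  have [measurable]: "G j \<in> borel_measurable borel" for j
    by (rule borel_measurable_continuous_onI[OF smooth1_continuous0[OF cc_smooth[OF assms]]])
  show ?thesis unfolding tens_def[abs_def] by measurable
qed

text \<open>The passage to a Borel version moves the integrals from the completed measure to
  \<open>lborel\<close>, where Fubini's theorem is used.\<close>

lemma regular_distr_representative:
  fixes f :: "real ^ 'n::finite \<Rightarrow> complex"
  assumes f [measurable]: "f \<in> borel_measurable lebesgue" and T: "is_regular_distr f T"
    and g [measurable]: "g \<in> borel_measurable borel" and fg: "AE x in lborel. f x = g x"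
  shows "integrable lborel (\<lambda>y. indicator (cbox p q) y *\<^sub>R g y)"
    and "(\<And>j. cc (G j)) \<Longrightarrow> T (tens G) = (LINT y|lborel. g y * tens G y)"
proof -
  have ae: "AE x in lebesgue. f x = g x" using fg by (rule AE_completion)
  have g' [measurable]: "g \<in> borel_measurable lebesgue" by (rule measurable_completion) simp
  have "f absolutely_integrable_on cbox p q" using T compact_cbox unfolding is_regular_distr_def by blast
  then have "integrable lebesgue (\<lambda>y. indicator (cbox p q) y *\<^sub>R f y)" by (simp only: set_integrable_def)
  moreover have "integrable lebesgue (\<lambda>y. indicator (cbox p q) y *\<^sub>R f y) \<longleftrightarrow> integrable lebesgue (\<lambda>y. indicator (cbox p q) y *\<^sub>R g y)"
  proof (rule integrable_cong_AE)
    have ind: "(indicator (cbox p q) :: _ \<Rightarrow> real) \<in> borel_measurable lebesgue"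
      by (rule borel_measurable_indicator[OF fmeasurableD[OF lmeasurable_cbox]])
    show "(\<lambda>y. indicator (cbox p q) y *\<^sub>R f y) \<in> borel_measurable lebesgue" "(\<lambda>y. indicator (cbox p q) y *\<^sub>R g y) \<in> borel_measurable lebesgue"
      by (rule borel_measurable_scaleR[OF ind f], rule borel_measurable_scaleR[OF ind g'])
    show "AE y in lebesgue. indicator (cbox p q) y *\<^sub>R f y = indicator (cbox p q) y *\<^sub>R g y"
      using ae by eventually_elim (simp only:)
  qed
  ultimately have "integrable lebesgue (\<lambda>y. indicator (cbox p q) y *\<^sub>R g y)" by blast
  then show "integrable lborel (\<lambda>y. indicator (cbox p q) y *\<^sub>R g y)"
    by (subst (asm) integrable_completion) measurable
next
  assume G: "\<And>j. cc (G j)"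
  have ae: "AE x in lebesgue. f x = g x" using fg by (rule AE_completion)
  have g': "g \<in> borel_measurable lebesgue" by (rule measurable_completion) simp
  have G': "tens G \<in> borel_measurable borel" by (rule tens_measurable) (rule G)
  have "tens G \<in> borel_measurable lborel" using G' by (simp only: measurable_lborel2)
  then have G'': "tens G \<in> borel_measurable lebesgue" by (rule measurable_completion)
  have "T (tens G) = (LINT y|lebesgue. f y * tens G y)"
    using T tens_test_function[of G, OF G] unfolding is_regular_distr_def by blast
  also have "\<dots> = (LINT y|lebesgue. g y * tens G y)"
  proof (rule integral_cong_AE)
    show "(\<lambda>y. f y * tens G y) \<in> borel_measurable lebesgue" by (rule borel_measurable_times[OF f G''])
    show "(\<lambda>y. g y * tens G y) \<in> borel_measurable lebesgue" by (rule borel_measurable_times[OF g' G''])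
    show "AE y in lebesgue. f y * tens G y = g y * tens G y" using ae by eventually_elim (simp only:)
  qed
  also have "\<dots> = (LINT y|lborel. g y * tens G y)"
  proof (rule integral_completion)
    have "(\<lambda>y. g y * tens G y) \<in> borel_measurable borel" by (rule borel_measurable_times[OF g G'])
    then show "(\<lambda>y. g y * tens G y) \<in> borel_measurable lborel" by (simp only: measurable_lborel2)
  qed
  finally show "T (tens G) = (LINT y|lborel. g y * tens G y)" .
qed

lemma mixed_herz_qnorm_eq_hstep:
  assumes "\<And>i. 0 < q $ i" "h \<in> borel_measurable borel"
  shows "mixed_herz_qnorm p \<alpha> q h = fold (hstep p \<alpha> q) (sorted_list_of_set UNIV) (\<lambda>x. ennreal (norm (h x))) 0"
  unfolding mixed_herz_qnorm_def by (subst fold_herz_step_eq_hstep) (use assms in auto)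

theorem lemma2p21:
  fixes p s r q \<theta> :: "ennreal ^ 'n::{finite,linorder}"
    and \<alpha>1 \<alpha>2 :: "real ^ 'n::{finite,linorder}"
  assumes "\<And>i. 0 < p $ i" and "\<And>i. 0 < s $ i" and "\<And>i. 0 < r $ i" and "\<And>i. 0 < q $ i"
    and "\<And>i. \<alpha>1 $ i + enn2real (1 / s $ i) > 0"
    and "\<And>i. p $ i \<le> s $ i"
    and "\<And>i. \<alpha>2 $ i \<ge> \<alpha>1 $ i"
    and "\<And>i. \<theta> $ i = (if \<alpha>2 $ i = \<alpha>1 $ i then r $ i else q $ i)"
  shows "\<exists>c::real. c > 0 \<and>
    (\<forall>R>0. \<forall>f \<in> mixed_herz_space p \<alpha>2 \<theta>. \<forall>T.
       tempered_distribution T \<longrightarrow> is_regular_distr f T \<longrightarrow>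
       distr_support (fourier_distr T) \<subseteq> {\<xi>. norm \<xi> \<le> R} \<longrightarrow>
       mixed_herz_qnorm s \<alpha>1 r f \<le>
         ennreal (c * R powr ((\<Sum>i\<in>UNIV. enn2real (1 / p $ i)) - (\<Sum>i\<in>UNIV. enn2real (1 / s $ i))
                              + (\<Sum>i\<in>UNIV. \<alpha>2 $ i) - (\<Sum>i\<in>UNIV. \<alpha>1 $ i)))
         * mixed_herz_qnorm p \<alpha>2 \<theta> f)"
proof -
  have \<theta>0: "0 < \<theta> $ i" for i using assms by simp
  \<comment> \<open>Division by d brings p, r and \<theta> up to at least 1, and with p also s. The
    last condition becomes the upper bound on \<alpha>2 + 1/p in the one-dimensional
    embedding.\<close>
  obtain d where d: "0 < d" "d \<le> 1" and dp: "\<And>i. ennreal d \<le> p $ i" and dr: "\<And>i. ennreal d \<le> r $ i"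
    and d\<theta>: "\<And>i. ennreal d \<le> \<theta> $ i" and de: "\<And>i. d * (\<alpha>2 $ i + enn2real (1 / p $ i)) < 1"
    using ex_small_exponent[of p r \<theta> "\<lambda>i. \<alpha>2 $ i + enn2real (1 / p $ i)"] assms(1,3) \<theta>0 by blast
  let ?p = "scale_exps d p" and ?s = "scale_exps d s" and ?r = "scale_exps d r" and ?\<theta> = "scale_exps d \<theta>"
  let ?\<alpha>1 = "d *\<^sub>R \<alpha>1" and ?\<alpha>2 = "d *\<^sub>R \<alpha>2"
  let ?L = "sorted_list_of_set (UNIV :: 'n set)"
  have ip: "enn2real (1 / ?p $ i) = d * enn2real (1 / p $ i)" for i
    using enn2real_inverse_scaled[OF assms(1) d(1)] by (simp add: scale_exps_def)
  have "is": "enn2real (1 / ?s $ i) = d * enn2real (1 / s $ i)" for i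
    using enn2real_inverse_scaled[OF assms(2) d(1)] by (simp add: scale_exps_def)
  define b where "b i = 2 * (?\<alpha>1 $ i + enn2real (1 / ?s $ i) + (1 - enn2real (1 / ?p $ i) - ?\<alpha>2 $ i))" for i
  \<comment> \<open>The 2 makes the weight integrable; the sum dominates the order of decay required
    in each coordinate.\<close>
  define N where "N = 2 + (\<Sum>i\<in>UNIV. \<bar>b i\<bar>)"
  have N: "2 \<le> N" by (simp add: N_def sum_nonneg)
  have Nb: "b i \<le> N" for i
  proof -
    have "b i \<le> \<bar>b i\<bar>" by (rule abs_ge_self)
    also have "\<dots> \<le> (\<Sum>i\<in>UNIV. \<bar>b i\<bar>)" by (rule member_le_sum) auto
    finally show ?thesis by (simp add: N_def)
  qed
  obtain C where C: "0 < C" "\<And>y. norm (fcoef kappa y) powr d \<le> C * wt N y"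
    using fcoef_kappa_powr_decay[OF d(1), of N] by blast
  let ?e = "\<lambda>i. \<alpha>2 $ i + enn2real (1 / p $ i) - \<alpha>1 $ i - enn2real (1 / s $ i)"
  define E where "E = (\<Sum>i\<in>UNIV. ?e i)"
  have E: "(\<Sum>i\<in>UNIV. enn2real (1 / p $ i)) - (\<Sum>i\<in>UNIV. enn2real (1 / s $ i))
      + (\<Sum>i\<in>UNIV. \<alpha>2 $ i) - (\<Sum>i\<in>UNIV. \<alpha>1 $ i) = E"
    by (simp add: E_def sum.distrib sum_subtractf)
  have "0 \<le> ?e i" for i using assms(7)[of i] enn2real_inverse_antimono[OF assms(1,6), of i] by linarith
  \<comment> \<open>The exponent has to be nonnegative because a is estimated from above by 2
    R.\<close>
  then have E0: "0 \<le> E" unfolding E_def by (intro sum_nonneg)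
  have sumE: "(\<Sum>i\<in>set ?L. ?\<alpha>2 $ i + enn2real (1 / ?p $ i) - ?\<alpha>1 $ i - enn2real (1 / ?s $ i)) = d * E"
    unfolding E_def sum_distrib_left ip "is" by (intro sum.cong) (auto simp: algebra_simps)
  have "\<exists>K>0. \<forall>(j::int). \<forall>F\<in>borel_measurable borel. (\<forall>i\<in>set ?L. submean C N j i F) \<longrightarrow>
    (\<forall>x. fold (hstep ?s ?\<alpha>1 ?r) ?L F x \<le>
      ennreal (K * 2 powr (of_int j * (\<Sum>i\<in>set ?L. ?\<alpha>2 $ i + enn2real (1 / ?p $ i) - ?\<alpha>1 $ i - enn2real (1 / ?s $ i))))
        * fold (hstep ?p ?\<alpha>2 ?\<theta>) ?L F x)"
  proof (rule fold_hstep_embedding)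
    fix i
    show "1 \<le> ?p $ i" "1 \<le> ?r $ i" "1 \<le> ?\<theta> $ i"
      using one_le_scaled[OF dp d(1)] one_le_scaled[OF dr d(1)] one_le_scaled[OF d\<theta> d(1)] by (simp_all add: scale_exps_def)
    show "?p $ i \<le> ?s $ i" using assms(6) by (simp add: scale_exps_def divide_right_mono_ennreal)
    have "0 < d * (\<alpha>1 $ i + enn2real (1 / s $ i))" using assms(5) d by simp
    then show "0 < ?\<alpha>1 $ i + enn2real (1 / ?s $ i)" unfolding "is" by (simp add: distrib_left)
    show "?\<alpha>2 $ i + enn2real (1 / ?p $ i) < 1" using de[of i] unfolding ip by (simp add: distrib_left)
    show "?\<alpha>1 $ i \<le> ?\<alpha>2 $ i" using assms(7) d by (simp add: mult_left_mono)
    show "?\<theta> $ i = ?r $ i" if "?\<alpha>1 $ i = ?\<alpha>2 $ i" using that assms(8)[of i] d by (simp add: scale_exps_def)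
    show "2 * (?\<alpha>1 $ i + enn2real (1 / ?s $ i) + (1 - enn2real (1 / ?p $ i) - ?\<alpha>2 $ i)) \<le> N"
      using Nb[of i] unfolding b_def .
  qed (use N in auto)
  then obtain K where K: "0 < K" and emb: "\<And>(j::int) F x. F \<in> borel_measurable borel \<Longrightarrow> (\<And>i. submean C N j i F) \<Longrightarrow>
      fold (hstep ?s ?\<alpha>1 ?r) ?L F x \<le> ennreal (K * 2 powr (of_int j * (d * E))) * fold (hstep ?p ?\<alpha>2 ?\<theta>) ?L F x"
    unfolding sumE by blast
  \<comment> \<open>\<open>K powr (1 / d)\<close> undoes the d-th power; \<open>2 powr E\<close> is
    the price of rounding R up to a power of two.\<close>
  define c where "c = K powr (1 / d) * 2 powr E"
  show ?thesis
    unfolding E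
  proof (intro exI[of _ c] conjI allI impI ballI)
    show "0 < c" using K by (simp add: c_def)
    fix R :: real and f T
    assume R: "0 < R" and f: "f \<in> mixed_herz_space p \<alpha>2 \<theta>" and T: "tempered_distribution T"
      and reg: "is_regular_distr f T" and supp: "distr_support (fourier_distr T) \<subseteq> {\<xi>. norm \<xi> \<le> R}"
    interpret tempered T by unfold_locales (rule T)
    define j where "j = \<lceil>log 2 R\<rceil>"
    define a where "a = (2::real) powr of_int j"
    have "R = 2 powr log 2 R" using R by simp
    also have "\<dots> \<le> a" unfolding a_def j_def by (intro powr_mono) auto
    finally have Ra: "R \<le> a" .
    have "a \<le> 2 powr (log 2 R + 1)" unfolding a_def j_def by (intro powr_mono) linarith+
    also have "\<dots> = 2 * R" using R by (simp add: powr_add)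
    finally have aR: "a \<le> 2 * R" .
    have f_meas: "f \<in> borel_measurable lebesgue" using f by (simp add: mixed_herz_space_def)
    obtain g where g: "g \<in> borel_measurable borel" and fg: "AE x in lborel. f x = g x"
      using ex_borel_representative[OF f_meas] by blast
    note rep = regular_distr_representative[OF f_meas reg g fg]
    have band_meas: "band a \<in> borel_measurable borel" by (rule band_measurable[OF g rep supp R Ra])
    have "AE x in lborel. g x = band a x" by (rule band_eq_AE[OF g rep supp R Ra])
    with fg have fb: "AE x in lborel. f x = band a x" by eventually_elim simp
    \<comment> \<open>Slices of \<open>f\<close> may be nonmeasurable. The quasi-norms ignore null
      sets, so the Borel representative takes its place and they become iterated
      \<open>hz\<close>.\<close>
    define F where "F x = ennreal (norm (band a x))" for x
    have F: "F \<in> borel_measurable borel" unfolding F_def using band_meas by measurable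
    define A where "A = mixed_herz_qnorm s \<alpha>1 r f"
    define B where "B = mixed_herz_qnorm p \<alpha>2 \<theta> f"
    have A: "A = fold (hstep s \<alpha>1 r) ?L F 0"
      unfolding A_def F_def[abs_def] mixed_herz_qnorm_cong_AE[OF fb] by (rule mixed_herz_qnorm_eq_hstep[OF assms(3) band_meas])
    have B: "B = fold (hstep p \<alpha>2 \<theta>) ?L F 0"
      unfolding B_def F_def[abs_def] mixed_herz_qnorm_cong_AE[OF fb] by (rule mixed_herz_qnorm_eq_hstep[OF \<theta>0 band_meas])
    have "submean C N j i (\<lambda>x. ennpow (F x) d)" for i
      unfolding F_def a_def by (rule band_submean[OF d less_imp_le[OF C(1)] C(2)]) (rule band_meas[unfolded a_def])
    moreover have "(\<lambda>x. ennpow (F x) d) \<in> borel_measurable borel" using F by measurable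
    ultimately have "ennpow A d \<le> ennreal (K * 2 powr (of_int j * (d * E))) * ennpow B d"
      unfolding A B ennpow_fold_hstep[OF F assms(2,3) d(1)] ennpow_fold_hstep[OF F assms(1) \<theta>0 d(1)] by (intro emb)
    also have "K * 2 powr (of_int j * (d * E)) = (K powr (1 / d) * a powr E) powr d"
      using K d by (simp add: a_def powr_mult powr_powr mult_ac)
    also have "ennreal \<dots> * ennpow B d = ennpow (ennreal (K powr (1 / d) * a powr E) * B) d"
      unfolding ennpow_mult by (subst ennpow_ennreal) auto
    finally have "A \<le> ennreal (K powr (1 / d) * a powr E) * B" using d by (simp only: ennpow_le_iff)
    also have "\<dots> \<le> ennreal (c * R powr E) * B"
    proof (intro mult_right_mono ennreal_leI)
      have "a powr E \<le> (2 * R) powr E" using aR E0 by (intro powr_mono2) (auto simp: a_def)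
      also have "\<dots> = 2 powr E * R powr E" using R by (simp add: powr_mult)
      finally show "K powr (1 / d) * a powr E \<le> c * R powr E" unfolding c_def by (simp add: mult_left_mono mult.assoc)
    qed simp
    finally show "mixed_herz_qnorm s \<alpha>1 r f \<le> ennreal (c * R powr E) * mixed_herz_qnorm p \<alpha>2 \<theta> f"
      unfolding A_def B_def .
  qed
qed

end
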